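(* Let $F$ be a Maass waveform on a congruence subgroup $\Gamma$ with eigenvalue $1/4$ under $\Delta$ which is cuspidal at $i\infty$. Then $F^+$ defines a quantum modular form of weight one on a subset $X\subseteq\mathbb{P}^1(\mathbb{Q})$ on $\Gamma_F$. Moreover, $F$ is cuspidal exactly at those cusps which lie in the maximal such set $X$.
   Context: With $\tau=u+iv$, $\Delta=-v^2(\partial_u^2+\partial_v^2)$. A Maass waveform on $\Gamma$ with eigenvalue $\lambda$ is a smooth $F:\mathbb{H}\to\mathbb{C}$ with $F(\gamma\tau)=F(\tau)$ for $\gamma\in\Gamma$, of at most polynomial growth at the cusps, and $\Delta F=\lambda F$. For eigenvalue $1/4$, at each cusp $F$ has an expansion of the form $\kappa_1v^{1/2}+\kappa_2v^{1/2}\log v+v^{1/2}\sum_{n\ne0}a(n)K_0(2\pi|n|v)e(nu)$ (in a local coordinate at the cusp), and $F$ is cuspidal at that cusp if $\kappa_1=\kappa_2=0$. If $F$ is cuspidal at $i\infty$ with $F(\tau)=v^{1/2}\sum_{n\ne0}A(n)K_0(2\pi|n|v/N)e(nu/N)$, then $F^+(\tau)=\sum_{n>0}A(n)e^{2\pi in\tau/N}$. $\Gamma_F:=\{\gamma\in\Gamma: F \text{ is cuspidal at } \gamma^{-1}i\infty\}$. A function $f$ on $X\subseteq\mathbb{P}^1(\mathbb{Q})$ is a quantum modular form of weight $1$ on a group $\Gamma'$ if for all $\gamma=\begin{pmatrix}a&b\\c&d\end{pmatrix}\in\Gamma'$ the cocycle $r_\gamma(x)=f(x)-(cx+d)^{-1}f(\gamma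 x)$ extends to an open subset of $\mathbb{R}$ and is real-analytic; the value of $F^+$ at a rational $\alpha$ is $\lim_{t\to0^+}F^+(\alpha+it)$ when this limit exists.
   Formalization: The cocycle uses the factor |cx+d|^{-1} instead of (cx+d)^{-1}: with the signed factor the claim fails, e.g. when -1 lies in the group, where it would force F^+ itself to extend real-analytically (false for Cohen's Maass form). *)

theory Defs
  imports "HOL-Analysis.Analysis" "HOL-Algebra.Group"
begin

definition SL2Z :: "(int^2^2) monoid" where
  "SL2Z = \<lparr>carrier = {A. det A = 1}, mult = (**), one = mat 1\<rparr>"

lemma group_SL2Z: "group SL2Z"
proof (rule groupI)
  fix A assume A: "A \<in> carrier SL2Z"
  define B :: "int^2^2" where
    "B = (\<chi> i j. if i = j then (if i = 1 then A$2$2 else A$1$1) else - (A$i$j))"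
  have "det B = 1" "B ** A = mat 1"
    using A by (simp_all add: SL2Z_def B_def det_2 vec_eq_iff forall_2 matrix_matrix_mult_def
        sum_2 mat_def algebra_simps)
  then show "\<exists>B\<in>carrier SL2Z. B \<otimes>\<^bsub>SL2Z\<^esub> A = \<one>\<^bsub>SL2Z\<^esub>"
    by (auto simp: SL2Z_def)
qed (auto simp: SL2Z_def det_mul matrix_mul_assoc)

definition principal_congruence_subgroup :: "nat \<Rightarrow> (int^2^2) set" where
  "principal_congruence_subgroup N =
     {A \<in> carrier SL2Z. \<forall>i j. A$i$j mod int N = (mat 1 :: int^2^2)$i$j mod int N}"

definition congruence_subgroup :: "(int^2^2) set \<Rightarrow> bool" where
  "congruence_subgroup \<Gamma> \<longleftrightarrow>
     subgroup \<Gamma> SL2Z \<and> (\<exists>N>0. principal_congruence_subgroup N \<subseteq> \<Gamma>)"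

definition upper_half_plane :: "complex set" where
  "upper_half_plane = {\<tau>. Im \<tau> > 0}"

definition sl2_act :: "int^2^2 \<Rightarrow> complex \<Rightarrow> complex" where
  "sl2_act \<gamma> = moebius (of_int (\<gamma>$1$1)) (of_int (\<gamma>$1$2)) (of_int (\<gamma>$2$1)) (of_int (\<gamma>$2$2))"

text \<open>The projective line over the rationals.\<close>

datatype cusp = Infty | Fin rat

fun cusp_act :: "int^2^2 \<Rightarrow> cusp \<Rightarrow> cusp" where
  "cusp_act \<gamma> Infty =
     (if \<gamma>$2$1 = 0 then Infty else Fin (of_int (\<gamma>$1$1) / of_int (\<gamma>$2$1)))"
| "cusp_act \<gamma> (Fin x) =
     (if of_int (\<gamma>$2$1) * x + of_int (\<gamma>$2$2) = 0 then Infty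
      else Fin ((of_int (\<gamma>$1$1) * x + of_int (\<gamma>$1$2)) / (of_int (\<gamma>$2$1) * x + of_int (\<gamma>$2$2))))"

text \<open>Partial derivatives: with \<open>\<tau> = u + i v\<close>, direction \<open>1\<close> is the derivative in \<open>u\<close> and
  direction \<open>\<i>\<close> the derivative in \<open>v\<close>.\<close>

definition dir_deriv :: "complex \<Rightarrow> (complex \<Rightarrow> complex) \<Rightarrow> complex \<Rightarrow> complex" where
  "dir_deriv w F \<tau> = vector_derivative (\<lambda>t. F (\<tau> + of_real t * w)) (at 0)"

text \<open>Real smoothness (not holomorphy): every iterated partial derivative, in any order, is real
  (Frechet) differentiable.\<close>

definition smooth_on_uhp :: "(complex \<Rightarrow> complex) \<Rightarrow> bool" where
  "smooth_on_uhp F \<longleftrightarrow>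
     (\<forall>ws. set ws \<subseteq> {1, \<i>} \<longrightarrow> foldr dir_deriv ws F differentiable_on upper_half_plane)"

definition hyp_laplacian :: "(complex \<Rightarrow> complex) \<Rightarrow> complex \<Rightarrow> complex" where
  "hyp_laplacian F \<tau> =
     - (of_real (Im \<tau>))\<^sup>2 * (dir_deriv 1 (dir_deriv 1 F) \<tau> + dir_deriv \<i> (dir_deriv \<i> F) \<tau>)"

text \<open>Every cusp is \<open>g \<infinity>\<close> with \<open>g\<close> in \<open>SL2Z\<close>, and \<open>F \<circ> g\<close> describes \<open>F\<close> near it.\<close>

definition polynomial_growth_at_cusps :: "(complex \<Rightarrow> complex) \<Rightarrow> bool" where
  "polynomial_growth_at_cusps F \<longleftrightarrow>
     (\<forall>g\<in>carrier SL2Z. \<exists>C (k::nat) v\<^sub>0. v\<^sub>0 > 0 \<and>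
        (\<forall>\<tau>. Im \<tau> \<ge> v\<^sub>0 \<longrightarrow> norm (F (sl2_act g \<tau>)) \<le> C * Im \<tau> ^ k))"

definition maass_waveform :: "(int^2^2) set \<Rightarrow> complex \<Rightarrow> (complex \<Rightarrow> complex) \<Rightarrow> bool" where
  "maass_waveform \<Gamma> lam F \<longleftrightarrow>
     smooth_on_uhp F \<and>
     (\<forall>\<gamma>\<in>\<Gamma>. \<forall>\<tau>\<in>upper_half_plane. F (sl2_act \<gamma> \<tau>) = F \<tau>) \<and>
     polynomial_growth_at_cusps F \<and>
     (\<forall>\<tau>\<in>upper_half_plane. hyp_laplacian F \<tau> = lam * F \<tau>)"

text \<open>The modified Bessel function \<open>K\<^sub>0(y)\<close> for \<open>y > 0\<close>.\<close>

definition bessel_K0 :: "real \<Rightarrow> real" where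
  "bessel_K0 y = integral {0..} (\<lambda>t. exp (- y * cosh t))"

text \<open>The expansion
  \<open>\<kappa>\<^sub>1 v\<^bsup>1/2\<^esup> + \<kappa>\<^sub>2 v\<^bsup>1/2\<^esup> log v + v\<^bsup>1/2\<^esup> \<Sum>\<^bsub>n \<noteq> 0\<^esub> a(n) K\<^sub>0(2\<pi>|n|v/h) e(nu/h)\<close> of a function of
  \<open>\<tau> = u + i v\<close> having period \<open>h\<close>. Passing to the local coordinate \<open>\<tau>/h\<close> of period one only
  replaces \<open>\<kappa>\<^sub>1, \<kappa>\<^sub>2\<close> by an invertible linear combination and rescales \<open>a\<close>.\<close>

definition has_cusp_expansion ::
    "nat \<Rightarrow> (complex \<Rightarrow> complex) \<Rightarrow> complex \<Rightarrow> complex \<Rightarrow> (int \<Rightarrow> complex) \<Rightarrow> bool" where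
  "has_cusp_expansion h G \<kappa>\<^sub>1 \<kappa>\<^sub>2 a \<longleftrightarrow>
     (\<forall>\<tau>\<in>upper_half_plane. \<exists>S.
        ((\<lambda>n. a n * of_real (bessel_K0 (2 * pi * \<bar>real_of_int n\<bar> * Im \<tau> / real h))
               * cis (2 * pi * real_of_int n * Re \<tau> / real h)) has_sum S) (UNIV - {0}) \<and>
        G \<tau> = \<kappa>\<^sub>1 * of_real (sqrt (Im \<tau>)) + \<kappa>\<^sub>2 * of_real (sqrt (Im \<tau>) * ln (Im \<tau>))
               + of_real (sqrt (Im \<tau>)) * S)"

text \<open>Vanishing of \<open>\<kappa>\<^sub>1\<close> and \<open>\<kappa>\<^sub>2\<close> does not depend on the choice of \<open>g\<close> and \<open>h\<close>.\<close>

definition cuspidal_at :: "(complex \<Rightarrow> complex) \<Rightarrow> cusp \<Rightarrow> bool" where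
  "cuspidal_at F \<alpha> \<longleftrightarrow>
     (\<exists>g\<in>carrier SL2Z. \<exists>h>0. \<exists>a. cusp_act g Infty = \<alpha> \<and>
        has_cusp_expansion h (\<lambda>\<tau>. F (sl2_act g \<tau>)) 0 0 a)"

definition Gamma_F :: "(int^2^2) set \<Rightarrow> (complex \<Rightarrow> complex) \<Rightarrow> (int^2^2) set" where
  "Gamma_F \<Gamma> F = {\<gamma>\<in>\<Gamma>. cuspidal_at F (cusp_act (inv\<^bsub>SL2Z\<^esub> \<gamma>) Infty)}"

text \<open>The function \<open>F\<^sup>+\<close> attached to an expansion at infinity of width \<open>N\<close> with coefficients \<open>A\<close>.\<close>

definition F_plus :: "nat \<Rightarrow> (int \<Rightarrow> complex) \<Rightarrow> complex \<Rightarrow> complex" where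
  "F_plus N A \<tau> = (\<Sum>\<^sub>\<infinity>n\<in>{0<..}. A n * exp (2 * of_real pi * \<i> * of_int n * \<tau> / of_nat N))"

text \<open>The vertical limit at a cusp; at infinity this is the limit as \<open>t\<close> tends to infinity.\<close>

fun has_cusp_value :: "(complex \<Rightarrow> complex) \<Rightarrow> cusp \<Rightarrow> complex \<Rightarrow> bool" where
  "has_cusp_value G Infty L \<longleftrightarrow> ((\<lambda>t. G (\<i> * of_real t)) \<longlongrightarrow> L) at_top"
| "has_cusp_value G (Fin x) L \<longleftrightarrow> ((\<lambda>t. G (of_rat x + \<i> * of_real t)) \<longlongrightarrow> L) (at_right 0)"

definition real_analytic_on :: "(real \<Rightarrow> complex) \<Rightarrow> real set \<Rightarrow> bool" where
  "real_analytic_on g U \<longleftrightarrow>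
     (\<forall>x\<in>U. \<exists>a r. r > 0 \<and> (\<forall>y. \<bar>y - x\<bar> < r \<longrightarrow> (\<lambda>n. a n * of_real (y - x) ^ n) sums g y))"

text \<open>Weight one. The cocycle at \<open>x\<close> is defined when \<open>x\<close> and \<open>\<gamma> x\<close> are both finite, and it is
  required to extend to an open set containing all these \<open>x\<close>. Since it involves the value of \<open>f\<close>
  at \<open>\<gamma> x\<close>, the set \<open>X\<close> is required to be stable under \<open>\<Gamma>'\<close>.

  Maass waveforms of weight zero see \<open>\<gamma>\<close> only up to sign, whereas the factor \<open>(cx+d)\<close> of odd weight
  changes sign with \<open>\<gamma>\<close>: for \<open>\<gamma> = -1\<close> the expression \<open>f(x) - (cx+d)\<^sup>-\<^sup>1 f(\<gamma>x)\<close> would be \<open>2 f(x)\<close>.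
  The sign is fixed by using at each \<open>x\<close> the representative of \<open>\<plusminus>\<gamma>\<close> with \<open>cx + d > 0\<close>, that is, by the
  factor \<open>\<bar>cx + d\<bar>\<^sup>-\<^sup>1\<close>, as in Zagier's functional equation for the example of Cohen.\<close>

definition quantum_modular_form ::
    "(cusp \<Rightarrow> complex) \<Rightarrow> cusp set \<Rightarrow> (int^2^2) set \<Rightarrow> bool" where
  "quantum_modular_form f X \<Gamma>' \<longleftrightarrow>
     subgroup \<Gamma>' SL2Z \<and>
     (\<forall>\<gamma>\<in>\<Gamma>'. \<forall>\<alpha>\<in>X. cusp_act \<gamma> \<alpha> \<in> X) \<and>
     (\<forall>\<gamma>\<in>\<Gamma>'. \<exists>U r. open U \<and> real_analytic_on r U \<and>
        (\<forall>x. Fin x \<in> X \<and> of_int (\<gamma>$2$1) * x + of_int (\<gamma>$2$2) \<noteq> 0 \<longrightarrow>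
           of_rat x \<in> U \<and>
           r (of_rat x) = f (Fin x)
             - inverse (of_rat \<bar>of_int (\<gamma>$2$1) * x + of_int (\<gamma>$2$2)\<bar>) * f (cusp_act \<gamma> (Fin x))))"

definition defines_quantum_modular_form ::
    "(complex \<Rightarrow> complex) \<Rightarrow> cusp set \<Rightarrow> (int^2^2) set \<Rightarrow> bool" where
  "defines_quantum_modular_form G X \<Gamma>' \<longleftrightarrow>
     (\<exists>f. (\<forall>\<alpha>\<in>X. has_cusp_value G \<alpha> (f \<alpha>)) \<and> quantum_modular_form f X \<Gamma>')"

end

theory Submission
  imports Defs "HOL-Complex_Analysis.Cauchy_Integral_Formula" "HOL-Real_Asymp.Real_Asymp" "HOL-Library.Periodic_Fun"
begin

text \<open>On a vertical line put \<open>f(v) = F(x + iv) / v\<^bsup>1/2\<^esup>\<close>. Integrating the Bessel expansion of \<open>f\<close> and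
  of its derivatives along the hyperbolas \<open>v\<^sup>2 = y\<^sup>2 + s\<^sup>2\<close> is an Abel transform that turns \<open>K\<^sub>0\<close> into an
  exponential and recovers \<open>F\<^sup>+(x + iy)\<close>. Letting \<open>y\<close> tend to 0 at a cusp \<open>x\<close> gives a divergent term
  \<open>(\<alpha> - \<beta> log y) / y\<close>, where \<open>\<alpha>\<close> and \<open>\<beta>\<close> vanish together exactly if \<open>\<kappa>\<^sub>1 = \<kappa>\<^sub>2 = 0\<close>, plus the
  limit \<open>- (i / \<pi>) \<integral> F\<^sub>u(x + iv) v\<^bsup>-1/2\<^esup> dv\<close>. Hence the limit exists exactly at the cuspidal cusps.

  This integral is the integral over the line from \<open>x\<close> to \<open>\<infinity>\<close> of the closed form that Green's
  formula attaches to \<open>F\<close> and the eigenfunction \<open>v\<^bsup>1/2\<^esup> / |\<tau> - x|\<close>, which is equivariant of weight one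
  in \<open>x\<close>. Integrating around the ideal triangle with vertices \<open>\<infinity>\<close>, \<open>x\<close>, \<open>\<gamma>\<^sup>-\<^sup>1 \<infinity>\<close> expresses the
  cocycle as an integral over the line from \<open>\<gamma>\<^sup>-\<^sup>1 \<infinity>\<close> to \<open>\<infinity>\<close>, where the integrand is analytic
  in \<open>x\<close> away from \<open>\<gamma>\<^sup>-\<^sup>1 \<infinity>\<close>.\<close>

section \<open>The Bessel function K0\<close>

text \<open>Two obstacles shape the proof. A cusp expansion asserts only absolute convergence, so
  the coefficients are merely subexponential and give no uniform growth estimate for F towards the
  real line. All control near a rational point x therefore comes from the expansion of F at the cusp
  x itself, carried to the vertical line over x by some g in SL2(Z). The Abel transform is an exact
  identity at every height y > 0, so dominated convergence along that single line yields the limit.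
  Secondly, the converse concerns a cusp about which nothing is assumed; that an expansion with
  constants kappa_1, kappa_2 exists there has to be derived from smoothness, periodicity, growth and
  the eigenvalue. The factor |cx + d| is dictated by the kernel: v^(1/2) / |P tau + Q| sees the row
  (P, Q) only up to sign, and scaling the row scales the kernel by the inverse absolute value. Since
  F is cuspidal at infinity, it is so at every \<gamma>^-1 infinity. Hence \<open>Gamma_F\<close> is
  all of \<Gamma>, the set of cuspidal cusps is stable, and F decays at the third vertex of the
  triangle.\<close>

definition cosh_moment :: "nat \<Rightarrow> real \<Rightarrow> real" where
  "cosh_moment m y = integral {0..} (\<lambda>t. cosh t ^ m * exp (- y * cosh t))"

text \<open>Each derivative in y under the integral brings down a factor \<open>- cosh t\<close>, so
  the m-th moment is the m-th derivative of K0 up to the sign (-1)^m. The family is closed under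
  differentiation, which keeps all derivatives of Bessel series within one class.\<close>

lemma bessel_K0_eq_cosh_moment: "bessel_K0 = cosh_moment 0"
  by (simp add: fun_eq_iff bessel_K0_def cosh_moment_def)

lemma power_le_fact_exp:
  fixes x :: real
  assumes "x \<ge> 0"
  shows "x ^ m \<le> fact m * exp x"
proof -
  have "(\<lambda>n. x ^ n /\<^sub>R fact n) sums exp x"
    by (rule exp_converges)
  moreover have "0 \<le> x ^ n /\<^sub>R fact n" for n
    using assms by simp
  ultimately have "(\<Sum>n\<in>{m}. x ^ n /\<^sub>R fact n) \<le> exp x"
    using sum_le_suminf[of "\<lambda>n. x ^ n /\<^sub>R fact n" "{m}"] by (simp add: sums_iff)
  then show ?thesis
    by (simp add: divide_simps mult.commute)
qed

lemma le_cosh: "t \<le> cosh (t::real)"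
proof (cases "t \<ge> 0")
  case True
  have "1 + t + t\<^sup>2 / 2 \<le> exp t"
    using True by (rule exp_lower_Taylor_quadratic)
  moreover have "0 \<le> t\<^sup>2 - 2 * t + 1"
    using zero_le_power2[of "t - 1"] by (simp add: power2_diff)
  ultimately have "2 * t \<le> exp t + exp (- t)"
    using exp_gt_zero[of "-t"] by linarith
  then show ?thesis
    by (simp add: cosh_field_def)
next
  case False
  then show ?thesis
    using cosh_real_nonneg[of t] by linarith
qed

text \<open>Half of the exponential absorbs the power of \<open>cosh t\<close>; the other half is at
  most \<open>exp (- (y / 2) * t)\<close> because \<open>t\<close> is at most
  \<open>cosh t\<close>.\<close>

lemma cosh_moment_absolutely_integrable:
  fixes y :: real
  assumes "y > 0"
  shows "(\<lambda>t. cosh t ^ m * exp (- y * cosh t)) absolutely_integrable_on {0..}"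
proof -
  define C where "C = fact m * (2 / y) ^ m"
  have bd: "cosh t ^ m * exp (- y * cosh t) \<le> C * exp (- (y / 2) * t)" for t :: real
  proof -
    have "(y / 2 * cosh t) ^ m \<le> fact m * exp (y / 2 * cosh t)"
      by (rule power_le_fact_exp) (use assms in \<open>simp add: cosh_real_nonneg\<close>)
    then have "cosh t ^ m \<le> C * exp (y / 2 * cosh t)"
      unfolding C_def using assms by (simp add: power_mult_distrib power_divide field_simps)
    then have "cosh t ^ m * exp (- y * cosh t) \<le> C * exp (y / 2 * cosh t) * exp (- y * cosh t)"
      by (rule mult_right_mono) simp
    also have "\<dots> = C * exp (- (y / 2) * cosh t)"
      by (simp add: mult.assoc flip: exp_add)
    also have "\<dots> \<le> C * exp (- (y / 2) * t)"
      using assms le_cosh[of t] by (intro mult_left_mono) (auto simp: C_def)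
    finally show ?thesis .
  qed
  show ?thesis
  proof (rule measurable_bounded_by_integrable_imp_absolutely_integrable)
    show "(\<lambda>t. cosh t ^ m * exp (- y * cosh t)) \<in> borel_measurable (lebesgue_on {0..})"
      by (intro continuous_imp_measurable_on_sets_lebesgue continuous_intros) auto
    show "(\<lambda>t. C * exp (- (y / 2) * t)) integrable_on {0..}"
      using integrable_on_exp_minus_to_infinity[of "y / 2" 0] assms
      by (intro integrable_on_mult_right) auto
  qed (use bd in \<open>auto simp: cosh_real_nonneg\<close>)
qed

lemma cosh_moment_integrable:
  fixes y :: real
  assumes "y > 0"
  shows "(\<lambda>t. cosh t ^ m * exp (- y * cosh t)) integrable_on {0..}"
  using cosh_moment_absolutely_integrable[OF assms]
  by (rule absolutely_integrable_on_def[THEN iffD1, THEN conjunct1])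

lemma cosh_moment_nonneg: "cosh_moment m y \<ge> 0"
  unfolding cosh_moment_def
  by (cases "(\<lambda>t. cosh t ^ m * exp (- y * cosh t)) integrable_on {0..}")
     (auto intro!: integral_nonneg simp: cosh_real_nonneg not_integrable_integral)

text \<open>Restrict the integral to \<open>{0..d}\<close> and bound the exponential by its value at
  d. As \<open>cosh d\<close> tends to 1 with d, the moments decay hardly faster than
  \<open>exp (- y)\<close>. It is used with d = 1 to control coefficients and with
  \<open>cosh d = 5 / 4\<close> to exclude growing solutions.\<close>

lemma cosh_moment_lower:
  assumes "y > 0" "d > 0"
  shows "d * exp (- y * cosh d) \<le> cosh_moment m y"
proof -
  have "d * exp (- y * cosh d) = integral {0..d} (\<lambda>t. exp (- y * cosh d))"
    using assms by simp
  also have "\<dots> \<le> integral {0..d} (\<lambda>t. cosh t ^ m * exp (- y * cosh t))"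
  proof (rule integral_le)
    show "(\<lambda>t. cosh t ^ m * exp (- y * cosh t)) integrable_on {0..d}"
      by (intro integrable_continuous_interval continuous_intros)
  next
    fix t assume t: "t \<in> {0..d}"
    have "exp (- y * cosh d) \<le> exp (- y * cosh t)"
      using t assms by (simp add: cosh_real_nonneg_le_iff)
    also have "\<dots> \<le> cosh t ^ m * exp (- y * cosh t)"
      using one_le_power[OF cosh_real_ge_1, of t m] mult_right_mono by fastforce
    finally show "exp (- y * cosh d) \<le> cosh t ^ m * exp (- y * cosh t)" .
  qed auto
  also have "\<dots> \<le> cosh_moment m y"
    unfolding cosh_moment_def
    by (rule integral_subset_le)
       (use cosh_moment_integrable[OF assms(1)] in \<open>auto simp: cosh_real_nonneg
           intro!: integrable_continuous_interval continuous_intros\<close>)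
  finally show ?thesis .
qed

lemma cosh_moment_pos: "y > 0 \<Longrightarrow> cosh_moment m y > 0"
  using cosh_moment_lower[of y 1 m] by (smt (verit) exp_gt_zero mult_pos_pos)

text \<open>Since \<open>cosh t\<close> is at least 1, passing from y0 to y gains the factor
  \<open>exp (y0 - y)\<close> uniformly in t. This sharp rate lets the lowest frequency govern the
  decay of a whole Bessel series.\<close>

lemma cosh_moment_decay:
  assumes "0 < y0" "y0 \<le> y"
  shows "cosh_moment m y \<le> exp (y0 - y) * cosh_moment m y0"
proof -
  have "cosh_moment m y \<le> integral {0..} (\<lambda>t. exp (y0 - y) * (cosh t ^ m * exp (- y0 * cosh t)))"
    unfolding cosh_moment_def
  proof (rule integral_le)
    fix t :: real
    have "0 \<le> (y - y0) * (cosh t - 1)"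
      using assms cosh_real_ge_1[of t] by simp
    then have "exp (- y * cosh t) \<le> exp (y0 - y + - y0 * cosh t)"
      by (simp add: algebra_simps)
    then have "cosh t ^ m * exp (- y * cosh t) \<le> cosh t ^ m * exp (y0 - y + - y0 * cosh t)"
      by (intro mult_left_mono) (auto simp: cosh_real_nonneg)
    then show "cosh t ^ m * exp (- y * cosh t) \<le> exp (y0 - y) * (cosh t ^ m * exp (- y0 * cosh t))"
      by (simp only: exp_add mult_ac)
  next
    show "(\<lambda>t. exp (y0 - y) * (cosh t ^ m * exp (- y0 * cosh t))) integrable_on {0..}"
      by (intro integrable_on_mult_right cosh_moment_integrable assms)
  qed (use assms in \<open>intro cosh_moment_integrable, linarith\<close>)
  then show ?thesis
    by (simp add: cosh_moment_def)
qed

lemma exp_second_order_bound: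
  fixes z :: real
  assumes "\<bar>z\<bar> \<le> w"
  shows "\<bar>exp z - 1 - z\<bar> \<le> z\<^sup>2 * exp w"
proof (cases "z = 0")
  case False
  from Maclaurin_exp_le[of z 2]
  obtain t where t: "\<bar>t\<bar> \<le> \<bar>z\<bar>" and e: "exp z = (\<Sum>m<2. (z ^ m) / fact m) + (exp t / fact 2) * z ^ 2"
    by auto
  have "(\<Sum>m<2. (z ^ m) / fact m) = 1 + z"
    by (simp add: lessThan_nat_numeral lessThan_Suc)
  with e have "exp z - 1 - z = exp t * (z\<^sup>2 / 2)"
    by simp
  then have "\<bar>exp z - 1 - z\<bar> = \<bar>exp t * (z\<^sup>2 / 2)\<bar>"
    by (rule arg_cong)
  also have "\<dots> = exp t * (z\<^sup>2 / 2)"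
    by simp
  also have "\<dots> \<le> exp w * z\<^sup>2"
    using t(1) assms by (intro mult_mono) auto
  finally show ?thesis
    by (simp only: mult.commute)
qed simp

text \<open>The remainder of the exponential costs half of the decay, whence the moment at
  \<open>y / 2\<close>. A remainder that is quadratic in h with a constant of this explicit form can
  be summed over all frequencies, and this is what justifies termwise differentiation.\<close>

lemma cosh_moment_taylor:
  assumes "y > 0" "\<bar>h\<bar> \<le> y / 2"
  shows "\<bar>cosh_moment m (y + h) - cosh_moment m y + h * cosh_moment (Suc m) y\<bar>
           \<le> h\<^sup>2 * cosh_moment (m + 2) (y / 2)"
proof -
  let ?f = "\<lambda>m y t. cosh t ^ m * exp (- y * cosh t) :: real"
  have "y + h > 0"
    using assms by linarith
  note int = cosh_moment_integrable[OF this] cosh_moment_integrable[OF assms(1)]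
  have eq: "cosh_moment m (y + h) - cosh_moment m y + h * cosh_moment (Suc m) y =
      integral {0..} (\<lambda>t. ?f m (y + h) t - ?f m y t + h * ?f (Suc m) y t)"
    unfolding cosh_moment_def using int
    by (simp add: Henstock_Kurzweil_Integration.integral_add
        Henstock_Kurzweil_Integration.integral_diff integrable_diff integrable_on_mult_right
        del: power_Suc)
  have "norm (integral {0..} (\<lambda>t. ?f m (y + h) t - ?f m y t + h * ?f (Suc m) y t))
      \<le> integral {0..} (\<lambda>t. h\<^sup>2 * ?f (m + 2) (y / 2) t)"
  proof (rule integral_norm_bound_integral)
    fix t :: real
    define c where "c = cosh t"
    have c: "c \<ge> 1"
      by (simp add: c_def cosh_real_ge_1)
    have "\<bar>exp (- h * c) - 1 - (- h * c)\<bar> \<le> (- h * c)\<^sup>2 * exp (y / 2 * c)"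
      using assms c by (intro exp_second_order_bound) (auto simp: abs_mult mult_right_mono)
    then have "c ^ m * exp (- y * c) * \<bar>exp (- h * c) - 1 - (- h * c)\<bar> \<le>
        c ^ m * exp (- y * c) * ((- h * c)\<^sup>2 * exp (y / 2 * c))"
      using c by (intro mult_left_mono) auto
    also have "\<dots> = h\<^sup>2 * (c ^ (m + 2) * (exp (- y * c) * exp (y / 2 * c)))"
      by (simp add: power_mult_distrib power_add power2_eq_square mult_ac)
    also have "exp (- y * c) * exp (y / 2 * c) = exp (- (y / 2) * c)"
      by (simp flip: exp_add)
    also have "c ^ m * exp (- y * c) * \<bar>exp (- h * c) - 1 - (- h * c)\<bar> =
        \<bar>c ^ m * exp (- y * c) * (exp (- h * c) - 1 - (- h * c))\<bar>"
      using c by (simp add: abs_mult)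
    also have "c ^ m * exp (- y * c) * (exp (- h * c) - 1 - (- h * c)) =
        c ^ m * (exp (- y * c) * exp (- h * c)) - c ^ m * exp (- y * c) + h * (c ^ Suc m * exp (- y * c))"
      by (simp add: algebra_simps)
    also have "exp (- y * c) * exp (- h * c) = exp (- (y + h) * c)"
      by (simp add: algebra_simps flip: exp_add)
    finally show "norm (?f m (y + h) t - ?f m y t + h * ?f (Suc m) y t) \<le> h\<^sup>2 * ?f (m + 2) (y / 2) t"
      by (simp add: c_def del: power_Suc)
  next
    show "(\<lambda>t. ?f m (y + h) t - ?f m y t + h * ?f (Suc m) y t) integrable_on {0..}"
      by (intro integrable_add integrable_diff integrable_on_mult_right int)
    show "(\<lambda>t. h\<^sup>2 * ?f (m + 2) (y / 2) t) integrable_on {0..}"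
      using assms by (intro integrable_on_mult_right cosh_moment_integrable) simp
  qed
  also have "\<dots> = h\<^sup>2 * cosh_moment (m + 2) (y / 2)"
    by (simp add: cosh_moment_def)
  finally show ?thesis
    using eq by (metis real_norm_def)
qed

lemma has_vector_derivative_quadratic_bound:
  fixes f :: "real \<Rightarrow> 'a::real_normed_vector"
  assumes "d > 0" and bound: "\<And>h. \<bar>h\<bar> \<le> d \<Longrightarrow> norm (f (x + h) - f x - h *\<^sub>R D) \<le> C * h\<^sup>2"
  shows "(f has_vector_derivative D) (at x)"
  unfolding has_vector_derivative_def has_derivative_at
proof (intro conjI bounded_linear_scaleR_left)
  have lim: "((\<lambda>h. C * \<bar>h\<bar>) \<longlongrightarrow> 0) (at 0)"
    by (rule tendsto_eq_intros refl | simp)+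
  show "(\<lambda>h. norm (f (x + h) - f x - h *\<^sub>R D) / norm h) \<midarrow>0\<rightarrow> 0"
  proof (rule Lim_null_comparison[OF _ lim])
    have "\<forall>\<^sub>F h in at 0. \<bar>h\<bar> < d" 
      using assms(1) eventually_at[of "\<lambda>h. \<bar>h\<bar> < d" 0 UNIV] by (auto intro!: exI[of _ d])
    moreover have "\<forall>\<^sub>F h in at (0::real). h \<noteq> 0"
      by (simp add: eventually_at_filter)
    ultimately show "\<forall>\<^sub>F h in at 0. norm (norm (f (x + h) - f x - h *\<^sub>R D) / norm h) \<le> C * \<bar>h\<bar>"
    proof eventually_elim
      case (elim h)
      then have "norm (f (x + h) - f x - h *\<^sub>R D) \<le> C * \<bar>h\<bar> * \<bar>h\<bar>"
        using bound[of h] by (simp add: power2_eq_square mult.assoc flip: abs_mult)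
      then show ?case
        using elim by (simp add: pos_divide_le_eq)
    qed
  qed
qed

lemma cosh_moment_has_derivative:
  assumes "y > 0"
  shows "(cosh_moment m has_real_derivative - cosh_moment (Suc m) y) (at y)"
  unfolding has_real_derivative_iff_has_vector_derivative
proof (rule has_vector_derivative_quadratic_bound)
  show "y / 2 > 0" using assms by simp
  show "norm (cosh_moment m (y + h) - cosh_moment m y - h *\<^sub>R - cosh_moment (Suc m) y)
      \<le> cosh_moment (m + 2) (y / 2) * h\<^sup>2" if "\<bar>h\<bar> \<le> y / 2" for h
    using cosh_moment_taylor[OF assms that, of m] by (simp add: mult.commute)
qed

section \<open>Integrals over the half-line and Bessel's differential equation\<close>

lemma integral_Icc_tendsto:
  fixes f :: "real \<Rightarrow> 'a::euclidean_space"
  assumes f: "f absolutely_integrable_on {0<..}"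
    and a: "\<And>n. a n > 0" "a \<longlonglongrightarrow> 0" and b: "filterlim b at_top sequentially"
  shows "(\<lambda>n. integral {a n..b n} f) \<longlonglongrightarrow> integral {0<..} f"
proof -
  have sub: "f integrable_on {a n..b n}" for n
    by (rule absolutely_integrable_on_def[THEN iffD1, THEN conjunct1],
        rule set_integrable_subset[OF f]) (use a(1)[of n] in auto)
  have "(\<lambda>n. integral {0<..} (\<lambda>t. if t \<in> {a n..b n} then f t else 0)) \<longlonglongrightarrow> integral {0<..} f"
  proof (rule dominated_convergence(2)[where h = "\<lambda>t. norm (f t)"])
    show "(\<lambda>t. if t \<in> {a n..b n} then f t else 0) integrable_on {0<..}" for n
    proof (rule integrable_on_superset[of _ "{a n..b n}"])
      show "(\<lambda>t. if t \<in> {a n..b n} then f t else 0) integrable_on {a n..b n}"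
        by (rule integrable_eq[OF sub[of n]]) simp
    qed (use a(1)[of n] in auto)
    show "(\<lambda>t. norm (f t)) integrable_on {0<..}"
      using f by (simp add: absolutely_integrable_on_def)
    show "(\<lambda>n. if t \<in> {a n..b n} then f t else 0) \<longlonglongrightarrow> f t" if "t \<in> {0<..}" for t
    proof (rule tendsto_eventually)
      have "\<forall>\<^sub>F n in sequentially. a n < t"
        using order_tendstoD(2)[OF a(2)] that by simp
      moreover have "\<forall>\<^sub>F n in sequentially. b n \<ge> t"
        using b by (simp add: filterlim_at_top)
      ultimately show "\<forall>\<^sub>F n in sequentially. (if t \<in> {a n..b n} then f t else 0) = f t"
        by eventually_elim auto
    qed
  qed auto
  moreover have "integral {0<..} (\<lambda>t. if t \<in> {a n..b n} then f t else 0) = integral {a n..b n} f" for n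
  proof -
    have "{a n..b n} \<inter> {0<..} = {a n..b n}"
      using a(1)[of n] by auto
    then show ?thesis
      by (simp only: integral_restrict_Int)
  qed
  ultimately show ?thesis by simp
qed

text \<open>K0 is defined over the closed half-line, whereas substitutions and exhaustion by compact
  intervals take place on the open one; the end point is negligible.\<close>

lemma integral_Ioi_Ici:
  fixes f :: "real \<Rightarrow> 'a::euclidean_space"
  shows "integral {0<..} f = integral {0..} f"
    and "f integrable_on {0<..} \<longleftrightarrow> f integrable_on {0..}"
    and "f absolutely_integrable_on {0<..} \<longleftrightarrow> f absolutely_integrable_on {0..}"
proof -
  have n: "negligible {0::real}"
    by simp
  then show *: "f integrable_on {0<..} \<longleftrightarrow> f integrable_on {0..}"
    "integral {0<..} f = integral {0..} f"
    by (auto intro!: integrable_spike_set_eq integral_spike_set intro: negligible_subset[OF n])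
  show "f absolutely_integrable_on {0<..} \<longleftrightarrow> f absolutely_integrable_on {0..}"
    by (rule absolutely_integrable_spike_set_eq) (rule negligible_subset[OF n]; auto)+
qed

text \<open>Bessel's equation K0'' + K0'/y = K0 in terms of moments. The integrand of the difference
  of both sides is, up to the factor y, the derivative of
  \<open>sinh t * exp (- y * cosh t)\<close>, which vanishes at 0 and at infinity.\<close>

lemma cosh_moment_recurrence:
  assumes "y > 0"
  shows "cosh_moment 2 y = cosh_moment 0 y + cosh_moment 1 y / y"
proof -
  let ?f = "\<lambda>m t. cosh t ^ m * exp (- y * cosh t) :: real"
  let ?h = "\<lambda>t. ?f 1 t - y * (?f 2 t - ?f 0 t)"
  let ?G = "\<lambda>t. sinh t * exp (- y * cosh t)"
  have FTC: "(?h has_integral ?G v - ?G u) {u..v}" if "u \<le> v" for u v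
  proof (rule fundamental_theorem_of_calculus[OF that])
    fix t
    have "(?G has_real_derivative ?h t) (at t within {u..v})"
      by (rule DERIV_cong, (rule derivative_intros)+)
         (simp add: cosh_square_eq, simp add: algebra_simps power2_eq_square)
    then show "(?G has_vector_derivative ?h t) (at t within {u..v})"
      by (simp add: has_real_derivative_iff_has_vector_derivative)
  qed
  have "?h absolutely_integrable_on {0..}"
    using cosh_moment_absolutely_integrable[OF assms]
    by (intro set_integral_diff set_integrable_mult_right) (rule cosh_moment_absolutely_integrable[OF assms])+
  then have "(\<lambda>n. integral {inverse (real (Suc n))..real n + 1} ?h) \<longlonglongrightarrow> integral {0<..} ?h"
    by (intro integral_Icc_tendsto LIMSEQ_inverse_real_of_nat)
       (simp_all add: integral_Ioi_Ici, real_asymp)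
  moreover have "integral {inverse (real (Suc n))..real n + 1} ?h =
      ?G (real n + 1) - ?G (inverse (real (Suc n)))" for n
  proof (rule integral_unique, rule FTC)
    have "inverse (real (Suc n)) \<le> 1"
      by (simp add: field_simps)
    then show "inverse (real (Suc n)) \<le> real n + 1"
      by linarith
  qed
  moreover have "(\<lambda>n. ?G (real n + 1) - ?G (inverse (real (Suc n)))) \<longlonglongrightarrow> 0 - ?G 0"
  proof (intro tendsto_diff)
    show "(\<lambda>n. ?G (inverse (real (Suc n)))) \<longlonglongrightarrow> ?G 0"
      by (intro tendsto_intros LIMSEQ_inverse_real_of_nat)
    show "(\<lambda>n. ?G (real n + 1)) \<longlonglongrightarrow> 0"
    proof (rule Lim_null_comparison)
      have "norm (?G t) \<le> 2 / y\<^sup>2 * (1 / cosh t)" for t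
      proof -
        have "(y * cosh t)^2 \<le> fact 2 * exp (y * cosh t)"
          by (rule power_le_fact_exp) (use assms in \<open>simp add: cosh_real_nonneg\<close>)
        then have "exp (- y * cosh t) \<le> 2 / (y * cosh t)^2"
          using assms cosh_real_pos[of t] by (simp add: exp_minus field_simps)
        moreover have "\<bar>sinh t\<bar> \<le> cosh t"
          unfolding sinh_field_def cosh_field_def by (auto simp: abs_le_iff field_simps)
        ultimately have "\<bar>sinh t\<bar> * exp (- y * cosh t) \<le> cosh t * (2 / (y * cosh t)^2)"
          by (intro mult_mono) (auto simp: cosh_real_nonneg)
        also have "\<dots> = 2 / y\<^sup>2 * (1 / cosh t)"
          using cosh_real_pos[of t] assms by (simp add: power2_eq_square field_simps)
        finally show ?thesis by (simp add: abs_mult)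
      qed
      then show "\<forall>\<^sub>F n in sequentially. norm (?G (real n + 1)) \<le> 2 / y\<^sup>2 * (1 / cosh (real n + 1))"
        by (intro always_eventually allI)
      show "(\<lambda>n. 2 / y\<^sup>2 * (1 / cosh (real n + 1))) \<longlonglongrightarrow> 0"
        by (intro tendsto_mult_right_zero) real_asymp
    qed
  qed
  ultimately have "integral {0<..} ?h = 0"
    using LIMSEQ_unique by force
  moreover have "integral {0..} ?h = cosh_moment 1 y - y * (cosh_moment 2 y - cosh_moment 0 y)"
    unfolding cosh_moment_def using cosh_moment_integrable[OF assms]
    by (intro integral_unique has_integral_diff has_integral_mult_right integrable_integral)
  ultimately have "cosh_moment 1 y - y * (cosh_moment 2 y - cosh_moment 0 y) = 0"
    by (simp add: integral_Ioi_Ici)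
  then show ?thesis
    using assms by (simp add: field_simps)
qed

section \<open>Bessel series\<close>

lemma summable_on_exp_int:
  assumes "c > 0"
  shows "(\<lambda>n::int. exp (- c * \<bar>real_of_int n\<bar>)) summable_on A"
proof -
  let ?f = "\<lambda>n::int. exp (- c * \<bar>real_of_int n\<bar>)"
  have "summable (\<lambda>n. exp (- c) ^ n)"
    using assms by (intro summable_geometric) simp
  then have s: "(\<lambda>n. exp (- c) ^ n) summable_on UNIV"
    by (intro norm_summable_imp_summable_on) simp
  have "(?f \<circ> int) summable_on UNIV" "(?f \<circ> (\<lambda>n. - int n)) summable_on UNIV"
    using s by (simp_all add: o_def mult.commute flip: exp_of_nat_mult)
  then have "?f summable_on range int" "?f summable_on range (\<lambda>n. - int n)"
    by (simp_all add: summable_on_reindex inj_on_def)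
  then have "?f summable_on (range int \<union> (range (\<lambda>n. - int n) - range int))"
    by (intro summable_on_Un_disjoint) (auto intro: summable_on_subset_banach)
  moreover have "range int \<union> (range (\<lambda>n. - int n) - range int) = UNIV"
  proof -
    have "n \<in> range int \<or> n \<in> range (\<lambda>n. - int n)" for n
      by (cases n rule: int_cases2) auto
    then show ?thesis by blast
  qed
  ultimately show ?thesis
    by (auto intro: summable_on_subset_banach)
qed

lemma norm_summable_comparison:
  fixes f :: "'b \<Rightarrow> 'a::banach"
  assumes "g summable_on A" and "\<And>x. x \<in> A \<Longrightarrow> norm (f x) \<le> g x"
  shows "(\<lambda>x. norm (f x)) summable_on A"
proof (rule Infinite_Sum.abs_summable_on_comparison_test)
  have g: "norm (g x) = g x" if "x \<in> A" for x
    using assms(2)[OF that] norm_ge_zero[of "f x"] by (simp del: norm_ge_zero)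
  show "(\<lambda>x. norm (g x)) summable_on A"
    using assms(1) g by (simp cong: summable_on_cong)
  show "norm (f x) \<le> norm (g x)" if "x \<in> A" for x
    using assms(2)[OF that] g[OF that] by simp
qed

lemma le_exp_div:
  fixes x e :: real
  assumes "e > 0"
  shows "x \<le> exp (e * x) / e"
proof -
  have "e * x \<le> exp (e * x)"
    using exp_ge_add_one_self[of "e * x"] by linarith
  then show ?thesis
    using assms by (simp add: field_simps)
qed

lemma norm_cis_second_order: "norm (cis t - 1 - \<i> * of_real t) \<le> t\<^sup>2"
  using Taylor_exp[of "\<i> * of_real t" 1]
  by (simp add: cis_conv_exp power2_eq_square norm_mult diff_diff_eq)

text \<open>A cusp expansion is only required to converge absolutely, and this is all it says about the growth
  of the coefficients.\<close>

definition subexponential :: "(int \<Rightarrow> complex) \<Rightarrow> bool" where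
  "subexponential a \<longleftrightarrow> (\<forall>e>0. \<exists>C. \<forall>n. n \<noteq> 0 \<longrightarrow> norm (a n) \<le> C * exp (e * \<bar>real_of_int n\<bar>))"

text \<open>A factor |n| costs an arbitrarily small exponential, so the rate e is split into halves.
  The class of coefficients is thereby stable under multiplication by frequencies, that is, under
  differentiation of the series.\<close>

lemma subexponential_linear_factor:
  assumes "subexponential a" and "\<And>n. norm (b n) \<le> D * \<bar>real_of_int n\<bar> * norm (a n)"
  shows "subexponential b"
  unfolding subexponential_def
proof (intro allI impI)
  fix e :: real assume e: "e > 0"
  define e' where "e' = e / 2"
  have e': "e' > 0" using e by (simp add: e'_def)
  obtain C where C: "\<And>n. n \<noteq> 0 \<Longrightarrow> norm (a n) \<le> C * exp (e' * \<bar>real_of_int n\<bar>)"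
    using assms(1) e' unfolding subexponential_def by blast
  show "\<exists>C. \<forall>n. n \<noteq> 0 \<longrightarrow> norm (b n) \<le> C * exp (e * \<bar>real_of_int n\<bar>)"
  proof (intro exI allI impI)
    fix n :: int assume n: "n \<noteq> 0"
    have "norm (b n) \<le> \<bar>D\<bar> * (\<bar>real_of_int n\<bar> * norm (a n))"
      using assms(2)[of n] mult_right_mono[of D "\<bar>D\<bar>" "\<bar>real_of_int n\<bar> * norm (a n)"]
      by (simp add: mult.assoc abs_ge_self)
    also have "\<dots> \<le> \<bar>D\<bar> * (exp (e' * \<bar>real_of_int n\<bar>) / e' * (C * exp (e' * \<bar>real_of_int n\<bar>)))"
      using C[OF n] le_exp_div[OF e', of "\<bar>real_of_int n\<bar>"] e'
      by (intro mult_left_mono mult_mono) auto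
    also have "\<dots> = \<bar>D\<bar> * C / e' * (exp (e' * \<bar>real_of_int n\<bar>) * exp (e' * \<bar>real_of_int n\<bar>))"
      by simp
    also have "exp (e' * \<bar>real_of_int n\<bar>) * exp (e' * \<bar>real_of_int n\<bar>) = exp (e * \<bar>real_of_int n\<bar>)"
      by (simp add: e'_def flip: exp_add)
    finally show "norm (b n) \<le> \<bar>D\<bar> * C / e' * exp (e * \<bar>real_of_int n\<bar>)" .
  qed
qed

definition freq :: "nat \<Rightarrow> int \<Rightarrow> real" where
  "freq h n = 2 * pi * real_of_int n / real h"

lemma freq_abs: "\<bar>freq h n\<bar> = 2 * pi * \<bar>real_of_int n\<bar> / real h"
  by (simp add: freq_def abs_mult)

lemma freq_1_pos: "h > 0 \<Longrightarrow> freq h 1 > 0"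
  by (simp add: freq_def)

lemma freq_abs_ge: "n \<noteq> 0 \<Longrightarrow> freq h 1 \<le> \<bar>freq h n\<bar>"
  by (simp add: freq_def abs_mult divide_right_mono)

lemma freq_abs_pos: "h > 0 \<Longrightarrow> n \<noteq> 0 \<Longrightarrow> \<bar>freq h n\<bar> > 0"
  by (simp add: freq_def)

definition bessel_term :: "nat \<Rightarrow> nat \<Rightarrow> (int \<Rightarrow> complex) \<Rightarrow> real \<Rightarrow> real \<Rightarrow> int \<Rightarrow> complex" where
  "bessel_term h m a u v n = a n * of_real (cosh_moment m (\<bar>freq h n\<bar> * v)) * cis (freq h n * u)"

definition bessel_series :: "nat \<Rightarrow> nat \<Rightarrow> (int \<Rightarrow> complex) \<Rightarrow> real \<Rightarrow> real \<Rightarrow> complex" where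
  "bessel_series h m a u v = (\<Sum>\<^sub>\<infinity>n\<in>UNIV - {0}. bessel_term h m a u v n)"

lemma norm_bessel_term:
  "norm (bessel_term h m a u v n) = norm (a n) * cosh_moment m (\<bar>freq h n\<bar> * v)"
  by (simp add: bessel_term_def norm_mult cosh_moment_nonneg)

lemma bessel_coeff_summable:
  assumes h: "h > 0" and a: "subexponential a" and v: "v > 0"
  shows "(\<lambda>n. norm (a n) * cosh_moment m (\<bar>freq h n\<bar> * v)) summable_on (UNIV - {0})"
proof -
  define f1 where "f1 = freq h 1"
  have f1: "f1 > 0"
    using h by (simp add: f1_def freq_1_pos)
  \<comment> \<open>The Bessel terms decay at the rate \<open>f1 * v\<close> in |n|: one half pays
    for the coefficients, the other half is left for a geometric series.\<close>
  define e where "e = f1 * v / 2"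
  have e: "e > 0"
    using f1 v by (simp add: e_def)
  obtain C where C: "\<And>n. n \<noteq> 0 \<Longrightarrow> norm (a n) \<le> C * exp (e * \<bar>real_of_int n\<bar>)"
    using a e unfolding subexponential_def by blast
  define D where "D = C * (exp (f1 * v) * cosh_moment m (f1 * v))"
  have "(\<lambda>n. norm (norm (a n) * cosh_moment m (\<bar>freq h n\<bar> * v))) summable_on (UNIV - {0})"
  proof (rule norm_summable_comparison)
    show "(\<lambda>n. D * exp (- e * \<bar>real_of_int n\<bar>)) summable_on (UNIV - {0})"
      by (intro summable_on_cmult_right summable_on_exp_int e)
    fix n :: int assume "n \<in> UNIV - {0}"
    then have n: "n \<noteq> 0" by simp
    have fn: "\<bar>freq h n\<bar> = f1 * \<bar>real_of_int n\<bar>"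
      by (simp add: f1_def freq_def abs_mult)
    have "cosh_moment m (\<bar>freq h n\<bar> * v) \<le> exp (f1 * v - \<bar>freq h n\<bar> * v) * cosh_moment m (f1 * v)"
      using freq_abs_ge[OF n, of h] f1 v by (intro cosh_moment_decay) (auto simp: f1_def)
    also have "f1 * v - \<bar>freq h n\<bar> * v = f1 * v + (- e * \<bar>real_of_int n\<bar> + - e * \<bar>real_of_int n\<bar>)"
      unfolding fn e_def by (simp add: algebra_simps)
    finally have "norm (a n) * cosh_moment m (\<bar>freq h n\<bar> * v) \<le> C * exp (e * \<bar>real_of_int n\<bar>) *
        (exp (f1 * v + (- e * \<bar>real_of_int n\<bar> + - e * \<bar>real_of_int n\<bar>)) * cosh_moment m (f1 * v))"
      by (intro mult_mono C n) (auto simp: cosh_moment_nonneg order_trans[OF norm_ge_zero C[OF n]])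
    also have "\<dots> = D * exp (- e * \<bar>real_of_int n\<bar>)"
      unfolding D_def by (simp only: exp_add exp_minus mult_minus_left) (simp add: field_simps)
    finally show "norm (norm (a n) * cosh_moment m (\<bar>freq h n\<bar> * v)) \<le> D * exp (- e * \<bar>real_of_int n\<bar>)"
      by (simp add: cosh_moment_nonneg)
  qed
  then show ?thesis
    by (simp add: cosh_moment_nonneg)
qed

lemma bessel_term_abs_summable:
  assumes "h > 0" "subexponential a" "v > 0"
  shows "(\<lambda>n. norm (bessel_term h m a u v n)) summable_on (UNIV - {0})"
  unfolding norm_bessel_term by (rule bessel_coeff_summable[OF assms])

lemma bessel_term_summable:
  assumes "h > 0" "subexponential a" "v > 0"
  shows "bessel_term h m a u v summable_on (UNIV - {0})"
  by (rule abs_summable_summable[OF bessel_term_abs_summable[OF assms]])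

lemma bessel_term_has_sum:
  assumes "h > 0" "subexponential a" "v > 0"
  shows "(bessel_term h m a u v has_sum bessel_series h m a u v) (UNIV - {0})"
  unfolding bessel_series_def
  by (rule has_sum_infsum[OF bessel_term_summable[OF assms]])

lemma norm_bessel_series_le:
  assumes "h > 0" "subexponential a" "v > 0"
  shows "norm (bessel_series h m a u v) \<le>
    (\<Sum>\<^sub>\<infinity>n\<in>UNIV - {0}. norm (a n) * cosh_moment m (\<bar>freq h n\<bar> * v))"
  using norm_infsum_bound[OF bessel_term_abs_summable[OF assms, of m u]]
  by (simp add: norm_bessel_term bessel_series_def)

text \<open>Moving from v0 to v multiplies every term by at most
  \<open>exp (freq h 1 * (v0 - v))\<close>, because no frequency is below the first. The bound
  concerns the sum of the norms, since this is what the dominated convergence in the Abel inversion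
  requires.\<close>

lemma bessel_coeff_sum_decay:
  assumes h: "h > 0" and a: "subexponential a" and v0: "v0 > 0"
  shows "\<exists>C. \<forall>v\<ge>v0. (\<Sum>\<^sub>\<infinity>n\<in>UNIV - {0}. norm (a n) * cosh_moment m (\<bar>freq h n\<bar> * v)) \<le> C * exp (- freq h 1 * v)"
proof (intro exI allI impI)
  fix v assume v: "v \<ge> v0"
  define S where "S = (\<Sum>\<^sub>\<infinity>n\<in>UNIV - {0}. norm (a n) * cosh_moment m (\<bar>freq h n\<bar> * v0))"
  have f1: "freq h 1 > 0"
    using h by (rule freq_1_pos)
  have "(\<Sum>\<^sub>\<infinity>n\<in>UNIV - {0}. norm (a n) * cosh_moment m (\<bar>freq h n\<bar> * v)) \<le> (\<Sum>\<^sub>\<infinity>n\<in>UNIV - {0}. exp (freq h 1 * (v0 - v)) * (norm (a n) * cosh_moment m (\<bar>freq h n\<bar> * v0)))"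
  proof (rule infsum_mono)
    fix n :: int assume "n \<in> UNIV - {0}"
    then have n: "n \<noteq> 0" by simp
    have "cosh_moment m (\<bar>freq h n\<bar> * v) \<le> exp (\<bar>freq h n\<bar> * v0 - \<bar>freq h n\<bar> * v) * cosh_moment m (\<bar>freq h n\<bar> * v0)"
      using freq_abs_pos[OF h n] v0 v by (intro cosh_moment_decay) (auto intro: mult_left_mono)
    also have "\<dots> \<le> exp (freq h 1 * (v0 - v)) * cosh_moment m (\<bar>freq h n\<bar> * v0)"
    proof (rule mult_right_mono)
      have "\<bar>freq h n\<bar> * (v0 - v) \<le> freq h 1 * (v0 - v)"
        using freq_abs_ge[OF n, of h] v by (intro mult_right_mono_neg) auto
      then show "exp (\<bar>freq h n\<bar> * v0 - \<bar>freq h n\<bar> * v) \<le> exp (freq h 1 * (v0 - v))"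
        by (simp add: algebra_simps)
    qed (rule cosh_moment_nonneg)
    finally have "norm (a n) * cosh_moment m (\<bar>freq h n\<bar> * v) \<le> norm (a n) * (exp (freq h 1 * (v0 - v)) * cosh_moment m (\<bar>freq h n\<bar> * v0))"
      by (rule mult_left_mono) simp
    then show "norm (a n) * cosh_moment m (\<bar>freq h n\<bar> * v) \<le>
        exp (freq h 1 * (v0 - v)) * (norm (a n) * cosh_moment m (\<bar>freq h n\<bar> * v0))"
      by (simp only: mult_ac)
  next
    show "(\<lambda>n. norm (a n) * cosh_moment m (\<bar>freq h n\<bar> * v)) summable_on (UNIV - {0})"
      using v v0 by (intro bessel_coeff_summable h a) simp
    show "(\<lambda>n. exp (freq h 1 * (v0 - v)) * (norm (a n) * cosh_moment m (\<bar>freq h n\<bar> * v0))) summable_on (UNIV - {0})"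
      by (intro summable_on_cmult_right bessel_coeff_summable h a v0)
  qed
  also have "\<dots> = exp (freq h 1 * (v0 - v)) * S"
    unfolding S_def by (rule infsum_cmult_right')
  also have "freq h 1 * (v0 - v) = freq h 1 * v0 + - freq h 1 * v"
    by (simp add: algebra_simps)
  also have "exp \<dots> * S = (S * exp (freq h 1 * v0)) * exp (- freq h 1 * v)"
    by (simp only: exp_add mult_ac)
  finally show "(\<Sum>\<^sub>\<infinity>n\<in>UNIV - {0}. norm (a n) * cosh_moment m (\<bar>freq h n\<bar> * v)) \<le> (S * exp (freq h 1 * v0)) * exp (- freq h 1 * v)" .
qed

lemma bessel_series_decay:
  assumes h: "h > 0" and a: "subexponential a" and v0: "v0 > 0"
  shows "\<exists>C. \<forall>u v. v \<ge> v0 \<longrightarrow> norm (bessel_series h m a u v) \<le> C * exp (- freq h 1 * v)"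
proof -
  obtain C where C: "\<And>v. v \<ge> v0 \<Longrightarrow> (\<Sum>\<^sub>\<infinity>n\<in>UNIV - {0}. norm (a n) * cosh_moment m (\<bar>freq h n\<bar> * v)) \<le> C * exp (- freq h 1 * v)"
    using bessel_coeff_sum_decay[OF assms] by blast
  have "norm (bessel_series h m a u v) \<le> C * exp (- freq h 1 * v)" if "v \<ge> v0" for u v
    using norm_bessel_series_le[OF h a, of v m u] C[OF that] v0 that by linarith
  then show ?thesis
    by blast
qed

text \<open>Quadratic remainders add up: with summable constants \<open>M\<close> the remainder of
  the sum is again of order h^2, so the derivative passes under the infinite sum.\<close>

lemma has_vector_derivative_infsum_quadratic:
  fixes f :: "real \<Rightarrow> 'b \<Rightarrow> 'a::banach"
  assumes d: "d > 0" and f: "\<And>h. \<bar>h\<bar> \<le> d \<Longrightarrow> f (x + h) summable_on A" and f': "f' summable_on A"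
    and M: "M summable_on A"
    and bound: "\<And>h n. \<bar>h\<bar> \<le> d \<Longrightarrow> n \<in> A \<Longrightarrow> norm (f (x + h) n - f x n - h *\<^sub>R f' n) \<le> M n * h\<^sup>2"
  shows "((\<lambda>x. infsum (f x) A) has_vector_derivative infsum f' A) (at x)"
proof (rule has_vector_derivative_quadratic_bound[OF d])
  fix h assume h: "\<bar>h\<bar> \<le> d"
  let ?g = "\<lambda>n. f (x + h) n - f x n - h *\<^sub>R f' n"
  have "(?g has_sum (infsum (f (x + h)) A - infsum (f x) A - h *\<^sub>R infsum f' A)) A"
  proof -
    have "((\<lambda>n. f (x + h) n + - f x n + (- h) *\<^sub>R f' n) has_sum
        (infsum (f (x + h)) A + - infsum (f x) A + (- h) *\<^sub>R infsum f' A)) A"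
      using f[OF h] f[of 0] f' d
      by (intro has_sum_add has_sum_scaleR has_sum_infsum) (simp_all add: has_sum_uminus)
    then show ?thesis
      by simp
  qed
  then have eq: "infsum ?g A = infsum (f (x + h)) A - infsum (f x) A - h *\<^sub>R infsum f' A"
    by (rule infsumI)
  have sM: "(\<lambda>n. M n * h\<^sup>2) summable_on A"
    by (intro summable_on_cmult_left M)
  have abs: "(\<lambda>n. norm (?g n)) summable_on A"
    by (rule norm_summable_comparison[OF sM]) (use bound[OF h] in auto)
  have "norm (infsum ?g A) \<le> (\<Sum>\<^sub>\<infinity>n\<in>A. norm (?g n))"
    by (rule norm_infsum_bound[OF abs])
  also have "\<dots> \<le> (\<Sum>\<^sub>\<infinity>n\<in>A. M n * h\<^sup>2)"
    by (rule infsum_mono[OF abs sM]) (use bound[OF h] in auto)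
  also have "\<dots> = infsum M A * h\<^sup>2"
    by (rule infsum_cmult_left')
  finally show "norm (infsum (f (x + h)) A - infsum (f x) A - h *\<^sub>R infsum f' A) \<le> infsum M A * h\<^sup>2"
    by (simp only: eq)
qed

lemma subexponential_freq:
  assumes "subexponential a"
  shows "subexponential (\<lambda>n. \<i> * of_real (freq h n) * a n)"
    and "subexponential (\<lambda>n. of_real \<bar>freq h n\<bar> * a n)"
    and "subexponential (\<lambda>n. of_real (freq h n) ^ 2 * a n)"
proof -
  have 1: "subexponential (\<lambda>n. of_real \<bar>freq h n\<bar> * a n)" if "subexponential a" for a
    by (rule subexponential_linear_factor[OF that, of _ "2 * pi / real h"])
       (simp add: norm_mult norm_divide freq_def abs_mult)
  show "subexponential (\<lambda>n. of_real \<bar>freq h n\<bar> * a n)"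
    by (rule 1[OF assms])
  show "subexponential (\<lambda>n. \<i> * of_real (freq h n) * a n)"
    by (rule subexponential_linear_factor[OF assms, of _ "2 * pi / real h"])
       (simp add: norm_mult norm_divide freq_def abs_mult)
  have "(\<lambda>n. of_real (freq h n) ^ 2 * a n) = (\<lambda>n. of_real \<bar>freq h n\<bar> * (of_real \<bar>freq h n\<bar> * a n))"
    by (simp add: fun_eq_iff power2_eq_square mult.assoc flip: of_real_mult of_real_power)
  then show "subexponential (\<lambda>n. of_real (freq h n) ^ 2 * a n)"
    using 1[OF 1[OF assms]] by (simp only:)
qed

lemma bessel_series_deriv_u:
  assumes h: "h > 0" and a: "subexponential a" and v: "v > 0"
  shows "((\<lambda>u. bessel_series h m a u v) has_vector_derivative
      bessel_series h m (\<lambda>n. \<i> * of_real (freq h n) * a n) u v) (at u)"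
  unfolding bessel_series_def
proof (rule has_vector_derivative_infsum_quadratic[where d = 1])
  let ?M = "\<lambda>n. norm (of_real (freq h n) ^ 2 * a n) * cosh_moment m (\<bar>freq h n\<bar> * v)"
  show "?M summable_on (UNIV - {0})"
    by (rule bessel_coeff_summable[OF h subexponential_freq(3)[OF a] v])
  show "bessel_term h m a (u + k) v summable_on (UNIV - {0})" for k
    by (rule bessel_term_summable[OF assms])
  show "bessel_term h m (\<lambda>n. \<i> * of_real (freq h n) * a n) u v summable_on (UNIV - {0})"
    by (rule bessel_term_summable[OF h subexponential_freq(1)[OF a] v])
  fix k :: real and n :: int
  have "bessel_term h m a (u + k) v n - bessel_term h m a u v n -
      k *\<^sub>R bessel_term h m (\<lambda>n. \<i> * of_real (freq h n) * a n) u v n =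
      bessel_term h m a u v n * (cis (freq h n * k) - 1 - \<i> * of_real (freq h n * k))"
    by (simp add: bessel_term_def algebra_simps scaleR_conv_of_real flip: cis_mult)
  also have "norm \<dots> \<le> norm (bessel_term h m a u v n) * (freq h n * k)\<^sup>2"
    unfolding norm_mult by (intro mult_left_mono norm_cis_second_order norm_ge_zero)
  also have "\<dots> = ?M n * k\<^sup>2"
    by (simp add: norm_bessel_term norm_mult norm_power power_mult_distrib mult_ac)
  finally show "norm (bessel_term h m a (u + k) v n - bessel_term h m a u v n -
      k *\<^sub>R bessel_term h m (\<lambda>n. \<i> * of_real (freq h n) * a n) u v n) \<le> ?M n * k\<^sup>2" .
qed simp

lemma bessel_series_deriv_v:
  assumes h: "h > 0" and a: "subexponential a" and v: "v > 0"
  shows "((\<lambda>v. bessel_series h m a u v) has_vector_derivative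
      - bessel_series h (Suc m) (\<lambda>n. of_real \<bar>freq h n\<bar> * a n) u v) (at v)"
proof -
  let ?b = "\<lambda>n. - (of_real \<bar>freq h n\<bar> * a n)"
  have b: "subexponential ?b"
    using subexponential_freq(2)[OF a, of h] by (simp add: subexponential_def)
  have "((\<lambda>v. bessel_series h m a u v) has_vector_derivative bessel_series h (Suc m) ?b u v) (at v)"
    unfolding bessel_series_def
  proof (rule has_vector_derivative_infsum_quadratic[where d = "v / 2"])
    \<comment> \<open>The Taylor constant involves the moment at half the argument. Summability
      holds at every positive height, so also at \<open>v / 2\<close>; the restriction of the
      increment to \<open>v / 2\<close> is the one of the Taylor estimate.\<close>
    let ?M = "\<lambda>n. norm (of_real (freq h n) ^ 2 * a n) * cosh_moment (m + 2) (\<bar>freq h n\<bar> * (v / 2))"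
    show "?M summable_on (UNIV - {0})"
      using v by (intro bessel_coeff_summable[OF h subexponential_freq(3)[OF a]]) simp
    show "bessel_term h m a u (v + k) summable_on (UNIV - {0})" if "\<bar>k\<bar> \<le> v / 2" for k
      using v that by (intro bessel_term_summable h a) linarith
    show "bessel_term h (Suc m) ?b u v summable_on (UNIV - {0})"
      by (rule bessel_term_summable[OF h b v])
    fix k :: real and n :: int
    assume k: "\<bar>k\<bar> \<le> v / 2" and "n \<in> UNIV - {0}"
    then have f: "\<bar>freq h n\<bar> > 0"
      using freq_abs_pos[OF h] by simp
    let ?y = "\<bar>freq h n\<bar> * v" and ?k = "\<bar>freq h n\<bar> * k"
    have "bessel_term h m a u (v + k) n - bessel_term h m a u v n - k *\<^sub>R bessel_term h (Suc m) ?b u v n =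
        a n * cis (freq h n * u) * of_real (cosh_moment m (?y + ?k) - cosh_moment m ?y + ?k * cosh_moment (Suc m) ?y)"
      by (simp add: bessel_term_def algebra_simps scaleR_conv_of_real)
    also have "norm \<dots> = norm (a n) * \<bar>cosh_moment m (?y + ?k) - cosh_moment m ?y + ?k * cosh_moment (Suc m) ?y\<bar>"
      by (simp only: norm_mult norm_cis norm_of_real mult_1_right)
    also have "\<dots> \<le> norm (a n) * (?k\<^sup>2 * cosh_moment (m + 2) (?y / 2))"
      using f v k by (intro mult_left_mono cosh_moment_taylor) (auto simp: abs_mult)
    also have "\<dots> = ?M n * k\<^sup>2"
      by (simp add: norm_mult norm_power power_mult_distrib mult_ac)
    finally show "norm (bessel_term h m a u (v + k) n - bessel_term h m a u v n -
        k *\<^sub>R bessel_term h (Suc m) ?b u v n) \<le> ?M n * k\<^sup>2" .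
  qed (use v in simp)
  moreover have "bessel_series h (Suc m) ?b u v = - bessel_series h (Suc m) (\<lambda>n. of_real \<bar>freq h n\<bar> * a n) u v"
    unfolding bessel_series_def bessel_term_def by (simp flip: infsum_uminus)
  ultimately show ?thesis
    by simp
qed

text \<open>K0 decays at most exponentially, so bounded terms at height v allow the coefficients a
  growth rate proportional to v. Since v may be taken arbitrarily small, every positive rate is
  reached.\<close>

lemma subexponential_if_bessel_bounded:
  assumes h: "h > 0"
    and bound: "\<And>v. v > 0 \<Longrightarrow> \<exists>C. \<forall>n. n \<noteq> 0 \<longrightarrow> norm (a n) * cosh_moment 0 (\<bar>freq h n\<bar> * v) \<le> C"
  shows "subexponential a"
  unfolding subexponential_def
proof (intro allI impI)
  fix e :: real assume e: "e > 0"
  \<comment> \<open>Chosen such that \<open>\<bar>freq h n\<bar> * v * cosh 1\<close> equals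
    \<open>e * \<bar>n\<bar>\<close>, which matches the lower bound for the moment with d =
    1.\<close>
  define v where "v = e * real h / (2 * pi * cosh 1)"
  have v: "v > 0"
    using e h by (simp add: v_def)
  obtain C where C: "\<And>n. n \<noteq> 0 \<Longrightarrow> norm (a n) * cosh_moment 0 (\<bar>freq h n\<bar> * v) \<le> C"
    using bound[OF v] by blast
  show "\<exists>C. \<forall>n. n \<noteq> 0 \<longrightarrow> norm (a n) \<le> C * exp (e * \<bar>real_of_int n\<bar>)"
  proof (intro exI allI impI)
    fix n :: int assume n: "n \<noteq> 0"
    have "exp (- (e * \<bar>real_of_int n\<bar>)) = 1 * exp (- (\<bar>freq h n\<bar> * v) * cosh 1)"
      using h cosh_real_pos[of 1] by (simp add: v_def freq_abs field_simps)
    also have "\<dots> \<le> cosh_moment 0 (\<bar>freq h n\<bar> * v)"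
      using freq_abs_pos[OF h n] v by (intro cosh_moment_lower) auto
    finally have "norm (a n) * exp (- (e * \<bar>real_of_int n\<bar>)) \<le> C"
      using C[OF n] by (meson mult_left_mono norm_ge_zero order_trans)
    then show "norm (a n) \<le> C * exp (e * \<bar>real_of_int n\<bar>)"
      by (simp add: exp_minus field_simps)
  qed
qed

text \<open>Unconditional convergence of a complex sum is absolute, so the points of the imaginary
  axis alone already bound the coefficients. After this equivalence the existentially quantified
  sums are replaced by the function \<open>bessel_series\<close> and a growth condition.\<close>

lemma has_cusp_expansion_iff:
  assumes h: "h > 0"
  shows "has_cusp_expansion h G k1 k2 a \<longleftrightarrow> subexponential a \<and>
    (\<forall>\<tau>\<in>upper_half_plane. G \<tau> = k1 * of_real (sqrt (Im \<tau>)) + k2 * of_real (sqrt (Im \<tau>) * ln (Im \<tau>))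
               + of_real (sqrt (Im \<tau>)) * bessel_series h 0 a (Re \<tau>) (Im \<tau>))"
proof -
  have trm: "a n * of_real (bessel_K0 (2 * pi * \<bar>real_of_int n\<bar> * v / real h)) * cis (2 * pi * real_of_int n * u / real h)
      = bessel_term h 0 a u v n" for n u v
    by (simp add: bessel_term_def bessel_K0_eq_cosh_moment freq_def abs_mult)
  show ?thesis
  proof
    assume exp: "has_cusp_expansion h G k1 k2 a"
    have "subexponential a"
    proof (rule subexponential_if_bessel_bounded[OF h])
      fix v :: real assume "v > 0"
      then have "\<i> * of_real v \<in> upper_half_plane"
        by (simp add: upper_half_plane_def)
      then have "bessel_term h 0 a 0 v summable_on (UNIV - {0})"
        using exp unfolding has_cusp_expansion_def trm
        by (force simp: summable_on_def)
      then have s: "(\<lambda>n. norm (bessel_term h 0 a 0 v n)) summable_on (UNIV - {0})"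
        by (simp add: summable_on_iff_abs_summable_on_complex)
      have "norm (a n) * cosh_moment 0 (\<bar>freq h n\<bar> * v) \<le> (\<Sum>\<^sub>\<infinity>n\<in>UNIV - {0}. norm (bessel_term h 0 a 0 v n))" if "n \<noteq> 0" for n
        using finite_sum_le_infsum[OF s, of "{n}"] that by (simp add: norm_bessel_term cosh_moment_nonneg)
      then show "\<exists>C. \<forall>n. n \<noteq> 0 \<longrightarrow> norm (a n) * cosh_moment 0 (\<bar>freq h n\<bar> * v) \<le> C"
        by blast
    qed
    then show "subexponential a \<and> (\<forall>\<tau>\<in>upper_half_plane. G \<tau> = k1 * of_real (sqrt (Im \<tau>)) + k2 * of_real (sqrt (Im \<tau>) * ln (Im \<tau>))
               + of_real (sqrt (Im \<tau>)) * bessel_series h 0 a (Re \<tau>) (Im \<tau>))"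
      using exp unfolding has_cusp_expansion_def trm bessel_series_def
      by (force dest: infsumI)
  next
    assume *: "subexponential a \<and> (\<forall>\<tau>\<in>upper_half_plane. G \<tau> = k1 * of_real (sqrt (Im \<tau>)) + k2 * of_real (sqrt (Im \<tau>) * ln (Im \<tau>))
               + of_real (sqrt (Im \<tau>)) * bessel_series h 0 a (Re \<tau>) (Im \<tau>))"
    show "has_cusp_expansion h G k1 k2 a"
      unfolding has_cusp_expansion_def trm
    proof (intro ballI exI conjI)
      fix \<tau> assume \<tau>: "\<tau> \<in> upper_half_plane"
      show "(bessel_term h 0 a (Re \<tau>) (Im \<tau>) has_sum bessel_series h 0 a (Re \<tau>) (Im \<tau>)) (UNIV - {0})"
        using * \<tau> by (intro bessel_term_has_sum h) (auto simp: upper_half_plane_def)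
      show "G \<tau> = k1 * of_real (sqrt (Im \<tau>)) + k2 * of_real (sqrt (Im \<tau>) * ln (Im \<tau>))
               + of_real (sqrt (Im \<tau>)) * bessel_series h 0 a (Re \<tau>) (Im \<tau>)"
        using * \<tau> by blast
    qed
  qed
qed

section \<open>Abel inversion of Bessel series\<close>

lemma has_integral_indicator_UNIV:
  fixes f :: "real \<Rightarrow> real"
  shows "((\<lambda>x. f x * indicator S x) has_integral I) UNIV \<longleftrightarrow> (f has_integral I) S"
proof -
  have "(\<lambda>x. f x * indicator S x) = (\<lambda>x. if x \<in> S then f x else 0)"
    by (auto simp: indicator_def)
  then show ?thesis
    using has_integral_restrict_UNIV[of S f I] by simp
qed

text \<open>The double integral is computed in both orders as a nonnegative Lebesgue integral and
  converted back. The measurability of \<open>g\<close> and \<open>k\<close> that the conversion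
  requires follows from their being partial integrals of a measurable function.\<close>

lemma tonelli_has_integral:
  fixes f :: "real \<Rightarrow> real \<Rightarrow> real"
  assumes meas: "(\<lambda>(x, y). f x y) \<in> borel_measurable borel"
    and nonneg: "\<And>x y. x > 0 \<Longrightarrow> y > 0 \<Longrightarrow> f x y \<ge> 0"
    and g: "\<And>x. x > 0 \<Longrightarrow> (f x has_integral g x) {0<..}"
    and k: "\<And>y. y > 0 \<Longrightarrow> ((\<lambda>x. f x y) has_integral k y) {0<..}"
    and I: "(k has_integral I) {0<..}"
  shows "(g has_integral I) {0<..}"
proof -
  let ?i = "indicator {0<..} :: real \<Rightarrow> real"
  define F where "F x y = f x y * (?i x * ?i y)" for x y
  have F0: "F x y \<ge> 0" for x y
    using nonneg[of x y] by (auto simp: F_def indicator_def)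
  have F[measurable]: "(\<lambda>p. F (fst p) (snd p)) \<in> borel_measurable (borel \<Otimes>\<^sub>M borel)"
    unfolding F_def using meas[unfolded borel_prod[symmetric]]
    by (simp add: case_prod_beta)
  have Fx[measurable]: "F x \<in> borel_measurable borel" for x
    using measurable_compose[OF measurable_Pair1'[of x borel borel] F] by simp
  have Fy[measurable]: "(\<lambda>x. F x y) \<in> borel_measurable borel" for y
    using measurable_compose[OF measurable_Pair2'[of y borel borel] F] by simp
  have g0: "g x \<ge> 0" if "x > 0" for x
    using has_integral_nonneg[OF g[OF that]] nonneg[OF that] by auto
  have k0: "k y \<ge> 0" if "y > 0" for y
    using has_integral_nonneg[OF k[OF that]] nonneg[OF _ that] by auto
  have I0: "I \<ge> 0"
    using has_integral_nonneg[OF I] k0 by auto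
  have inner1: "(\<integral>\<^sup>+y. ennreal (F x y) \<partial>lborel) = ennreal (g x * ?i x)" for x
  proof (rule nn_integral_has_integral_lborel)
    show "(F x has_integral g x * ?i x) UNIV"
    proof (cases "x > 0")
      case True
      then have "F x = (\<lambda>y. f x y * ?i y)"
        by (auto simp: F_def fun_eq_iff)
      then show ?thesis
        using g[OF True] True by (simp add: has_integral_indicator_UNIV)
    qed (simp add: F_def[abs_def])
  qed (auto simp: F0)
  have inner2: "(\<integral>\<^sup>+x. ennreal (F x y) \<partial>lborel) = ennreal (k y * ?i y)" for y
  proof (rule nn_integral_has_integral_lborel)
    show "((\<lambda>x. F x y) has_integral k y * ?i y) UNIV"
    proof (cases "y > 0")
      case True
      then have "(\<lambda>x. F x y) = (\<lambda>x. f x y * ?i x)"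
        by (auto simp: F_def fun_eq_iff)
      then show ?thesis
        using k[OF True] True by (simp add: has_integral_indicator_UNIV)
    qed (simp add: F_def[abs_def])
  qed (auto simp: F0)
  have F': "case_prod (\<lambda>x y. ennreal (F x y)) \<in> borel_measurable (lborel \<Otimes>\<^sub>M lborel)"
    by (simp add: case_prod_beta)
  have "(\<lambda>x. \<integral>\<^sup>+y. ennreal (F x y) \<partial>lborel) \<in> borel_measurable lborel"
    using F' by (intro lborel.borel_measurable_nn_integral) 
  then have "(\<lambda>x. ennreal (g x * ?i x)) \<in> borel_measurable borel"
    by (simp add: inner1)
  then have mg: "(\<lambda>x. g x * ?i x) \<in> borel_measurable borel"
  proof -
    assume "(\<lambda>x. ennreal (g x * ?i x)) \<in> borel_measurable borel"
    then have "(\<lambda>x. enn2real (ennreal (g x * ?i x))) \<in> borel_measurable borel"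
      by measurable
    moreover have "enn2real (ennreal (g x * ?i x)) = g x * ?i x" for x
      using g0[of x] by (auto simp: indicator_def)
    ultimately show ?thesis by simp
  qed
  have "(\<lambda>y. \<integral>\<^sup>+x. ennreal (F x y) \<partial>lborel) \<in> borel_measurable lborel"
    using measurable_compose[OF measurable_pair_swap' F]
    by (intro lborel.borel_measurable_nn_integral) (simp add: case_prod_beta)
  then have mk: "(\<lambda>y. k y * ?i y) \<in> borel_measurable borel"
  proof -
    assume "(\<lambda>y. \<integral>\<^sup>+x. ennreal (F x y) \<partial>lborel) \<in> borel_measurable lborel"
    then have "(\<lambda>x. enn2real (ennreal (k x * ?i x))) \<in> borel_measurable borel"
      by (simp add: inner2)
    moreover have "enn2real (ennreal (k x * ?i x)) = k x * ?i x" for x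
      using k0[of x] by (auto simp: indicator_def)
    ultimately show ?thesis by simp
  qed
  have "(\<integral>\<^sup>+x. ennreal (g x * ?i x) \<partial>lborel) = (\<integral>\<^sup>+x. \<integral>\<^sup>+y. ennreal (F x y) \<partial>lborel \<partial>lborel)"
    by (simp add: inner1)
  also have "\<dots> = (\<integral>\<^sup>+y. \<integral>\<^sup>+x. ennreal (F x y) \<partial>lborel \<partial>lborel)"
    by (rule lborel_pair.Fubini'[OF F', symmetric])
  also have "\<dots> = (\<integral>\<^sup>+y. ennreal (k y * ?i y) \<partial>lborel)"
    by (simp add: inner2)
  also have "\<dots> = ennreal I"
  proof (rule nn_integral_has_integral_lborel[OF mk])
    show "((\<lambda>y. k y * ?i y) has_integral I) UNIV"
      by (rule has_integral_indicator_UNIV[THEN iffD2, OF I])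
    show "0 \<le> k y * ?i y" for y
      using k0[of y] by (simp add: indicator_def)
  qed
  finally have "((\<lambda>x. g x * ?i x) has_integral I) UNIV"
    using mg g0 I0 by (intro nn_integral_has_integral) (auto simp: indicator_def)
  then show ?thesis
    by (simp add: has_integral_indicator_UNIV)
qed

lemma has_integral_FTC_Ioi:
  fixes f :: "real \<Rightarrow> real"
  assumes "f \<in> borel_measurable borel" "\<And>x. x \<ge> 0 \<Longrightarrow> (F has_real_derivative f x) (at x)"
    "\<And>x. x \<ge> 0 \<Longrightarrow> 0 \<le> f x" "(F \<longlongrightarrow> T) at_top"
  shows "(f has_integral T - F 0) {0<..}"
proof -
  have n: "(\<integral>\<^sup>+x. ennreal (f x) * indicator {0..} x \<partial>lborel) = ennreal (T - F 0)"
    by (rule nn_integral_FTC_atLeast) (use assms in auto)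
  have "T \<ge> F 0"
  proof (rule tendsto_lowerbound[OF assms(4)])
    show "\<forall>\<^sub>F x in at_top. F 0 \<le> F x"
      using eventually_ge_at_top[of 0]
    proof eventually_elim
      case (elim x)
      show ?case
        by (rule DERIV_nonneg_imp_nondecreasing[OF elim]) (use assms in force)
    qed
  qed simp
  then have "((\<lambda>x. f x * indicator {0..} x) has_integral T - F 0) UNIV"
  proof (intro nn_integral_has_integral)
    have "ennreal (f x * indicator {0..} x) = ennreal (f x) * indicator {0..} x" for x
      by (simp add: indicator_def)
    then show "(\<integral>\<^sup>+x. ennreal (f x * indicator {0..} x) \<partial>lborel) = ennreal (T - F 0)"
      using n by simp
    show "0 \<le> f x * indicator {0..} x" for x
      using assms(3)[of x] by (simp add: indicator_def)
  qed (use assms(1) in auto)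
  then have "(f has_integral T - F 0) {0..}"
    by (simp add: has_integral_indicator_UNIV)
  then show ?thesis
    by (simp add: has_integral_iff integral_Ioi_Ici)
qed

text \<open>For nonnegative integrands integrability is absolute integrability, so the change of
  variables becomes an equivalence; it is applied in both directions.\<close>

lemma has_integral_substitution_Ioi:
  fixes f :: "real \<Rightarrow> real"
  assumes f: "\<And>x. x > 0 \<Longrightarrow> f x \<ge> 0"
    and g: "\<And>x. x > 0 \<Longrightarrow> (g has_real_derivative h x) (at x)" "\<And>x. x > 0 \<Longrightarrow> h x > 0"
    and im: "g ` {0<..} = {0<..}"
  shows "((\<lambda>x. h x * f (g x)) has_integral I) {0<..} \<longleftrightarrow> (f has_integral I) {0<..}"
proof -
  have inj: "inj_on g {0<..}"
  proof (rule strict_mono_on_imp_inj_on, rule strict_mono_onI)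
    fix r s :: real assume rs: "r \<in> {0<..}" "r < s"
    show "g r < g s"
    proof (rule DERIV_pos_imp_increasing[OF rs(2)])
      fix x assume "r \<le> x"
      then have "x > 0" using rs(1) by simp
      then show "\<exists>y. (g has_real_derivative y) (at x) \<and> y > 0"
        using g by blast
    qed
  qed
  have abs: "f integrable_on {0<..} \<longleftrightarrow> f absolutely_integrable_on {0<..}"
    if "\<And>x. x > 0 \<Longrightarrow> f x \<ge> 0" for f :: "real \<Rightarrow> real"
    using nonnegative_absolutely_integrable_1[of f "{0<..}"] that
    by (auto simp: absolutely_integrable_on_def)
  have hf: "h x * f (g x) \<ge> 0" if "x > 0" for x
  proof -
    have "g x > 0"
      using im that by auto
    then show ?thesis
      using g(2)[OF that] f[of "g x"] by simp
  qed
  have "((\<lambda>x. h x * f (g x)) has_integral I) {0<..} \<longleftrightarrow>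
      ((\<lambda>x. \<bar>h x\<bar> * f (g x)) has_integral I) {0<..}"
    by (rule has_integral_cong) (use g(2) in force)
  also have "\<dots> \<longleftrightarrow> (\<lambda>x. \<bar>h x\<bar> * f (g x)) absolutely_integrable_on {0<..} \<and>
        integral {0<..} (\<lambda>x. \<bar>h x\<bar> * f (g x)) = I"
  proof -
    have "0 \<le> \<bar>h x\<bar> * f (g x)" if "x > 0" for x
      using hf[OF that] g(2)[OF that] by simp
    from abs[of "\<lambda>x. \<bar>h x\<bar> * f (g x)", OF this] show ?thesis
      by (simp add: has_integral_iff)
  qed
  also have "\<dots> \<longleftrightarrow> f absolutely_integrable_on (g ` {0<..}) \<and> integral (g ` {0<..}) f = I"
    by (rule has_absolute_integral_change_of_variables_1')
       (use g(1) inj in \<open>auto intro: has_field_derivative_at_within\<close>)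
  also have "\<dots> \<longleftrightarrow> (f has_integral I) {0<..}"
    using abs[of f] f by (simp add: im has_integral_iff)
  finally show ?thesis .
qed

lemma has_integral_sinh_substitution:
  fixes f :: "real \<Rightarrow> real"
  assumes "r > 0" "\<And>x. x > 0 \<Longrightarrow> f x \<ge> 0"
  shows "((\<lambda>t. r * cosh t * f (r * sinh t)) has_integral I) {0<..} \<longleftrightarrow> (f has_integral I) {0<..}"
proof (rule has_integral_substitution_Ioi)
  show "(\<lambda>t. r * sinh t) ` {0<..} = {0<..}"
  proof (intro equalityI subsetI)
    fix x :: real assume "x \<in> {0<..}"
    then show "x \<in> (\<lambda>t. r * sinh t) ` {0<..}"
      using assms by (intro image_eqI[of _ _ "arsinh (x / r)"]) auto
  qed (use assms in auto)
qed (use assms in \<open>auto intro!: derivative_eq_intros\<close>)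

lemma has_integral_scale_substitution:
  fixes f :: "real \<Rightarrow> real"
  assumes "r > 0" "\<And>x. x > 0 \<Longrightarrow> f x \<ge> 0"
  shows "((\<lambda>t. r * f (r * t)) has_integral I) {0<..} \<longleftrightarrow> (f has_integral I) {0<..}"
proof (rule has_integral_substitution_Ioi)
  show "(\<lambda>t. r * t) ` {0<..} = {0<..}"
  proof (intro equalityI subsetI)
    fix x :: real assume "x \<in> {0<..}"
    then show "x \<in> (\<lambda>t. r * t) ` {0<..}"
      using assms by (intro image_eqI[of _ _ "x / r"]) auto
  qed (use assms in auto)
qed (use assms in \<open>auto intro!: derivative_eq_intros\<close>)

section \<open>Abel transforms of the Bessel moments\<close>

lemma cosh_moment_has_integral:
  "y > 0 \<Longrightarrow> ((\<lambda>t. cosh t ^ m * exp (- y * cosh t)) has_integral cosh_moment m y) {0<..}"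
  using cosh_moment_integrable[of y m]
  by (simp add: has_integral_iff integral_Ioi_Ici cosh_moment_def)

text \<open>With p = r sinh t the root becomes r cosh t and dp divided by the root becomes dt, which
  leaves the integral representation of K0(a r).\<close>

lemma yukawa_has_integral:
  assumes "a > 0" "r > 0"
  shows "((\<lambda>p. exp (- a * sqrt (r\<^sup>2 + p\<^sup>2)) / sqrt (r\<^sup>2 + p\<^sup>2)) has_integral cosh_moment 0 (a * r)) {0<..}"
proof (rule has_integral_sinh_substitution[of r, THEN iffD1])
  have "sqrt (r\<^sup>2 + (r * sinh t)\<^sup>2) = r * cosh t" for t
  proof -
    have "r\<^sup>2 + (r * sinh t)\<^sup>2 = (r * cosh t)\<^sup>2"
      by (simp add: power_mult_distrib cosh_square_eq algebra_simps)
    then show ?thesis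
      using assms by (simp add: cosh_real_nonneg)
  qed
  moreover have "r * cosh t \<noteq> 0" for t
    using assms by simp
  ultimately show "((\<lambda>t. r * cosh t * (exp (- a * sqrt (r\<^sup>2 + (r * sinh t)\<^sup>2)) / sqrt (r\<^sup>2 + (r * sinh t)\<^sup>2)))
      has_integral cosh_moment 0 (a * r)) {0<..}"
    using cosh_moment_has_integral[of "a * r" 0] assms by (simp add: mult_ac)
qed (use assms in auto)

lemma inverse_square_has_integral: "((\<lambda>m. 1 / (1 + m\<^sup>2)) has_integral pi / 2) {0<..}"
proof -
  have "((\<lambda>m. 1 / (1 + m\<^sup>2)) has_integral pi / 2 - arctan 0) {0<..}"
  proof (rule has_integral_FTC_Ioi)
    show "(arctan has_real_derivative 1 / (1 + x\<^sup>2)) (at x)" for x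
      using DERIV_arctan[of x] by (simp add: divide_inverse)
  qed (auto simp: tendsto_arctan_at_top)
  then show ?thesis by simp
qed

text \<open>In polar coordinates this is the projection of the Yukawa potential
  \<open>exp (- a X) / X\<close> of three-space onto a line.\<close>

lemma cosh_moment_0_has_integral:
  assumes a: "a > 0" and y: "y > 0"
  shows "((\<lambda>s. cosh_moment 0 (a * sqrt (y\<^sup>2 + s\<^sup>2))) has_integral pi / 2 * exp (- a * y) / a) {0<..}"
proof (rule tonelli_has_integral)
  \<comment> \<open>The plane of points (s, p) is parametrised by s and the slope m = p / s, with
    Jacobian s. For fixed m the radicand is y^2 + s^2 (1 + m^2), so the s-integral is elementary and
    leaves the factor 1 / (1 + m^2).\<close>
  let ?X = "\<lambda>s m. sqrt (y\<^sup>2 + s\<^sup>2 + (s * m)\<^sup>2) :: real"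
  let ?f = "\<lambda>s m. s * (exp (- a * ?X s m) / ?X s m)"
  have X: "y\<^sup>2 + s\<^sup>2 + (s * m)\<^sup>2 > 0" for s m
    using y by (simp add: add_pos_nonneg)
  show "(\<lambda>(s, m). ?f s m) \<in> borel_measurable borel"
    by (simp add: case_prod_beta borel_prod[symmetric])
  show "0 \<le> ?f s m" if "s > 0" for s m
    using that X[of s m] by (intro mult_nonneg_nonneg divide_nonneg_nonneg) auto
  show "(?f s has_integral cosh_moment 0 (a * sqrt (y\<^sup>2 + s\<^sup>2))) {0<..}" if "s > 0" for s
  proof (rule has_integral_scale_substitution[OF that, THEN iffD2])
    show "((\<lambda>p. exp (- a * sqrt (y\<^sup>2 + s\<^sup>2 + p\<^sup>2)) / sqrt (y\<^sup>2 + s\<^sup>2 + p\<^sup>2))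
        has_integral cosh_moment 0 (a * sqrt (y\<^sup>2 + s\<^sup>2))) {0<..}"
      using yukawa_has_integral[of a "sqrt (y\<^sup>2 + s\<^sup>2)"] a y by (simp add: add_pos_nonneg)
    show "0 \<le> exp (- a * sqrt (y\<^sup>2 + s\<^sup>2 + x\<^sup>2)) / sqrt (y\<^sup>2 + s\<^sup>2 + x\<^sup>2)" for x
      by simp
  qed
  show "((\<lambda>s. ?f s m) has_integral exp (- a * y) / (a * (1 + m\<^sup>2))) {0<..}" for m
  proof -
    let ?F = "\<lambda>s. - exp (- a * ?X s m) / (a * (1 + m\<^sup>2))"
    have m: "1 + m\<^sup>2 > 0"
      by (simp add: add_pos_nonneg)
    have "((\<lambda>s. ?f s m) has_integral 0 - ?F 0) {0<..}"
    proof (rule has_integral_FTC_Ioi)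
      fix s :: real
      have "(?F has_real_derivative - (exp (- a * ?X s m) * (- a * ((2 * s + 2 * (s * m) * m) * (inverse (?X s m) / 2))))
          / (a * (1 + m\<^sup>2))) (at s)"
        using X[of s m] a m by (auto intro!: derivative_eq_intros simp: add_nonneg_eq_0_iff)
      moreover have "2 * s + 2 * (s * m) * m = 2 * s * (1 + m\<^sup>2)"
        by (simp add: algebra_simps power2_eq_square)
      moreover have "- (E * (- a * ((2 * s * k) * (inverse Y / 2)))) / (a * k) = s * (E / Y)"
        if "k > 0" for E Y k :: real
        using a that by (simp add: field_simps)
      ultimately show "(?F has_real_derivative ?f s m) (at s)"
        using m by (simp only:)
      show "0 \<le> ?f s m" if "s \<ge> 0"
        using that X[of s m] by (intro mult_nonneg_nonneg divide_nonneg_nonneg) auto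
    next
      have "filterlim (\<lambda>s. a * ?X s m) at_top at_top"
      proof (rule filterlim_at_top_mono)
        show "filterlim (\<lambda>s. a * s) at_top at_top"
          using a by real_asymp
        have "a * s \<le> a * ?X s m" for s
          using a by (intro mult_left_mono real_le_rsqrt) auto
        then show "\<forall>\<^sub>F s in at_top. a * s \<le> a * ?X s m"
          by simp
      qed
      then have "((\<lambda>s. exp (- (a * ?X s m))) \<longlongrightarrow> 0) at_top"
        by (intro filterlim_compose[OF exp_at_bot] filterlim_compose[OF filterlim_uminus_at_bot_at_top])
      from tendsto_mult_left[OF this, of "- 1 / (a * (1 + m\<^sup>2))"]
      show "(?F \<longlongrightarrow> 0) at_top"
        by simp
    qed simp
    then show ?thesis
      using y by simp
  qed
  have "((\<lambda>m. exp (- a * y) / a * (1 / (1 + m\<^sup>2))) has_integral exp (- a * y) / a * (pi / 2)) {0<..}"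
    by (intro has_integral_mult_right inverse_square_has_integral)
  then show "((\<lambda>m. exp (- a * y) / (a * (1 + m\<^sup>2))) has_integral pi / 2 * exp (- a * y) / a) {0<..}"
    by (simp add: mult_ac)
qed

text \<open>Write the first moment as its integral over t and integrate over s before t: the
  s-integral is the Yukawa integral with a replaced by a cosh t. The substitution s = y sinh t then
  reduces what remains to the transform of the moment of order 0, divided by y.\<close>

lemma cosh_moment_1_has_integral:
  assumes a: "a > 0" and y: "y > 0"
  shows "((\<lambda>s. cosh_moment 1 (a * sqrt (y\<^sup>2 + s\<^sup>2)) / sqrt (y\<^sup>2 + s\<^sup>2)) has_integral
    pi / 2 * exp (- a * y) / (a * y)) {0<..}"
proof (rule tonelli_has_integral)
  let ?r = "\<lambda>s. sqrt (y\<^sup>2 + s\<^sup>2)"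
  let ?f = "\<lambda>s t. cosh t * (exp (- (a * cosh t) * ?r s) / ?r s)"
  have r: "?r s > 0" for s
    using y by (simp add: add_pos_nonneg)
  show "(\<lambda>(s, t). ?f s t) \<in> borel_measurable borel"
    unfolding cosh_field_def by (simp add: case_prod_beta borel_prod[symmetric])
  show "0 \<le> ?f s t" for s t
    by (simp add: cosh_real_nonneg)
  show "(?f s has_integral cosh_moment 1 (a * ?r s) / ?r s) {0<..}" for s
    using has_integral_divide[OF cosh_moment_has_integral[of "a * ?r s" 1], of "?r s"] a r[of s]
    by (simp add: mult_ac)
  show "((\<lambda>s. ?f s t) has_integral cosh t * cosh_moment 0 (a * cosh t * y)) {0<..}" for t
    using a y by (intro has_integral_mult_right yukawa_has_integral) auto
  have "((\<lambda>t. y * cosh t * cosh_moment 0 (a * sqrt (y\<^sup>2 + (y * sinh t)\<^sup>2))) has_integral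
      pi / 2 * exp (- a * y) / a) {0<..}"
    by (rule has_integral_sinh_substitution[of y, THEN iffD2])
       (use cosh_moment_0_has_integral[OF assms] y in \<open>auto simp: cosh_moment_nonneg\<close>)
  moreover have "sqrt (y\<^sup>2 + (y * sinh t)\<^sup>2) = y * cosh t" for t
  proof -
    have "y\<^sup>2 + (y * sinh t)\<^sup>2 = (y * cosh t)\<^sup>2"
      by (simp add: power_mult_distrib cosh_square_eq algebra_simps)
    then show ?thesis
      using y by (simp add: cosh_real_nonneg)
  qed
  ultimately have "((\<lambda>t. y * (cosh t * cosh_moment 0 (a * cosh t * y))) has_integral
      pi / 2 * exp (- a * y) / a) {0<..}"
    by (simp add: mult_ac)
  from has_integral_divide[OF this, of y]
  show "((\<lambda>t. cosh t * cosh_moment 0 (a * cosh t * y)) has_integral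
      pi / 2 * exp (- a * y) / (a * y)) {0<..}"
    using y by (simp add: mult.assoc)
qed

text \<open>An enumeration of A turns the unordered sum into a sequence of partial sums, all
  dominated by the sum of the norms. The enumeration does not influence the limits because both sums
  converge unconditionally.\<close>

lemma has_integral_infsum_dominated:
  fixes f :: "'i \<Rightarrow> 'n::euclidean_space \<Rightarrow> 'a::euclidean_space"
  assumes \<beta>: "bij_betw \<beta> (UNIV :: nat set) A"
    and f: "\<And>n. n \<in> A \<Longrightarrow> (f n has_integral J n) S"
    and summable: "\<And>s. s \<in> S \<Longrightarrow> (\<lambda>n. norm (f n s)) summable_on A"
    and h: "h integrable_on S" "\<And>s. s \<in> S \<Longrightarrow> (\<Sum>\<^sub>\<infinity>n\<in>A. norm (f n s)) \<le> h s"
    and J: "(J has_sum I) A"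
  shows "((\<lambda>s. \<Sum>\<^sub>\<infinity>n\<in>A. f n s) has_integral I) S"
proof -
  have \<beta>A: "\<beta> i \<in> A" for i
    using \<beta> by (auto simp: bij_betw_def)
  let ?p = "\<lambda>k s. \<Sum>i<k. f (\<beta> i) s"
  have p: "(?p k has_integral (\<Sum>i<k. J (\<beta> i))) S" for k
    by (intro has_integral_sum f \<beta>A) auto
  have lim: "(\<lambda>k. ?p k s) \<longlonglongrightarrow> (\<Sum>\<^sub>\<infinity>n\<in>A. f n s)" if "s \<in> S" for s
  proof -
    have "((\<lambda>n. f n s) has_sum (\<Sum>\<^sub>\<infinity>n\<in>A. f n s)) A"
      by (rule has_sum_infsum[OF abs_summable_summable[OF summable[OF that]]])
    then have "((\<lambda>i. f (\<beta> i) s) has_sum (\<Sum>\<^sub>\<infinity>n\<in>A. f n s)) UNIV"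
      by (simp add: has_sum_reindex_bij_betw[OF \<beta>, of "\<lambda>n. f n s"])
    then show ?thesis
      using has_sum_imp_sums sums_def by blast
  qed
  have bd: "norm (?p k s) \<le> h s" if "s \<in> S" for k s
  proof -
    have "norm (?p k s) \<le> (\<Sum>i<k. norm (f (\<beta> i) s))"
      by (rule norm_sum)
    also have "\<dots> = (\<Sum>n\<in>\<beta> ` {..<k}. norm (f n s))"
      using \<beta> by (subst sum.reindex) (auto simp: bij_betw_def intro: inj_on_subset)
    also have "\<dots> \<le> (\<Sum>\<^sub>\<infinity>n\<in>A. norm (f n s))"
      by (rule finite_sum_le_infsum[OF summable[OF that]]) (use \<beta>A in auto)
    also have "\<dots> \<le> h s"
      by (rule h(2)[OF that])
    finally show ?thesis .
  qed
  have pi: "?p k integrable_on S" for k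
    using p by (rule has_integral_integrable)
  note dc = dominated_convergence[where f = ?p, OF pi h(1) bd lim]
  have "(\<lambda>k. \<Sum>i<k. J (\<beta> i)) \<longlonglongrightarrow> I"
  proof -
    have "((\<lambda>i. J (\<beta> i)) has_sum I) UNIV"
      using J by (simp add: has_sum_reindex_bij_betw[OF \<beta>, of J])
    then show ?thesis
      using has_sum_imp_sums sums_def by blast
  qed
  moreover have "(\<lambda>k. \<Sum>i<k. J (\<beta> i)) \<longlonglongrightarrow> integral S (\<lambda>s. \<Sum>\<^sub>\<infinity>n\<in>A. f n s)"
    using dc(2) by (simp only: integral_unique[OF p])
  ultimately show ?thesis
    using dc(1) LIMSEQ_unique by (metis has_integral_integral)
qed

lemma F_plus_summand:
  "A n * exp (2 * of_real pi * \<i> * of_int n * Complex x y / of_nat N) =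
     A n * of_real (exp (- freq N n * y)) * cis (freq N n * x)"
proof -
  have "2 * of_real pi * \<i> * of_int n * Complex x y / of_nat N =
      of_real (- freq N n * y) + \<i> * of_real (freq N n * x)"
    by (simp add: freq_def complex_eq_iff field_simps)
  then show ?thesis
    by (simp only: exp_add exp_of_real cis_conv_exp mult.assoc)
qed

lemma F_plus_has_sum:
  assumes N: "N > 0" and A: "subexponential A" and y: "y > 0"
  shows "((\<lambda>n. A n * of_real (exp (- freq N n * y)) * cis (freq N n * x)) has_sum
    F_plus N A (Complex x y)) {0<..}"
proof -
  let ?t = "\<lambda>n. A n * of_real (exp (- freq N n * y)) * cis (freq N n * x)"
  define f1 where "f1 = freq N 1"
  have f1: "f1 > 0"
    using N by (simp add: f1_def freq_1_pos)
  obtain C where C: "\<And>n. n \<noteq> 0 \<Longrightarrow> norm (A n) \<le> C * exp (f1 * y / 2 * \<bar>real_of_int n\<bar>)"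
    using A f1 y unfolding subexponential_def by (meson half_gt_zero mult_pos_pos)
  have "(\<lambda>n. norm (?t n)) summable_on {0<..}"
  proof (rule norm_summable_comparison)
    show "(\<lambda>n. C * exp (- (f1 * y / 2) * \<bar>real_of_int n\<bar>)) summable_on {0<..}"
      using f1 y by (intro summable_on_cmult_right summable_on_exp_int) simp
    fix n :: int assume "n \<in> {0<..}"
    then have n: "n > 0" by simp
    have fn: "freq N n = f1 * \<bar>real_of_int n\<bar>"
      using n by (simp add: f1_def freq_def)
    have "norm (?t n) = norm (A n) * exp (- (f1 * \<bar>real_of_int n\<bar>) * y)"
      by (simp add: norm_mult fn)
    also have "norm (A n) * exp (- (f1 * \<bar>real_of_int n\<bar>) * y) \<le>
        C * exp (f1 * y / 2 * \<bar>real_of_int n\<bar>) * exp (- (f1 * \<bar>real_of_int n\<bar>) * y)"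
      using n by (intro mult_right_mono C) auto
    also have "\<dots> = C * exp (- (f1 * y / 2) * \<bar>real_of_int n\<bar>)"
      by (simp add: mult.assoc algebra_simps flip: exp_add)
    finally show "norm (?t n) \<le> C * exp (- (f1 * y / 2) * \<bar>real_of_int n\<bar>)" .
  qed
  from has_sum_infsum[OF abs_summable_summable[OF this]] show ?thesis
    by (simp only: F_plus_def F_plus_summand)
qed

lemma bij_betw_nat_nonzero_int: "\<exists>\<beta>. bij_betw \<beta> (UNIV :: nat set) (UNIV - {0 :: int})"
proof -
  have "infinite (UNIV - {0 :: int})"
    by (simp add: infinite_UNIV_int)
  then show ?thesis
    using bij_betw_from_nat_into[of "UNIV - {0 :: int}"] by blast
qed

text \<open>Abel inversion of \<open>F \<mapsto> F\<^sup>+\<close> on a vertical line: the two derivatives of \<open>F / v\<^bsup>1/2\<^esup>\<close> enter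
  with weights for which the terms with \<open>n < 0\<close> cancel.\<close>

lemma F_plus_integral:
  assumes N: "N > 0" and A: "subexponential A" and y: "y > 0"
  shows "((\<lambda>s. \<i> * bessel_series N 0 (\<lambda>n. \<i> * of_real (freq N n) * A n) x (sqrt (y\<^sup>2 + s\<^sup>2))
      - of_real (y / sqrt (y\<^sup>2 + s\<^sup>2)) * bessel_series N 1 (\<lambda>n. of_real \<bar>freq N n\<bar> * A n) x (sqrt (y\<^sup>2 + s\<^sup>2)))
    has_integral - of_real pi * F_plus N A (Complex x y)) {0<..}"
proof -
  let ?S = "UNIV - {0 :: int}"
  let ?r = "\<lambda>s. sqrt (y\<^sup>2 + s\<^sup>2)"
  let ?b0 = "\<lambda>n. \<i> * of_real (freq N n) * A n" and ?b1 = "\<lambda>n. of_real \<bar>freq N n\<bar> * A n"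
  let ?f = "\<lambda>n s. \<i> * bessel_term N 0 ?b0 x (?r s) n - of_real (y / ?r s) * bessel_term N 1 ?b1 x (?r s) n"
  let ?J = "\<lambda>n. if n > 0 then - of_real pi * (A n * of_real (exp (- freq N n * y)) * cis (freq N n * x)) else 0"
  have sub0: "subexponential ?b0" and sub1: "subexponential ?b1"
    by (rule subexponential_freq[OF A])+
  have r: "?r s \<ge> y" "?r s \<ge> s" "?r s > 0" for s
    using y by (auto intro: real_le_rsqrt simp: add_pos_nonneg)
  note s0 = bessel_term_abs_summable[OF N sub0 r(3), of 0 x]
  note s1 = bessel_term_abs_summable[OF N sub1 r(3), of 1 x]
  have yr: "y / ?r s \<le> 1" for s
    using r[of s] by simp
  have bound: "norm (?f n s) \<le> norm (bessel_term N 0 ?b0 x (?r s) n) + norm (bessel_term N 1 ?b1 x (?r s) n)" for n s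
  proof -
    have "norm (?f n s) \<le> norm (bessel_term N 0 ?b0 x (?r s) n) + (y / ?r s) * norm (bessel_term N 1 ?b1 x (?r s) n)"
      by (rule order_trans[OF norm_triangle_ineq4]) (use y r[of s] in \<open>simp add: norm_mult norm_divide\<close>)
    also have "(y / ?r s) * norm (bessel_term N 1 ?b1 x (?r s) n) \<le> 1 * norm (bessel_term N 1 ?b1 x (?r s) n)"
      by (intro mult_right_mono yr) simp
    finally show ?thesis by simp
  qed
  obtain C0 where C0: "\<And>v. v \<ge> y \<Longrightarrow> (\<Sum>\<^sub>\<infinity>n\<in>?S. norm (?b0 n) * cosh_moment 0 (\<bar>freq N n\<bar> * v)) \<le> C0 * exp (- freq N 1 * v)"
    using bessel_coeff_sum_decay[OF N sub0 y] by blast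
  obtain C1 where C1: "\<And>v. v \<ge> y \<Longrightarrow> (\<Sum>\<^sub>\<infinity>n\<in>?S. norm (?b1 n) * cosh_moment 1 (\<bar>freq N n\<bar> * v)) \<le> C1 * exp (- freq N 1 * v)"
    using bessel_coeff_sum_decay[OF N sub1 y] by blast
  obtain \<beta> where \<beta>: "bij_betw \<beta> (UNIV :: nat set) ?S"
    using bij_betw_nat_nonzero_int by blast
  have "((\<lambda>s. \<Sum>\<^sub>\<infinity>n\<in>?S. ?f n s) has_integral - of_real pi * F_plus N A (Complex x y)) {0<..}"
  proof (rule has_integral_infsum_dominated[OF \<beta>])
    fix n assume "n \<in> ?S"
    then have n: "\<bar>freq N n\<bar> > 0"
      using freq_abs_pos[OF N] by simp
    let ?k = "\<bar>freq N n\<bar>"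
    have "((\<lambda>s. - freq N n * cosh_moment 0 (?k * ?r s) - y * ?k * (cosh_moment 1 (?k * ?r s) / ?r s))
        has_integral - freq N n * (pi / 2 * exp (- ?k * y) / ?k) - y * ?k * (pi / 2 * exp (- ?k * y) / (?k * y))) {0<..}"
      by (intro has_integral_diff has_integral_mult_right cosh_moment_0_has_integral cosh_moment_1_has_integral n y)
    \<comment> \<open>Both contributions have modulus pi/2 times \<open>exp (- ?k * y)\<close>. The
      first carries the sign of n and the second does not, so they double for n > 0.\<close>
    also have "- freq N n * (pi / 2 * exp (- ?k * y) / ?k) - y * ?k * (pi / 2 * exp (- ?k * y) / (?k * y)) =
        (if n > 0 then - pi * exp (- freq N n * y) else 0)"
    proof (cases "n > 0")
      case True
      then have "freq N n > 0"
        using N by (simp add: freq_def)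
      then show ?thesis
        using True y by (simp add: field_simps)
    next
      case False
      then have "freq N n < 0"
        using N n by (cases "n = 0") (auto simp: freq_def divide_less_0_iff mult_less_0_iff)
      then show ?thesis
        using False y by (simp add: field_simps)
    qed
    finally have "((\<lambda>s. - freq N n * cosh_moment 0 (?k * ?r s) - y * ?k * (cosh_moment 1 (?k * ?r s) / ?r s))
        has_integral (if n > 0 then - pi * exp (- freq N n * y) else 0)) {0<..}" .
    from has_integral_mult_right[OF has_integral_linear[OF this bounded_linear_of_real], of "A n * cis (freq N n * x)"]
    have "((\<lambda>s. A n * cis (freq N n * x) * of_real (- freq N n * cosh_moment 0 (?k * ?r s) - y * ?k * (cosh_moment 1 (?k * ?r s) / ?r s)))
        has_integral A n * cis (freq N n * x) * of_real (if n > 0 then - pi * exp (- freq N n * y) else 0)) {0<..}"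
      by (simp add: o_def)
    also have "A n * cis (freq N n * x) * of_real (if n > 0 then - pi * exp (- freq N n * y) else 0) = ?J n"
      by simp
    also have "(\<lambda>s. A n * cis (freq N n * x) * of_real (- freq N n * cosh_moment 0 (?k * ?r s) - y * ?k * (cosh_moment 1 (?k * ?r s) / ?r s))) = ?f n"
    proof
      fix s
      have "\<i> * (\<i> * z) = - z" for z
        by (simp flip: mult.assoc)
      then show "A n * cis (freq N n * x) * of_real (- freq N n * cosh_moment 0 (?k * ?r s) - y * ?k * (cosh_moment 1 (?k * ?r s) / ?r s)) = ?f n s"
        by (simp add: bessel_term_def algebra_simps)
    qed
    finally show "(?f n has_integral ?J n) {0<..}" .
  next
    fix s :: real assume s: "s \<in> {0<..}"
    show sf: "(\<lambda>n. norm (?f n s)) summable_on ?S"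
      by (rule norm_summable_comparison[OF summable_on_add[OF s0 s1] bound])
    have "(\<Sum>\<^sub>\<infinity>n\<in>?S. norm (?f n s)) \<le>
        (\<Sum>\<^sub>\<infinity>n\<in>?S. norm (bessel_term N 0 ?b0 x (?r s) n) + norm (bessel_term N 1 ?b1 x (?r s) n))"
      by (rule infsum_mono[OF sf summable_on_add[OF s0 s1] bound])
    also have "\<dots> = (\<Sum>\<^sub>\<infinity>n\<in>?S. norm (bessel_term N 0 ?b0 x (?r s) n)) + (\<Sum>\<^sub>\<infinity>n\<in>?S. norm (bessel_term N 1 ?b1 x (?r s) n))"
      by (rule infsum_add[OF s0 s1])
    also have "\<dots> \<le> C0 * exp (- freq N 1 * ?r s) + C1 * exp (- freq N 1 * ?r s)"
      unfolding norm_bessel_term using C0[OF r(1)] C1[OF r(1)] by (intro add_mono) blast+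
    also have "\<dots> = (C0 + C1) * exp (- freq N 1 * ?r s)"
      by (simp add: algebra_simps)
    also have "\<dots> \<le> \<bar>C0 + C1\<bar> * exp (- freq N 1 * s)"
      using r(2)[of s] freq_1_pos[OF N] by (intro mult_mono) auto
    finally show "(\<Sum>\<^sub>\<infinity>n\<in>?S. norm (?f n s)) \<le> \<bar>C0 + C1\<bar> * exp (- freq N 1 * s)" .
  next
    show "(\<lambda>s. \<bar>C0 + C1\<bar> * exp (- freq N 1 * s)) integrable_on {0<..}"
      unfolding integral_Ioi_Ici(2)
      using freq_1_pos[OF N] by (intro integrable_on_mult_right integrable_on_exp_minus_to_infinity)
  next
    have "((\<lambda>n. - of_real pi * (A n * of_real (exp (- freq N n * y)) * cis (freq N n * x))) has_sum
        - of_real pi * F_plus N A (Complex x y)) {0<..}"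
      by (intro has_sum_cmult_right F_plus_has_sum N A y)
    then show "(?J has_sum - of_real pi * F_plus N A (Complex x y)) ?S"
      by (rule has_sum_cong_neutral[THEN iffD1, rotated -1]) auto
  qed
  also have "(\<lambda>s. \<Sum>\<^sub>\<infinity>n\<in>?S. ?f n s) = (\<lambda>s. \<i> * bessel_series N 0 ?b0 x (?r s)
      - of_real (y / ?r s) * bessel_series N 1 ?b1 x (?r s))"
  proof
    fix s
    have "((\<lambda>n. \<i> * bessel_term N 0 ?b0 x (?r s) n + - of_real (y / ?r s) * bessel_term N 1 ?b1 x (?r s) n) has_sum
        \<i> * bessel_series N 0 ?b0 x (?r s) + - of_real (y / ?r s) * bessel_series N 1 ?b1 x (?r s)) ?S"
      by (intro has_sum_add has_sum_cmult_right bessel_term_has_sum N sub0 sub1 r)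
    then show "(\<Sum>\<^sub>\<infinity>n\<in>?S. ?f n s) = \<i> * bessel_series N 0 ?b0 x (?r s)
      - of_real (y / ?r s) * bessel_series N 1 ?b1 x (?r s)"
      by (simp add: infsumI)
  qed
  finally show ?thesis .
qed

section \<open>Eigenfunctions on the upper half-plane\<close>

text \<open>Total real differentiability with both partials as explicit functions. Total
  differentiability is what the chain rule along Moebius maps needs, and a pair of functions can be
  read as the components of a one-form, of which F is then a primitive.\<close>

definition uhp_partials :: "(complex \<Rightarrow> complex) \<Rightarrow> (complex \<Rightarrow> complex) \<Rightarrow> (complex \<Rightarrow> complex) \<Rightarrow> bool" where
  "uhp_partials F Fu Fv \<longleftrightarrow> (\<forall>\<tau>\<in>upper_half_plane.
     (F has_derivative (\<lambda>w. of_real (Re w) * Fu \<tau> + of_real (Im w) * Fv \<tau>)) (at \<tau>))"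

lemma open_upper_half_plane: "open upper_half_plane"
  unfolding upper_half_plane_def by (rule open_halfspace_Im_gt)

lemma uhp_partialsD:
  "uhp_partials F Fu Fv \<Longrightarrow> Im \<tau> > 0 \<Longrightarrow>
    (F has_derivative (\<lambda>w. of_real (Re w) * Fu \<tau> + of_real (Im w) * Fv \<tau>)) (at \<tau>)"
  by (auto simp: uhp_partials_def upper_half_plane_def)

lemma uhp_partials_continuous_on: "uhp_partials F Fu Fv \<Longrightarrow> continuous_on upper_half_plane F"
  by (meson continuous_at_imp_continuous_on has_derivative_continuous uhp_partials_def)

lemma uhp_partials_cong:
  assumes F: "uhp_partials F Fu Fv"
    and eq: "\<And>\<tau>. Im \<tau> > 0 \<Longrightarrow> F \<tau> = G \<tau>" "\<And>\<tau>. Im \<tau> > 0 \<Longrightarrow> Fu \<tau> = Gu \<tau>"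
      "\<And>\<tau>. Im \<tau> > 0 \<Longrightarrow> Fv \<tau> = Gv \<tau>"
  shows "uhp_partials G Gu Gv"
  unfolding uhp_partials_def
proof
  fix \<tau> assume \<tau>: "\<tau> \<in> upper_half_plane"
  then have "Im \<tau> > 0" by (simp add: upper_half_plane_def)
  with uhp_partialsD[OF F this]
  have "(F has_derivative (\<lambda>w. of_real (Re w) * Gu \<tau> + of_real (Im w) * Gv \<tau>)) (at \<tau>)"
    by (simp add: eq)
  then show "(G has_derivative (\<lambda>w. of_real (Re w) * Gu \<tau> + of_real (Im w) * Gv \<tau>)) (at \<tau>)"
    by (rule has_derivative_transform_within_open[OF _ open_upper_half_plane \<tau>])
       (simp add: eq upper_half_plane_def)
qed

lemma uhp_partials_unique:
  assumes F: "uhp_partials F Fu Fv" and G: "uhp_partials G Gu Gv"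
    and eq: "\<And>\<tau>. Im \<tau> > 0 \<Longrightarrow> F \<tau> = G \<tau>" and \<tau>: "Im \<tau> > 0"
  shows "Fu \<tau> = Gu \<tau>" "Fv \<tau> = Gv \<tau>"
proof -
  have "uhp_partials G Fu Fv"
    using uhp_partials_cong[OF F eq] by simp
  then have "(\<lambda>w. of_real (Re w) * Fu \<tau> + of_real (Im w) * Fv \<tau>) =
      (\<lambda>w. of_real (Re w) * Gu \<tau> + of_real (Im w) * Gv \<tau>)"
    using uhp_partialsD[OF G \<tau>] \<tau> by (blast intro: has_derivative_unique uhp_partialsD)
  from fun_cong[OF this, of 1] fun_cong[OF this, of \<i>]
  show "Fu \<tau> = Gu \<tau>" "Fv \<tau> = Gv \<tau>"
    by simp_all
qed

lemma uhp_partials_add: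
  assumes "uhp_partials F Fu Fv" "uhp_partials G Gu Gv"
  shows "uhp_partials (\<lambda>\<tau>. F \<tau> + G \<tau>) (\<lambda>\<tau>. Fu \<tau> + Gu \<tau>) (\<lambda>\<tau>. Fv \<tau> + Gv \<tau>)"
  unfolding uhp_partials_def
proof
  fix \<tau> assume \<tau>: "\<tau> \<in> upper_half_plane"
  show "((\<lambda>\<tau>. F \<tau> + G \<tau>) has_derivative
    (\<lambda>w. of_real (Re w) * (Fu \<tau> + Gu \<tau>) + of_real (Im w) * (Fv \<tau> + Gv \<tau>))) (at \<tau>)"
    by (rule has_derivative_eq_rhs[OF has_derivative_add[OF assms[unfolded uhp_partials_def, THEN bspec, OF \<tau>]]])
       (simp add: algebra_simps)
qed

lemma uhp_partials_mult:
  assumes "uhp_partials F Fu Fv" "uhp_partials G Gu Gv"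
  shows "uhp_partials (\<lambda>\<tau>. F \<tau> * G \<tau>) (\<lambda>\<tau>. F \<tau> * Gu \<tau> + Fu \<tau> * G \<tau>) (\<lambda>\<tau>. F \<tau> * Gv \<tau> + Fv \<tau> * G \<tau>)"
  unfolding uhp_partials_def
proof
  fix \<tau> assume \<tau>: "\<tau> \<in> upper_half_plane"
  show "((\<lambda>\<tau>. F \<tau> * G \<tau>) has_derivative
    (\<lambda>w. of_real (Re w) * (F \<tau> * Gu \<tau> + Fu \<tau> * G \<tau>) + of_real (Im w) * (F \<tau> * Gv \<tau> + Fv \<tau> * G \<tau>))) (at \<tau>)"
    by (rule has_derivative_eq_rhs[OF has_derivative_mult[OF assms[unfolded uhp_partials_def, THEN bspec, OF \<tau>]]])
       (simp add: algebra_simps)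
qed

lemma uhp_partials_const: "uhp_partials (\<lambda>\<tau>. c) (\<lambda>\<tau>. 0) (\<lambda>\<tau>. 0)"
  by (simp add: uhp_partials_def)

lemma uhp_partials_cmult:
  assumes "uhp_partials F Fu Fv"
  shows "uhp_partials (\<lambda>\<tau>. c * F \<tau>) (\<lambda>\<tau>. c * Fu \<tau>) (\<lambda>\<tau>. c * Fv \<tau>)"
  using uhp_partials_mult[OF uhp_partials_const assms, of c] by simp

lemma uhp_partials_diff:
  assumes "uhp_partials F Fu Fv" "uhp_partials G Gu Gv"
  shows "uhp_partials (\<lambda>\<tau>. F \<tau> - G \<tau>) (\<lambda>\<tau>. Fu \<tau> - Gu \<tau>) (\<lambda>\<tau>. Fv \<tau> - Gv \<tau>)"
  using uhp_partials_add[OF assms(1) uhp_partials_cmult[OF assms(2), of "-1"]] by simp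

text \<open>These are the Cauchy-Riemann equations for p with complex derivative q.\<close>

lemma uhp_partials_Re_Im:
  assumes p: "\<And>\<tau>. Im \<tau> > 0 \<Longrightarrow> (p has_field_derivative q \<tau>) (at \<tau>)"
  shows "uhp_partials (\<lambda>\<tau>. of_real (Re (p \<tau>))) (\<lambda>\<tau>. of_real (Re (q \<tau>))) (\<lambda>\<tau>. - of_real (Im (q \<tau>)))"
    and "uhp_partials (\<lambda>\<tau>. of_real (Im (p \<tau>))) (\<lambda>\<tau>. of_real (Im (q \<tau>))) (\<lambda>\<tau>. of_real (Re (q \<tau>)))"
proof -
  have d: "(p has_derivative (\<lambda>w. q \<tau> * w)) (at \<tau>)" if "Im \<tau> > 0" for \<tau>
    using p[OF that] by (rule has_field_derivative_imp_has_derivative)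
  show "uhp_partials (\<lambda>\<tau>. of_real (Re (p \<tau>))) (\<lambda>\<tau>. of_real (Re (q \<tau>))) (\<lambda>\<tau>. - of_real (Im (q \<tau>)))"
    unfolding uhp_partials_def upper_half_plane_def
  proof safe
    fix \<tau> assume \<tau>: "Im \<tau> > 0"
    show "((\<lambda>\<tau>. complex_of_real (Re (p \<tau>))) has_derivative
       (\<lambda>w. of_real (Re w) * of_real (Re (q \<tau>)) + of_real (Im w) * - of_real (Im (q \<tau>)))) (at \<tau>)"
      by (rule has_derivative_eq_rhs[OF has_derivative_of_real[OF has_derivative_Re[OF d[OF \<tau>]]]])
         (simp add: fun_eq_iff algebra_simps)
  qed
  show "uhp_partials (\<lambda>\<tau>. of_real (Im (p \<tau>))) (\<lambda>\<tau>. of_real (Im (q \<tau>))) (\<lambda>\<tau>. of_real (Re (q \<tau>)))"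
    unfolding uhp_partials_def upper_half_plane_def
  proof safe
    fix \<tau> assume \<tau>: "Im \<tau> > 0"
    show "((\<lambda>\<tau>. complex_of_real (Im (p \<tau>))) has_derivative
       (\<lambda>w. of_real (Re w) * of_real (Im (q \<tau>)) + of_real (Im w) * of_real (Re (q \<tau>)))) (at \<tau>)"
      by (rule has_derivative_eq_rhs[OF has_derivative_of_real[OF has_derivative_Im[OF d[OF \<tau>]]]])
         (simp add: fun_eq_iff algebra_simps)
  qed
qed

lemma uhp_partials_compose:
  assumes F: "uhp_partials F Fu Fv"
    and m: "\<And>\<tau>. Im \<tau> > 0 \<Longrightarrow> (m has_field_derivative p \<tau>) (at \<tau>)"
    and mH: "\<And>\<tau>. Im \<tau> > 0 \<Longrightarrow> Im (m \<tau>) > 0"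
  shows "uhp_partials (\<lambda>\<tau>. F (m \<tau>))
    (\<lambda>\<tau>. of_real (Re (p \<tau>)) * Fu (m \<tau>) + of_real (Im (p \<tau>)) * Fv (m \<tau>))
    (\<lambda>\<tau>. of_real (Re (p \<tau>)) * Fv (m \<tau>) - of_real (Im (p \<tau>)) * Fu (m \<tau>))"
  unfolding uhp_partials_def upper_half_plane_def
proof safe
  fix \<tau> assume \<tau>: "Im \<tau> > 0"
  have "(m has_derivative (\<lambda>w. p \<tau> * w)) (at \<tau>)"
    using m[OF \<tau>] by (rule has_field_derivative_imp_has_derivative)
  from has_derivative_compose[OF this uhp_partialsD[OF F mH[OF \<tau>]]]
  show "((\<lambda>\<tau>. F (m \<tau>)) has_derivative
     (\<lambda>w. of_real (Re w) * (of_real (Re (p \<tau>)) * Fu (m \<tau>) + of_real (Im (p \<tau>)) * Fv (m \<tau>)) +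
          of_real (Im w) * (of_real (Re (p \<tau>)) * Fv (m \<tau>) - of_real (Im (p \<tau>)) * Fu (m \<tau>)))) (at \<tau>)"
    by (rule has_derivative_eq_rhs) (simp add: fun_eq_iff algebra_simps)
qed

lemma uhp_partials_vector_derivative:
  assumes F: "uhp_partials F Fu Fv" and v: "v > 0"
  shows "((\<lambda>u. F (Complex u v)) has_vector_derivative Fu (Complex u v)) (at u within S)"
    and "((\<lambda>v. F (Complex u v)) has_vector_derivative Fv (Complex u v)) (at v within T)"
proof -
  have d: "(F has_derivative (\<lambda>w. of_real (Re w) * Fu (Complex u v) + of_real (Im w) * Fv (Complex u v))) (at (Complex u v))"
    using uhp_partialsD[OF F, of "Complex u v"] v by simp
  have "((\<lambda>u. Complex u v) has_derivative (\<lambda>h. of_real h)) (at u within S)"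
    unfolding Complex_eq by (auto intro!: derivative_eq_intros)
  from has_derivative_compose[OF this d]
  show "((\<lambda>u. F (Complex u v)) has_vector_derivative Fu (Complex u v)) (at u within S)"
    by (simp add: has_vector_derivative_def scaleR_conv_of_real)
  have "((\<lambda>v. Complex u v) has_derivative (\<lambda>h. \<i> * of_real h)) (at v within T)"
    unfolding Complex_eq by (auto intro!: derivative_eq_intros)
  from has_derivative_compose[OF this d]
  show "((\<lambda>v. F (Complex u v)) has_vector_derivative Fv (Complex u v)) (at v within T)"
    by (simp add: has_vector_derivative_def scaleR_conv_of_real)
qed

text \<open>The eigenvalue equation for 1/4, divided by -v^2. The first partials are parameters
  because they enter the Green form and the decay estimates; continuity of the second ones serves
  the differentiation under the integral that produces a primitive of that form.\<close>

definition eigenfunction :: "(complex \<Rightarrow> complex) \<Rightarrow> (complex \<Rightarrow> complex) \<Rightarrow> (complex \<Rightarrow> complex) \<Rightarrow> bool" where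
  "eigenfunction F Fu Fv \<longleftrightarrow> uhp_partials F Fu Fv \<and> (\<exists>Fuu Fuv Fvu Fvv.
     uhp_partials Fu Fuu Fuv \<and> uhp_partials Fv Fvu Fvv \<and>
     continuous_on upper_half_plane Fuu \<and> continuous_on upper_half_plane Fuv \<and>
     continuous_on upper_half_plane Fvu \<and> continuous_on upper_half_plane Fvv \<and>
     (\<forall>\<tau>\<in>upper_half_plane. Fuu \<tau> + Fvv \<tau> = - F \<tau> / (4 * (of_real (Im \<tau>))\<^sup>2)))"

lemma eigenfunctionI:
  assumes "uhp_partials F Fu Fv" "uhp_partials Fu Fuu Fuv" "uhp_partials Fv Fvu Fvv"
    and "continuous_on upper_half_plane Fuu" "continuous_on upper_half_plane Fuv"
    and "continuous_on upper_half_plane Fvu" "continuous_on upper_half_plane Fvv"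
    and "\<And>\<tau>. Im \<tau> > 0 \<Longrightarrow> Fuu \<tau> + Fvv \<tau> = - F \<tau> / (4 * (of_real (Im \<tau>))\<^sup>2)"
  shows "eigenfunction F Fu Fv"
  unfolding eigenfunction_def upper_half_plane_def
  using assms[unfolded upper_half_plane_def] by blast

lemma eigenfunction_imp_partials: "eigenfunction F Fu Fv \<Longrightarrow> uhp_partials F Fu Fv"
  by (simp add: eigenfunction_def)

lemma eigenfunction_continuous_on:
  assumes "eigenfunction F Fu Fv"
  shows "continuous_on upper_half_plane F" "continuous_on upper_half_plane Fu" "continuous_on upper_half_plane Fv"
  using assms by (auto simp: eigenfunction_def intro: uhp_partials_continuous_on)

text \<open>A holomorphic map multiplies the Euclidean Laplacian by |p|^2; the terms with q cancel
  since real and imaginary part are harmonic. The condition on \<open>Im (m \<tau>)\<close> says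
  that m is a hyperbolic isometry, and it turns |p|^2 / (Im m)^2 back into 1 / v^2.\<close>

lemma eigenfunction_compose:
  assumes F: "eigenfunction F Fu Fv"
    and m: "\<And>\<tau>. Im \<tau> > 0 \<Longrightarrow> (m has_field_derivative p \<tau>) (at \<tau>)"
    and p: "\<And>\<tau>. Im \<tau> > 0 \<Longrightarrow> (p has_field_derivative q \<tau>) (at \<tau>)"
    and q: "continuous_on upper_half_plane q"
    and Im_m: "\<And>\<tau>. Im \<tau> > 0 \<Longrightarrow> Im (m \<tau>) = norm (p \<tau>) * Im \<tau>"
    and p0: "\<And>\<tau>. Im \<tau> > 0 \<Longrightarrow> p \<tau> \<noteq> 0"
  shows "eigenfunction (\<lambda>\<tau>. F (m \<tau>))
    (\<lambda>\<tau>. of_real (Re (p \<tau>)) * Fu (m \<tau>) + of_real (Im (p \<tau>)) * Fv (m \<tau>))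
    (\<lambda>\<tau>. of_real (Re (p \<tau>)) * Fv (m \<tau>) - of_real (Im (p \<tau>)) * Fu (m \<tau>))"
proof -
  obtain Fuu Fuv Fvu Fvv where F1: "uhp_partials F Fu Fv"
    and F2: "uhp_partials Fu Fuu Fuv" "uhp_partials Fv Fvu Fvv"
    and c: "continuous_on upper_half_plane Fuu" "continuous_on upper_half_plane Fuv"
      "continuous_on upper_half_plane Fvu" "continuous_on upper_half_plane Fvv"
    and L: "\<And>\<tau>. Im \<tau> > 0 \<Longrightarrow> Fuu \<tau> + Fvv \<tau> = - F \<tau> / (4 * (of_real (Im \<tau>))\<^sup>2)"
    using F unfolding eigenfunction_def upper_half_plane_def by blast
  have mH: "Im (m \<tau>) > 0" if "Im \<tau> > 0" for \<tau>
    using Im_m[OF that] p0[OF that] that by simp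
  have cm: "continuous_on upper_half_plane m" and cp: "continuous_on upper_half_plane p"
    using m p by (auto simp: upper_half_plane_def intro!: continuous_at_imp_continuous_on
        intro: DERIV_isCont)
  have comp: "continuous_on upper_half_plane (\<lambda>\<tau>. f (m \<tau>))" if "continuous_on upper_half_plane f" for f
    by (rule continuous_on_compose2[OF that cm]) (auto simp: upper_half_plane_def mH)
  note P = uhp_partials_Re_Im[OF p]
  note A = uhp_partials_compose[OF F2(1) m mH] and B = uhp_partials_compose[OF F2(2) m mH]
  note Gu = uhp_partials_add[OF uhp_partials_mult[OF P(1) A] uhp_partials_mult[OF P(2) B]]
  have Gv: "uhp_partials (\<lambda>\<tau>. of_real (Re (p \<tau>)) * Fv (m \<tau>) - of_real (Im (p \<tau>)) * Fu (m \<tau>))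
    (\<lambda>\<tau>. of_real (Re (p \<tau>)) * (of_real (Re (p \<tau>)) * Fvu (m \<tau>) + of_real (Im (p \<tau>)) * Fvv (m \<tau>)) +
       of_real (Re (q \<tau>)) * Fv (m \<tau>) -
       (of_real (Im (p \<tau>)) * (of_real (Re (p \<tau>)) * Fuu (m \<tau>) + of_real (Im (p \<tau>)) * Fuv (m \<tau>)) +
        of_real (Im (q \<tau>)) * Fu (m \<tau>)))
    (\<lambda>\<tau>. of_real (Re (p \<tau>)) * (of_real (Re (p \<tau>)) * Fvv (m \<tau>) - of_real (Im (p \<tau>)) * Fvu (m \<tau>)) +
       - of_real (Im (q \<tau>)) * Fv (m \<tau>) -
       (of_real (Im (p \<tau>)) * (of_real (Re (p \<tau>)) * Fuv (m \<tau>) - of_real (Im (p \<tau>)) * Fuu (m \<tau>)) +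
        of_real (Re (q \<tau>)) * Fu (m \<tau>)))"
    by (rule uhp_partials_diff[OF uhp_partials_mult[OF P(1) B] uhp_partials_mult[OF P(2) A]])
  note cont = continuous_on_add continuous_on_diff continuous_on_mult continuous_on_of_real
    continuous_on_Re continuous_on_Im continuous_on_minus comp[OF c(1)] comp[OF c(2)] comp[OF c(3)] comp[OF c(4)]
    comp[OF uhp_partials_continuous_on[OF F2(1)]] comp[OF uhp_partials_continuous_on[OF F2(2)]] cp q
  show ?thesis
  proof (rule eigenfunctionI[OF uhp_partials_compose[OF F1 m mH] Gu Gv])
    fix \<tau> :: complex assume \<tau>: "Im \<tau> > 0"
    let ?lhs = "of_real (Re (p \<tau>)) * (of_real (Re (p \<tau>)) * Fuu (m \<tau>) + of_real (Im (p \<tau>)) * Fuv (m \<tau>)) +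
      of_real (Re (q \<tau>)) * Fu (m \<tau>) +
      (of_real (Im (p \<tau>)) * (of_real (Re (p \<tau>)) * Fvu (m \<tau>) + of_real (Im (p \<tau>)) * Fvv (m \<tau>)) +
       of_real (Im (q \<tau>)) * Fv (m \<tau>)) +
      (of_real (Re (p \<tau>)) * (of_real (Re (p \<tau>)) * Fvv (m \<tau>) - of_real (Im (p \<tau>)) * Fvu (m \<tau>)) +
       - of_real (Im (q \<tau>)) * Fv (m \<tau>) -
       (of_real (Im (p \<tau>)) * (of_real (Re (p \<tau>)) * Fuv (m \<tau>) - of_real (Im (p \<tau>)) * Fuu (m \<tau>)) +
        of_real (Re (q \<tau>)) * Fu (m \<tau>)))"
    have "?lhs = of_real ((Re (p \<tau>))\<^sup>2 + (Im (p \<tau>))\<^sup>2) * (Fuu (m \<tau>) + Fvv (m \<tau>))"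
      by (simp add: algebra_simps power2_eq_square)
    also have "\<dots> = of_real ((norm (p \<tau>))\<^sup>2) * (- F (m \<tau>) / (4 * (of_real (norm (p \<tau>) * Im \<tau>))\<^sup>2))"
      by (simp only: cmod_power2 L[OF mH[OF \<tau>]] Im_m[OF \<tau>])
    also have "\<dots> = - F (m \<tau>) / (4 * (of_real (Im \<tau>))\<^sup>2)"
      using p0[OF \<tau>] by (simp add: power_mult_distrib)
    finally show "?lhs = - F (m \<tau>) / (4 * (of_real (Im \<tau>))\<^sup>2)" .
  qed (assumption | rule cont)+
qed

section \<open>The eigenfunction v^(1/2) and its images under real Moebius maps\<close>

lemma uhp_partials_vertical:
  fixes f f' :: "real \<Rightarrow> real"
  assumes "\<And>v. v > 0 \<Longrightarrow> (f has_real_derivative f' v) (at v)"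
  shows "uhp_partials (\<lambda>\<tau>. of_real (f (Im \<tau>))) (\<lambda>\<tau>. 0) (\<lambda>\<tau>. of_real (f' (Im \<tau>)))"
  unfolding uhp_partials_def upper_half_plane_def
proof safe
  fix \<tau> assume "Im \<tau> > 0"
  from assms[OF this] have "(f has_derivative (\<lambda>h. f' (Im \<tau>) * h)) (at (Im \<tau>))"
    by (rule has_field_derivative_imp_has_derivative)
  from has_derivative_of_real[OF has_derivative_compose[OF has_derivative_Im[OF has_derivative_ident] this]]
  show "((\<lambda>\<tau>. of_real (f (Im \<tau>))) has_derivative
    (\<lambda>w. of_real (Re w) * 0 + of_real (Im w) * complex_of_real (f' (Im \<tau>)))) (at \<tau>)"
    by (simp add: mult.commute)
qed

text \<open>In general v^s has the eigenvalue s (1 - s); the value 1/4 belongs to s = 1/2.\<close>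

lemma eigenfunction_sqrt_Im:
  "eigenfunction (\<lambda>\<tau>. of_real (sqrt (Im \<tau>))) (\<lambda>\<tau>. 0) (\<lambda>\<tau>. of_real (1 / (2 * sqrt (Im \<tau>))))"
proof (rule eigenfunctionI)
  show "uhp_partials (\<lambda>\<tau>. of_real (sqrt (Im \<tau>))) (\<lambda>\<tau>. 0) (\<lambda>\<tau>. of_real (1 / (2 * sqrt (Im \<tau>))))"
    by (rule uhp_partials_vertical) (auto intro!: derivative_eq_intros simp: field_simps)
  show "uhp_partials (\<lambda>\<tau>. 0) (\<lambda>\<tau>. 0) (\<lambda>\<tau>. 0)"
    by (rule uhp_partials_const)
  show "uhp_partials (\<lambda>\<tau>. of_real (1 / (2 * sqrt (Im \<tau>)))) (\<lambda>\<tau>. 0) (\<lambda>\<tau>. of_real (- 1 / (4 * sqrt (Im \<tau>) * Im \<tau>)))"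
  proof (rule uhp_partials_vertical)
    fix v :: real assume v: "v > 0"
    have "((\<lambda>v. 1 / (2 * sqrt v)) has_real_derivative - (2 * (inverse (sqrt v) / 2)) / (2 * sqrt v)\<^sup>2) (at v)"
      using v by (auto intro!: derivative_eq_intros simp: power2_eq_square)
    then show "((\<lambda>v. 1 / (2 * sqrt v)) has_real_derivative - 1 / (4 * sqrt v * v)) (at v)"
      using v by (simp add: field_simps power_mult_distrib)
  qed
  show "0 + of_real (- 1 / (4 * sqrt (Im \<tau>) * Im \<tau>)) =
      - complex_of_real (sqrt (Im \<tau>)) / (4 * (of_real (Im \<tau>))\<^sup>2)" if "Im \<tau> > 0" for \<tau>
  proof -
    have "- 1 / (4 * sqrt (Im \<tau>) * Im \<tau>) = - sqrt (Im \<tau>) / (4 * (Im \<tau>)\<^sup>2)"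
      using that by (simp add: field_simps power2_eq_square)
    then show "0 + of_real (- 1 / (4 * sqrt (Im \<tau>) * Im \<tau>)) =
      - complex_of_real (sqrt (Im \<tau>)) / (4 * (of_real (Im \<tau>))\<^sup>2)"
      by (simp only: of_real_divide of_real_minus of_real_mult of_real_power of_real_numeral add_0)
  qed
  show "continuous_on upper_half_plane (\<lambda>\<tau>. complex_of_real (- 1 / (4 * sqrt (Im \<tau>) * Im \<tau>)))"
    by (intro continuous_intros) (auto simp: upper_half_plane_def)
qed (rule continuous_on_const)+

text \<open>For every real Moebius transformation with bottom row \<open>(P, Q)\<close> this is the square root of
  the imaginary part of the image; it is \<open>R\<^bsub>x\<^esub>\<^bsup>1/2\<^esup>\<close> of Lewis and Zagier for \<open>(P, Q) = (1, -x)\<close>.\<close>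

definition poisson :: "real \<Rightarrow> real \<Rightarrow> complex \<Rightarrow> complex" where
  "poisson P Q \<tau> = of_real (sqrt (Im \<tau>) / norm (of_real P * \<tau> + of_real Q))"

text \<open>Chain rule for the square root of Im m: with m' = 1 / (P tau + Q)^2 the partials of Im m
  are Im m' and Re m', and 1 / (2 (Im m)^(1/2)) is |P tau + Q| / (2 v^(1/2)).\<close>

definition poisson_u :: "real \<Rightarrow> real \<Rightarrow> complex \<Rightarrow> complex" where
  "poisson_u P Q \<tau> = of_real (Im (1 / (of_real P * \<tau> + of_real Q)\<^sup>2) * norm (of_real P * \<tau> + of_real Q) / (2 * sqrt (Im \<tau>)))"

definition poisson_v :: "real \<Rightarrow> real \<Rightarrow> complex \<Rightarrow> complex" where
  "poisson_v P Q \<tau> = of_real (Re (1 / (of_real P * \<tau> + of_real Q)\<^sup>2) * norm (of_real P * \<tau> + of_real Q) / (2 * sqrt (Im \<tau>)))"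

lemma linear_nonzero_uhp:
  assumes "(c, d) \<noteq> (0 :: real, 0 :: real)" "Im \<tau> > 0"
  shows "of_real c * \<tau> + of_real d \<noteq> (0 :: complex)"
  using assms by (auto simp: complex_eq_iff)

lemma Im_moebius_real:
  assumes "a * d - b * c = 1"
  shows "Im (moebius (of_real a) (of_real b) (of_real c) (of_real d) \<tau>) =
    Im \<tau> / (norm (of_real c * \<tau> + of_real d))\<^sup>2"
proof -
  have "Im (moebius (of_real a) (of_real b) (of_real c) (of_real d) \<tau>) =
    (a * d - b * c) * Im \<tau> / (norm (of_real c * \<tau> + of_real d))\<^sup>2"
    unfolding moebius_def by (simp add: Im_divide cmod_power2) (simp add: algebra_simps)
  then show ?thesis
    by (simp add: assms)
qed

lemma moebius_real_has_field_derivative: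
  assumes "a * d - b * c = (1 :: real)" "Im \<tau> > 0"
  shows "(moebius (of_real a) (of_real b) (of_real c) (of_real d) has_field_derivative
      1 / (of_real c * \<tau> + of_real d)\<^sup>2) (at \<tau>)"
    and "((\<lambda>\<tau>. 1 / (of_real c * \<tau> + of_real d)\<^sup>2) has_field_derivative
      - 2 * of_real c / (of_real c * \<tau> + of_real d) ^ 3) (at \<tau>)"
proof -
  have nz: "of_real c * \<tau> + of_real d \<noteq> (0 :: complex)"
    using assms by (intro linear_nonzero_uhp) auto
  have "of_real a * of_real d - of_real b * of_real c = (1 :: complex)"
    using assms(1) by (metis of_real_1 of_real_diff of_real_mult)
  then have eq: "of_real a * (of_real c * \<tau> + of_real d) - (of_real a * \<tau> + of_real b) * of_real c = (1 :: complex)"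
    by (simp add: algebra_simps)
  have "((\<lambda>z. (of_real a * z + of_real b) / (of_real c * z + of_real d)) has_field_derivative
      (of_real a * (of_real c * \<tau> + of_real d) - (of_real a * \<tau> + of_real b) * of_real c) /
      ((of_real c * \<tau> + of_real d) * (of_real c * \<tau> + of_real d))) (at \<tau>)"
    by (rule DERIV_divide) (use nz in \<open>auto intro!: derivative_eq_intros\<close>)
  then show "(moebius (of_real a) (of_real b) (of_real c) (of_real d) has_field_derivative
      1 / (of_real c * \<tau> + of_real d)\<^sup>2) (at \<tau>)"
    by (simp only: eq power2_eq_square moebius_def)
  have "((\<lambda>\<tau>. inverse ((of_real c * \<tau> + of_real d)\<^sup>2)) has_field_derivative
      - (inverse ((of_real c * \<tau> + of_real d)\<^sup>2) * (2 * (of_real c * \<tau> + of_real d) * of_real c) * inverse ((of_real c * \<tau> + of_real d)\<^sup>2))) (at \<tau>)"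
    by (rule DERIV_inverse'[OF DERIV_cong]) (use nz in \<open>auto intro!: derivative_eq_intros\<close>)
  note D = this
  have E: "- (inverse (z\<^sup>2) * (2 * z * k) * inverse (z\<^sup>2)) = - 2 * k / z ^ 3" if "z \<noteq> 0" for z k :: complex
    using that by (simp add: field_simps power2_eq_square power3_eq_cube)
  show "((\<lambda>\<tau>. 1 / (of_real c * \<tau> + of_real d)\<^sup>2) has_field_derivative
      - 2 * of_real c / (of_real c * \<tau> + of_real d) ^ 3) (at \<tau>)"
    using D[unfolded E[OF nz]] by (simp add: inverse_eq_divide)
qed

lemma eigenfunction_moebius:
  assumes F: "eigenfunction F Fu Fv" and det: "a * d - b * c = (1 :: real)"
  defines "m \<equiv> moebius (of_real a) (of_real b) (of_real c) (of_real d)"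
    and "p \<equiv> \<lambda>\<tau>. 1 / (of_real c * \<tau> + of_real d)\<^sup>2"
  shows "eigenfunction (\<lambda>\<tau>. F (m \<tau>))
    (\<lambda>\<tau>. of_real (Re (p \<tau>)) * Fu (m \<tau>) + of_real (Im (p \<tau>)) * Fv (m \<tau>))
    (\<lambda>\<tau>. of_real (Re (p \<tau>)) * Fv (m \<tau>) - of_real (Im (p \<tau>)) * Fu (m \<tau>))"
proof (rule eigenfunction_compose[OF F])
  have nz: "of_real c * \<tau> + of_real d \<noteq> (0 :: complex)" if "Im \<tau> > 0" for \<tau>
    using det that by (intro linear_nonzero_uhp) auto
  fix \<tau> :: complex assume \<tau>: "Im \<tau> > 0"
  show "(m has_field_derivative p \<tau>) (at \<tau>)"
    unfolding m_def p_def by (rule moebius_real_has_field_derivative(1)[OF det \<tau>])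
  show "(p has_field_derivative - 2 * of_real c / (of_real c * \<tau> + of_real d) ^ 3) (at \<tau>)"
    unfolding p_def by (rule moebius_real_has_field_derivative(2)[OF det \<tau>])
  show "Im (m \<tau>) = norm (p \<tau>) * Im \<tau>"
    by (simp add: m_def p_def Im_moebius_real[OF det] norm_divide norm_power)
  show "p \<tau> \<noteq> 0"
    using nz[OF \<tau>] by (simp add: p_def)
next
  show "continuous_on upper_half_plane (\<lambda>\<tau>. - 2 * of_real c / (of_real c * \<tau> + of_real d) ^ 3 :: complex)"
  proof (intro continuous_intros ballI)
    fix \<tau> :: complex assume "\<tau> \<in> upper_half_plane"
    moreover have "(c, d) \<noteq> (0, 0)"
      using det by auto
    ultimately show "(of_real c * \<tau> + of_real d) ^ 3 \<noteq> 0"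
      using linear_nonzero_uhp[of c d \<tau>] by (simp add: upper_half_plane_def)
  qed
qed

lemma eigenfunction_poisson:
  assumes PQ: "(P, Q) \<noteq> (0, 0)"
  shows "eigenfunction (poisson P Q) (poisson_u P Q) (poisson_v P Q)"
proof -
  define n where "n = P\<^sup>2 + Q\<^sup>2"
  have n: "n > 0"
    using PQ by (auto simp: n_def sum_power2_gt_zero_iff)
  \<comment> \<open>The row (Q, -P) divided by P^2 + Q^2 completes (P, Q) to a real matrix of
    determinant 1.\<close>
  define a b where "a = Q / n" and "b = - P / n"
  have "a * Q - b * P = (P\<^sup>2 + Q\<^sup>2) / n"
    unfolding a_def b_def by (simp add: add_divide_distrib power2_eq_square)
  then have det: "a * Q - b * P = 1"
    using n unfolding n_def[symmetric] by simp
  have sq: "sqrt (v / r\<^sup>2) = sqrt v / r" if "r \<ge> 0" for v r :: real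
    using that by (simp add: real_sqrt_divide)
  have "poisson P Q = (\<lambda>\<tau>. of_real (sqrt (Im (moebius (of_real a) (of_real b) (of_real P) (of_real Q) \<tau>))))"
    by (simp add: fun_eq_iff poisson_def Im_moebius_real[OF det] sq)
  moreover have "poisson_u P Q = (\<lambda>\<tau>. of_real (Re (1 / (of_real P * \<tau> + of_real Q)\<^sup>2)) * 0 +
      of_real (Im (1 / (of_real P * \<tau> + of_real Q)\<^sup>2)) *
      of_real (1 / (2 * sqrt (Im (moebius (of_real a) (of_real b) (of_real P) (of_real Q) \<tau>)))))"
    by (simp add: fun_eq_iff poisson_u_def Im_moebius_real[OF det] sq)
  moreover have "poisson_v P Q = (\<lambda>\<tau>. of_real (Re (1 / (of_real P * \<tau> + of_real Q)\<^sup>2)) *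
      of_real (1 / (2 * sqrt (Im (moebius (of_real a) (of_real b) (of_real P) (of_real Q) \<tau>)))) -
      of_real (Im (1 / (of_real P * \<tau> + of_real Q)\<^sup>2)) * 0)"
    by (simp add: fun_eq_iff poisson_v_def Im_moebius_real[OF det] sq)
  ultimately show ?thesis
    using eigenfunction_moebius[OF eigenfunction_sqrt_Im det] by simp
qed

text \<open>The denominators cancel, and the row vector (P, Q) is multiplied by the matrix from the
  right. Applied to the row (1, -x) this is the equivariance of weight one in x, with an absolute
  value in the automorphy factor.\<close>

lemma poisson_moebius:
  assumes "a * d - b * c = (1 :: real)" "Im \<tau> > 0"
  shows "poisson P Q (moebius (of_real a) (of_real b) (of_real c) (of_real d) \<tau>) =
    poisson (P * a + Q * c) (P * b + Q * d) \<tau>"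
proof -
  have nz: "of_real c * \<tau> + of_real d \<noteq> (0 :: complex)"
    using assms by (intro linear_nonzero_uhp) auto
  have "of_real P * moebius (of_real a) (of_real b) (of_real c) (of_real d) \<tau> + of_real Q =
      (of_real (P * a + Q * c) * \<tau> + of_real (P * b + Q * d)) / (of_real c * \<tau> + of_real d)"
    using nz by (simp add: moebius_def field_simps)
  moreover have "sqrt (Im \<tau> / (norm (of_real c * \<tau> + of_real d))\<^sup>2) = sqrt (Im \<tau>) / norm (of_real c * \<tau> + of_real d)"
    by (simp add: real_sqrt_divide)
  ultimately show ?thesis
    using nz by (simp add: poisson_def Im_moebius_real[OF assms(1)] norm_divide)
qed

lemma norm_poisson_partials_le:
  assumes "(P, Q) \<noteq> (0, 0)" "Im \<tau> > 0"
  shows "norm (poisson_u P Q \<tau>) \<le> norm (poisson P Q \<tau>) / (2 * Im \<tau>)"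
    and "norm (poisson_v P Q \<tau>) \<le> norm (poisson P Q \<tau>) / (2 * Im \<tau>)"
proof -
  define Z where "Z = of_real P * \<tau> + (of_real Q :: complex)"
  have Z: "norm Z > 0"
    using linear_nonzero_uhp[OF assms] by (simp add: Z_def)
  have v: "sqrt (Im \<tau>) > 0" "Im \<tau> = sqrt (Im \<tau>) * sqrt (Im \<tau>)"
    using assms by simp_all
  have "\<bar>t\<bar> * norm Z / (2 * sqrt (Im \<tau>)) \<le> sqrt (Im \<tau>) / norm Z / (2 * Im \<tau>)"
    if "\<bar>t\<bar> \<le> norm (1 / Z\<^sup>2)" for t
  proof -
    have "\<bar>t\<bar> * norm Z / (2 * sqrt (Im \<tau>)) \<le> norm (1 / Z\<^sup>2) * norm Z / (2 * sqrt (Im \<tau>))"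
      using that v by (intro divide_right_mono mult_right_mono) auto
    also have "\<dots> = sqrt (Im \<tau>) / norm Z / (2 * (sqrt (Im \<tau>) * sqrt (Im \<tau>)))"
      using Z v(1) by (simp add: norm_divide norm_mult power2_eq_square field_simps del: real_sqrt_mult_self)
    finally show ?thesis
      using v(2) by simp
  qed
  from this[OF abs_Im_le_cmod] this[OF abs_Re_le_cmod]
  show "norm (poisson_u P Q \<tau>) \<le> norm (poisson P Q \<tau>) / (2 * Im \<tau>)"
    "norm (poisson_v P Q \<tau>) \<le> norm (poisson P Q \<tau>) / (2 * Im \<tau>)"
    using assms(2)
    by (simp_all only: poisson_u_def poisson_v_def poisson_def norm_of_real Z_def[symmetric])
       (simp_all add: abs_mult)
qed

section \<open>Primitives of the Green form\<close>

lemma uhp_partials_along: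
  assumes F: "uhp_partials F Fu Fv" and z: "(z has_vector_derivative z') (at s within S)" and "Im (z s) > 0"
  shows "((\<lambda>s. F (z s)) has_vector_derivative
    of_real (Re z') * Fu (z s) + of_real (Im z') * Fv (z s)) (at s within S)"
  using has_derivative_compose[OF z[unfolded has_vector_derivative_def] uhp_partialsD[OF assms(1,3)]]
  by (simp add: has_vector_derivative_def scaleR_conv_of_real algebra_simps)

text \<open>The Poincare lemma on a domain that is star-shaped about the point i: the primitive is
  the integral of the form along the segment from i. Both partials come from differentiation under
  the integral; one existing and one continuous partial give total differentiability.\<close>

lemma closed_form_primitive:
  assumes a: "uhp_partials a au av" and b: "uhp_partials b bu bv"
    and c: "continuous_on upper_half_plane au" "continuous_on upper_half_plane av"
      "continuous_on upper_half_plane bu" "continuous_on upper_half_plane bv"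
    and closed: "\<And>\<tau>. Im \<tau> > 0 \<Longrightarrow> av \<tau> = bu \<tau>"
  shows "\<exists>W. uhp_partials W a b"
proof -
  define g where "g u v t = Complex (t * u) (1 + t * (v - 1))" for u v t :: real
  have g_pos: "Im (g u v t) > 0" if "v > 0" "t \<in> {0..1}" for u v t
  proof -
    have "1 + t * (v - 1) = (1 - t) + t * v"
      by (simp add: algebra_simps)
    also have "\<dots> > 0"
      using that by (cases "t = 0") (auto intro: add_nonneg_pos)
    finally show ?thesis
      by (simp add: g_def)
  qed
  have gH: "g u v t \<in> upper_half_plane" if "v > 0" "t \<in> {0..1}" for u v t
    using g_pos[OF that] by (simp add: upper_half_plane_def)
  have g_du: "((\<lambda>u. g u v t) has_vector_derivative of_real t) (at u within S)" for u v t S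
    unfolding g_def Complex_eq by (auto intro!: derivative_eq_intros simp: has_vector_derivative_def scaleR_conv_of_real)
  have g_dv: "((\<lambda>v. g u v t) has_vector_derivative \<i> * of_real t) (at v within S)" for u v t S
    unfolding g_def Complex_eq by (auto intro!: derivative_eq_intros simp: has_vector_derivative_def scaleR_conv_of_real)
  have g_dt: "(g u v has_vector_derivative Complex u (v - 1)) (at t within S)" for u v t S
    unfolding g_def Complex_eq has_vector_derivative_def
    by (auto intro!: derivative_eq_intros simp: scaleR_conv_of_real algebra_simps)
  have of_real_deriv: "((\<lambda>t. complex_of_real t) has_vector_derivative 1) (at t within S)" for t S
    using has_vector_derivative_of_real[OF DERIV_ident] by simp
  note ca = uhp_partials_continuous_on[OF a] and cb = uhp_partials_continuous_on[OF b]
  have cg: "continuous_on (S \<times> T) (\<lambda>p. g (fst p) v (snd p))" "continuous_on (S \<times> T) (\<lambda>p. g u (fst p) (snd p))" for S T u v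
    unfolding g_def Complex_eq by (intro continuous_intros)+
  have cu: "continuous_on (UNIV \<times> cbox 0 1) (\<lambda>p. F (g (fst p) v (snd p)))"
    if "continuous_on upper_half_plane F" "v > 0" for F :: "complex \<Rightarrow> complex" and v
    by (rule continuous_on_compose2[OF that(1) cg(1)]) (use gH that in auto)
  have cv: "continuous_on ({0<..} \<times> cbox 0 1) (\<lambda>p. F (g u (fst p) (snd p)))"
    if "continuous_on upper_half_plane F" for F :: "complex \<Rightarrow> complex" and u
    by (rule continuous_on_compose2[OF that cg(2)]) (use gH that in auto)
  have cgt: "continuous_on (cbox 0 1) (\<lambda>t. F (g u v t))"
    if "continuous_on upper_half_plane F" "v > 0" for F :: "complex \<Rightarrow> complex" and u v
    by (rule continuous_on_compose2[OF that(1)]) (use gH that in \<open>auto simp: g_def Complex_eq intro!: continuous_intros\<close>)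
  define f where "f u v t = of_real u * a (g u v t) + of_real (v - 1) * b (g u v t)" for u v t
  define w where "w u v = integral (cbox 0 1) (f u v)" for u v
  have f_int: "f u v integrable_on cbox 0 1" if "v > 0" for u v
    unfolding f_def[abs_def] by (intro integrable_continuous continuous_intros cgt ca cb that)
  have w_u: "((\<lambda>u. w u v) has_vector_derivative a (Complex u v)) (at u)" if v: "v > 0" for u v
  proof -
    define fu where "fu u t = a (g u v t) + of_real u * (of_real t * au (g u v t)) + of_real (v - 1) * (of_real t * bu (g u v t))" for u t
    have "((\<lambda>u. w u v) has_vector_derivative integral (cbox 0 1) (fu u)) (at u within UNIV)"
      unfolding w_def
    proof (rule leibniz_rule_vector_derivative[where U = UNIV])
      fix u t :: real assume "t \<in> cbox 0 1"
      then have "Im (g u v t) > 0" using g_pos v by simp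
      from uhp_partials_along[OF a g_du[of v t u UNIV] this] uhp_partials_along[OF b g_du[of v t u UNIV] this]
      show "((\<lambda>u. f u v t) has_vector_derivative fu u t) (at u within UNIV)"
        unfolding f_def fu_def
        by (auto intro!: derivative_eq_intros simp: algebra_simps)
    next
      show "continuous_on (UNIV \<times> cbox 0 1) (\<lambda>(u, t). fu u t)"
        unfolding fu_def case_prod_beta
        by (intro continuous_intros cu ca c v)
    qed (use f_int v in auto)
    \<comment> \<open>Closedness replaces \<open>bu\<close> by \<open>av\<close>, and the integrand
      becomes the derivative of \<open>t * a\<close> along the segment; only the end point t = 1
      contributes.\<close>
    moreover have "(fu u has_integral of_real 1 * a (g u v 1) - of_real 0 * a (g u v 0)) (cbox 0 1)"
    proof -
      have "(fu u has_integral of_real 1 * a (g u v 1) - of_real 0 * a (g u v 0)) {0..1}"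
      proof (rule fundamental_theorem_of_calculus)
        fix t :: real assume t: "t \<in> {0..1}"
        have "((\<lambda>t. of_real t * a (g u v t)) has_vector_derivative
           of_real t * (of_real u * au (g u v t) + of_real (v - 1) * av (g u v t)) + 1 * a (g u v t)) (at t within {0..1})"
          using has_vector_derivative_mult[OF of_real_deriv uhp_partials_along[OF a g_dt[of u v t "{0..1}"] g_pos[OF v t]]] by simp
        then show "((\<lambda>t. of_real t * a (g u v t)) has_vector_derivative fu u t) (at t within {0..1})"
          using closed[OF g_pos[OF v t]] by (simp add: fu_def algebra_simps)
      qed simp
      then show ?thesis by simp
    qed
    ultimately show ?thesis
      by (simp add: integral_unique g_def)
  qed
  have w_v: "((\<lambda>v. w u v) has_vector_derivative b (Complex u v)) (at v within {0<..})" if v: "v \<in> {0<..}" for u v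
  proof -
    define fv where "fv v t = of_real u * (of_real t * av (g u v t)) + b (g u v t) + of_real (v - 1) * (of_real t * bv (g u v t))" for v t
    have "((\<lambda>v. w u v) has_vector_derivative integral (cbox 0 1) (fv v)) (at v within {0<..})"
      unfolding w_def
    proof (rule leibniz_rule_vector_derivative[where U = "{0<..}"])
      fix v t :: real assume "t \<in> cbox 0 1" "v \<in> {0<..}"
      then have "Im (g u v t) > 0" using g_pos by simp
      from uhp_partials_along[OF a g_dv[of u t v "{0<..}"] this] uhp_partials_along[OF b g_dv[of u t v "{0<..}"] this]
      show "((\<lambda>v. f u v t) has_vector_derivative fv v t) (at v within {0<..})"
        unfolding f_def fv_def
        by (auto intro!: derivative_eq_intros simp: algebra_simps)
    next
      show "continuous_on ({0<..} \<times> cbox 0 1) (\<lambda>(v, t). fv v t)"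
        unfolding fv_def case_prod_beta
        by (intro continuous_intros cv cb c)
    qed (use f_int v in auto)
    moreover have "(fv v has_integral of_real 1 * b (g u v 1) - of_real 0 * b (g u v 0)) (cbox 0 1)"
    proof -
      have v': "v > 0" using v by simp
      have "(fv v has_integral of_real 1 * b (g u v 1) - of_real 0 * b (g u v 0)) {0..1}"
      proof (rule fundamental_theorem_of_calculus)
        fix t :: real assume t: "t \<in> {0..1}"
        have "((\<lambda>t. of_real t * b (g u v t)) has_vector_derivative
           of_real t * (of_real u * bu (g u v t) + of_real (v - 1) * bv (g u v t)) + 1 * b (g u v t)) (at t within {0..1})"
          using has_vector_derivative_mult[OF of_real_deriv uhp_partials_along[OF b g_dt[of u v t "{0..1}"] g_pos[OF v' t]]] by simp
        then show "((\<lambda>t. of_real t * b (g u v t)) has_vector_derivative fv v t) (at t within {0..1})"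
          using closed[OF g_pos[OF v' t]] by (simp add: fv_def algebra_simps)
      qed simp
      then show ?thesis by simp
    qed
    ultimately show ?thesis
      by (simp add: integral_unique g_def)
  qed
  have "uhp_partials (\<lambda>\<tau>. w (Re \<tau>) (Im \<tau>)) a b"
    unfolding uhp_partials_def
  proof
    fix \<tau> assume "\<tau> \<in> upper_half_plane"
    then have \<tau>: "Im \<tau> > 0" by (simp add: upper_half_plane_def)
    have cC: "continuous_on (UNIV \<times> {0<..}) (\<lambda>p. b (Complex (fst p) (snd p)))"
      by (rule continuous_on_compose2[OF cb])
         (auto simp: Complex_eq upper_half_plane_def intro!: continuous_intros)
    have "((\<lambda>(u, v). w u v) has_derivative
        (\<lambda>(x, y). x *\<^sub>R a (Complex (Re \<tau>) (Im \<tau>)) + blinfun_apply (blinfun_scaleR_left (b (Complex (Re \<tau>) (Im \<tau>)))) y))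
        (at (Re \<tau>, Im \<tau>) within UNIV \<times> {0<..})"
    proof (rule has_derivative_partialsI)
      show "((\<lambda>u. w u (Im \<tau>)) has_derivative (\<lambda>x. x *\<^sub>R a (Complex (Re \<tau>) (Im \<tau>)))) (at (Re \<tau>) within UNIV)"
        using w_u[OF \<tau>, of "Re \<tau>"] by (simp add: has_vector_derivative_def)
      show "((\<lambda>v. w u v) has_derivative blinfun_apply (blinfun_scaleR_left (b (Complex u v)))) (at v within {0<..})"
        if "v \<in> {0<..}" for u v
        using w_v[OF that, of u] by (simp add: has_vector_derivative_def)
      have "continuous_on (UNIV \<times> {0<..}) (\<lambda>(u, v). blinfun_scaleR_left (b (Complex u v)))"
        unfolding case_prod_beta
        by (rule bounded_linear.continuous_on[OF bounded_linear_blinfun_scaleR_left cC])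
      then show "continuous (at (Re \<tau>, Im \<tau>) within UNIV \<times> {0<..}) (\<lambda>(u, v). blinfun_scaleR_left (b (Complex u v)))"
        using \<tau> by (simp add: continuous_on_eq_continuous_within)
    qed (use \<tau> in auto)
    then have D: "((\<lambda>(u, v). w u v) has_derivative
        (\<lambda>(x, y). x *\<^sub>R a \<tau> + y *\<^sub>R b \<tau>)) (at (Re \<tau>, Im \<tau>) within UNIV \<times> {0<..})"
      by simp
    have "open (UNIV \<times> {0<..} :: (real \<times> real) set)"
      by (intro open_Times) auto
    then have D: "((\<lambda>(u, v). w u v) has_derivative
        (\<lambda>(x, y). x *\<^sub>R a \<tau> + y *\<^sub>R b \<tau>)) (at (Re \<tau>, Im \<tau>))"
      using D \<tau> at_within_open[of "(Re \<tau>, Im \<tau>)" "UNIV \<times> {0<..}"] by simp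
    have "((\<lambda>\<tau>. (Re \<tau>, Im \<tau>)) has_derivative (\<lambda>w. (Re w, Im w))) (at \<tau>)"
      by (intro has_derivative_Pair has_derivative_Re has_derivative_Im has_derivative_ident)
    from has_derivative_compose[OF this D]
    show "((\<lambda>\<tau>. w (Re \<tau>) (Im \<tau>)) has_derivative (\<lambda>w. of_real (Re w) * a \<tau> + of_real (Im w) * b \<tau>)) (at \<tau>)"
      by (simp add: scaleR_conv_of_real)
  qed
  then show ?thesis by blast
qed

text \<open>By Green's formula the form \<open>F \<star>dR - R \<star>dF\<close> is closed, because \<open>F\<close> and \<open>R\<close> have the same
  eigenvalue.\<close>

definition green_primitive where
  "green_primitive W F Fu Fv R Ru Rv \<longleftrightarrow>
     uhp_partials W (\<lambda>\<tau>. F \<tau> * Rv \<tau> - R \<tau> * Fv \<tau>) (\<lambda>\<tau>. R \<tau> * Fu \<tau> - F \<tau> * Ru \<tau>)"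

lemma green_primitive_exists:
  assumes "eigenfunction F Fu Fv" "eigenfunction R Ru Rv"
  shows "\<exists>W. green_primitive W F Fu Fv R Ru Rv"
proof -
  obtain Fuu Fuv Fvu Fvv where F1: "uhp_partials F Fu Fv"
    and F2: "uhp_partials Fu Fuu Fuv" "uhp_partials Fv Fvu Fvv"
    and cF: "continuous_on upper_half_plane Fuu" "continuous_on upper_half_plane Fuv"
      "continuous_on upper_half_plane Fvu" "continuous_on upper_half_plane Fvv"
    and LF: "\<And>\<tau>. Im \<tau> > 0 \<Longrightarrow> Fuu \<tau> + Fvv \<tau> = - F \<tau> / (4 * (of_real (Im \<tau>))\<^sup>2)"
    using assms(1) unfolding eigenfunction_def upper_half_plane_def by blast
  obtain Ruu Ruv Rvu Rvv where R1: "uhp_partials R Ru Rv"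
    and R2: "uhp_partials Ru Ruu Ruv" "uhp_partials Rv Rvu Rvv"
    and cR: "continuous_on upper_half_plane Ruu" "continuous_on upper_half_plane Ruv"
      "continuous_on upper_half_plane Rvu" "continuous_on upper_half_plane Rvv"
    and LR: "\<And>\<tau>. Im \<tau> > 0 \<Longrightarrow> Ruu \<tau> + Rvv \<tau> = - R \<tau> / (4 * (of_real (Im \<tau>))\<^sup>2)"
    using assms(2) unfolding eigenfunction_def upper_half_plane_def by blast
  note cont = cF cR uhp_partials_continuous_on[OF F1] uhp_partials_continuous_on[OF R1]
    uhp_partials_continuous_on[OF F2(1)] uhp_partials_continuous_on[OF F2(2)]
    uhp_partials_continuous_on[OF R2(1)] uhp_partials_continuous_on[OF R2(2)]
    continuous_on_add continuous_on_diff continuous_on_mult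
  show ?thesis
    unfolding green_primitive_def
  proof (rule closed_form_primitive[OF
      uhp_partials_diff[OF uhp_partials_mult[OF F1 R2(2)] uhp_partials_mult[OF R1 F2(2)]]
      uhp_partials_diff[OF uhp_partials_mult[OF R1 F2(1)] uhp_partials_mult[OF F1 R2(1)]]])
    fix \<tau> :: complex assume \<tau>: "Im \<tau> > 0"
    have "F \<tau> * (Ruu \<tau> + Rvv \<tau>) = R \<tau> * (Fuu \<tau> + Fvv \<tau>)"
      by (simp add: LF[OF \<tau>] LR[OF \<tau>])
    then show "F \<tau> * Rvv \<tau> + Fv \<tau> * Rv \<tau> - (R \<tau> * Fvv \<tau> + Rv \<tau> * Fv \<tau>) =
        R \<tau> * Fuu \<tau> + Ru \<tau> * Fu \<tau> - (F \<tau> * Ruu \<tau> + Fu \<tau> * Ru \<tau>)"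
      by (simp add: algebra_simps)
  qed (rule cont)+
qed

text \<open>The star operator on one-forms is invariant under holomorphic maps in dimension two, so
  the Green form of a pair pulls back to the Green form of the pulled back pair. The given partials
  of \<open>G\<close> and \<open>S\<close> agree with those of the compositions by
  uniqueness.\<close>

lemma green_primitive_compose:
  assumes W: "green_primitive W F Fu Fv R Ru Rv"
    and F: "uhp_partials F Fu Fv" and R: "uhp_partials R Ru Rv"
    and m: "\<And>\<tau>. Im \<tau> > 0 \<Longrightarrow> (m has_field_derivative p \<tau>) (at \<tau>)"
    and mH: "\<And>\<tau>. Im \<tau> > 0 \<Longrightarrow> Im (m \<tau>) > 0"
    and G: "uhp_partials G Gu Gv" "\<And>\<tau>. Im \<tau> > 0 \<Longrightarrow> F (m \<tau>) = G \<tau>"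
    and S: "uhp_partials S Su Sv" "\<And>\<tau>. Im \<tau> > 0 \<Longrightarrow> R (m \<tau>) = S \<tau>"
  shows "green_primitive (\<lambda>\<tau>. W (m \<tau>)) G Gu Gv S Su Sv"
  unfolding green_primitive_def
proof (rule uhp_partials_cong[OF uhp_partials_compose[OF W[unfolded green_primitive_def] m mH]])
  have FC: "uhp_partials (\<lambda>\<tau>. F (m \<tau>))
    (\<lambda>\<tau>. of_real (Re (p \<tau>)) * Fu (m \<tau>) + of_real (Im (p \<tau>)) * Fv (m \<tau>))
    (\<lambda>\<tau>. of_real (Re (p \<tau>)) * Fv (m \<tau>) - of_real (Im (p \<tau>)) * Fu (m \<tau>))"
    by (rule uhp_partials_compose[OF F m mH])
  have RC: "uhp_partials (\<lambda>\<tau>. R (m \<tau>))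
    (\<lambda>\<tau>. of_real (Re (p \<tau>)) * Ru (m \<tau>) + of_real (Im (p \<tau>)) * Rv (m \<tau>))
    (\<lambda>\<tau>. of_real (Re (p \<tau>)) * Rv (m \<tau>) - of_real (Im (p \<tau>)) * Ru (m \<tau>))"
    by (rule uhp_partials_compose[OF R m mH])
  fix \<tau> :: complex assume \<tau>: "Im \<tau> > 0"
  have FG: "Gu \<tau> = of_real (Re (p \<tau>)) * Fu (m \<tau>) + of_real (Im (p \<tau>)) * Fv (m \<tau>)"
    "Gv \<tau> = of_real (Re (p \<tau>)) * Fv (m \<tau>) - of_real (Im (p \<tau>)) * Fu (m \<tau>)"
    by (rule uhp_partials_unique[OF FC G(1), symmetric]; use G(2) \<tau> in auto)+
  have RS: "Su \<tau> = of_real (Re (p \<tau>)) * Ru (m \<tau>) + of_real (Im (p \<tau>)) * Rv (m \<tau>)"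
    "Sv \<tau> = of_real (Re (p \<tau>)) * Rv (m \<tau>) - of_real (Im (p \<tau>)) * Ru (m \<tau>)"
    by (rule uhp_partials_unique[OF RC S(1), symmetric]; use S(2) \<tau> in auto)+
  show "of_real (Re (p \<tau>)) * (F (m \<tau>) * Rv (m \<tau>) - R (m \<tau>) * Fv (m \<tau>)) +
      of_real (Im (p \<tau>)) * (R (m \<tau>) * Fu (m \<tau>) - F (m \<tau>) * Ru (m \<tau>)) =
      G \<tau> * Sv \<tau> - S \<tau> * Gv \<tau>"
    unfolding FG RS G(2)[OF \<tau>, symmetric] S(2)[OF \<tau>, symmetric]
    by (simp add: algebra_simps)
  show "of_real (Re (p \<tau>)) * (R (m \<tau>) * Fu (m \<tau>) - F (m \<tau>) * Ru (m \<tau>)) -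
      of_real (Im (p \<tau>)) * (F (m \<tau>) * Rv (m \<tau>) - R (m \<tau>) * Fv (m \<tau>)) =
      S \<tau> * Gu \<tau> - G \<tau> * Su \<tau>"
    unfolding FG RS G(2)[OF \<tau>, symmetric] S(2)[OF \<tau>, symmetric]
    by (simp add: algebra_simps)
qed simp_all

section \<open>The primitive along vertical lines and high up in the half-plane\<close>

lemma vertical_integral_limit:
  assumes W: "uhp_partials W a b" and b: "(\<lambda>t. b (Complex x t)) absolutely_integrable_on {0<..}"
    and \<alpha>: "\<And>n. \<alpha> n > 0" "\<alpha> \<longlonglongrightarrow> 0" and \<beta>: "filterlim \<beta> at_top sequentially"
    and le: "\<And>n. \<alpha> n \<le> \<beta> n"
  shows "(\<lambda>n. W (Complex x (\<beta> n)) - W (Complex x (\<alpha> n))) \<longlonglongrightarrow> integral {0<..} (\<lambda>t. b (Complex x t))"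
proof -
  have "integral {\<alpha> n..\<beta> n} (\<lambda>t. b (Complex x t)) = W (Complex x (\<beta> n)) - W (Complex x (\<alpha> n))" for n
    by (rule integral_unique, rule fundamental_theorem_of_calculus[OF le])
       (use \<alpha>(1)[of n] in \<open>auto intro: uhp_partials_vector_derivative(2)[OF W]\<close>)
  then show ?thesis
    using integral_Icc_tendsto[OF b \<alpha> \<beta>] by simp
qed

text \<open>Cuspidality in the form used for estimates: exponential decay of the function and its
  first partials, uniformly in the real part. For another cusp it is applied to the composition with
  a matrix that maps infinity to this cusp.\<close>

definition decays_at_infinity :: "(complex \<Rightarrow> complex) \<Rightarrow> (complex \<Rightarrow> complex) \<Rightarrow> (complex \<Rightarrow> complex) \<Rightarrow> bool" where
  "decays_at_infinity G Gu Gv \<longleftrightarrow> (\<exists>C e. e > 0 \<and> (\<forall>\<tau>. Im \<tau> \<ge> 1 \<longrightarrow>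
     norm (G \<tau>) \<le> C * exp (- e * Im \<tau>) \<and> norm (Gu \<tau>) \<le> C * exp (- e * Im \<tau>) \<and>
     norm (Gv \<tau>) \<le> C * exp (- e * Im \<tau>)))"

lemma norm_poisson_le:
  assumes "(P, Q) \<noteq> (0, 0)"
  shows "\<exists>D\<ge>0. \<forall>\<tau>. Im \<tau> \<ge> 1 \<longrightarrow> norm (poisson P Q \<tau>) \<le> D * sqrt (Im \<tau>)"
proof -
  define d where "d = (if P = 0 then \<bar>Q\<bar> else \<bar>P\<bar>)"
  have d: "d > 0"
    using assms by (auto simp: d_def)
  have "norm (poisson P Q \<tau>) \<le> 1 / d * sqrt (Im \<tau>)" if "Im \<tau> \<ge> 1" for \<tau>
  proof -
    have "d \<le> norm (of_real P * \<tau> + of_real Q)"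
    proof (cases "P = 0")
      case False
      have "\<bar>P\<bar> * 1 \<le> \<bar>P\<bar> * Im \<tau>"
        using that by (intro mult_left_mono) auto
      also have "\<dots> = \<bar>Im (of_real P * \<tau> + of_real Q)\<bar>"
        using that by (simp add: abs_mult)
      also have "\<dots> \<le> norm (of_real P * \<tau> + of_real Q)"
        by (rule abs_Im_le_cmod)
      finally show ?thesis
        using False by (simp add: d_def)
    qed (simp add: d_def)
    then have "sqrt (Im \<tau>) / norm (of_real P * \<tau> + of_real Q) \<le> sqrt (Im \<tau>) / d"
      using d that by (intro divide_left_mono mult_pos_pos) auto
    then show ?thesis
      using that unfolding poisson_def norm_of_real by simp
  qed
  then show ?thesis
    using d by (intro exI[of _ "1 / d"]) auto
qed

text \<open>On a horizontal segment of fixed length the primitive changes by at most the length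
  times the size of the form, which is exponentially small against the growth v^(1/2) of the kernel.
  This cuts off an ideal vertex at no cost in the limit.\<close>

lemma primitive_corner:
  assumes W: "green_primitive W G Gu Gv (poisson P Q) (poisson_u P Q) (poisson_v P Q)"
    and PQ: "(P, Q) \<noteq> (0, 0)" and G: "decays_at_infinity G Gu Gv"
    and T: "filterlim T at_top sequentially"
  shows "(\<lambda>n. W (Complex u1 (T n)) - W (Complex u2 (T n))) \<longlonglongrightarrow> 0"
proof -
  obtain C e where e: "e > 0" and C: "\<And>\<tau>. Im \<tau> \<ge> 1 \<Longrightarrow> norm (G \<tau>) \<le> C * exp (- e * Im \<tau>)"
      "\<And>\<tau>. Im \<tau> \<ge> 1 \<Longrightarrow> norm (Gv \<tau>) \<le> C * exp (- e * Im \<tau>)"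
    using G unfolding decays_at_infinity_def by blast
  obtain D where D: "D \<ge> 0" "\<And>\<tau>. Im \<tau> \<ge> 1 \<Longrightarrow> norm (poisson P Q \<tau>) \<le> D * sqrt (Im \<tau>)"
    using norm_poisson_le[OF PQ] by blast
  define B where "B v = 2 * C * D * sqrt v * exp (- e * v)" for v
  have bound: "norm (G \<tau> * poisson_v P Q \<tau> - poisson P Q \<tau> * Gv \<tau>) \<le> B (Im \<tau>)" if \<tau>: "Im \<tau> \<ge> 1" for \<tau>
  proof -
    have "norm (poisson_v P Q \<tau>) \<le> norm (poisson P Q \<tau>) / (2 * Im \<tau>)"
      using \<tau> by (intro norm_poisson_partials_le PQ) simp
    also have "\<dots> \<le> norm (poisson P Q \<tau>) / 1"
      using \<tau> by (intro divide_left_mono) auto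
    finally have v: "norm (poisson_v P Q \<tau>) \<le> D * sqrt (Im \<tau>)"
      using D(2)[OF \<tau>] by simp
    have C0: "C * exp (- e * Im \<tau>) \<ge> 0"
      using C(1)[OF \<tau>] norm_ge_zero order_trans by blast
    have "norm (G \<tau> * poisson_v P Q \<tau> - poisson P Q \<tau> * Gv \<tau>) \<le>
        norm (G \<tau>) * norm (poisson_v P Q \<tau>) + norm (poisson P Q \<tau>) * norm (Gv \<tau>)"
      by (rule order_trans[OF norm_triangle_ineq4]) (simp add: norm_mult)
    also have "\<dots> \<le> (C * exp (- e * Im \<tau>)) * (D * sqrt (Im \<tau>)) + (D * sqrt (Im \<tau>)) * (C * exp (- e * Im \<tau>))"
      using C0 D \<tau> by (intro add_mono mult_mono C D v) auto
    also have "\<dots> = B (Im \<tau>)"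
      by (simp add: B_def)
    finally show ?thesis .
  qed
  have diff: "norm (W (Complex u1 v) - W (Complex u2 v)) \<le> B v * \<bar>u1 - u2\<bar>" if v: "v \<ge> 1" for v
  proof -
    have "norm (W (Complex u1 v) - W (Complex u2 v)) \<le> B v * norm (u1 - u2)"
    proof (rule differentiable_bound[of UNIV "\<lambda>u. W (Complex u v)"])
      fix u
      show "((\<lambda>u. W (Complex u v)) has_derivative (\<lambda>h. h *\<^sub>R (G (Complex u v) * poisson_v P Q (Complex u v) - poisson P Q (Complex u v) * Gv (Complex u v)))) (at u within UNIV)"
        using uhp_partials_vector_derivative(1)[OF W[unfolded green_primitive_def], of v u UNIV] v
        by (simp add: has_vector_derivative_def)
      show "onorm (\<lambda>h. h *\<^sub>R (G (Complex u v) * poisson_v P Q (Complex u v) - poisson P Q (Complex u v) * Gv (Complex u v))) \<le> B v"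
        using bound[of "Complex u v"] v by (intro onorm_le) (simp add: mult.commute[of "B v"] mult_left_mono)
    qed auto
    then show ?thesis by simp
  qed
  show ?thesis
  proof (rule Lim_null_comparison)
    have "\<forall>\<^sub>F n in sequentially. T n \<ge> 1"
      using T by (simp add: filterlim_at_top)
    then show "\<forall>\<^sub>F n in sequentially. norm (W (Complex u1 (T n)) - W (Complex u2 (T n))) \<le> B (T n) * \<bar>u1 - u2\<bar>"
      by eventually_elim (rule diff)
    have "((\<lambda>v. sqrt v * exp (- e * v)) \<longlongrightarrow> 0) at_top"
      using e by real_asymp
    then have "((\<lambda>v. 2 * C * D * (sqrt v * exp (- e * v)) * \<bar>u1 - u2\<bar>) \<longlongrightarrow> 0) at_top"
      by (intro tendsto_mult_left_zero tendsto_mult_right_zero)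
    then have "((\<lambda>v. B v * \<bar>u1 - u2\<bar>) \<longlongrightarrow> 0) at_top"
      by (simp add: B_def mult.assoc)
    then show "(\<lambda>n. B (T n) * \<bar>u1 - u2\<bar>) \<longlonglongrightarrow> 0"
      using T by (rule filterlim_compose)
  qed
qed

lemma bessel_expansion_partials:
  assumes h: "h > 0" and a: "subexponential a" and G: "uhp_partials G Gu Gv"
    and exp: "\<And>\<tau>. Im \<tau> > 0 \<Longrightarrow> G \<tau> = of_real (sqrt (Im \<tau>)) * bessel_series h 0 a (Re \<tau>) (Im \<tau>)"
    and \<tau>: "Im \<tau> > 0"
  shows "Gu \<tau> = of_real (sqrt (Im \<tau>)) * bessel_series h 0 (\<lambda>n. \<i> * of_real (freq h n) * a n) (Re \<tau>) (Im \<tau>)"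
    and "Gv \<tau> = of_real (1 / (2 * sqrt (Im \<tau>))) * bessel_series h 0 a (Re \<tau>) (Im \<tau>)
      - of_real (sqrt (Im \<tau>)) * bessel_series h 1 (\<lambda>n. of_real \<bar>freq h n\<bar> * a n) (Re \<tau>) (Im \<tau>)"
proof -
  let ?u = "Re \<tau>" and ?v = "Im \<tau>"
  have "((\<lambda>u. G (Complex u ?v)) has_vector_derivative Gu (Complex ?u ?v)) (at ?u)"
    by (rule uhp_partials_vector_derivative(1)[OF G \<tau>])
  moreover have "((\<lambda>u. of_real (sqrt ?v) * bessel_series h 0 a u ?v) has_vector_derivative
      of_real (sqrt ?v) * bessel_series h 0 (\<lambda>n. \<i> * of_real (freq h n) * a n) ?u ?v) (at ?u)"
    by (rule has_vector_derivative_mult_right[OF bessel_series_deriv_u[OF h a \<tau>]])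
  moreover have "(\<lambda>u. G (Complex u ?v)) = (\<lambda>u. of_real (sqrt ?v) * bessel_series h 0 a u ?v)"
    using \<tau> by (simp add: exp)
  ultimately show "Gu \<tau> = of_real (sqrt ?v) * bessel_series h 0 (\<lambda>n. \<i> * of_real (freq h n) * a n) ?u ?v"
    using vector_derivative_unique_at by fastforce
  have "((\<lambda>v. G (Complex ?u v)) has_vector_derivative Gv \<tau>) (at ?v)"
    using uhp_partials_vector_derivative(2)[OF G \<tau>, of ?u] by simp
  then have 1: "((\<lambda>v. of_real (sqrt v) * bessel_series h 0 a ?u v) has_vector_derivative Gv \<tau>) (at ?v)"
    unfolding has_vector_derivative_def
    by (rule has_derivative_transform_within_open[OF _ open_greaterThan[of 0]]) (use \<tau> exp in auto)
  have "((\<lambda>v. complex_of_real (sqrt v)) has_vector_derivative of_real (1 / (2 * sqrt ?v))) (at ?v)"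
    using \<tau> by (intro has_vector_derivative_of_real) (auto intro!: derivative_eq_intros simp: field_simps)
  from has_vector_derivative_mult[OF this bessel_series_deriv_v[OF h a \<tau>, of 0 ?u]]
  have "Gv \<tau> = of_real (sqrt ?v) * - bessel_series h (Suc 0) (\<lambda>n. of_real \<bar>freq h n\<bar> * a n) ?u ?v
      + of_real (1 / (2 * sqrt ?v)) * bessel_series h 0 a ?u ?v"
    by (rule vector_derivative_unique_at[OF 1])
  then show "Gv \<tau> = of_real (1 / (2 * sqrt ?v)) * bessel_series h 0 a ?u ?v
      - of_real (sqrt ?v) * bessel_series h 1 (\<lambda>n. of_real \<bar>freq h n\<bar> * a n) ?u ?v"
    by simp
qed

lemma bessel_expansion_decays:
  assumes h: "h > 0" and a: "subexponential a" and G: "uhp_partials G Gu Gv"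
    and exp: "\<And>\<tau>. Im \<tau> > 0 \<Longrightarrow> G \<tau> = of_real (sqrt (Im \<tau>)) * bessel_series h 0 a (Re \<tau>) (Im \<tau>)"
  shows "decays_at_infinity G Gu Gv"
proof -
  have f1: "freq h 1 > 0"
    using h by (rule freq_1_pos)
  obtain C0 where C0: "\<And>u v. v \<ge> 1 \<Longrightarrow> norm (bessel_series h 0 a u v) \<le> C0 * exp (- freq h 1 * v)"
    using bessel_series_decay[OF h a zero_less_one] by blast
  obtain C1 where C1: "\<And>u v. v \<ge> 1 \<Longrightarrow> norm (bessel_series h 0 (\<lambda>n. \<i> * of_real (freq h n) * a n) u v) \<le> C1 * exp (- freq h 1 * v)"
    using bessel_series_decay[OF h subexponential_freq(1)[OF a] zero_less_one] by blast
  obtain C2 where C2: "\<And>u v. v \<ge> 1 \<Longrightarrow> norm (bessel_series h 1 (\<lambda>n. of_real \<bar>freq h n\<bar> * a n) u v) \<le> C2 * exp (- freq h 1 * v)"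
    using bessel_series_decay[OF h subexponential_freq(2)[OF a] zero_less_one] by blast
  \<comment> \<open>Half of the rate of the lowest frequency is given up to absorb the factor
    \<open>sqrt v\<close>.\<close>
  define e where "e = freq h 1 / 2"
  have e: "e > 0" using f1 by (simp add: e_def)
  define C where "C = (\<bar>C0\<bar> + \<bar>C1\<bar> + \<bar>C2\<bar>) / e"
  have key: "sqrt v * (K * exp (- freq h 1 * v)) \<le> \<bar>K\<bar> / e * exp (- e * v)" if "v \<ge> 1" for v K
  proof -
    have "sqrt v \<le> v"
      using that by (simp add: real_le_lsqrt power2_eq_square)
    also have "v \<le> exp (e * v) / e"
      by (rule le_exp_div[OF e])
    finally have v: "sqrt v \<le> exp (e * v) / e" .
    have "sqrt v * (K * exp (- freq h 1 * v)) \<le> sqrt v * (\<bar>K\<bar> * exp (- freq h 1 * v))"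
      using that by (intro mult_left_mono mult_right_mono) auto
    also have "\<dots> \<le> (exp (e * v) / e) * (\<bar>K\<bar> * exp (- freq h 1 * v))"
      by (intro mult_right_mono v) auto
    also have "\<dots> = \<bar>K\<bar> / e * (exp (e * v) * exp (- freq h 1 * v))"
      by simp
    also have "exp (e * v) * exp (- freq h 1 * v) = exp (- e * v)"
      by (simp add: e_def flip: exp_add)
    finally show ?thesis .
  qed
  have "norm (G \<tau>) \<le> C * exp (- e * Im \<tau>) \<and> norm (Gu \<tau>) \<le> C * exp (- e * Im \<tau>) \<and> norm (Gv \<tau>) \<le> C * exp (- e * Im \<tau>)"
    if \<tau>: "Im \<tau> \<ge> 1" for \<tau>
  proof (intro conjI)
    have pos: "Im \<tau> > 0" using \<tau> by simp
    have sq: "sqrt (Im \<tau>) \<ge> 1" using \<tau> by simp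
    have gu: "Gu \<tau> = of_real (sqrt (Im \<tau>)) * bessel_series h 0 (\<lambda>n. \<i> * of_real (freq h n) * a n) (Re \<tau>) (Im \<tau>)"
      by (rule bessel_expansion_partials(1)[OF h a G exp pos])
    have gv: "Gv \<tau> = of_real (1 / (2 * sqrt (Im \<tau>))) * bessel_series h 0 a (Re \<tau>) (Im \<tau>)
        - of_real (sqrt (Im \<tau>)) * bessel_series h 1 (\<lambda>n. of_real \<bar>freq h n\<bar> * a n) (Re \<tau>) (Im \<tau>)"
      by (rule bessel_expansion_partials(2)[OF h a G exp pos])
    have nK: "norm (of_real (sqrt (Im \<tau>)) * z) \<le> \<bar>K\<bar> / e * exp (- e * Im \<tau>)"
      if "norm z \<le> K * exp (- freq h 1 * Im \<tau>)" for z :: complex and K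
    proof -
      have "norm (of_real (sqrt (Im \<tau>)) * z) = sqrt (Im \<tau>) * norm z"
        using pos by (simp add: norm_mult)
      also have "\<dots> \<le> sqrt (Im \<tau>) * (K * exp (- freq h 1 * Im \<tau>))"
        using pos by (intro mult_left_mono that) simp
      also have "\<dots> \<le> \<bar>K\<bar> / e * exp (- e * Im \<tau>)"
        by (rule key[OF \<tau>])
      finally show ?thesis .
    qed
    have n0: "norm (of_real (sqrt (Im \<tau>)) * bessel_series h 0 a (Re \<tau>) (Im \<tau>)) \<le> \<bar>C0\<bar> / e * exp (- e * Im \<tau>)"
      by (rule nK[OF C0[OF \<tau>]])
    have n1: "norm (of_real (sqrt (Im \<tau>)) * bessel_series h 0 (\<lambda>n. \<i> * of_real (freq h n) * a n) (Re \<tau>) (Im \<tau>)) \<le> \<bar>C1\<bar> / e * exp (- e * Im \<tau>)"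
      by (rule nK[OF C1[OF \<tau>]])
    have n2: "norm (of_real (sqrt (Im \<tau>)) * bessel_series h 1 (\<lambda>n. of_real \<bar>freq h n\<bar> * a n) (Re \<tau>) (Im \<tau>)) \<le> \<bar>C2\<bar> / e * exp (- e * Im \<tau>)"
      by (rule nK[OF C2[OF \<tau>]])
    have C: "(\<bar>C0\<bar> / e + \<bar>C1\<bar> / e + \<bar>C2\<bar> / e) * exp (- e * Im \<tau>) = C * exp (- e * Im \<tau>)"
      by (simp add: C_def add_divide_distrib)
    have nn: "\<bar>C0\<bar> / e * exp (- e * Im \<tau>) \<ge> 0" "\<bar>C1\<bar> / e * exp (- e * Im \<tau>) \<ge> 0" "\<bar>C2\<bar> / e * exp (- e * Im \<tau>) \<ge> 0"
      using e by auto
    show "norm (G \<tau>) \<le> C * exp (- e * Im \<tau>)"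
      using n0 nn C unfolding exp[OF pos] distrib_right by linarith
    show "norm (Gu \<tau>) \<le> C * exp (- e * Im \<tau>)"
      using n1 nn C unfolding gu distrib_right by linarith
    have "norm (of_real (1 / (2 * sqrt (Im \<tau>))) * bessel_series h 0 a (Re \<tau>) (Im \<tau>)) \<le>
        norm (of_real (sqrt (Im \<tau>)) * bessel_series h 0 a (Re \<tau>) (Im \<tau>))"
    proof -
      have "1 \<le> 2 * sqrt (Im \<tau>)"
        using sq by linarith
      then have "1 / (2 * sqrt (Im \<tau>)) \<le> 1"
        by (intro divide_le_eq_1_pos[THEN iffD2]) linarith+
      then have "1 / (2 * sqrt (Im \<tau>)) \<le> sqrt (Im \<tau>)"
        using sq by linarith
      moreover have "norm (complex_of_real (1 / (2 * sqrt (Im \<tau>)))) = 1 / (2 * sqrt (Im \<tau>))"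
        unfolding norm_of_real using sq by simp
      ultimately show ?thesis
        unfolding norm_mult using sq by (intro mult_right_mono) auto
    qed
    then have "norm (Gv \<tau>) \<le> \<bar>C0\<bar> / e * exp (- e * Im \<tau>) + \<bar>C2\<bar> / e * exp (- e * Im \<tau>)"
      unfolding gv
      using n0 n2 norm_triangle_ineq4 order_trans add_mono by (smt (verit))
    then show "norm (Gv \<tau>) \<le> C * exp (- e * Im \<tau>)"
      using nn C unfolding distrib_right by linarith
  qed
  then show ?thesis
    unfolding decays_at_infinity_def using e by blast
qed

section \<open>Fourier expansion of periodic eigenfunctions\<close>

lemma cis_freq_period: "h > 0 \<Longrightarrow> cis (freq h n * real h) = 1"
  by (simp add: freq_def cis_multiple_2pi)

lemma has_vector_derivative_cis:
  "((\<lambda>u. cis (w * u)) has_vector_derivative \<i> * of_real w * cis (w * u)) (at u within S)"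
proof -
  have "((\<lambda>z. exp (\<i> * of_real w * z)) has_field_derivative \<i> * of_real w * exp (\<i> * of_real w * of_real u)) (at (of_real u))"
    by (auto intro!: derivative_eq_intros)
  from has_vector_derivative_real_field[OF this] show ?thesis
    by (simp add: cis_conv_exp mult.assoc)
qed

lemma continuous_on_cis_linear: "continuous_on S (\<lambda>u. cis (w * u))"
  by (intro continuous_intros)

lemma fourier_orthogonality:
  assumes h: "h > 0"
  shows "((\<lambda>u. cis (freq h n * u) * cis (- (freq h m * u))) has_integral (if n = m then of_nat h else 0)) {0..real h}"
proof (cases "n = m")
  case True
  then show ?thesis
    using has_integral_const_real[of "1 :: complex" 0 "real h"] by (simp add: cis_mult scaleR_conv_of_real)
next
  case False
  let ?w = "freq h (n - m)"
  have w: "?w \<noteq> 0"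
    using False h by (simp add: freq_def)
  have eq: "cis (freq h n * u) * cis (- (freq h m * u)) = cis (?w * u)" for u
  proof -
    have "freq h n * u + - (freq h m * u) = ?w * u"
      by (simp add: freq_def algebra_simps diff_divide_distrib)
    then show ?thesis
      by (simp only: cis_mult)
  qed
  have "((\<lambda>u. cis (?w * u)) has_integral cis (?w * real h) / (\<i> * of_real ?w) - cis (?w * 0) / (\<i> * of_real ?w)) {0..real h}"
  proof (rule fundamental_theorem_of_calculus)
    fix u
    have "((\<lambda>u. cis (?w * u) / (\<i> * of_real ?w)) has_vector_derivative (\<i> * of_real ?w * cis (?w * u)) / (\<i> * of_real ?w)) (at u within {0..real h})"
      by (intro has_vector_derivative_divide has_vector_derivative_cis)
    then show "((\<lambda>u. cis (?w * u) / (\<i> * of_real ?w)) has_vector_derivative cis (?w * u)) (at u within {0..real h})"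
      using w by simp
  qed simp
  then show ?thesis
    using False by (simp add: eq cis_freq_period[OF h])
qed

text \<open>Expand the nonnegative integral of |g - s/h|^2. The coefficients \<open>d n\<close> are
  not normalised, so that s/h, and not s, is the orthogonal projection of g onto the chosen
  frequencies; this also explains the factor h on the right.\<close>

lemma bessel_inequality:
  fixes g :: "real \<Rightarrow> complex"
  assumes h: "h > 0" and g: "continuous_on {0..real h} g" and S: "finite S"
  defines "d \<equiv> \<lambda>n. integral {0..real h} (\<lambda>u. g u * cis (- (freq h n * u)))"
  shows "(\<Sum>n\<in>S. (norm (d n))\<^sup>2) \<le> real h * integral {0..real h} (\<lambda>u. (norm (g u))\<^sup>2)"
proof -
  let ?I = "{0..real h}"
  define s where "s u = (\<Sum>n\<in>S. d n * cis (freq h n * u))" for u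
  define Q where "Q = (\<Sum>n\<in>S. (norm (d n))\<^sup>2)"
  have d: "((\<lambda>u. g u * cis (- (freq h n * u))) has_integral d n) ?I" for n
    unfolding d_def
    by (intro integrable_integral integrable_continuous_interval continuous_intros g)
  have gs: "((\<lambda>u. g u * cnj (s u)) has_integral of_real Q) ?I"
  proof -
    have "((\<lambda>u. \<Sum>n\<in>S. cnj (d n) * (g u * cis (- (freq h n * u)))) has_integral (\<Sum>n\<in>S. cnj (d n) * d n)) ?I"
      by (intro has_integral_sum S has_integral_mult_right d)
    moreover have "(\<lambda>u. \<Sum>n\<in>S. cnj (d n) * (g u * cis (- (freq h n * u)))) = (\<lambda>u. g u * cnj (s u))"
      by (simp add: fun_eq_iff s_def cnj_sum sum_distrib_left cis_cnj mult_ac)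
    moreover have "(\<Sum>n\<in>S. cnj (d n) * d n) = of_real Q"
      unfolding Q_def of_real_sum by (intro sum.cong refl) (metis complex_norm_square mult.commute)
    ultimately show ?thesis by simp
  qed
  have sg: "((\<lambda>u. cnj (g u) * s u) has_integral of_real Q) ?I"
    using has_integral_linear[OF gs bounded_linear_cnj] by (simp add: o_def)
  have ss: "((\<lambda>u. s u * cnj (s u)) has_integral of_nat h * of_real Q) ?I"
  proof -
    have "((\<lambda>u. \<Sum>n\<in>S. \<Sum>m\<in>S. d n * cnj (d m) * (cis (freq h n * u) * cis (- (freq h m * u)))) has_integral
        (\<Sum>n\<in>S. \<Sum>m\<in>S. d n * cnj (d m) * (if n = m then of_nat h else 0))) ?I"
      by (intro has_integral_sum S has_integral_mult_right fourier_orthogonality h)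
    moreover have "(\<lambda>u. \<Sum>n\<in>S. \<Sum>m\<in>S. d n * cnj (d m) * (cis (freq h n * u) * cis (- (freq h m * u)))) = (\<lambda>u. s u * cnj (s u))"
      by (simp add: fun_eq_iff s_def cnj_sum sum_product cis_cnj mult_ac)
    moreover have "(\<Sum>n\<in>S. \<Sum>m\<in>S. d n * cnj (d m) * (if n = m then of_nat h else 0)) = of_nat h * of_real Q"
    proof -
      have "(\<Sum>m\<in>S. d n * cnj (d m) * (if n = m then of_nat h else 0)) = of_nat h * of_real ((norm (d n))\<^sup>2)" if "n \<in> S" for n
      proof -
        have "(\<Sum>m\<in>S. d n * cnj (d m) * (if n = m then of_nat h else 0)) = (\<Sum>m\<in>S. if n = m then d n * cnj (d n) * of_nat h else 0)"
          by (intro sum.cong) auto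
        also have "\<dots> = d n * cnj (d n) * of_nat h"
          using S that by simp
        finally show ?thesis
          by (simp only: complex_norm_square mult.commute)
      qed
      then show ?thesis
        by (simp add: Q_def sum_distrib_left)
    qed
    ultimately show ?thesis by simp
  qed
  have gg: "((\<lambda>u. of_real ((norm (g u))\<^sup>2)) has_integral complex_of_real (integral ?I (\<lambda>u. (norm (g u))\<^sup>2))) ?I"
    using has_integral_linear[OF integrable_integral bounded_linear_of_real, of "\<lambda>u. (norm (g u))\<^sup>2" ?I]
    by (simp add: o_def integrable_continuous_interval continuous_intros g)
  have "((\<lambda>u. of_real ((norm (g u))\<^sup>2) - g u * cnj (s u) / of_nat h - cnj (g u) * s u / of_nat h + s u * cnj (s u) / (of_nat h * of_nat h))
      has_integral of_real (integral ?I (\<lambda>u. (norm (g u))\<^sup>2)) - of_real Q / of_nat h - of_real Q / of_nat h + of_nat h * of_real Q / (of_nat h * of_nat h)) ?I"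
    by (intro has_integral_add has_integral_diff has_integral_divide gg gs sg ss)
  also have "(\<lambda>u. of_real ((norm (g u))\<^sup>2) - g u * cnj (s u) / of_nat h - cnj (g u) * s u / of_nat h + s u * cnj (s u) / (of_nat h * of_nat h)) =
      (\<lambda>u. of_real ((norm (g u - s u / of_nat h))\<^sup>2))"
    unfolding complex_norm_square by (simp add: fun_eq_iff algebra_simps add_divide_distrib diff_divide_distrib)
  also have "of_real (integral ?I (\<lambda>u. (norm (g u))\<^sup>2)) - of_real Q / of_nat h - of_real Q / of_nat h + of_nat h * of_real Q / (of_nat h * of_nat h) =
      complex_of_real (integral ?I (\<lambda>u. (norm (g u))\<^sup>2) - Q / real h)"
    using h by simp
  finally have "((\<lambda>u. Re (of_real ((norm (g u - s u / of_nat h))\<^sup>2))) has_integral Re (of_real (integral ?I (\<lambda>u. (norm (g u))\<^sup>2) - Q / real h))) ?I"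
    using has_integral_linear[OF _ bounded_linear_Re] unfolding o_def by blast
  then have "((\<lambda>u. (norm (g u - s u / of_nat h))\<^sup>2) has_integral (integral ?I (\<lambda>u. (norm (g u))\<^sup>2) - Q / real h)) ?I"
    by (simp only: Re_complex_of_real)
  then have "integral ?I (\<lambda>u. (norm (g u))\<^sup>2) - Q / real h \<ge> 0"
    by (rule has_integral_nonneg) simp
  then show ?thesis
    using h by (simp add: Q_def field_simps)
qed

lemma cis_freq_inj:
  assumes h: "h > 0" and u: "u \<in> {0..real h}" and u0: "u0 \<in> {0<..<real h}" and "u \<noteq> u0"
  shows "cis (freq h 1 * u) \<noteq> cis (freq h 1 * u0)"
proof
  assume "cis (freq h 1 * u) = cis (freq h 1 * u0)"
  then have "cis (freq h 1 * u - freq h 1 * u0) = 1"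
    by (simp flip: cis_divide)
  then have "cos (freq h 1 * u - freq h 1 * u0) = 1"
    by (simp add: complex_eq_iff)
  then obtain k :: int where k: "freq h 1 * u - freq h 1 * u0 = of_int k * 2 * pi"
    using cos_one_2pi_int by blast
  then have "(u - u0) * (2 * pi) = real_of_int k * real h * (2 * pi)"
    using h by (simp add: freq_def field_simps)
  then have e: "u - u0 = real_of_int k * real h"
    by (rule mult_right_cancel[of "2 * pi", THEN iffD1, rotated]) simp
  have "\<bar>real_of_int k * real h\<bar> < 1 * real h"
    unfolding e[symmetric] using u u0 by auto
  then have "\<bar>real_of_int k\<bar> < 1"
    using h unfolding abs_mult by (simp add: mult_less_cancel_right)
  then have "k = 0"
    by linarith
  then show False
    using e assms by simp
qed

text \<open>Chernoff's proof of pointwise convergence: dividing by \<open>e (u/h) - e (u0/h)\<close> turns the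
  vanishing of the Fourier coefficients into a two-term recurrence for those of the quotient,
  and the latter are square summable.\<close>

lemma fourier_uniqueness:
  fixes D :: "real \<Rightarrow> complex"
  assumes h: "h > 0" and D: "\<And>u. (D has_vector_derivative D' u) (at u)"
    and coeff: "\<And>n. integral {0..real h} (\<lambda>u. D u * cis (- (freq h n * u))) = 0"
    and u0: "u0 \<in> {0<..<real h}"
  shows "D u0 = 0"
proof -
  let ?I = "{0..real h}"
  define z where "z u = cis (freq h 1 * u)" for u
  \<comment> \<open>The value at u0 is the limit of the quotient, which makes g continuous on the
    closed interval, so that Bessel's inequality applies to it.\<close>
  define g where "g u = (if u = u0 then D' u0 / (\<i> * of_real (freq h 1) * z u0) else (D u - D u0) / (z u - z u0))" for u
  have zD: "(z has_vector_derivative \<i> * of_real (freq h 1) * z u) (at u)" for u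
    unfolding z_def by (rule has_vector_derivative_cis)
  have z_ne: "z u \<noteq> z u0" if "u \<in> ?I" "u \<noteq> u0" for u
    unfolding z_def using cis_freq_inj[OF h that(1) u0 that(2)] .
  have nz: "\<i> * of_real (freq h 1) * z u0 \<noteq> 0"
    using freq_1_pos[OF h] by (simp add: z_def)
  have cD: "continuous_on S D" for S
    using D by (intro continuous_at_imp_continuous_on ballI has_vector_derivative_continuous)
  have cz: "continuous_on S z" for S
    unfolding z_def by (rule continuous_on_cis_linear)
  have slope: "((\<lambda>u. (f u - f u0) / of_real (u - u0)) \<longlongrightarrow> f') (at u0)"
    if "(f has_vector_derivative f') (at u0)" for f :: "real \<Rightarrow> complex" and f'
  proof -
    have "((\<lambda>u. norm (f u - f u0 - (u - u0) *\<^sub>R f') / norm (u - u0)) \<longlongrightarrow> 0) (at u0)"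
      using that unfolding has_vector_derivative_def has_derivative_iff_norm by blast
    moreover have "\<forall>\<^sub>F u in at u0. norm (f u - f u0 - (u - u0) *\<^sub>R f') / norm (u - u0) = norm ((f u - f u0) / of_real (u - u0) - f')"
      unfolding eventually_at_filter
    proof (intro always_eventually allI impI)
      fix u assume "u \<noteq> u0"
      then have "(f u - f u0) / of_real (u - u0) - f' = (f u - f u0 - (u - u0) *\<^sub>R f') / of_real (u - u0)"
        by (simp add: scaleR_conv_of_real diff_divide_distrib)
      then show "norm (f u - f u0 - (u - u0) *\<^sub>R f') / norm (u - u0) = norm ((f u - f u0) / of_real (u - u0) - f')"
        by (simp only: norm_divide norm_of_real real_norm_def)
    qed
    ultimately have "((\<lambda>u. norm ((f u - f u0) / of_real (u - u0) - f')) \<longlongrightarrow> 0) (at u0)"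
      by (rule Lim_transform_eventually)
    then show ?thesis
      by (metis LIM_zero_cancel tendsto_norm_zero_cancel)
  qed
  have cg: "continuous_on ?I g"
    unfolding continuous_on_eq_continuous_within
  proof
    fix u assume u: "u \<in> ?I"
    show "continuous (at u within ?I) g"
    proof (cases "u = u0")
      case True
      have "((\<lambda>u. ((D u - D u0) / of_real (u - u0)) / ((z u - z u0) / of_real (u - u0))) \<longlongrightarrow>
          D' u0 / (\<i> * of_real (freq h 1) * z u0)) (at u0)"
        by (intro tendsto_divide slope D zD nz)
      moreover have "\<forall>\<^sub>F u in at u0. ((D u - D u0) / of_real (u - u0)) / ((z u - z u0) / of_real (u - u0)) = g u"
        by (simp add: eventually_at_filter g_def)
      ultimately have "(g \<longlongrightarrow> g u0) (at u0)"
        by (simp add: g_def[of u0] Lim_transform_eventually)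
      then show ?thesis
        using True continuous_at_imp_continuous_at_within by (auto simp: continuous_at)
    next
      case False
      have c: "continuous (at u) (\<lambda>u. (D u - D u0) / (z u - z u0))"
        using z_ne[OF u False] has_vector_derivative_continuous[OF D] has_vector_derivative_continuous[OF zD]
        by (intro continuous_intros) auto
      have "\<forall>\<^sub>F v in nhds u. (D v - D u0) / (z v - z u0) = g v"
        using t1_space_nhds[OF False] by eventually_elim (simp add: g_def)
      from isCont_cong[OF this] c have "continuous (at u) g"
        by simp
      then show ?thesis
        by (rule continuous_at_imp_continuous_at_within)
    qed
  qed
  define d where "d n = integral ?I (\<lambda>u. g u * cis (- (freq h n * u)))" for n
  have dI: "((\<lambda>u. g u * cis (- (freq h n * u))) has_integral d n) ?I" for n
    unfolding d_def
    by (intro integrable_integral integrable_continuous_interval continuous_intros cg)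
  \<comment> \<open>Multiplication by z lowers the index of a coefficient by one. As all
    coefficients of D vanish, the product of g and \<open>z - z u0\<close> contributes only the
    constant \<open>- D u0\<close>, visible at n = 0.\<close>
  have rec: "d (n - 1) - z u0 * d n = (if n = 0 then - of_nat h * D u0 else 0)" for n
  proof -
    have eq: "D u * cis (- (freq h n * u)) - D u0 * (cis (freq h 0 * u) * cis (- (freq h n * u))) =
        g u * cis (- (freq h (n - 1) * u)) - z u0 * (g u * cis (- (freq h n * u)))" if "u \<in> ?I" for u
    proof -
      let ?e = "cis (- (freq h n * u))"
      have D: "D u - D u0 = g u * (z u - z u0)"
        using z_ne[OF that] by (auto simp: g_def)
      have "freq h 1 * u + - (freq h n * u) = - (freq h (n - 1) * u)"
        by (simp add: freq_def algebra_simps diff_divide_distrib)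
      then have e: "z u * ?e = cis (- (freq h (n - 1) * u))"
        by (simp only: z_def cis_mult)
      have "cis (freq h 0 * u) = 1"
        by (simp add: freq_def)
      then have "D u * ?e - D u0 * (cis (freq h 0 * u) * ?e) = (D u - D u0) * ?e"
        by (simp add: algebra_simps)
      also have "\<dots> = g u * (z u * ?e) - z u0 * (g u * ?e)"
        unfolding D by (simp add: algebra_simps)
      finally show ?thesis
        by (simp only: e)
    qed
    have "(\<lambda>u. D u * cis (- (freq h n * u))) integrable_on ?I"
      by (intro integrable_continuous_interval continuous_intros cD)
    from integrable_integral[OF this] have D0: "((\<lambda>u. D u * cis (- (freq h n * u))) has_integral 0) ?I"
      by (simp only: coeff)
    have h1: "((\<lambda>u. D u * cis (- (freq h n * u)) - D u0 * (cis (freq h 0 * u) * cis (- (freq h n * u)))) has_integral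
        0 - D u0 * (if 0 = n then of_nat h else 0)) ?I"
      by (intro has_integral_diff has_integral_mult_right fourier_orthogonality h D0)
    have h2: "((\<lambda>u. g u * cis (- (freq h (n - 1) * u)) - z u0 * (g u * cis (- (freq h n * u)))) has_integral
        d (n - 1) - z u0 * d n) ?I"
      by (intro has_integral_diff has_integral_mult_right dI)
    have "0 - D u0 * (if 0 = n then of_nat h else 0) = d (n - 1) - z u0 * d n"
      by (rule has_integral_unique[OF has_integral_eq[OF eq h1] h2])
    then show ?thesis
      by (auto simp: mult.commute split: if_splits)
  qed
  have nz1: "norm (z u0) = 1"
    by (simp add: z_def)
  have pos: "norm (d (int n)) = norm (d 0)" for n
  proof (induction n)
    case (Suc n)
    have "d (int n) = z u0 * d (int (Suc n))"
      using rec[of "int (Suc n)"] by simp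
    then show ?case
      using Suc nz1 by (simp add: norm_mult)
  qed simp
  have neg: "norm (d (- 1 - int n)) = norm (d (- 1))" for n
  proof (induction n)
    case (Suc n)
    have "d (- 1 - int (Suc n)) = z u0 * d (- 1 - int n)"
      using rec[of "- 1 - int n"] by (simp add: algebra_simps)
    then show ?case
      using Suc nz1 by (simp add: norm_mult)
  qed simp
  \<comment> \<open>The recurrence preserves the modulus on the indices from 0 upwards and from -1
    downwards. A constant nonzero modulus along infinitely many indices would violate Bessel's
    inequality.\<close>
  have zero: "d (f 0) = 0" if f: "inj f" "\<And>n. norm (d (f n)) = norm (d (f 0))" for f :: "nat \<Rightarrow> int"
  proof (rule ccontr)
    assume ne: "d (f 0) \<noteq> 0"
    define B where "B = real h * integral ?I (\<lambda>u. (norm (g u))\<^sup>2)"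
    have "real M * (norm (d (f 0)))\<^sup>2 \<le> B" for M
    proof -
      have "(\<Sum>n<M. (norm (d (f n)))\<^sup>2) = (\<Sum>n<M. (norm (d (f 0)))\<^sup>2)"
        by (rule sum.cong[OF refl], rule arg_cong[where f = "\<lambda>x. x\<^sup>2"], rule f(2))
      then have "real M * (norm (d (f 0)))\<^sup>2 = (\<Sum>n<M. (norm (d (f n)))\<^sup>2)"
        by simp
      also have "\<dots> = (\<Sum>n\<in>f ` {..<M}. (norm (d n))\<^sup>2)"
        using f(1) by (subst sum.reindex) (auto intro: inj_on_subset)
      also have "\<dots> \<le> B"
        unfolding B_def d_def by (intro bessel_inequality h cg) auto
      finally show ?thesis .
    qed
    moreover obtain M where "real M * (norm (d (f 0)))\<^sup>2 > B"
      using reals_Archimedean3[of "(norm (d (f 0)))\<^sup>2"] ne by auto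
    ultimately show False
      by (meson not_le)
  qed
  have "d 0 = 0"
    using zero[of int] pos by (simp add: inj_of_nat)
  moreover have "d (- 1) = 0"
    using zero[of "\<lambda>n. - 1 - int n"] neg by (simp add: inj_on_def)
  ultimately show ?thesis
    using rec[of 0] h by simp
qed

section \<open>Separation of variables for a periodic eigenfunction\<close>

definition fourier_coeff :: "nat \<Rightarrow> (complex \<Rightarrow> complex) \<Rightarrow> int \<Rightarrow> real \<Rightarrow> complex" where
  "fourier_coeff h F n v = integral {0..real h} (\<lambda>u. F (Complex u v) * cis (- (freq h n * u)))"

lemma continuous_on_horizontal:
  assumes "continuous_on upper_half_plane F" "v > 0"
  shows "continuous_on S (\<lambda>u. F (Complex u v))"
  by (rule continuous_on_compose2[OF assms(1)])
     (use assms(2) in \<open>auto simp: Complex_eq upper_half_plane_def intro!: continuous_intros\<close>)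

lemma fourier_coeff_has_integral:
  assumes "continuous_on upper_half_plane F" "v > 0"
  shows "((\<lambda>u. F (Complex u v) * cis (- (freq h n * u))) has_integral fourier_coeff h F n v) {0..real h}"
  unfolding fourier_coeff_def
  by (intro integrable_integral integrable_continuous_interval continuous_intros continuous_on_horizontal assms)

lemma fourier_coeff_deriv:
  assumes F: "uhp_partials F Fu Fv" and Fv: "continuous_on upper_half_plane Fv" and v: "v > 0"
  shows "(fourier_coeff h F n has_vector_derivative fourier_coeff h Fv n v) (at v)"
proof -
  have cC: "continuous_on ({0<..} \<times> cbox 0 (real h)) (\<lambda>p. Fv (Complex (snd p) (fst p)))"
    by (rule continuous_on_compose2[OF Fv])
       (auto simp: Complex_eq upper_half_plane_def intro!: continuous_intros)
  have "((\<lambda>v. integral (cbox 0 (real h)) (\<lambda>u. F (Complex u v) * cis (- (freq h n * u)))) has_vector_derivative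
      integral (cbox 0 (real h)) (\<lambda>u. Fv (Complex u v) * cis (- (freq h n * u)))) (at v within {0<..})"
  proof (rule leibniz_rule_vector_derivative)
    fix v u :: real assume "v \<in> {0<..}"
    then show "((\<lambda>v. F (Complex u v) * cis (- (freq h n * u))) has_vector_derivative Fv (Complex u v) * cis (- (freq h n * u))) (at v within {0<..})"
      by (intro has_vector_derivative_mult_left uhp_partials_vector_derivative(2)[OF F]) simp
  next
    fix v :: real assume "v \<in> {0<..}"
    then show "(\<lambda>u. F (Complex u v) * cis (- (freq h n * u))) integrable_on cbox 0 (real h)"
      using fourier_coeff_has_integral[OF uhp_partials_continuous_on[OF F], of v h n] by auto
  next
    show "continuous_on ({0<..} \<times> cbox 0 (real h)) (\<lambda>(v, u). Fv (Complex u v) * cis (- (freq h n * u)))"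
      unfolding case_prod_beta by (intro continuous_intros cC)
  qed (use v in auto)
  then show ?thesis
    using v at_within_open[of v "{0<..}"] by (simp add: fourier_coeff_def[abs_def])
qed

text \<open>Two integrations by parts in one step: \<open>?P\<close> is an antiderivative of the sum
  of both integrands, and its boundary values agree because F and \<open>Fu\<close> have period
  h.\<close>

lemma fourier_coeff_second_u:
  assumes h: "h > 0" and F: "uhp_partials F Fu Fv" and Fu: "uhp_partials Fu Fuu Fuv"
    and Fuu: "continuous_on upper_half_plane Fuu"
    and per: "\<And>\<tau>. Im \<tau> > 0 \<Longrightarrow> F (\<tau> + of_nat h) = F \<tau>" and v: "v > 0"
  shows "fourier_coeff h Fuu n v = - of_real ((freq h n)\<^sup>2) * fourier_coeff h F n v"
proof -
  have Fc: "uhp_partials (\<lambda>\<tau>. F (\<tau> + of_nat h))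
      (\<lambda>\<tau>. of_real (Re 1) * Fu (\<tau> + of_nat h) + of_real (Im 1) * Fv (\<tau> + of_nat h))
      (\<lambda>\<tau>. of_real (Re 1) * Fv (\<tau> + of_nat h) - of_real (Im 1) * Fu (\<tau> + of_nat h))"
    by (rule uhp_partials_compose[OF F]) (auto intro!: derivative_eq_intros)
  have perU: "Fu (\<tau> + of_nat h) = Fu \<tau>" if "Im \<tau> > 0" for \<tau>
    using uhp_partials_unique(1)[OF Fc F per that] by simp
  have at_h: "Complex (real h) v = Complex 0 v + of_nat h"
    by (simp add: complex_eq_iff)
  let ?e = "\<lambda>u. cis (- (freq h n) * u)"
  let ?P = "\<lambda>u. Fu (Complex u v) * ?e u + \<i> * of_real (freq h n) * (F (Complex u v) * ?e u)"
  have "((\<lambda>u. Fuu (Complex u v) * ?e u + of_real ((freq h n)\<^sup>2) * (F (Complex u v) * ?e u)) has_integral ?P (real h) - ?P 0) {0..real h}"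
  proof (rule fundamental_theorem_of_calculus)
    fix u :: real
    have "(?P has_vector_derivative
        (Fu (Complex u v) * (\<i> * of_real (- freq h n) * ?e u) + Fuu (Complex u v) * ?e u) +
        \<i> * of_real (freq h n) * (F (Complex u v) * (\<i> * of_real (- freq h n) * ?e u) + Fu (Complex u v) * ?e u)) (at u within {0..real h})"
      by (intro has_vector_derivative_add has_vector_derivative_mult has_vector_derivative_mult_right
          has_vector_derivative_cis uhp_partials_vector_derivative(1)[OF F v] uhp_partials_vector_derivative(1)[OF Fu v])
    moreover have "A * (\<i> * - w * e) + B * e + \<i> * w * (C * (\<i> * - w * e) + A * e) = B * e + w\<^sup>2 * (C * e)" for A B C w e :: complex
      by (simp add: algebra_simps power2_eq_square)
    ultimately show "(?P has_vector_derivative Fuu (Complex u v) * ?e u + of_real ((freq h n)\<^sup>2) * (F (Complex u v) * ?e u)) (at u within {0..real h})"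
      by (simp only: of_real_minus of_real_power)
  qed simp
  moreover have "?P (real h) = ?P 0"
  proof -
    have "?e (real h) = 1"
      using cis_freq_period[OF h, of "- n"] by (simp add: freq_def)
    then show ?thesis
      using perU[of "Complex 0 v"] per[of "Complex 0 v"] v by (simp add: at_h)
  qed
  ultimately have "((\<lambda>u. Fuu (Complex u v) * ?e u + of_real ((freq h n)\<^sup>2) * (F (Complex u v) * ?e u)) has_integral 0) {0..real h}"
    by simp
  moreover have "((\<lambda>u. Fuu (Complex u v) * ?e u + of_real ((freq h n)\<^sup>2) * (F (Complex u v) * ?e u)) has_integral
      fourier_coeff h Fuu n v + of_real ((freq h n)\<^sup>2) * fourier_coeff h F n v) {0..real h}"
    using fourier_coeff_has_integral[OF Fuu v, of h n] fourier_coeff_has_integral[OF uhp_partials_continuous_on[OF F] v, of h n]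
    by (intro has_integral_add has_integral_mult_right) simp_all
  ultimately have "fourier_coeff h Fuu n v + of_real ((freq h n)\<^sup>2) * fourier_coeff h F n v = 0"
    using has_integral_unique by blast
  then show ?thesis
    by (simp add: add_eq_0_iff)
qed

text \<open>An Euler equation with the double exponent 1/2, which is the source of the logarithm.
  Reduction of order: \<open>?w\<close> is v times the derivative of c / v^(1/2) and is constant,
  say k2; then c / v^(1/2) minus k2 times log v is constant as well.\<close>

lemma ode_zero_frequency:
  assumes c: "\<And>v. v > 0 \<Longrightarrow> (c has_vector_derivative c1 v) (at v)"
    and c1: "\<And>v. v > 0 \<Longrightarrow> (c1 has_vector_derivative - c v / of_real (4 * v\<^sup>2)) (at v)"
  shows "\<exists>k1 k2 :: complex. \<forall>v>0. c v = k1 * of_real (sqrt v) + k2 * of_real (sqrt v * ln v)"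
proof -
  have s: "((\<lambda>v. complex_of_real (sqrt v)) has_vector_derivative of_real (1 / (2 * sqrt v))) (at v)" if "v > 0" for v
    using that by (intro has_vector_derivative_of_real) (auto intro!: derivative_eq_intros simp: field_simps)
  have si: "((\<lambda>v. complex_of_real (1 / sqrt v)) has_vector_derivative of_real (- 1 / (2 * v * sqrt v))) (at v)" if "v > 0" for v
    using that by (intro has_vector_derivative_of_real) (auto intro!: derivative_eq_intros simp: field_simps power2_eq_square)
  let ?w = "\<lambda>v. of_real (sqrt v) * c1 v - (of_real (1 / sqrt v) * c v) / 2"
  have "\<exists>k2. \<forall>v\<in>{0<..}. ?w v = k2"
  proof (rule has_vector_derivative_zero_constant[of "{0<..}" ?w])
    fix v :: real assume "v \<in> {0<..}"
    then have v: "v > 0" by simp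
    have "(?w has_vector_derivative
        (of_real (sqrt v) * (- c v / of_real (4 * v\<^sup>2)) + of_real (1 / (2 * sqrt v)) * c1 v) -
        (of_real (1 / sqrt v) * c1 v + of_real (- 1 / (2 * v * sqrt v)) * c v) / 2) (at v)"
      by (intro has_vector_derivative_diff has_vector_derivative_mult has_vector_derivative_divide s[OF v] si[OF v] c[OF v] c1[OF v])
    moreover have "(of_real (sqrt v) * (- c v / of_real (4 * v\<^sup>2)) + of_real (1 / (2 * sqrt v)) * c1 v) -
        (of_real (1 / sqrt v) * c1 v + of_real (- 1 / (2 * v * sqrt v)) * c v) / 2 = 0"
    proof -
      define S where "S = complex_of_real (sqrt v)"
      have S: "S \<noteq> 0" "complex_of_real v = S * S"
        using v by (simp_all add: S_def flip: of_real_mult)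
      have "S * (- x / (4 * (S * S)\<^sup>2)) + 1 / (2 * S) * y - (1 / S * y + - 1 / (2 * (S * S) * S) * x) / 2 = 0" for x y
        using S(1) by (simp add: field_simps power2_eq_square)
      from this[of "c v" "c1 v"] show ?thesis
        by (simp only: of_real_mult of_real_divide of_real_minus of_real_power of_real_1 of_real_numeral
            S_def[symmetric] S(2))
    qed
    ultimately show "(?w has_vector_derivative 0) (at v within {0<..})"
      by (simp only: has_vector_derivative_at_within)
  qed auto
  then obtain k2 where k2: "\<And>v. v > 0 \<Longrightarrow> ?w v = k2"
    by auto
  let ?r = "\<lambda>v. of_real (1 / sqrt v) * c v - k2 * of_real (ln v)"
  have "\<exists>k1. \<forall>v\<in>{0<..}. ?r v = k1"
  proof (rule has_vector_derivative_zero_constant[of "{0<..}" ?r])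
    fix v :: real assume "v \<in> {0<..}"
    then have v: "v > 0" by simp
    have "(?r has_vector_derivative
        (of_real (1 / sqrt v) * c1 v + of_real (- 1 / (2 * v * sqrt v)) * c v) - k2 * of_real (1 / v)) (at v)"
      using v by (intro has_vector_derivative_diff has_vector_derivative_mult has_vector_derivative_mult_right
          has_vector_derivative_of_real si c) (auto intro!: derivative_eq_intros)
    moreover have "(of_real (1 / sqrt v) * c1 v + of_real (- 1 / (2 * v * sqrt v)) * c v) - k2 * of_real (1 / v) =
        of_real (1 / sqrt v - sqrt v / v) * c1 v"
      unfolding k2[OF v, symmetric] by (simp add: algebra_simps)
    moreover have "1 / sqrt v - sqrt v / v = 0"
      using v by (simp add: field_simps)
    ultimately show "(?r has_vector_derivative 0) (at v within {0<..})"
      by (simp only: has_vector_derivative_at_within of_real_0 mult_zero_left)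
  qed auto
  then obtain k1 where k1: "\<And>v. v > 0 \<Longrightarrow> ?r v = k1"
    by auto
  have "c v = k1 * of_real (sqrt v) + k2 * of_real (sqrt v * ln v)" if v: "v > 0" for v
  proof -
    have "of_real (sqrt v) * (of_real (1 / sqrt v) * c v) = of_real (sqrt v) * (k1 + k2 * of_real (ln v))"
      using k1[OF v] by (simp add: algebra_simps)
    moreover have "of_real (sqrt v) * (of_real (1 / sqrt v) * c v) = c v"
      using v by simp
    ultimately show ?thesis
      by (simp add: algebra_simps)
  qed
  then show ?thesis by blast
qed

text \<open>The factor v^(1/2) removes the first-order term from Bessel's equation and leaves the
  equation of the Fourier coefficients of frequency k.\<close>

lemma sqrt_cosh_moment_deriv:
  assumes k: "k > 0" and v: "v > 0"
  defines "B \<equiv> \<lambda>v. sqrt v * cosh_moment 0 (k * v)"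
    and "B1 \<equiv> \<lambda>v. cosh_moment 0 (k * v) / (2 * sqrt v) - k * sqrt v * cosh_moment 1 (k * v)"
  shows "(B has_real_derivative B1 v) (at v)"
    and "(B1 has_real_derivative (k\<^sup>2 - 1 / (4 * v\<^sup>2)) * B v) (at v)"
proof -
  have K: "((\<lambda>v. cosh_moment m (k * v)) has_real_derivative - cosh_moment (Suc m) (k * v) * k) (at v)" for m
  proof -
    have g: "((\<lambda>v. k * v) has_real_derivative k) (at v)"
      by (auto intro!: derivative_eq_intros)
    have "k * v > 0"
      using k v by simp
    from DERIV_chain2[where f = "cosh_moment m", OF cosh_moment_has_derivative[OF this] g]
    show ?thesis .
  qed
  have s: "(sqrt has_real_derivative 1 / (2 * sqrt v)) (at v)"
    using v by (auto intro!: derivative_eq_intros simp: field_simps)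
  have "(B has_real_derivative 1 / (2 * sqrt v) * cosh_moment 0 (k * v) + - cosh_moment (Suc 0) (k * v) * k * sqrt v) (at v)"
    unfolding B_def by (rule DERIV_mult[OF s K])
  then show "(B has_real_derivative B1 v) (at v)"
    by (simp add: B1_def mult_ac)
  have "((\<lambda>v. 2 * sqrt v) has_real_derivative 2 * (1 / (2 * sqrt v))) (at v)"
    by (rule DERIV_cmult[OF s])
  then have "((\<lambda>v. cosh_moment 0 (k * v) / (2 * sqrt v)) has_real_derivative
      (- cosh_moment (Suc 0) (k * v) * k * (2 * sqrt v) - cosh_moment 0 (k * v) * (2 * (1 / (2 * sqrt v)))) / (2 * sqrt v * (2 * sqrt v))) (at v)"
    using v by (intro DERIV_divide K) auto
  moreover have "((\<lambda>v. k * sqrt v * cosh_moment 1 (k * v)) has_real_derivative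
      k * (1 / (2 * sqrt v)) * cosh_moment 1 (k * v) + - cosh_moment (Suc 1) (k * v) * k * (k * sqrt v)) (at v)"
    by (intro DERIV_mult DERIV_cmult[OF s] K)
  ultimately have "(B1 has_real_derivative
      (- cosh_moment (Suc 0) (k * v) * k * (2 * sqrt v) - cosh_moment 0 (k * v) * (2 * (1 / (2 * sqrt v)))) / (2 * sqrt v * (2 * sqrt v)) -
      (k * (1 / (2 * sqrt v)) * cosh_moment 1 (k * v) + - cosh_moment (Suc 1) (k * v) * k * (k * sqrt v))) (at v)"
    unfolding B1_def by (rule DERIV_diff)
  moreover have "(- K1 * k * (2 * s) - K0 * (2 * (1 / (2 * s)))) / (2 * s * (2 * s)) -
      (k * (1 / (2 * s)) * K1 + - (K0 + K1 / (k * (s * s))) * k * (k * s)) = (k\<^sup>2 - 1 / (4 * (s * s)\<^sup>2)) * (s * K0)"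
    if "s > 0" for s K0 K1 :: real
    using that k by (simp add: field_simps power2_eq_square)
  from this[of "sqrt v" "cosh_moment 1 (k * v)" "cosh_moment 0 (k * v)"] have
    "(- cosh_moment 1 (k * v) * k * (2 * sqrt v) - cosh_moment 0 (k * v) * (2 * (1 / (2 * sqrt v)))) / (2 * sqrt v * (2 * sqrt v)) -
      (k * (1 / (2 * sqrt v)) * cosh_moment 1 (k * v) + - (cosh_moment 0 (k * v) + cosh_moment 1 (k * v) / (k * v)) * k * (k * sqrt v)) =
      (k\<^sup>2 - 1 / (4 * v\<^sup>2)) * B v"
    using v by (simp add: B_def)
  moreover have "cosh_moment (Suc 1) (k * v) = cosh_moment 0 (k * v) + cosh_moment 1 (k * v) / (k * v)"
    using cosh_moment_recurrence[of "k * v"] k v by (simp add: numeral_2_eq_2)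
  ultimately show "(B1 has_real_derivative (k\<^sup>2 - 1 / (4 * v\<^sup>2)) * B v) (at v)"
    by (simp only: One_nat_def)
qed

text \<open>If the Wronskian with \<open>v\<^bsup>1/2\<^esup> K\<^sub>0 (k v)\<close> did not vanish, the solution would grow like
  \<open>exp (k v)\<close>.\<close>

lemma ode_nonzero_frequency:
  assumes k: "k > 0"
    and c: "\<And>v. v > 0 \<Longrightarrow> (c has_vector_derivative c1 v) (at v)"
    and c1: "\<And>v. v > 0 \<Longrightarrow> (c1 has_vector_derivative of_real (k\<^sup>2 - 1 / (4 * v\<^sup>2)) * c v) (at v)"
    and growth: "\<And>v. v \<ge> v0 \<Longrightarrow> norm (c v) \<le> C * v ^ K"
  shows "\<exists>A :: complex. \<forall>v>0. c v = A * of_real (sqrt v * cosh_moment 0 (k * v))"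
proof -
  define B where "B v = sqrt v * cosh_moment 0 (k * v)" for v
  define B1 where "B1 v = cosh_moment 0 (k * v) / (2 * sqrt v) - k * sqrt v * cosh_moment 1 (k * v)" for v
  have B: "(B has_real_derivative B1 v) (at v)" "(B1 has_real_derivative (k\<^sup>2 - 1 / (4 * v\<^sup>2)) * B v) (at v)" if "v > 0" for v
    using sqrt_cosh_moment_deriv[OF k that] by (simp_all add: B_def[abs_def] B1_def[abs_def])
  have Bpos: "B v > 0" if "v > 0" for v
    using that k by (simp add: B_def cosh_moment_pos)
  note Bc = has_vector_derivative_of_real[OF B(1)] and B1c = has_vector_derivative_of_real[OF B(2)]
  let ?w = "\<lambda>v. of_real (B v) * c1 v - of_real (B1 v) * c v"
  have "\<exists>w. \<forall>v\<in>{0<..}. ?w v = w"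
  proof (rule has_vector_derivative_zero_constant[of "{0<..}" ?w])
    fix v :: real assume "v \<in> {0<..}"
    then have v: "v > 0" by simp
    have "(?w has_vector_derivative
        (of_real (B v) * (of_real (k\<^sup>2 - 1 / (4 * v\<^sup>2)) * c v) + of_real (B1 v) * c1 v) -
        (of_real (B1 v) * c1 v + of_real ((k\<^sup>2 - 1 / (4 * v\<^sup>2)) * B v) * c v)) (at v)"
      by (intro has_vector_derivative_diff has_vector_derivative_mult Bc[OF v] B1c[OF v] c[OF v] c1[OF v])
    then show "(?w has_vector_derivative 0) (at v within {0<..})"
      by (simp add: has_vector_derivative_at_within algebra_simps)
  qed auto
  then obtain w where w: "\<And>v. v > 0 \<Longrightarrow> ?w v = w"
    by auto
  have r: "((\<lambda>v. of_real (1 / B v) * c v) has_vector_derivative of_real (1 / (B v)\<^sup>2) * w) (at v)" if v: "v > 0" for v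
  proof -
    have "((\<lambda>v. 1 / B v) has_real_derivative - B1 v / (B v)\<^sup>2) (at v)"
      using DERIV_inverse'[OF B(1)[OF v]] Bpos[OF v] by (simp add: divide_inverse power2_eq_square mult_ac)
    from has_vector_derivative_mult[OF has_vector_derivative_of_real[OF this] c[OF v]]
    have "((\<lambda>v. of_real (1 / B v) * c v) has_vector_derivative of_real (1 / B v) * c1 v + of_real (- B1 v / (B v)\<^sup>2) * c v) (at v)" .
    moreover have "of_real (1 / B v) * c1 v + of_real (- B1 v / (B v)\<^sup>2) * c v = of_real (1 / (B v)\<^sup>2) * ?w v"
    proof -
      have "of_real (1 / B v) = of_real (1 / (B v)\<^sup>2) * (of_real (B v) :: complex)"
        using Bpos[OF v] by (simp add: power2_eq_square)
      then show ?thesis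
        by (simp add: algebra_simps)
    qed
    ultimately show ?thesis
      by (simp only: w[OF v])
  qed
  have "w = 0"
  proof (rule ccontr)
    assume w0: "w \<noteq> 0"
    \<comment> \<open>The lower bound for K0 loses the factor \<open>cosh d\<close> in the exponent,
      and 5/4 is a convenient value below 2. Of the difference 2 - 5/4 = 1/4 + 1/2, a quarter of k
      absorbs the powers of v and half of k is left for the contradiction.\<close>
    define d where "d = arcosh (5 / 4 :: real)"
    have d: "cosh d = 5 / 4" "d > 0"
    proof -
      show "cosh d = 5 / 4"
        by (simp add: d_def)
      have "d \<ge> 0"
        by (simp add: d_def)
      moreover have "d \<noteq> 0"
        using \<open>cosh d = 5 / 4\<close> by auto
      ultimately show "d > 0" by simp
    qed
    define M where "M = exp k * cosh_moment 0 k"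
    have M: "M > 0"
      using k by (simp add: M_def cosh_moment_pos)
    \<comment> \<open>The derivative of c / B is w / B^2. Dividing by w and taking real parts yields
      a real function with derivative 1 / B^2, to which the mean value theorem applies.\<close>
    define g where "g v = Re (of_real (1 / B v) * c v / w)" for v
    have g: "(g has_real_derivative 1 / (B v)\<^sup>2) (at v)" if "v > 0" for v
    proof -
      have "((\<lambda>v. Re (of_real (1 / B v) * c v / w)) has_vector_derivative Re (of_real (1 / (B v)\<^sup>2) * w / w)) (at v)"
        by (rule bounded_linear.has_vector_derivative[OF bounded_linear_Re has_vector_derivative_divide[OF r[OF that]]])
      then show ?thesis
        using w0 by (simp add: g_def[abs_def] has_real_derivative_iff_has_vector_derivative)
    qed
    define C' where "C' = \<bar>C\<bar> / (norm w * d)"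
    have C': "C' \<ge> 0"
      using d by (simp add: C'_def)
    have gb: "\<bar>g v\<bar> \<le> C' * v ^ K * exp (5 / 4 * k * v)" if v: "v \<ge> v0" "v \<ge> 1" for v
    proof -
      have lower: "d * exp (- (k * v) * (5 / 4)) \<le> B v"
      proof -
        have "d * exp (- (k * v) * cosh d) \<le> cosh_moment 0 (k * v)"
          using v k d by (intro cosh_moment_lower) auto
        also have "\<dots> \<le> sqrt v * cosh_moment 0 (k * v)"
          using v mult_right_mono[of 1 "sqrt v" "cosh_moment 0 (k * v)"] by (simp add: cosh_moment_nonneg)
        finally show ?thesis
          by (simp add: B_def d)
      qed
      have "\<bar>g v\<bar> \<le> norm (of_real (1 / B v) * c v / w)"
        unfolding g_def by (rule abs_Re_le_cmod)
      also have "\<dots> = norm (c v) / (norm w * B v)"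
        using Bpos[of v] v by (simp add: norm_mult norm_divide)
      also have "\<dots> \<le> (\<bar>C\<bar> * v ^ K) / (norm w * (d * exp (- (k * v) * (5 / 4))))"
      proof (rule frac_le)
        show "norm (c v) \<le> \<bar>C\<bar> * v ^ K"
          using growth[OF v(1)] v by (meson abs_ge_self mult_right_mono order_trans zero_le_one zero_le_power)
        show "norm w * (d * exp (- (k * v) * (5 / 4))) \<le> norm w * B v"
          by (intro mult_left_mono lower) simp
      qed (use w0 d v in auto)
      also have "\<dots> = C' * v ^ K * exp (5 / 4 * k * v)"
        by (simp add: C'_def exp_minus field_simps)
      finally show ?thesis .
    qed
    \<comment> \<open>Between v - 1 and v the function B is of size at most
      \<open>exp (- k * (v - 1))\<close> up to the factor \<open>sqrt v\<close>, so g increases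
      there by at least the left-hand side; the polynomial growth of c limits this increase.\<close>
    have key: "exp (2 * k * (v - 1)) / (v * M\<^sup>2) \<le> 2 * (C' * v ^ K * exp (5 / 4 * k * v))"
      if v: "v \<ge> v0 + 1" "v \<ge> 2" for v
    proof -
      obtain x where x: "v - 1 < x" "x < v" and gx: "g v - g (v - 1) = (v - (v - 1)) * (1 / (B x)\<^sup>2)"
        using MVT2[of "v - 1" v g "\<lambda>v. 1 / (B v)\<^sup>2"] g v by force
      have x1: "x \<ge> 1"
        using x v by simp
      have "B x \<le> sqrt v * (M * exp (- (k * (v - 1))))"
      proof -
        have "cosh_moment 0 (k * x) \<le> exp (k * 1 - k * x) * cosh_moment 0 (k * 1)"
          using k x1 by (intro cosh_moment_decay) auto
        also have "\<dots> \<le> exp (k - k * (v - 1)) * cosh_moment 0 k"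
          using k x by (intro mult_mono) (auto simp: cosh_moment_nonneg)
        also have "\<dots> = M * exp (- (k * (v - 1)))"
          by (simp add: M_def exp_diff exp_minus divide_inverse)
        finally show ?thesis
          unfolding B_def using x x1 by (intro mult_mono) (auto simp: cosh_moment_nonneg)
      qed
      then have "(B x)\<^sup>2 \<le> (sqrt v * (M * exp (- (k * (v - 1)))))\<^sup>2"
        using Bpos[of x] x1 by (intro power_mono) auto
      also have "\<dots> = v * M\<^sup>2 * exp (- (2 * k * (v - 1)))"
        using v by (simp add: power_mult_distrib exp_double[symmetric] mult_ac)
      finally have "1 / (v * M\<^sup>2 * exp (- (2 * k * (v - 1)))) \<le> 1 / (B x)\<^sup>2"
        using Bpos[of x] x1 M v by (intro divide_left_mono mult_pos_pos) auto
      also have "\<dots> = g v - g (v - 1)"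
        using gx by simp
      also have "\<dots> \<le> \<bar>g v\<bar> + \<bar>g (v - 1)\<bar>"
        by simp
      also have "\<dots> \<le> C' * v ^ K * exp (5 / 4 * k * v) + C' * (v - 1) ^ K * exp (5 / 4 * k * (v - 1))"
        using v by (intro add_mono gb) auto
      also have "\<dots> \<le> C' * v ^ K * exp (5 / 4 * k * v) + C' * v ^ K * exp (5 / 4 * k * v)"
        using v k C' by (intro add_left_mono mult_mono power_mono) auto
      also have "1 / (v * M\<^sup>2 * exp (- (2 * k * (v - 1)))) = exp (2 * k * (v - 1)) / (v * M\<^sup>2)"
        by (simp add: exp_minus divide_inverse)
      finally show ?thesis
        by simp
    qed
    define D where "D = 2 * C' * M\<^sup>2 * exp (2 * k) * (fact (Suc K) / (k / 4) ^ Suc K)"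
    have "exp (k / 2 * v) \<le> D" if v: "v \<ge> v0 + 1" "v \<ge> 2" for v
    proof -
      have "(k / 4 * v) ^ Suc K \<le> fact (Suc K) * exp (k / 4 * v)"
        using k v by (intro power_le_fact_exp) auto
      then have pw: "v ^ Suc K \<le> fact (Suc K) / (k / 4) ^ Suc K * exp (k / 4 * v)"
        using k unfolding power_mult_distrib by (simp add: field_simps del: power_Suc fact_Suc)
      have "exp (2 * k * (v - 1)) \<le> 2 * (C' * v ^ K * exp (5 / 4 * k * v)) * (v * M\<^sup>2)"
        using key[OF v] v M by (simp add: pos_divide_le_eq)
      also have "\<dots> = 2 * C' * M\<^sup>2 * (v ^ Suc K) * exp (5 / 4 * k * v)"
        by (simp add: mult_ac)
      also have "\<dots> \<le> 2 * C' * M\<^sup>2 * (fact (Suc K) / (k / 4) ^ Suc K * exp (k / 4 * v)) * exp (5 / 4 * k * v)"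
        using C' by (intro mult_right_mono mult_left_mono pw) auto
      also have "\<dots> = 2 * C' * M\<^sup>2 * (fact (Suc K) / (k / 4) ^ Suc K) * (exp (k / 4 * v) * exp (5 / 4 * k * v))"
        by (simp only: mult_ac)
      also have "exp (k / 4 * v) * exp (5 / 4 * k * v) = exp (3 / 2 * k * v)"
        by (simp flip: exp_add)
      finally have "exp (2 * k * (v - 1)) * (exp (2 * k) * exp (- (3 / 2 * k * v))) \<le>
          2 * C' * M\<^sup>2 * (fact (Suc K) / (k / 4) ^ Suc K) * exp (3 / 2 * k * v) * (exp (2 * k) * exp (- (3 / 2 * k * v)))"
        by (rule mult_right_mono) simp
      also have "\<dots> = D * (exp (3 / 2 * k * v) * exp (- (3 / 2 * k * v)))"
        by (simp only: D_def mult_ac)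
      also have "\<dots> = D"
        by (simp flip: exp_add)
      also have "exp (2 * k * (v - 1)) * (exp (2 * k) * exp (- (3 / 2 * k * v))) = exp (k / 2 * v)"
        by (simp add: algebra_simps flip: exp_add)
      finally show ?thesis .
    qed
    moreover have "filterlim (\<lambda>v. exp (k / 2 * v)) at_top at_top"
      using k by real_asymp
    then have "\<forall>\<^sub>F v in at_top. exp (k / 2 * v) > D"
      by (simp add: filterlim_at_top_dense)
    then have "\<forall>\<^sub>F v in at_top. v \<ge> v0 + 1 \<and> v \<ge> 2 \<and> exp (k / 2 * v) > D"
      using eventually_ge_at_top[of "v0 + 1"] eventually_ge_at_top[of 2] by eventually_elim auto
    then obtain v where "v \<ge> v0 + 1" "v \<ge> 2" "exp (k / 2 * v) > D"
      using eventually_happens'[OF trivial_limit_at_top_linorder] by blast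
    ultimately show False
      by (meson not_le)
  qed
  then have "((\<lambda>v. of_real (1 / B v) * c v) has_vector_derivative 0) (at v within {0<..})" if "v \<in> {0<..}" for v
    using r[of v] that by (simp add: has_vector_derivative_at_within)
  then obtain A where A: "\<And>v. v > 0 \<Longrightarrow> of_real (1 / B v) * c v = A"
    using has_vector_derivative_zero_constant[of "{0<..}" "\<lambda>v. of_real (1 / B v) * c v"] by auto
  have "c v = A * of_real (B v)" if "v > 0" for v
    using A[OF that] Bpos[OF that] by (auto simp: field_simps)
  then show ?thesis
    by (auto simp: B_def)
qed

lemma norm_fourier_coeff_le:
  assumes F: "continuous_on upper_half_plane F" and v: "v > 0"
    and M: "\<And>u. u \<in> {0..real h} \<Longrightarrow> norm (F (Complex u v)) \<le> M"
  shows "norm (fourier_coeff h F n v) \<le> real h * M"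
proof -
  have "norm (fourier_coeff h F n v) \<le> integral {0..real h} (\<lambda>u. M)"
    unfolding fourier_coeff_def
    by (rule integral_norm_bound_integral)
       (use fourier_coeff_has_integral[OF F v, of h n] M in \<open>auto simp: norm_mult\<close>)
  then show ?thesis by simp
qed

lemma bessel_series_fourier:
  assumes h: "h > 0" and a: "subexponential a" and v: "v > 0"
  shows "((\<lambda>u. bessel_series h 0 a u v * cis (- (freq h m * u))) has_integral
    (if m = 0 then 0 else of_nat h * (a m * of_real (cosh_moment 0 (\<bar>freq h m\<bar> * v))))) {0..real h}"
proof -
  let ?S = "UNIV - {0 :: int}"
  let ?f = "\<lambda>n u. bessel_term h 0 a u v n * cis (- (freq h m * u))"
  let ?J = "\<lambda>n. a n * of_real (cosh_moment 0 (\<bar>freq h n\<bar> * v)) * (if n = m then of_nat h else 0)"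
  obtain \<beta> where \<beta>: "bij_betw \<beta> (UNIV :: nat set) ?S"
    using bij_betw_nat_nonzero_int by blast
  have "((\<lambda>u. \<Sum>\<^sub>\<infinity>n\<in>?S. ?f n u) has_integral
     (if m = 0 then 0 else of_nat h * (a m * of_real (cosh_moment 0 (\<bar>freq h m\<bar> * v))))) {0..real h}"
  proof (rule has_integral_infsum_dominated[OF \<beta>])
    show "(?f n has_integral ?J n) {0..real h}" for n
      using has_integral_mult_right[OF fourier_orthogonality[OF h, of n m], of "a n * of_real (cosh_moment 0 (\<bar>freq h n\<bar> * v))"]
      by (simp add: bessel_term_def mult.assoc)
    show "(\<lambda>n. norm (?f n u)) summable_on ?S" for u
      using bessel_term_abs_summable[OF h a v, of 0 u] by (simp add: norm_mult)
    show "(\<Sum>\<^sub>\<infinity>n\<in>?S. norm (?f n u)) \<le> (\<Sum>\<^sub>\<infinity>n\<in>?S. norm (a n) * cosh_moment 0 (\<bar>freq h n\<bar> * v))" for u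
      by (simp add: norm_mult norm_bessel_term)
    show "(?J has_sum (if m = 0 then 0 else of_nat h * (a m * of_real (cosh_moment 0 (\<bar>freq h m\<bar> * v))))) ?S"
    proof (cases "m = 0")
      case True
      then show ?thesis
        by (auto intro!: has_sum_0 split: if_splits)
    next
      case False
      have "(?J has_sum sum ?J {m}) {m}"
        by (rule has_sum_finite) simp
      then have "(?J has_sum sum ?J {m}) ?S"
        by (rule has_sum_cong_neutral[THEN iffD1, rotated -1]) (use False in auto)
      then show ?thesis
        using False by (simp add: mult.commute)
    qed
  qed (auto intro: integrable_const_ivl)
  moreover have "(\<Sum>\<^sub>\<infinity>n\<in>?S. ?f n u) = bessel_series h 0 a u v * cis (- (freq h m * u))" for u
    unfolding bessel_series_def by (rule infsum_cmult_left')
  ultimately show ?thesis by simp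
qed

text \<open>Each Fourier coefficient in u satisfies an ordinary differential equation in v. For
  nonzero frequency polynomial growth leaves only the solution with K0; for frequency zero both
  solutions remain and provide the constants of the expansion.\<close>

lemma periodic_eigenfunction_expansion:
  assumes h: "h > 0" and G: "eigenfunction G Gu Gv"
    and per: "\<And>\<tau>. Im \<tau> > 0 \<Longrightarrow> G (\<tau> + of_nat h) = G \<tau>"
    and growth: "\<And>\<tau>. Im \<tau> \<ge> v0 \<Longrightarrow> norm (G \<tau>) \<le> C * Im \<tau> ^ K"
  shows "\<exists>k1 k2 a. has_cusp_expansion h G k1 k2 a"
proof -
  obtain Guu Guv Gvu Gvv where G1: "uhp_partials G Gu Gv"
    and G2: "uhp_partials Gu Guu Guv" "uhp_partials Gv Gvu Gvv"
    and c2: "continuous_on upper_half_plane Guu" "continuous_on upper_half_plane Gvv"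
    and L: "\<And>\<tau>. Im \<tau> > 0 \<Longrightarrow> Guu \<tau> + Gvv \<tau> = - G \<tau> / (4 * (of_real (Im \<tau>))\<^sup>2)"
    using G unfolding eigenfunction_def upper_half_plane_def by blast
  have cG: "continuous_on upper_half_plane G" and cGv: "continuous_on upper_half_plane Gv"
    by (rule uhp_partials_continuous_on[OF G1] uhp_partials_continuous_on[OF G2(2)])+
  have ode: "fourier_coeff h Gvv n v = of_real ((freq h n)\<^sup>2 - 1 / (4 * v\<^sup>2)) * fourier_coeff h G n v" if v: "v > 0" for n v
  proof -
    let ?e = "\<lambda>u. cis (- (freq h n * u))"
    have "((\<lambda>u. - (of_real (1 / (4 * v\<^sup>2))) * (G (Complex u v) * ?e u) - Guu (Complex u v) * ?e u) has_integral
        - (of_real (1 / (4 * v\<^sup>2))) * fourier_coeff h G n v - fourier_coeff h Guu n v) {0..real h}"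
      by (intro has_integral_diff has_integral_mult_right fourier_coeff_has_integral cG c2 v)
    moreover have "- (of_real (1 / (4 * v\<^sup>2))) * (G (Complex u v) * ?e u) - Guu (Complex u v) * ?e u = Gvv (Complex u v) * ?e u" for u
    proof -
      have "Guu (Complex u v) + Gvv (Complex u v) = - (of_real (1 / (4 * v\<^sup>2))) * G (Complex u v)"
        using L[of "Complex u v"] v by simp
      then have "Gvv (Complex u v) = - (of_real (1 / (4 * v\<^sup>2))) * G (Complex u v) - Guu (Complex u v)"
        by (simp only: eq_diff_eq add.commute)
      then show ?thesis
        by (simp only: left_diff_distrib mult.assoc)
    qed
    ultimately have "((\<lambda>u. Gvv (Complex u v) * ?e u) has_integral
        - (of_real (1 / (4 * v\<^sup>2))) * fourier_coeff h G n v - fourier_coeff h Guu n v) {0..real h}"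
      by simp
    then have "fourier_coeff h Gvv n v = - (of_real (1 / (4 * v\<^sup>2))) * fourier_coeff h G n v - fourier_coeff h Guu n v"
      unfolding fourier_coeff_def by (rule integral_unique)
    also have "fourier_coeff h Guu n v = - of_real ((freq h n)\<^sup>2) * fourier_coeff h G n v"
      by (rule fourier_coeff_second_u[OF h G1 G2(1) c2(1) per v])
    finally show ?thesis
      by (simp add: algebra_simps)
  qed
  note d1 = fourier_coeff_deriv[OF G1 cGv, of _ h]
  have d2: "(fourier_coeff h Gv n has_vector_derivative of_real ((freq h n)\<^sup>2 - 1 / (4 * v\<^sup>2)) * fourier_coeff h G n v) (at v)"
    if "v > 0" for n v
    using fourier_coeff_deriv[OF G2(2) c2(2) that, of h n] by (simp only: ode[OF that])
  have "\<exists>A. \<forall>v>0. fourier_coeff h G n v = A * of_real (sqrt v * cosh_moment 0 (\<bar>freq h n\<bar> * v))" if n: "n \<noteq> 0" for n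
  proof (rule ode_nonzero_frequency)
    show "\<bar>freq h n\<bar> > 0"
      by (rule freq_abs_pos[OF h n])
    show "(fourier_coeff h G n has_vector_derivative fourier_coeff h Gv n v) (at v)" if "v > 0" for v
      by (rule d1[OF that])
    show "(fourier_coeff h Gv n has_vector_derivative of_real (\<bar>freq h n\<bar>\<^sup>2 - 1 / (4 * v\<^sup>2)) * fourier_coeff h G n v) (at v)" if "v > 0" for v
      using d2[OF that] by simp
    show "norm (fourier_coeff h G n v) \<le> real h * C * v ^ K" if "v \<ge> max v0 1" for v
      unfolding mult.assoc using that growth[of "Complex _ v"] by (intro norm_fourier_coeff_le cG) auto
  qed
  then have "\<forall>n. \<exists>A. n \<noteq> 0 \<longrightarrow> (\<forall>v>0. fourier_coeff h G n v = A * of_real (sqrt v * cosh_moment 0 (\<bar>freq h n\<bar> * v)))"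
    by blast
  from choice[OF this] obtain A where A: "\<And>n v. n \<noteq> 0 \<Longrightarrow> v > 0 \<Longrightarrow>
      fourier_coeff h G n v = A n * of_real (sqrt v * cosh_moment 0 (\<bar>freq h n\<bar> * v))"
    by blast
  have "(fourier_coeff h Gv 0 has_vector_derivative - fourier_coeff h G 0 v / of_real (4 * v\<^sup>2)) (at v)" if "v > 0" for v
    using d2[OF that, of 0] by (simp add: freq_def)
  from ode_zero_frequency[OF d1 this] obtain k1 k2
    where k: "\<And>v. v > 0 \<Longrightarrow> fourier_coeff h G 0 v = k1 * of_real (sqrt v) + k2 * of_real (sqrt v * ln v)"
    by blast
  \<comment> \<open>\<open>fourier_coeff\<close> is an unnormalised integral over a period of length
    h.\<close>
  define a where "a n = A n / of_nat h" for n
  have ca: "fourier_coeff h G n v = of_real (sqrt v) * (of_nat h * (a n * of_real (cosh_moment 0 (\<bar>freq h n\<bar> * v))))"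
    if "n \<noteq> 0" "v > 0" for n v
    using A[OF that] h by (simp add: a_def)
  \<comment> \<open>The coefficients are known before the series is known to converge. On each
    horizontal line G is bounded by compactness of a period, which bounds all Bessel terms at that
    height.\<close>
  have sub: "subexponential a"
  proof (rule subexponential_if_bessel_bounded[OF h])
    fix v :: real assume v: "v > 0"
    have "compact ((\<lambda>u. G (Complex u v)) ` {0..real h})"
      by (intro compact_continuous_image continuous_on_horizontal cG v) simp
    from compact_imp_bounded[OF this] obtain M where "\<forall>x\<in>(\<lambda>u. G (Complex u v)) ` {0..real h}. norm x \<le> M"
      unfolding bounded_iff by (elim exE)
    then have M: "norm (G (Complex u v)) \<le> M" if "u \<in> {0..real h}" for u
      using that by (simp only: ball_simps)
    have "norm (a n) * cosh_moment 0 (\<bar>freq h n\<bar> * v) \<le> M / sqrt v" if n: "n \<noteq> 0" for n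
    proof -
      have "real h * (sqrt v * (norm (a n) * cosh_moment 0 (\<bar>freq h n\<bar> * v))) = norm (fourier_coeff h G n v)"
        using v by (simp add: ca[OF n v] norm_mult cosh_moment_nonneg)
      also have "\<dots> \<le> real h * M"
        by (rule norm_fourier_coeff_le[OF cG v M])
      finally show ?thesis
        using h v by (simp add: pos_le_divide_eq mult.commute)
    qed
    then show "\<exists>C. \<forall>n. n \<noteq> 0 \<longrightarrow> norm (a n) * cosh_moment 0 (\<bar>freq h n\<bar> * v) \<le> C"
      by blast
  qed
  let ?k1 = "k1 / of_nat h" and ?k2 = "k2 / of_nat h"
  have "G \<tau> = ?k1 * of_real (sqrt (Im \<tau>)) + ?k2 * of_real (sqrt (Im \<tau>) * ln (Im \<tau>)) +
      of_real (sqrt (Im \<tau>)) * bessel_series h 0 a (Re \<tau>) (Im \<tau>)" if "Im \<tau> > 0" for \<tau>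
  proof -
    define v where "v = Im \<tau>"
    have v: "v > 0" using that by (simp add: v_def)
    define \<kappa> where "\<kappa> = ?k1 * of_real (sqrt v) + ?k2 * of_real (sqrt v * ln v)"
    \<comment> \<open>The difference between G and the proposed expansion on one horizontal line.
      All its Fourier coefficients vanish, so it vanishes inside a period by uniqueness, at the ends
      by continuity, and elsewhere by periodicity.\<close>
    define D where "D u = G (Complex u v) - \<kappa> - of_real (sqrt v) * bessel_series h 0 a u v" for u
    define D' where "D' u = Gu (Complex u v) - 0 - of_real (sqrt v) * bessel_series h 0 (\<lambda>n. \<i> * of_real (freq h n) * a n) u v" for u
    have D': "(D has_vector_derivative D' u) (at u)" for u
      unfolding D_def D'_def
      by (intro has_vector_derivative_diff has_vector_derivative_const has_vector_derivative_mult_right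
          uhp_partials_vector_derivative(1)[OF G1 v] bessel_series_deriv_u h sub v)
    have zero: "integral {0..real h} (\<lambda>u. D u * cis (- (freq h m * u))) = 0" for m
    proof -
      have "((\<lambda>u. G (Complex u v) * cis (- (freq h m * u)) - \<kappa> * (cis (freq h 0 * u) * cis (- (freq h m * u)))
          - of_real (sqrt v) * (bessel_series h 0 a u v * cis (- (freq h m * u)))) has_integral
          fourier_coeff h G m v - \<kappa> * (if 0 = m then of_nat h else 0) - of_real (sqrt v) *
          (if m = 0 then 0 else of_nat h * (a m * of_real (cosh_moment 0 (\<bar>freq h m\<bar> * v))))) {0..real h}"
        by (intro has_integral_diff has_integral_mult_right fourier_coeff_has_integral cG v
            fourier_orthogonality bessel_series_fourier h sub)
      moreover have "G (Complex u v) * cis (- (freq h m * u)) - \<kappa> * (cis (freq h 0 * u) * cis (- (freq h m * u)))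
          - of_real (sqrt v) * (bessel_series h 0 a u v * cis (- (freq h m * u))) = D u * cis (- (freq h m * u))" for u
        by (simp add: D_def freq_def algebra_simps)
      moreover have "fourier_coeff h G m v - \<kappa> * (if 0 = m then of_nat h else 0) - of_real (sqrt v) *
          (if m = 0 then 0 else of_nat h * (a m * of_real (cosh_moment 0 (\<bar>freq h m\<bar> * v)))) = 0"
        using ca[OF _ v, of m] k[OF v] h by (cases "m = 0") (auto simp: \<kappa>_def field_simps)
      ultimately show ?thesis
        by (simp add: integral_unique)
    qed
    have "D u = 0" if "u \<in> {0<..<real h}" for u
      by (rule fourier_uniqueness[OF h D' zero that])
    moreover have cD: "continuous_on S D" for S
      using D' by (intro continuous_at_imp_continuous_on ballI has_vector_derivative_continuous)
    ultimately have D0: "D u = 0" if "u \<in> {0..real h}" for u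
      using continuous_constant_on_closure[of "{0<..<real h}" D 0 u] that h
      by (simp add: closure_greaterThanLessThan)
    interpret periodic_fun_simple D "real h"
    proof
      fix u
      have "Complex (u + real h) v = Complex u v + of_nat h"
        by (simp add: complex_eq_iff)
      then have "G (Complex (u + real h) v) = G (Complex u v)"
        using per[of "Complex u v"] v by simp
      moreover have "bessel_series h 0 a (u + real h) v = bessel_series h 0 a u v"
        unfolding bessel_series_def bessel_term_def distrib_left cis_mult[symmetric] cis_freq_period[OF h] by simp
      ultimately show "D (u + real h) = D u"
        by (simp add: D_def)
    qed
    define m where "m = \<lfloor>Re \<tau> / real h\<rfloor>"
    have "real_of_int m \<le> Re \<tau> / real h" "Re \<tau> / real h \<le> real_of_int m + 1"
      unfolding m_def by linarith+
    then have "real_of_int m * real h \<le> Re \<tau>" "Re \<tau> \<le> (real_of_int m + 1) * real h"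
      using h by (simp_all add: pos_le_divide_eq pos_divide_le_eq)
    then have "Re \<tau> - real_of_int m * real h \<in> {0..real h}"
      by (simp add: algebra_simps)
    from D0[OF this] have "D (Re \<tau>) = 0"
      using plus_of_int[of "Re \<tau> - real_of_int m * real h" m] by simp
    then show ?thesis
      by (simp add: D_def \<kappa>_def v_def algebra_simps)
  qed
  then have "has_cusp_expansion h G ?k1 ?k2 a"
    using sub unfolding has_cusp_expansion_iff[OF h] upper_half_plane_def by blast
  then show ?thesis by blast
qed

section \<open>The modular group and its cusps\<close>

lemma SL2Z_det:
  assumes "g \<in> carrier SL2Z"
  shows "g$1$1 * g$2$2 - g$1$2 * g$2$1 = 1"
    and "real_of_int (g$1$1) * real_of_int (g$2$2) - real_of_int (g$1$2) * real_of_int (g$2$1) = 1"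
proof -
  show "g$1$1 * g$2$2 - g$1$2 * g$2$1 = 1"
    using assms by (simp add: SL2Z_def det_2)
  then show "real_of_int (g$1$1) * real_of_int (g$2$2) - real_of_int (g$1$2) * real_of_int (g$2$1) = 1"
    by (metis of_int_1 of_int_diff of_int_mult)
qed

lemma SL2Z_mult: "g \<otimes>\<^bsub>SL2Z\<^esub> k = g ** k" and SL2Z_one: "\<one>\<^bsub>SL2Z\<^esub> = mat 1"
  by (simp_all add: SL2Z_def)

lemma SL2Z_closed: "g \<in> carrier SL2Z \<Longrightarrow> k \<in> carrier SL2Z \<Longrightarrow> g ** k \<in> carrier SL2Z"
  by (simp add: SL2Z_def det_mul)

lemma SL2Z_bottom_row:
  assumes "g \<in> carrier SL2Z"
  shows "(real_of_int (g$2$1), real_of_int (g$2$2)) \<noteq> (0, 0)"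
  using SL2Z_det(1)[OF assms] by auto

lemma sl2_act_real:
  "sl2_act g = moebius (of_real (real_of_int (g$1$1))) (of_real (real_of_int (g$1$2)))
     (of_real (real_of_int (g$2$1))) (of_real (real_of_int (g$2$2)))"
  by (simp add: sl2_act_def)

lemma Im_sl2_act_pos:
  assumes "g \<in> carrier SL2Z" "Im \<tau> > 0"
  shows "Im (sl2_act g \<tau>) > 0"
proof -
  have "norm (of_real (real_of_int (g$2$1)) * \<tau> + of_real (real_of_int (g$2$2)) :: complex) > 0"
    using linear_nonzero_uhp[OF SL2Z_bottom_row[OF assms(1)] assms(2)] by simp
  then show ?thesis
    using assms(2) unfolding sl2_act_real Im_moebius_real[OF SL2Z_det(2)[OF assms(1)]] by simp
qed

lemma sl2_act_mult:
  assumes "g \<in> carrier SL2Z" "k \<in> carrier SL2Z" "Im \<tau> > 0"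
  shows "sl2_act (g ** k) \<tau> = sl2_act g (sl2_act k \<tau>)"
proof -
  have nk: "of_int (k$2$1) * \<tau> + of_int (k$2$2) \<noteq> 0"
    using linear_nonzero_uhp[OF SL2Z_bottom_row[OF assms(2)] assms(3)] by simp
  have alg: "((a1 * a2 + b1 * c2) * \<tau> + (a1 * b2 + b1 * d2)) / ((c1 * a2 + d1 * c2) * \<tau> + (c1 * b2 + d1 * d2)) =
      (a1 * ((a2 * \<tau> + b2) / (c2 * \<tau> + d2)) + b1) / (c1 * ((a2 * \<tau> + b2) / (c2 * \<tau> + d2)) + d1)"
    if "c2 * \<tau> + d2 \<noteq> 0" for a1 b1 c1 d1 a2 b2 c2 d2 :: complex
  proof -
    have "x * ((a2 * \<tau> + b2) / (c2 * \<tau> + d2)) + y = ((x * a2 + y * c2) * \<tau> + (x * b2 + y * d2)) / (c2 * \<tau> + d2)" for x y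
      using that by (simp add: field_simps)
    then show ?thesis
      using that by simp
  qed
  show ?thesis
    unfolding sl2_act_def moebius_def alg[OF nk, symmetric]
    by (simp add: matrix_matrix_mult_def sum_2)
qed

lemma SL2Z_inverse:
  assumes "g \<in> carrier SL2Z"
  shows "inv\<^bsub>SL2Z\<^esub> g \<in> carrier SL2Z" "inv\<^bsub>SL2Z\<^esub> g ** g = mat 1" "g ** inv\<^bsub>SL2Z\<^esub> g = mat 1"
  using group.inv_closed[OF group_SL2Z assms] group.l_inv[OF group_SL2Z assms] group.r_inv[OF group_SL2Z assms]
  by (simp_all add: SL2Z_mult SL2Z_one)

lemma mat_1_SL2Z: "mat 1 \<in> carrier SL2Z"
  by (simp add: SL2Z_def)

lemma sl2_act_one: "sl2_act (mat 1) \<tau> = \<tau>"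
  by (simp add: sl2_act_def moebius_def mat_def)

lemma sl2_act_inverse:
  assumes "g \<in> carrier SL2Z" "Im \<tau> > 0"
  shows "sl2_act (inv\<^bsub>SL2Z\<^esub> g) (sl2_act g \<tau>) = \<tau>" "sl2_act g (sl2_act (inv\<^bsub>SL2Z\<^esub> g) \<tau>) = \<tau>"
  using sl2_act_mult[OF SL2Z_inverse(1)[OF assms(1)] assms] sl2_act_mult[OF assms(1) SL2Z_inverse(1)[OF assms(1)] assms(2)]
  by (simp_all add: SL2Z_inverse[OF assms(1)] sl2_act_one)

text \<open>Stated at \<open>Infty\<close> because every cusp is represented as the image of
  infinity under a matrix.\<close>

lemma cusp_act_mult_Infty:
  assumes g: "g \<in> carrier SL2Z" and k: "k \<in> carrier SL2Z"
  shows "cusp_act (g ** k) Infty = cusp_act g (cusp_act k Infty)"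
proof (cases "k$2$1 = 0")
  case True
  then have "k$1$1 \<noteq> 0"
    using SL2Z_det(1)[OF k] by auto
  then show ?thesis
    using True by (simp add: matrix_matrix_mult_def sum_2)
next
  case False
  have "rat_of_int x * (of_int (k$1$1) / of_int (k$2$1)) + of_int y = of_int (x * k$1$1 + y * k$2$1) / of_int (k$2$1)" for x y
    using False by (simp add: field_simps)
  moreover have "(rat_of_int z / of_int (k$2$1) = 0) = (z = 0)" for z
    using False by simp
  moreover have "(rat_of_int y / of_int (k$2$1)) / (rat_of_int z / of_int (k$2$1)) = rat_of_int y / of_int z" for y z
    using False by simp
  ultimately show ?thesis
    using False by (simp only: matrix_matrix_mult_def sum_2 cusp_act.simps if_False vec_lambda_beta)
qed

lemma ex_SL2Z_cusp: "\<exists>g\<in>carrier SL2Z. cusp_act g Infty = \<alpha>"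
proof (cases \<alpha>)
  case Infty
  then show ?thesis
    using mat_1_SL2Z by (intro bexI[of _ "mat 1"]) (auto simp: mat_def)
next
  case (Fin x)
  obtain p q where pq: "quotient_of x = (p, q)"
    by (cases "quotient_of x")
  have q: "q > 0" and cop: "coprime p q" and x: "x = of_int p / of_int q"
    using pq by (auto intro: quotient_of_denom_pos quotient_of_coprime quotient_of_div)
  obtain u v where uv: "u * p + v * q = 1"
    using bezout_int[of p q] cop by (auto simp: coprime_iff_gcd_eq_1)
  define g :: "int^2^2" where
    "g = (\<chi> i j. if i = 1 then (if j = 1 then p else - v) else (if j = 1 then q else u))"
  have "g \<in> carrier SL2Z"
    using uv by (simp add: SL2Z_def det_2 g_def algebra_simps)
  moreover have "cusp_act g Infty = \<alpha>"
    using q by (simp add: g_def Fin x)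
  ultimately show ?thesis by blast
qed

text \<open>The element \<open>g T\<^sup>n g\<^sup>-\<^sup>1\<close> of the stabilizer of the cusp \<open>g \<infinity>\<close> is congruent to 1 modulo \<open>n\<close>.\<close>

lemma conjugate_translation:
  assumes g: "g \<in> carrier SL2Z" and n: "n > 0"
  shows "\<exists>M\<in>principal_congruence_subgroup n. \<forall>\<tau>. Im \<tau> > 0 \<longrightarrow> sl2_act M (sl2_act g \<tau>) = sl2_act g (\<tau> + of_nat n)"
proof -
  define a b c d where abcd: "a = g$1$1" "b = g$1$2" "c = g$2$1" "d = g$2$2"
  have det: "a * d - b * c = 1"
    using SL2Z_det(1)[OF g] by (simp add: abcd)
  define M :: "int^2^2" where
    "M = (\<chi> i j. if i = 1 then (if j = 1 then 1 - int n * (a * c) else int n * (a * a))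
        else (if j = 1 then - (int n * (c * c)) else 1 + int n * (a * c)))"
  define T :: "int^2^2" where
    "T = (\<chi> i j. if i = 1 then (if j = 1 then 1 else int n) else (if j = 1 then 0 else 1))"
  have M: "M \<in> carrier SL2Z"
    by (simp add: SL2Z_def det_2 M_def algebra_simps)
  have T: "T \<in> carrier SL2Z"
    by (simp add: SL2Z_def det_2 T_def)
  have "(1 - int n * x) mod int n = 1 mod int n" "(1 + int n * x) mod int n = 1 mod int n"
    "(int n * x) mod int n = 0" "(- (int n * x)) mod int n = 0" for x
    by (simp_all add: mod_eq_dvd_iff mod_eq_0_iff_dvd)
  then have "M \<in> principal_congruence_subgroup n"
    using M by (auto simp: principal_congruence_subgroup_def forall_2 M_def mat_def)
  moreover have "sl2_act M (sl2_act g \<tau>) = sl2_act g (\<tau> + of_nat n)" if \<tau>: "Im \<tau> > 0" for \<tau>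
  proof -
    have "M ** g = g ** T"
    proof -
      have "(1 - int n * (a * c)) * b + int n * (a * a) * d = b + int n * a * (a * d - b * c)"
        by (simp add: algebra_simps)
      moreover have "- (int n * (c * c)) * b + (1 + int n * (a * c)) * d = d + int n * c * (a * d - b * c)"
        by (simp add: algebra_simps)
      ultimately have "(1 - int n * (a * c)) * b + int n * (a * a) * d = a * int n + b"
        "- (int n * (c * c)) * b + (1 + int n * (a * c)) * d = c * int n + d"
        by (simp_all add: det)
      then show ?thesis
        by (simp add: vec_eq_iff forall_2 matrix_matrix_mult_def sum_2 M_def T_def abcd[symmetric])
           (simp add: algebra_simps)
    qed
    then have "sl2_act M (sl2_act g \<tau>) = sl2_act g (sl2_act T \<tau>)"
      using sl2_act_mult[OF M g \<tau>] sl2_act_mult[OF g T \<tau>] by simp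
    moreover have "sl2_act T \<tau> = \<tau> + of_nat n"
      by (simp add: sl2_act_def T_def moebius_def)
    ultimately show ?thesis
      by (simp only:)
  qed
  ultimately show ?thesis by blast
qed

section \<open>Maass waveforms as eigenfunctions and their expansions at cusps\<close>

lemma differentiable_on_imp_uhp_partials:
  assumes "F differentiable_on upper_half_plane"
  shows "uhp_partials F (dir_deriv 1 F) (dir_deriv \<i> F)"
  unfolding uhp_partials_def
proof
  fix \<tau> assume \<tau>: "\<tau> \<in> upper_half_plane"
  then have "F differentiable (at \<tau>)"
    using assms open_upper_half_plane by (simp add: differentiable_on_eq_differentiable_at)
  then obtain D where D: "(F has_derivative D) (at \<tau>)"
    by (auto simp: differentiable_def)
  interpret D: bounded_linear D
    using D by (rule has_derivative_bounded_linear)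
  have dd: "dir_deriv w F \<tau> = D w" for w
  proof -
    have "((\<lambda>t. \<tau> + of_real t * w) has_derivative (\<lambda>t. of_real t * w)) (at 0)"
      by (auto intro!: derivative_eq_intros)
    moreover have "(F has_derivative D) (at (\<tau> + of_real 0 * w))"
      using D by simp
    ultimately have "((\<lambda>t. F (\<tau> + of_real t * w)) has_derivative (\<lambda>t. D (of_real t * w))) (at 0)"
      by (rule has_derivative_compose)
    then have "((\<lambda>t. F (\<tau> + of_real t * w)) has_vector_derivative D w) (at 0)"
      by (simp add: has_vector_derivative_def scaleR_conv_of_real[symmetric] D.scaleR)
    then show ?thesis
      unfolding dir_deriv_def by (rule vector_derivative_at)
  qed
  have Dw: "D w = of_real (Re w) * D 1 + of_real (Im w) * D \<i>" for w
  proof -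
    have w: "w = Re w *\<^sub>R 1 + Im w *\<^sub>R \<i>"
      by (simp add: complex_eq_iff)
    have "D w = Re w *\<^sub>R D 1 + Im w *\<^sub>R D \<i>"
      by (subst w) (simp only: D.add D.scaleR)
    then show ?thesis
      by (simp add: scaleR_conv_of_real)
  qed
  have "D = (\<lambda>w. of_real (Re w) * dir_deriv 1 F \<tau> + of_real (Im w) * dir_deriv \<i> F \<tau>)"
    unfolding dd by (rule ext) (rule Dw)
  then show "(F has_derivative (\<lambda>w. of_real (Re w) * dir_deriv 1 F \<tau> + of_real (Im w) * dir_deriv \<i> F \<tau>)) (at \<tau>)"
    using D by simp
qed

lemma maass_waveform_eigenfunction:
  assumes "maass_waveform \<Gamma> (1/4) F"
  shows "eigenfunction F (dir_deriv 1 F) (dir_deriv \<i> F)"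
proof -
  have d: "foldr dir_deriv ws F differentiable_on upper_half_plane" if "set ws \<subseteq> {1, \<i>}" for ws
    using assms that by (simp add: maass_waveform_def smooth_on_uhp_def)
  have d1: "dir_deriv w F differentiable_on upper_half_plane" if "w \<in> {1, \<i>}" for w
    using d[of "[w]"] that by simp
  have c2: "continuous_on upper_half_plane (dir_deriv w' (dir_deriv w F))" if "w \<in> {1, \<i>}" "w' \<in> {1, \<i>}" for w w'
    using d[of "[w', w]"] that by (auto intro!: differentiable_imp_continuous_on)
  show ?thesis
  proof (rule eigenfunctionI)
    show "uhp_partials F (dir_deriv 1 F) (dir_deriv \<i> F)"
      using d[of "[]"] by (intro differentiable_on_imp_uhp_partials) simp
    show "uhp_partials (dir_deriv 1 F) (dir_deriv 1 (dir_deriv 1 F)) (dir_deriv \<i> (dir_deriv 1 F))"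
      "uhp_partials (dir_deriv \<i> F) (dir_deriv 1 (dir_deriv \<i> F)) (dir_deriv \<i> (dir_deriv \<i> F))"
      by (intro differentiable_on_imp_uhp_partials d1; simp)+
    fix \<tau> :: complex assume \<tau>: "Im \<tau> > 0"
    then have L: "hyp_laplacian F \<tau> = 1 / 4 * F \<tau>"
      using assms by (simp add: maass_waveform_def upper_half_plane_def)
    have "x = - y / (4 * z)" if "- z * x = 1 / 4 * y" "z \<noteq> 0" for x y z :: complex
    proof -
      have "y = 4 * (1 / 4 * y)"
        by simp
      then have "y = 4 * (- z * x)"
        by (simp only: that(1))
      then show ?thesis
        using that(2) by simp
    qed
    from this[OF L[unfolded hyp_laplacian_def]] \<tau>
    show "dir_deriv 1 (dir_deriv 1 F) \<tau> + dir_deriv \<i> (dir_deriv \<i> F) \<tau> = - F \<tau> / (4 * (of_real (Im \<tau>))\<^sup>2)"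
      by simp
  qed (rule c2; simp)+
qed

lemma eigenfunction_sl2_act:
  assumes F: "eigenfunction F Fu Fv" and g: "g \<in> carrier SL2Z"
  shows "\<exists>Gu Gv. eigenfunction (\<lambda>\<tau>. F (sl2_act g \<tau>)) Gu Gv"
  unfolding sl2_act_real using eigenfunction_moebius[OF F SL2Z_det(2)[OF g]] by blast

text \<open>The level n of a principal congruence subgroup inside \<Gamma> is a period at every
  cusp, possibly a multiple of the width. This provides the constants at a cusp where F is not known
  to be cuspidal.\<close>

lemma cusp_expansion_exists:
  assumes \<Gamma>: "congruence_subgroup \<Gamma>" and F: "maass_waveform \<Gamma> (1/4) F" and g: "g \<in> carrier SL2Z"
  shows "\<exists>h>0. \<exists>k1 k2 a. has_cusp_expansion h (\<lambda>\<tau>. F (sl2_act g \<tau>)) k1 k2 a"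
proof -
  obtain n where n: "n > 0" "principal_congruence_subgroup n \<subseteq> \<Gamma>"
    using \<Gamma> by (auto simp: congruence_subgroup_def)
  obtain Gu Gv where G: "eigenfunction (\<lambda>\<tau>. F (sl2_act g \<tau>)) Gu Gv"
    using eigenfunction_sl2_act[OF maass_waveform_eigenfunction[OF F] g] by blast
  obtain C k v0 where growth: "\<And>\<tau>. Im \<tau> \<ge> v0 \<Longrightarrow> norm (F (sl2_act g \<tau>)) \<le> C * Im \<tau> ^ k"
    using F g unfolding maass_waveform_def polynomial_growth_at_cusps_def by blast
  obtain M where M: "M \<in> principal_congruence_subgroup n"
    "\<And>\<tau>. Im \<tau> > 0 \<Longrightarrow> sl2_act M (sl2_act g \<tau>) = sl2_act g (\<tau> + of_nat n)"
    using conjugate_translation[OF g n(1)] by blast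
  have per: "F (sl2_act g (\<tau> + of_nat n)) = F (sl2_act g \<tau>)" if "Im \<tau> > 0" for \<tau>
  proof -
    have "F (sl2_act M (sl2_act g \<tau>)) = F (sl2_act g \<tau>)"
      using F M(1) n(2) Im_sl2_act_pos[OF g that] by (auto simp: maass_waveform_def upper_half_plane_def)
    then show ?thesis
      by (simp only: M(2)[OF that])
  qed
  have "\<exists>k1 k2 a. has_cusp_expansion n (\<lambda>\<tau>. F (sl2_act g \<tau>)) k1 k2 a"
    by (rule periodic_eigenfunction_expansion[OF n(1) G per growth])
  then show ?thesis
    using n(1) by blast
qed

lemma cuspidal_expansion_decays:
  assumes h: "h > 0" and G: "uhp_partials G Gu Gv" and exp: "has_cusp_expansion h G 0 0 a"
  shows "decays_at_infinity G Gu Gv"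
proof (rule bessel_expansion_decays[OF h _ G])
  show "subexponential a"
    using exp by (simp add: has_cusp_expansion_iff[OF h])
  show "G \<tau> = of_real (sqrt (Im \<tau>)) * bessel_series h 0 a (Re \<tau>) (Im \<tau>)" if "Im \<tau> > 0" for \<tau>
    using exp that by (simp add: has_cusp_expansion_iff[OF h] upper_half_plane_def)
qed

lemma cuspidal_at_decays:
  assumes F: "eigenfunction F Fu Fv" and "cuspidal_at F \<alpha>"
  shows "\<exists>g Gu Gv. g \<in> carrier SL2Z \<and> cusp_act g Infty = \<alpha> \<and>
    uhp_partials (\<lambda>\<tau>. F (sl2_act g \<tau>)) Gu Gv \<and> decays_at_infinity (\<lambda>\<tau>. F (sl2_act g \<tau>)) Gu Gv"
proof -
  obtain g h a where g: "g \<in> carrier SL2Z" "h > 0" "cusp_act g Infty = \<alpha>"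
    and exp: "has_cusp_expansion h (\<lambda>\<tau>. F (sl2_act g \<tau>)) 0 0 a"
    using assms(2) by (auto simp: cuspidal_at_def)
  obtain Gu Gv where "eigenfunction (\<lambda>\<tau>. F (sl2_act g \<tau>)) Gu Gv"
    using eigenfunction_sl2_act[OF F g(1)] by blast
  then have "uhp_partials (\<lambda>\<tau>. F (sl2_act g \<tau>)) Gu Gv"
    by (rule eigenfunction_imp_partials)
  with cuspidal_expansion_decays[OF g(2) this exp] g show ?thesis
    by blast
qed

text \<open>The vertical geodesic over g^-1 infinity is mapped to the one over g infinity with its
  direction reversed, so small heights over a cusp correspond to large heights in the coordinate of
  its expansion.\<close>

lemma sl2_act_vertical:
  assumes g: "g \<in> carrier SL2Z" and c: "g$2$1 \<noteq> 0" and v: "v > 0"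
  shows "sl2_act g (Complex (- real_of_int (g$2$2) / real_of_int (g$2$1)) v) =
    Complex (real_of_int (g$1$1) / real_of_int (g$2$1)) (1 / ((real_of_int (g$2$1))\<^sup>2 * v))"
proof -
  define a b c d where abcd: "a = real_of_int (g$1$1)" "b = real_of_int (g$1$2)" "c = real_of_int (g$2$1)" "d = real_of_int (g$2$2)"
  have det: "a * d - b * c = 1"
    using SL2Z_det(2)[OF g] by (simp add: abcd)
  have c0: "c \<noteq> 0"
    using c by (simp add: abcd)
  define \<tau> where "\<tau> = Complex (- d / c) v"
  have den: "of_real c * \<tau> + of_real d = \<i> * of_real (c * v)"
    using c0 by (simp add: \<tau>_def complex_eq_iff)
  have num: "of_real a * \<tau> + of_real b = of_real (- 1 / c) + \<i> * of_real (a * v)"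
    using c0 det by (simp add: \<tau>_def complex_eq_iff field_simps)
  have "sl2_act g \<tau> = (of_real (- 1 / c) + \<i> * of_real (a * v)) / (\<i> * of_real (c * v))"
    unfolding sl2_act_real moebius_def abcd[symmetric] by (simp only: den num)
  also have "\<dots> = Complex (a / c) (1 / (c\<^sup>2 * v))"
    using c0 v by (simp add: complex_eq_iff Re_divide Im_divide power2_eq_square field_simps)
  finally show ?thesis
    by (simp add: \<tau>_def abcd)
qed

section \<open>Decay at cusps\<close>

lemma exp_neg_le_power:
  fixes e v :: real
  assumes "e > 0" "v > 0"
  shows "exp (- e * v) \<le> fact k / (e * v) ^ k"
proof -
  have "(e * v) ^ k \<le> fact k * exp (e * v)"
    using assms by (intro power_le_fact_exp) simp
  then show ?thesis
    using assms by (simp add: exp_minus field_simps)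
qed

text \<open>Each bound is proved at the end where it is the stronger one and implies the other
  there; the compact gap from d to 1 is covered by continuity.\<close>

lemma two_sided_bound:
  fixes f :: "real \<Rightarrow> complex"
  assumes f: "continuous_on {0<..} f" and d: "0 < d" "d \<le> 1"
    and zero: "\<And>v. 0 < v \<Longrightarrow> v \<le> d \<Longrightarrow> norm (f v) \<le> K * v ^ i"
    and infinity: "\<And>v. v \<ge> 1 \<Longrightarrow> norm (f v) \<le> K' / v ^ j"
  shows "\<exists>C\<ge>0. \<forall>v>0. norm (f v) \<le> C * v ^ i \<and> norm (f v) \<le> C / v ^ j"
proof -
  have "compact (f ` {d..1})"
    using d by (intro compact_continuous_image continuous_on_subset[OF f]) auto
  from compact_imp_bounded[OF this] obtain B where "\<forall>x\<in>f ` {d..1}. norm x \<le> B"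
    unfolding bounded_iff by (elim exE)
  then have B: "norm (f v) \<le> B" if "v \<in> {d..1}" for v
    using that by (simp only: ball_simps)
  have B0: "B \<ge> 0"
    using B[of 1] d norm_ge_zero[of "f 1"] by (simp del: norm_ge_zero)
  define C where "C = \<bar>K\<bar> + \<bar>K'\<bar> + B / d ^ i"
  have C: "\<bar>K\<bar> \<le> C" "\<bar>K'\<bar> \<le> C" "B / d ^ i \<le> C" "C \<ge> 0"
    using B0 d by (simp_all add: C_def)
  have "norm (f v) \<le> C * v ^ i \<and> norm (f v) \<le> C / v ^ j" if v: "v > 0" for v
  proof (cases "v \<le> 1")
    case True
    have "norm (f v) \<le> C * v ^ i"
    proof (cases "v \<le> d")
      case True
      have "norm (f v) \<le> K * v ^ i"
        by (rule zero[OF v True])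
      also have "\<dots> \<le> C * v ^ i"
        using C v by (intro mult_right_mono) auto
      finally show ?thesis .
    next
      case False
      have "norm (f v) \<le> B / d ^ i * d ^ i"
        using B[of v] False \<open>v \<le> 1\<close> d by simp
      also have "\<dots> \<le> C * v ^ i"
        using C False d by (intro mult_mono power_mono) auto
      finally show ?thesis .
    qed
    moreover have "C * v ^ i \<le> C * 1"
      using True v C by (intro mult_left_mono power_le_one) auto
    moreover have "C / 1 \<le> C / v ^ j"
      using True v C by (intro divide_left_mono power_le_one) auto
    ultimately show ?thesis by simp
  next
    case False
    have "norm (f v) \<le> K' / v ^ j"
      using False by (intro infinity) simp
    also have "\<dots> \<le> C / v ^ j"
      using C v by (intro divide_right_mono) auto
    finally have "norm (f v) \<le> C / v ^ j" .
    moreover have "C / v ^ j \<le> C / 1"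
      using False C by (intro divide_left_mono one_le_power) auto
    moreover have "C * 1 \<le> C * v ^ i"
      using False C by (intro mult_left_mono one_le_power) auto
    ultimately show ?thesis by simp
  qed
  then show ?thesis
    using C by blast
qed

text \<open>On the vertical line over x = g infinity the derivative of g^-1, realised as
  \<open>m\<close> in the proof, is the real number -1 / (c v)^2. Hence the two partials do not mix,
  and \<open>w\<close> is the point of the line over g^-1 infinity that g maps to x + iv.\<close>

lemma cusp_line_values:
  assumes g: "g \<in> carrier SL2Z" and c0: "g$2$1 \<noteq> 0"
    and G: "uhp_partials G Gu Gv" and F: "uhp_partials F Fu Fv"
    and eq: "\<And>\<tau>. Im \<tau> > 0 \<Longrightarrow> F (sl2_act g \<tau>) = G \<tau>" and v: "v > 0"
  defines "c \<equiv> real_of_int (g$2$1)" and "x \<equiv> real_of_int (g$1$1) / real_of_int (g$2$1)"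
    and "w \<equiv> Complex (- real_of_int (g$2$2) / real_of_int (g$2$1)) (1 / ((real_of_int (g$2$1))\<^sup>2 * v))"
  shows "F (Complex x v) = G w" "Fu (Complex x v) = - of_real (1 / (c * v)\<^sup>2) * Gu w"
    "Fv (Complex x v) = - of_real (1 / (c * v)\<^sup>2) * Gv w"
proof -
  define a b d where abd: "a = real_of_int (g$1$1)" "b = real_of_int (g$1$2)" "d = real_of_int (g$2$2)"
  have det: "a * d - b * c = 1"
    using SL2Z_det(2)[OF g] by (simp add: abd c_def)
  then have det': "d * a - (- b) * (- c) = 1"
    by (simp add: mult.commute[of d a])
  have c: "c \<noteq> 0"
    using c0 by (simp add: c_def)
  define m where "m = moebius (of_real d) (of_real (- b)) (of_real (- c)) (complex_of_real a)"
  define p where "p \<tau> = 1 / (of_real (- c) * \<tau> + complex_of_real a)\<^sup>2" for \<tau>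
  have g_m: "sl2_act g = moebius (of_real a) (of_real b) (of_real c) (of_real d)"
    by (simp add: sl2_act_def abd c_def)
  have detC: "complex_of_real a * of_real d \<noteq> of_real b * of_real c"
  proof -
    have "complex_of_real (a * d - b * c) \<noteq> 0"
      by (simp only: det) simp
    then show ?thesis
      by simp
  qed
  have gm: "sl2_act g (m \<tau>) = \<tau>" if "Im \<tau> > 0" for \<tau>
  proof -
    have "of_real (- c) * \<tau> + complex_of_real a \<noteq> 0"
      using det' that by (intro linear_nonzero_uhp) auto
    then show ?thesis
      using moebius_inverse[of "complex_of_real d" "complex_of_real a" "complex_of_real (- b)" "complex_of_real (- c)" \<tau>] detC
      by (simp add: g_m m_def mult.commute)
  qed
  have mH: "Im (m \<tau>) > 0" if "Im \<tau> > 0" for \<tau>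
  proof -
    have "of_real (- c) * \<tau> + complex_of_real a \<noteq> 0"
      using det' that by (intro linear_nonzero_uhp) auto
    then show ?thesis
      using that unfolding m_def Im_moebius_real[OF det'] by simp
  qed
  have GF: "G (m \<tau>) = F \<tau>" if "Im \<tau> > 0" for \<tau>
    using eq[OF mH[OF that]] gm[OF that] by simp
  have md: "(m has_field_derivative p \<tau>) (at \<tau>)" if "Im \<tau> > 0" for \<tau>
    unfolding m_def p_def by (rule moebius_real_has_field_derivative(1)[OF det' that])
  have comp: "uhp_partials (\<lambda>\<tau>. G (m \<tau>))
    (\<lambda>\<tau>. of_real (Re (p \<tau>)) * Gu (m \<tau>) + of_real (Im (p \<tau>)) * Gv (m \<tau>))
    (\<lambda>\<tau>. of_real (Re (p \<tau>)) * Gv (m \<tau>) - of_real (Im (p \<tau>)) * Gu (m \<tau>))"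
    by (rule uhp_partials_compose[OF G md mH])
  have wpos: "Im w > 0"
    using c v by (simp add: w_def c_def)
  have "sl2_act g w = Complex x (1 / (c\<^sup>2 * (1 / (c\<^sup>2 * v))))"
    unfolding w_def x_def c_def by (rule sl2_act_vertical[OF g c0]) (use c v in \<open>simp add: c_def\<close>)
  then have gw: "sl2_act g w = Complex x v"
    using c by simp
  have mw: "m (Complex x v) = w"
  proof -
    have "of_real c * w + complex_of_real d \<noteq> 0"
      using det wpos by (intro linear_nonzero_uhp) auto
    then show ?thesis
      using moebius_inverse[of "complex_of_real a" "complex_of_real d" "complex_of_real b" "complex_of_real c" w] detC
      unfolding gw[symmetric] g_m m_def by simp
  qed
  have px: "p (Complex x v) = - of_real (1 / (c * v)\<^sup>2)"
  proof -
    have "of_real (- c) * Complex x v + complex_of_real a = - \<i> * of_real (c * v)"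
      using c by (simp add: x_def complex_eq_iff abd c_def)
    then show ?thesis
      by (simp add: p_def power_mult_distrib)
  qed
  have pos: "Im (Complex x v) > 0"
    using v by simp
  show "F (Complex x v) = G w"
    using GF[OF pos] by (simp only: mw)
  have "of_real (Re (p (Complex x v))) = - complex_of_real (1 / (c * v)\<^sup>2)" "Im (p (Complex x v)) = 0"
    unfolding px by simp_all
  note P = this
  have "of_real (Re (p (Complex x v))) * Gu (m (Complex x v)) + of_real (Im (p (Complex x v))) * Gv (m (Complex x v)) = Fu (Complex x v)"
    by (rule uhp_partials_unique(1)[OF comp F GF pos])
  then show "Fu (Complex x v) = - of_real (1 / (c * v)\<^sup>2) * Gu w"
    unfolding P mw by simp
  have "of_real (Re (p (Complex x v))) * Gv (m (Complex x v)) - of_real (Im (p (Complex x v))) * Gu (m (Complex x v)) = Fv (Complex x v)"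
    by (rule uhp_partials_unique(2)[OF comp F GF pos])
  then show "Fv (Complex x v) = - of_real (1 / (c * v)\<^sup>2) * Gv w"
    unfolding P mw by simp
qed

text \<open>Exponential decay in the height 1 / (c^2 v) beats every power of v. The sixth power is
  taken so that a fourth power survives the derivative factor 1 / (c v)^2, enough for the division
  by powers of v in all kernels that follow.\<close>

lemma decay_near_cusp:
  assumes dec: "decays_at_infinity G Gu Gv" and c: "\<bar>c\<bar> \<ge> 1"
  shows "\<exists>K\<ge>0. \<forall>v. 0 < v \<and> v \<le> 1 / c\<^sup>2 \<longrightarrow> norm (G (Complex u (1 / (c\<^sup>2 * v)))) \<le> K * v ^ 6 \<and>
    norm (- of_real (1 / (c * v)\<^sup>2) * Gu (Complex u (1 / (c\<^sup>2 * v)))) \<le> K * v ^ 4 \<and>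
    norm (- of_real (1 / (c * v)\<^sup>2) * Gv (Complex u (1 / (c\<^sup>2 * v)))) \<le> K * v ^ 4"
proof -
  obtain C e where e: "e > 0" and C: "\<And>\<tau>. Im \<tau> \<ge> 1 \<Longrightarrow> norm (G \<tau>) \<le> C * exp (- e * Im \<tau>) \<and>
      norm (Gu \<tau>) \<le> C * exp (- e * Im \<tau>) \<and> norm (Gv \<tau>) \<le> C * exp (- e * Im \<tau>)"
    using dec unfolding decays_at_infinity_def by blast
  have c2: "c\<^sup>2 \<ge> 1"
    using c by (metis one_le_power power2_abs)
  define K where "K = \<bar>C\<bar> * (fact 6 / (e / c\<^sup>2) ^ 6)"
  have K: "K \<ge> 0"
    using e by (simp add: K_def)
  have "norm (G (Complex u (1 / (c\<^sup>2 * v)))) \<le> K * v ^ 6 \<and>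
    norm (- of_real (1 / (c * v)\<^sup>2) * Gu (Complex u (1 / (c\<^sup>2 * v)))) \<le> K * v ^ 4 \<and>
    norm (- of_real (1 / (c * v)\<^sup>2) * Gv (Complex u (1 / (c\<^sup>2 * v)))) \<le> K * v ^ 4"
    if v: "0 < v" "v \<le> 1 / c\<^sup>2" for v
  proof -
    let ?y = "1 / (c\<^sup>2 * v)"
    have y: "?y \<ge> 1" "?y > 0"
    proof -
      have cp: "c\<^sup>2 > 0"
        using c2 by linarith
      then have "c\<^sup>2 * v \<le> 1"
        using v(2) by (simp add: pos_le_divide_eq mult.commute)
      then show "?y \<ge> 1" "?y > 0"
        using cp v(1) by simp_all
    qed
    have "C * exp (- e * ?y) \<le> \<bar>C\<bar> * (fact 6 / (e * ?y) ^ 6)"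
      by (intro mult_mono exp_neg_le_power e y) auto
    also have "\<dots> = K * v ^ 6"
    proof -
      have "(e * ?y) ^ 6 = (e / c\<^sup>2) ^ 6 / v ^ 6"
        by (simp add: power_divide power_mult_distrib)
      then show ?thesis
        by (simp add: K_def)
    qed
    finally have exp6: "C * exp (- e * ?y) \<le> K * v ^ 6" .
    have key: "norm (- of_real (1 / (c * v)\<^sup>2) * z) \<le> K * v ^ 4" if "norm z \<le> K * v ^ 6" for z :: complex
    proof -
      have "norm (- of_real (1 / (c * v)\<^sup>2) * z) = 1 / (c * v)\<^sup>2 * norm z"
        unfolding norm_mult norm_minus_cancel norm_of_real by simp
      also have "\<dots> \<le> 1 / v\<^sup>2 * (K * v ^ 6)"
      proof (intro mult_mono that)
        have "1 * v\<^sup>2 \<le> c\<^sup>2 * v\<^sup>2"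
          using c2 by (intro mult_right_mono) auto
        then show "1 / (c * v)\<^sup>2 \<le> 1 / v\<^sup>2"
          using v c by (intro divide_left_mono) (auto simp: power_mult_distrib intro!: mult_pos_pos)
      qed auto
      also have "\<dots> = K * v ^ 4"
        using v by (simp add: power2_eq_square numeral_eq_Suc)
      finally show ?thesis .
    qed
    have "norm (G (Complex u ?y)) \<le> K * v ^ 6" "norm (Gu (Complex u ?y)) \<le> K * v ^ 6" "norm (Gv (Complex u ?y)) \<le> K * v ^ 6"
      using C[of "Complex u ?y"] exp6 y by auto
    then show ?thesis
      using key by blast
  qed
  then show ?thesis
    using K by blast
qed

lemma decay_power_at_infinity:
  assumes "decays_at_infinity F Fu Fv"
  shows "\<exists>K\<ge>0. \<forall>\<tau>. Im \<tau> \<ge> 1 \<longrightarrow> norm (F \<tau>) \<le> K / Im \<tau> ^ 4 \<and> norm (Fu \<tau>) \<le> K / Im \<tau> ^ 4 \<and> norm (Fv \<tau>) \<le> K / Im \<tau> ^ 4"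
proof -
  obtain C e where e: "e > 0" and C: "\<And>\<tau>. Im \<tau> \<ge> 1 \<Longrightarrow> norm (F \<tau>) \<le> C * exp (- e * Im \<tau>) \<and>
      norm (Fu \<tau>) \<le> C * exp (- e * Im \<tau>) \<and> norm (Fv \<tau>) \<le> C * exp (- e * Im \<tau>)"
    using assms unfolding decays_at_infinity_def by blast
  define K where "K = \<bar>C\<bar> * (fact 4 / e ^ 4)"
  have K: "K \<ge> 0"
    using e by (simp add: K_def)
  have "C * exp (- e * v) \<le> K / v ^ 4" if "v \<ge> 1" for v
  proof -
    have "C * exp (- e * v) \<le> \<bar>C\<bar> * (fact 4 / (e * v) ^ 4)"
      using that by (intro mult_mono exp_neg_le_power e) auto
    then show ?thesis
      by (simp add: K_def power_mult_distrib)
  qed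
  then have "norm (F \<tau>) \<le> K / Im \<tau> ^ 4 \<and> norm (Fu \<tau>) \<le> K / Im \<tau> ^ 4 \<and> norm (Fv \<tau>) \<le> K / Im \<tau> ^ 4" if "Im \<tau> \<ge> 1" for \<tau>
    using C[OF that] that by (auto intro: order_trans[of _ "C * exp (- e * Im \<tau>)"])
  then show ?thesis
    using K by blast
qed

lemma SL2Z_c_ge_1: "(g :: int^2^2)$2$1 \<noteq> 0 \<Longrightarrow> \<bar>real_of_int (g$2$1)\<bar> \<ge> 1"
  by linarith

lemma continuous_on_vertical:
  assumes "continuous_on upper_half_plane F"
  shows "continuous_on {0<..} (\<lambda>v. F (Complex x v))"
  by (rule continuous_on_compose2[OF assms])
     (auto simp: Complex_eq upper_half_plane_def intro!: continuous_intros)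

text \<open>Both ends of the line, q and infinity, are cuspidal cusps, and F and its derivative in u
  vanish there to fourth order. The convergence of the integrals of the Green form over this line
  rests on it.\<close>

lemma vertical_line_bounds:
  assumes F: "eigenfunction F Fu Fv" and dec: "decays_at_infinity F Fu Fv"
    and cusp: "cuspidal_at F (Fin q)"
  shows "\<exists>C\<ge>0. \<forall>v>0. norm (F (Complex (of_rat q) v)) \<le> C * v ^ 4 \<and> norm (F (Complex (of_rat q) v)) \<le> C / v ^ 4 \<and>
    norm (Fu (Complex (of_rat q) v)) \<le> C * v ^ 4 \<and> norm (Fu (Complex (of_rat q) v)) \<le> C / v ^ 4"
proof -
  obtain g Gu Gv where g: "g \<in> carrier SL2Z" "cusp_act g Infty = Fin q"
    and G: "uhp_partials (\<lambda>\<tau>. F (sl2_act g \<tau>)) Gu Gv" and decG: "decays_at_infinity (\<lambda>\<tau>. F (sl2_act g \<tau>)) Gu Gv"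
    using cuspidal_at_decays[OF F cusp] by blast
  have c0: "g$2$1 \<noteq> 0" and q: "q = of_int (g$1$1) / of_int (g$2$1)"
    using g(2) by (auto split: if_splits)
  have x: "of_rat q = real_of_int (g$1$1) / real_of_int (g$2$1)"
    by (simp add: q of_rat_divide)
  let ?c = "real_of_int (g$2$1)"
  note vals = cusp_line_values[OF g(1) c0 G eigenfunction_imp_partials[OF F] refl, folded x]
  obtain K where K: "K \<ge> 0" "\<And>v. 0 < v \<Longrightarrow> v \<le> 1 / ?c\<^sup>2 \<Longrightarrow> norm (F (Complex (of_rat q) v)) \<le> K * v ^ 6 \<and>
    norm (Fu (Complex (of_rat q) v)) \<le> K * v ^ 4"
    using decay_near_cusp[OF decG SL2Z_c_ge_1[OF c0], of "- real_of_int (g$2$2) / ?c"] vals by auto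
  obtain K' where K': "\<And>\<tau>. Im \<tau> \<ge> 1 \<Longrightarrow> norm (F \<tau>) \<le> K' / Im \<tau> ^ 4 \<and> norm (Fu \<tau>) \<le> K' / Im \<tau> ^ 4"
    using decay_power_at_infinity[OF dec] by blast
  have c2: "?c\<^sup>2 \<ge> 1"
    using SL2Z_c_ge_1[OF c0] by (metis one_le_power power2_abs)
  have "\<exists>C\<ge>0. \<forall>v>0. norm (F (Complex (of_rat q) v)) \<le> C * v ^ 4 \<and> norm (F (Complex (of_rat q) v)) \<le> C / v ^ 4"
  proof (rule two_sided_bound[where K = K and K' = K' and d = "1 / ?c\<^sup>2"])
    show "0 < 1 / ?c\<^sup>2" "1 / ?c\<^sup>2 \<le> 1"
      using c2 by (auto simp: divide_le_eq_1)
    fix v :: real assume v: "0 < v" "v \<le> 1 / ?c\<^sup>2"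
    then have "v \<le> 1"
      using \<open>1 / ?c\<^sup>2 \<le> 1\<close> by linarith
    have "norm (F (Complex (of_rat q) v)) \<le> K * v ^ 6"
      using K(2)[OF v] by blast
    also have "\<dots> \<le> K * v ^ 4"
      using K(1) v \<open>v \<le> 1\<close> by (intro mult_left_mono power_decreasing) auto
    finally show "norm (F (Complex (of_rat q) v)) \<le> K * v ^ 4" .
  next
    show "norm (F (Complex (of_rat q) v)) \<le> K' / v ^ 4" if "v \<ge> 1" for v
      using K'[of "Complex (of_rat q) v"] that by simp
  qed (rule continuous_on_vertical[OF eigenfunction_continuous_on(1)[OF F]])
  then obtain C1 where C1: "C1 \<ge> 0" "\<And>v. v > 0 \<Longrightarrow> norm (F (Complex (of_rat q) v)) \<le> C1 * v ^ 4 \<and> norm (F (Complex (of_rat q) v)) \<le> C1 / v ^ 4"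
    by blast
  have "\<exists>C\<ge>0. \<forall>v>0. norm (Fu (Complex (of_rat q) v)) \<le> C * v ^ 4 \<and> norm (Fu (Complex (of_rat q) v)) \<le> C / v ^ 4"
  proof (rule two_sided_bound[where K = K and K' = K' and d = "1 / ?c\<^sup>2"])
    show "0 < 1 / ?c\<^sup>2" "1 / ?c\<^sup>2 \<le> 1"
      using c2 by (auto simp: divide_le_eq_1)
    show "norm (Fu (Complex (of_rat q) v)) \<le> K * v ^ 4" if "0 < v" "v \<le> 1 / ?c\<^sup>2" for v
      using K(2)[OF that] by blast
    show "norm (Fu (Complex (of_rat q) v)) \<le> K' / v ^ 4" if "v \<ge> 1" for v
      using K'[of "Complex (of_rat q) v"] that by simp
  qed (rule continuous_on_vertical[OF eigenfunction_continuous_on(2)[OF F]])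
  then obtain C2 where C2: "C2 \<ge> 0" "\<And>v. v > 0 \<Longrightarrow> norm (Fu (Complex (of_rat q) v)) \<le> C2 * v ^ 4 \<and> norm (Fu (Complex (of_rat q) v)) \<le> C2 / v ^ 4"
    by blast
  have m: "C1 * z \<le> (C1 + C2) * z" "C2 * z \<le> (C1 + C2) * z" if "z \<ge> 0" for z
    using C1(1) C2(1) that by (auto intro: mult_right_mono)
  have d: "C1 / z \<le> (C1 + C2) / z" "C2 / z \<le> (C1 + C2) / z" if "z \<ge> 0" for z
    using C1(1) C2(1) that by (auto intro: divide_right_mono)
  show ?thesis
  proof (intro exI[of _ "C1 + C2"] conjI allI impI)
    show "C1 + C2 \<ge> 0" using C1(1) C2(1) by simp
    fix v :: real assume v: "v > 0"
    then have z: "v ^ 4 \<ge> 0" by simp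
    show "norm (F (Complex (of_rat q) v)) \<le> (C1 + C2) * v ^ 4" "norm (F (Complex (of_rat q) v)) \<le> (C1 + C2) / v ^ 4"
      "norm (Fu (Complex (of_rat q) v)) \<le> (C1 + C2) * v ^ 4" "norm (Fu (Complex (of_rat q) v)) \<le> (C1 + C2) / v ^ 4"
      using C1(2)[OF v] C2(2)[OF v] m[OF z] d[OF z] by linarith+
  qed
qed

section \<open>Integrals for the divergent leading term\<close>

lemma inverse_cube_has_integral:
  "((\<lambda>m. 1 / sqrt (1 + m\<^sup>2) ^ 3) has_integral 1) {0<..}"
proof -
  have "((\<lambda>m. 1 / sqrt (1 + m\<^sup>2) ^ 3) has_integral 1 - 0 / sqrt (1 + 0\<^sup>2)) {0<..}"
  proof (rule has_integral_FTC_Ioi)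
    fix m :: real
    have p: "1 + m\<^sup>2 > 0"
      by (simp add: add_pos_nonneg)
    have "((\<lambda>m. m / sqrt (1 + m\<^sup>2)) has_real_derivative (1 * sqrt (1 + m\<^sup>2) - m * (2 * m * (inverse (sqrt (1 + m\<^sup>2)) / 2))) / (sqrt (1 + m\<^sup>2) * sqrt (1 + m\<^sup>2))) (at m)"
      using p by (intro DERIV_divide) (auto intro!: derivative_eq_intros)
    moreover have alg: "(1 * q - m * (2 * m * (inverse q / 2))) / (q * q) = 1 / q ^ 3" if "q\<^sup>2 = 1 + m\<^sup>2" "q > 0" for q
    proof -
      have "(1 * q - m * (2 * m * (inverse q / 2))) / (q * q) = (q\<^sup>2 - m\<^sup>2) / q ^ 3"
        using that(2) by (simp add: field_simps power2_eq_square power3_eq_cube)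
      then show ?thesis
        using that(1) by simp
    qed
    moreover have "(sqrt (1 + m\<^sup>2))\<^sup>2 = 1 + m\<^sup>2" "sqrt (1 + m\<^sup>2) > 0"
      using p by simp_all
    ultimately show "((\<lambda>m. m / sqrt (1 + m\<^sup>2)) has_real_derivative 1 / sqrt (1 + m\<^sup>2) ^ 3) (at m)"
      by (simp only: alg)
    show "0 \<le> 1 / sqrt (1 + m\<^sup>2) ^ 3"
      using p by simp
  next
    show "((\<lambda>m. m / sqrt (1 + m\<^sup>2)) \<longlongrightarrow> 1) at_top"
      by real_asymp
  qed simp
  then show ?thesis by simp
qed

lemma log_cube_integrable:
  "(\<lambda>m. ln (sqrt (1 + m\<^sup>2)) / sqrt (1 + m\<^sup>2) ^ 3) integrable_on {0<..}"
proof (rule set_lebesgue_integral_eq_integral(1), rule measurable_bounded_by_integrable_imp_absolutely_integrable)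
  have p: "sqrt (1 + m\<^sup>2) > 0" "sqrt (1 + m\<^sup>2) \<ge> 1" for m :: real
    by (simp_all add: add_pos_nonneg)
  show "(\<lambda>m. ln (sqrt (1 + m\<^sup>2)) / sqrt (1 + m\<^sup>2) ^ 3) \<in> borel_measurable (lebesgue_on {0<..})"
    by (intro continuous_imp_measurable_on_sets_lebesgue continuous_intros) (use p in \<open>auto simp: less_imp_neq[symmetric]\<close>)
  show "(\<lambda>m::real. 1 / (1 + m\<^sup>2)) integrable_on {0<..}"
    using inverse_square_has_integral by (rule has_integral_integrable)
  fix m :: real
  let ?q = "sqrt (1 + m\<^sup>2)"
  have "ln ?q \<le> ?q"
    using ln_le_minus_one[OF p(1)[of m]] by simp
  have "norm (ln ?q / ?q ^ 3) = ln ?q / ?q ^ 3"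
    using p[of m] by simp
  also have "\<dots> \<le> ?q / ?q ^ 3"
    using p(1)[of m] \<open>ln ?q \<le> ?q\<close> by (intro divide_right_mono) auto
  also have "\<dots> = 1 / ?q\<^sup>2"
    using p(1)[of m] by (simp add: power2_eq_square power3_eq_cube)
  finally show "norm (ln ?q / ?q ^ 3) \<le> 1 / (1 + m\<^sup>2)"
    by (simp add: add_nonneg_nonneg)
qed auto

section \<open>Asymptotics at a cusp\<close>

text \<open>Applied with \<rho>^2 = y^2 + s^2, it merges a bound near 0 and a bound of order 1 /
  \<rho>^2 into a majorant in s that does not depend on y, as dominated convergence for y tending to
  0 requires.\<close>

lemma cauchy_bound:
  fixes z \<rho> s C D :: real
  assumes "z \<le> C" "z \<le> D / \<rho>\<^sup>2" "0 \<le> C" "0 \<le> D" "\<rho> > 0" "s\<^sup>2 \<le> \<rho>\<^sup>2"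
  shows "z \<le> (C + D) * (1 / (1 + s\<^sup>2))"
proof -
  have p: "1 + \<rho>\<^sup>2 > 0" "1 + s\<^sup>2 > 0"
    by (simp_all add: add_pos_nonneg)
  have "z * \<rho>\<^sup>2 \<le> D"
    using assms(2,5) by (simp add: pos_le_divide_eq)
  then have "z * (1 + \<rho>\<^sup>2) \<le> C + D"
    using assms(1) by (simp add: algebra_simps)
  then have "z \<le> (C + D) / (1 + \<rho>\<^sup>2)"
    using p by (simp add: pos_le_divide_eq)
  also have "\<dots> \<le> (C + D) / (1 + s\<^sup>2)"
    using assms p by (intro divide_left_mono) auto
  finally show ?thesis by simp
qed

text \<open>Comparison of \<open>\<kappa>\<^sub>1 v\<^bsup>1/2\<^esup> + \<kappa>\<^sub>2 v\<^bsup>1/2\<^esup> log v\<close> in the coordinate \<open>1 / (r\<^sup>2 s\<^sup>2)\<close> with the leading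
  term in the coordinate \<open>v = s\<^sup>2\<close>; here \<open>l\<close> is the logarithm of the former.\<close>

lemma leading_term_identity:
  fixes r s l k1 k2 :: complex
  assumes "r \<noteq> 0" "s \<noteq> 0"
  shows "- (1 / (r * s\<^sup>2)\<^sup>2) * (k1 * (r * s / 2) + k2 * (l * (r * s) / 2 + r * s)) / s
    - (k1 * (1 / (r * s)) + k2 * (1 / (r * s) * l)) / (2 * s\<^sup>2 * s) + (k1 + k2 + k2 * l) / r / (s\<^sup>2)\<^sup>2 = 0"
  using assms by (simp add: field_simps power2_eq_square)

text \<open>Dominated convergence is applied to sequences, so the limit at 0 from the right is
  tested along arbitrary positive null sequences.\<close>

lemma tendsto_at_right_0I:
  fixes f :: "real \<Rightarrow> 'a::topological_space"
  assumes "\<And>X. (\<And>n. X n > 0) \<Longrightarrow> X \<longlonglongrightarrow> 0 \<Longrightarrow> (\<lambda>n. f (X n)) \<longlonglongrightarrow> L"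
  shows "(f \<longlongrightarrow> L) (at_right 0)"
  unfolding tendsto_at_iff_sequentially
proof (intro allI impI)
  fix X :: "nat \<Rightarrow> real" assume "\<forall>i. X i \<in> {0<..} - {0}" and "X \<longlonglongrightarrow> 0"
  then have "(\<lambda>n. f (X n)) \<longlonglongrightarrow> L"
    by (intro assms) auto
  then show "(f \<circ> X) \<longlonglongrightarrow> L"
    by (simp add: o_def)
qed

text \<open>The Abel transform of the singular part that the constants of the expansion produce.
  Scaling s = y m extracts 1/y and log y; the integral of (1 + m^2)^(-3/2) is 1, and
  \<open>I2\<close> enters as a finite constant.\<close>

lemma model_integral:
  fixes al be :: complex
  assumes y: "y > 0"
  defines "I2 \<equiv> integral {0<..} (\<lambda>m. ln (sqrt (1 + m\<^sup>2)) / sqrt (1 + m\<^sup>2) ^ 3)"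
  shows "((\<lambda>s. of_real (y / sqrt (y\<^sup>2 + s\<^sup>2)) * ((al - be * of_real (ln (sqrt (y\<^sup>2 + s\<^sup>2)))) / of_real ((sqrt (y\<^sup>2 + s\<^sup>2))\<^sup>2)))
    has_integral (al - be * of_real (ln y) - be * of_real I2) / of_real y) {0<..}"
proof -
  let ?q = "\<lambda>m. sqrt (1 + m\<^sup>2)" and ?r = "\<lambda>s. sqrt (y\<^sup>2 + s\<^sup>2)"
  have q: "?q m \<ge> 1" "?q m > 0" for m :: real
    by (simp_all add: add_pos_nonneg)
  have r: "?r (y * m) = y * ?q m" for m
  proof -
    have "y\<^sup>2 + (y * m)\<^sup>2 = y\<^sup>2 * (1 + m\<^sup>2)"
      by (simp add: algebra_simps power_mult_distrib)
    then show ?thesis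
      using y by (simp add: real_sqrt_mult)
  qed
  have ry: "?r s \<ge> y" "?r s > 0" for s
    using y by (auto intro: real_le_rsqrt simp: add_pos_nonneg)
  have "((\<lambda>s. y / ?r s ^ 3) has_integral 1 / y) {0<..}"
  proof (rule has_integral_scale_substitution[OF y, THEN iffD1])
    have "y * (y / (y * q) ^ 3) = 1 / q ^ 3 / y" if "q > 0" for q
      using y that by (simp add: field_simps power3_eq_cube)
    then show "((\<lambda>m. y * (y / ?r (y * m) ^ 3)) has_integral 1 / y) {0<..}"
      using has_integral_divide[OF inverse_cube_has_integral, of y] q(2) by (simp add: r)
    show "0 \<le> y / ?r s ^ 3" for s
      using y ry(2)[of s] by simp
  qed
  note f1 = has_integral_linear[OF this bounded_linear_of_real, unfolded o_def]
  have "((\<lambda>s. y * ln (?r s / y) / ?r s ^ 3) has_integral I2 / y) {0<..}"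
  proof (rule has_integral_scale_substitution[OF y, THEN iffD1])
    have "y * (y * ln (y * q / y) / (y * q) ^ 3) = ln q / q ^ 3 / y" if "q > 0" for q
      using y that by (simp add: field_simps power3_eq_cube)
    then show "((\<lambda>m. y * (y * ln (?r (y * m) / y) / ?r (y * m) ^ 3)) has_integral I2 / y) {0<..}"
      using has_integral_divide[OF integrable_integral[OF log_cube_integrable], of y] q(2) by (simp add: r I2_def)
    show "0 \<le> y * ln (?r s / y) / ?r s ^ 3" for s
      using y ry[of s] by simp
  qed
  note f2 = has_integral_linear[OF this bounded_linear_of_real, unfolded o_def]
  have "((\<lambda>s. (al - be * of_real (ln y)) * of_real (y / ?r s ^ 3) - be * of_real (y * ln (?r s / y) / ?r s ^ 3)) has_integral
      (al - be * of_real (ln y)) * of_real (1 / y) - be * of_real (I2 / y)) {0<..}"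
    by (intro has_integral_diff has_integral_mult_right f1 f2)
  moreover have "(al - be * of_real (ln y)) * of_real (1 / y) - be * of_real (I2 / y) =
      (al - be * of_real (ln y) - be * of_real I2) / of_real y"
    by (simp add: diff_divide_distrib)
  moreover have "(al - be * of_real (ln y)) * of_real (y / ?r s ^ 3) - be * of_real (y * ln (?r s / y) / ?r s ^ 3) =
      of_real (y / ?r s) * ((al - be * of_real (ln (?r s))) / of_real ((?r s)\<^sup>2))" for s
  proof -
    have l: "ln (?r s / y) = ln (?r s) - ln y"
      using ry(2)[of s] y by (simp add: ln_div)
    have alg: "(al - be * ly) * (yy / R ^ 3) - be * (yy * (lr - ly) / R ^ 3) = (yy / R) * ((al - be * lr) / R\<^sup>2)"
      if "R \<noteq> 0" for ly yy R lr :: complex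
      using that by (simp add: field_simps power2_eq_square power3_eq_cube)
    have "?r s \<noteq> 0"
      using ry(2)[of s] by (rule less_imp_neq[THEN not_sym])
    then have "complex_of_real (?r s) \<noteq> 0"
      unfolding of_real_eq_0_iff .
    from alg[OF this] show ?thesis
      unfolding l by (simp only: of_real_mult of_real_divide of_real_power of_real_diff)
  qed
  ultimately show ?thesis by simp
qed

text \<open>One asymptotic formula serves both directions: for k1 = k2 = 0 it yields the value at a
  cuspidal cusp, in general it exhibits the divergence. In the coordinate 1 / (r^2 v) the leading
  part of F / v^(1/2) is (k1 + k2 l) / (r v) with l = - log r^2 - log v; its derivative is -
  (\<open>al\<close> - \<open>be\<close> log v) / v^2, where the extra k2 in \<open>al\<close> stems
  from differentiating l.\<close>

lemma F_plus_at_cusp: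
  assumes N: "N > 0" and F: "eigenfunction F Fu Fv" and expF: "has_cusp_expansion N F 0 0 A"
    and g: "g \<in> carrier SL2Z" and c0: "g$2$1 \<noteq> 0" and h: "h > 0"
    and expG: "has_cusp_expansion h (\<lambda>\<tau>. F (sl2_act g \<tau>)) k1 k2 a"
  defines "x \<equiv> real_of_int (g$1$1) / real_of_int (g$2$1)"
    and "r \<equiv> \<bar>real_of_int (g$2$1)\<bar>"
    and "I2 \<equiv> integral {0<..} (\<lambda>m. ln (sqrt (1 + m\<^sup>2)) / sqrt (1 + m\<^sup>2) ^ 3)"
  defines "al \<equiv> (k1 + k2 - k2 * of_real (ln (r\<^sup>2))) / of_real r" and "be \<equiv> k2 / of_real r"
  shows "((\<lambda>y. F_plus N A (Complex x y) - (al - be * of_real (ln y) - be * of_real I2) / (of_real pi * of_real y)) \<longlongrightarrow>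
    - (\<i> / of_real pi) * integral {0<..} (\<lambda>v. Fu (Complex x v) / of_real (sqrt v))) (at_right 0)"
proof -
  let ?c = "real_of_int (g$2$1)"
  let ?w = "\<lambda>v. Complex (- real_of_int (g$2$2) / ?c) (1 / (?c\<^sup>2 * v))"
  have r1: "r \<ge> 1" and rc: "r\<^sup>2 = ?c\<^sup>2"
    using SL2Z_c_ge_1[OF c0] by (simp_all add: r_def)
  have FP: "uhp_partials F Fu Fv"
    by (rule eigenfunction_imp_partials[OF F])
  obtain Gu Gv where "eigenfunction (\<lambda>\<tau>. F (sl2_act g \<tau>)) Gu Gv"
    using eigenfunction_sl2_act[OF F g] by blast
  then have G: "uhp_partials (\<lambda>\<tau>. F (sl2_act g \<tau>)) Gu Gv"
    by (rule eigenfunction_imp_partials)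
  \<comment> \<open>The terms of frequency zero at the cusp. What is left after subtracting them is
    a pure Bessel series, which decays exponentially.\<close>
  define mo where "mo \<tau> = k1 * of_real (sqrt (Im \<tau>)) + k2 * of_real (sqrt (Im \<tau>) * ln (Im \<tau>))" for \<tau>
  define mov where "mov \<tau> = k1 * of_real (1 / (2 * sqrt (Im \<tau>))) + k2 * of_real (ln (Im \<tau>) / (2 * sqrt (Im \<tau>)) + 1 / sqrt (Im \<tau>))" for \<tau>
  have mo: "uhp_partials mo (\<lambda>\<tau>. k1 * 0 + k2 * 0) mov"
    unfolding mo_def[abs_def] mov_def[abs_def]
  proof (intro uhp_partials_add uhp_partials_cmult uhp_partials_vertical)
    fix v :: real assume v: "v > 0"
    show s: "(sqrt has_real_derivative 1 / (2 * sqrt v)) (at v)"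
      using v by (auto intro!: derivative_eq_intros simp: field_simps)
    have "((\<lambda>v. sqrt v * ln v) has_real_derivative 1 / (2 * sqrt v) * ln v + 1 / v * sqrt v) (at v)"
      using v by (intro DERIV_mult s) (auto intro!: derivative_eq_intros)
    moreover have "1 / v * sqrt v = 1 / sqrt v"
      using v by (simp add: field_simps)
    ultimately show "((\<lambda>v. sqrt v * ln v) has_real_derivative ln v / (2 * sqrt v) + 1 / sqrt v) (at v)"
      by simp
  qed
  let ?H = "\<lambda>\<tau>. F (sl2_act g \<tau>) - mo \<tau>" and ?Hu = "\<lambda>\<tau>. Gu \<tau> - (k1 * 0 + k2 * 0)" and ?Hv = "\<lambda>\<tau>. Gv \<tau> - mov \<tau>"
  have decH: "decays_at_infinity ?H ?Hu ?Hv"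
  proof (rule bessel_expansion_decays[OF h _ uhp_partials_diff[OF G mo]])
    show "subexponential a"
      using expG by (simp add: has_cusp_expansion_iff[OF h])
    show "?H \<tau> = of_real (sqrt (Im \<tau>)) * bessel_series h 0 a (Re \<tau>) (Im \<tau>)" if "Im \<tau> > 0" for \<tau>
      using expG that by (simp add: has_cusp_expansion_iff[OF h] upper_half_plane_def mo_def)
  qed
  obtain K where K: "K \<ge> 0" and KH: "\<And>v. 0 < v \<Longrightarrow> v \<le> 1 / ?c\<^sup>2 \<Longrightarrow> norm (?H (?w v)) \<le> K * v ^ 6 \<and>
      norm (- of_real (1 / (?c * v)\<^sup>2) * ?Hu (?w v)) \<le> K * v ^ 4 \<and> norm (- of_real (1 / (?c * v)\<^sup>2) * ?Hv (?w v)) \<le> K * v ^ 4"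
    using decay_near_cusp[OF decH SL2Z_c_ge_1[OF c0], of "- real_of_int (g$2$2) / ?c"] by blast
  have AF: "subexponential A" and eqF: "\<And>\<tau>. Im \<tau> > 0 \<Longrightarrow> F \<tau> = of_real (sqrt (Im \<tau>)) * bessel_series N 0 A (Re \<tau>) (Im \<tau>)"
    using expF by (simp_all add: has_cusp_expansion_iff[OF N] upper_half_plane_def)
  obtain K' where K': "K' \<ge> 0" "\<And>\<tau>. Im \<tau> \<ge> 1 \<Longrightarrow> norm (F \<tau>) \<le> K' / Im \<tau> ^ 4 \<and> norm (Fu \<tau>) \<le> K' / Im \<tau> ^ 4 \<and> norm (Fv \<tau>) \<le> K' / Im \<tau> ^ 4"
    using decay_power_at_infinity[OF cuspidal_expansion_decays[OF N FP expF]] by blast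
  have vals: "F (Complex x v) = F (sl2_act g (?w v))" "Fu (Complex x v) = - of_real (1 / (?c * v)\<^sup>2) * Gu (?w v)"
      "Fv (Complex x v) = - of_real (1 / (?c * v)\<^sup>2) * Gv (?w v)" if "v > 0" for v
    unfolding x_def by (rule cusp_line_values[OF g c0 G FP refl that])+
  have d: "0 < 1 / ?c\<^sup>2" "1 / ?c\<^sup>2 \<le> 1"
  proof -
    have "?c\<^sup>2 \<ge> 1"
      using r1 unfolding rc[symmetric] by (rule one_le_power)
    then show "0 < 1 / ?c\<^sup>2" "1 / ?c\<^sup>2 \<le> 1"
      by (auto simp: divide_le_eq_1)
  qed
  \<comment> \<open>\<open>fu\<close> and \<open>fv\<close> are the partials of F / v^(1/2) on the
    line; \<open>ps\<close> is \<open>fv\<close> freed from its singular part at v = 0.\<close>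
  define fu where "fu v = Fu (Complex x v) / of_real (sqrt v)" for v
  define fv where "fv v = Fv (Complex x v) / of_real (sqrt v) - F (Complex x v) / of_real (2 * v * sqrt v)" for v
  define ps where "ps v = fv v + (al - be * of_real (ln v)) / of_real (v\<^sup>2)" for v
  note cont = continuous_on_vertical[OF eigenfunction_continuous_on(1)[OF F]]
    continuous_on_vertical[OF eigenfunction_continuous_on(2)[OF F]]
    continuous_on_vertical[OF eigenfunction_continuous_on(3)[OF F]]
  have cfu: "continuous_on {0<..} fu"
    unfolding fu_def by (intro continuous_intros cont) auto
  have cps: "continuous_on {0<..} ps"
    unfolding ps_def fv_def by (intro continuous_intros cont) auto
  have small: "v ^ 4 \<le> sqrt v" "v ^ 6 \<le> v * sqrt v" if "0 < v" "v \<le> 1" for v :: real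
  proof -
    have s: "v \<le> sqrt v"
      using that by (intro real_le_rsqrt) (simp add: power2_eq_square mult_left_le)
    have "v ^ 4 \<le> v ^ 1"
      using that by (intro power_decreasing) auto
    then show "v ^ 4 \<le> sqrt v"
      using s by simp
    have "v ^ 6 \<le> v ^ 2"
      using that by (intro power_decreasing) auto
    also have "\<dots> \<le> v * sqrt v"
      using s that by (simp add: power2_eq_square mult_left_mono)
    finally show "v ^ 6 \<le> v * sqrt v" .
  qed
  have "\<exists>C\<ge>0. \<forall>v>0. norm (fu v) \<le> C * v ^ 0 \<and> norm (fu v) \<le> C / v ^ 2"
  proof (rule two_sided_bound[OF cfu d])
    fix v :: real assume v: "0 < v" "v \<le> 1 / ?c\<^sup>2"
    then have v1: "v \<le> 1" using d by linarith
    have "norm (Fu (Complex x v)) \<le> K * v ^ 4"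
      using KH[OF v] by (simp add: vals[OF v(1)])
    also have "\<dots> \<le> K * sqrt v"
      by (rule mult_left_mono[OF small(1)[OF v(1) v1] K])
    finally show "norm (fu v) \<le> K * v ^ 0"
      using v by (simp add: fu_def norm_divide pos_divide_le_eq)
  next
    fix v :: real assume v: "v \<ge> 1"
    have "norm (fu v) = norm (Fu (Complex x v)) / sqrt v"
      using v by (simp add: fu_def norm_divide)
    also have "\<dots> \<le> (K' / v ^ 4) / 1"
      using K'(2)[of "Complex x v"] K'(1) v by (intro frac_le) auto
    also have "\<dots> \<le> K' / v ^ 2"
      using K'(1) v by (simp add: frac_le power_increasing)
    finally show "norm (fu v) \<le> K' / v ^ 2" .
  qed
  then obtain C1 where C1: "C1 \<ge> 0" "\<And>v. v > 0 \<Longrightarrow> norm (fu v) \<le> C1 \<and> norm (fu v) \<le> C1 / v ^ 2"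
    by auto
  have ps_eq: "ps v = - of_real (1 / (?c * v)\<^sup>2) * ?Hv (?w v) / of_real (sqrt v) - ?H (?w v) / of_real (2 * v * sqrt v)"
    if v: "v > 0" for v
  proof -
    define S where "S = complex_of_real (sqrt v)"
    define R where "R = complex_of_real r"
    define l where "l = complex_of_real (ln (1 / (?c\<^sup>2 * v)))"
    have S: "S \<noteq> 0" "complex_of_real v = S\<^sup>2"
      using v by (simp_all add: S_def flip: of_real_power)
    have R: "R \<noteq> 0" "complex_of_real (?c\<^sup>2) = R\<^sup>2"
      using r1 by (simp_all add: R_def rc flip: of_real_power)
    have sq: "sqrt (1 / (?c\<^sup>2 * v)) = 1 / (r * sqrt v)"
      using v by (simp add: real_sqrt_divide real_sqrt_mult r_def)
    have mo_w: "mo (?w v) = k1 * (1 / (R * S)) + k2 * (1 / (R * S) * l)"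
      unfolding mo_def complex.sel sq by (simp add: R_def S_def l_def)
    have mov_w: "mov (?w v) = k1 * (R * S / 2) + k2 * (l * (R * S) / 2 + R * S)"
      unfolding mov_def complex.sel sq by (simp add: R_def S_def l_def)
    have cv: "of_real (1 / (?c * v)\<^sup>2) = 1 / (R * S\<^sup>2)\<^sup>2"
      using R(2) S(2) by (simp add: power_mult_distrib)
    have lr: "k1 + k2 - k2 * of_real (ln (r\<^sup>2)) - k2 * of_real (ln v) = k1 + k2 + k2 * l"
    proof -
      have e: "ln (1 / (?c\<^sup>2 * v)) = - ln (r\<^sup>2) - ln v"
        using r1 v unfolding rc[symmetric] by (simp add: ln_div ln_mult)
      show ?thesis
        unfolding l_def e of_real_diff of_real_minus right_diff_distrib by simp
    qed
    have albe: "(al - be * of_real (ln v)) / of_real (v\<^sup>2) = (k1 + k2 + k2 * l) / R / (S\<^sup>2)\<^sup>2"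
      unfolding al_def be_def lr[symmetric] by (simp add: R_def S(2) diff_divide_distrib)
    have "2 * v * sqrt v = 2 * (v * sqrt v)" by simp
    have vs: "complex_of_real (2 * v * sqrt v) = 2 * S\<^sup>2 * S"
      by (simp add: S_def[symmetric] S(2))
    have "ps v = - (1 / (R * S\<^sup>2)\<^sup>2) * Gv (?w v) / S - F (sl2_act g (?w v)) / (2 * S\<^sup>2 * S) + (k1 + k2 + k2 * l) / R / (S\<^sup>2)\<^sup>2"
      unfolding ps_def fv_def vals[OF v] albe vs cv S_def[symmetric] ..
    also have "\<dots> = - (1 / (R * S\<^sup>2)\<^sup>2) * (Gv (?w v) - mov (?w v)) / S - (F (sl2_act g (?w v)) - mo (?w v)) / (2 * S\<^sup>2 * S)
        + (- (1 / (R * S\<^sup>2)\<^sup>2) * mov (?w v) / S - mo (?w v) / (2 * S\<^sup>2 * S) + (k1 + k2 + k2 * l) / R / (S\<^sup>2)\<^sup>2)"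
      by (simp add: diff_divide_distrib right_diff_distrib)
    also have "- (1 / (R * S\<^sup>2)\<^sup>2) * mov (?w v) / S - mo (?w v) / (2 * S\<^sup>2 * S) + (k1 + k2 + k2 * l) / R / (S\<^sup>2)\<^sup>2 = 0"
      unfolding mo_w mov_w by (rule leading_term_identity[OF R(1) S(1)])
    finally show ?thesis
      unfolding vs cv S_def[symmetric] by simp
  qed
  \<comment> \<open>At infinity the subtracted term only allows the estimate 1/v, by log v being at
    most v. The second power needed for integrability comes from the weight y / (y^2 +
    s^2)^(1/2).\<close>
  have "\<exists>C\<ge>0. \<forall>v>0. norm (ps v) \<le> C * v ^ 0 \<and> norm (ps v) \<le> C / v ^ 1"
  proof (rule two_sided_bound[OF cps d])
    fix v :: real assume v: "0 < v" "v \<le> 1 / ?c\<^sup>2"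
    then have v1: "v \<le> 1" using d by linarith
    have "norm (ps v) \<le> norm (- of_real (1 / (?c * v)\<^sup>2) * ?Hv (?w v)) / sqrt v + norm (?H (?w v)) / (2 * v * sqrt v)"
      unfolding ps_eq[OF v(1)]
      by (rule order_trans[OF norm_triangle_ineq4]) (use v in \<open>simp add: norm_divide norm_mult\<close>)
    also have "\<dots> \<le> (K * sqrt v) / sqrt v + (K * (v * sqrt v)) / (2 * v * sqrt v)"
    proof (intro add_mono divide_right_mono)
      show "norm (- of_real (1 / (?c * v)\<^sup>2) * ?Hv (?w v)) \<le> K * sqrt v"
        using KH[OF v] mult_left_mono[OF small(1)[OF v(1) v1] K] by linarith
      show "norm (?H (?w v)) \<le> K * (v * sqrt v)"
        using KH[OF v] mult_left_mono[OF small(2)[OF v(1) v1] K] by linarith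
    qed (use v in auto)
    also have "\<dots> \<le> 2 * K * v ^ 0"
      using v K by simp
    finally show "norm (ps v) \<le> 2 * K * v ^ 0" .
  next
    fix v :: real assume v: "v \<ge> 1"
    have v4: "K' / v ^ 4 \<le> K' / v" "v \<ge> 0"
      using K'(1) v self_le_power[of v 4] by (auto intro!: frac_le)
    have "norm (fv v) \<le> norm (Fv (Complex x v)) / sqrt v + norm (F (Complex x v)) / (2 * v * sqrt v)"
      unfolding fv_def by (rule order_trans[OF norm_triangle_ineq4]) (use v in \<open>simp add: norm_divide norm_mult\<close>)
    also have "\<dots> \<le> (K' / v) / 1 + (K' / v) / 1"
    proof (intro add_mono frac_le)
      show "norm (Fv (Complex x v)) \<le> K' / v" "norm (F (Complex x v)) \<le> K' / v"
        using K'(2)[of "Complex x v"] v v4(1) by auto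
      have "1 * 1 \<le> (2 * v) * sqrt v"
        using v by (intro mult_mono) auto
      then show "1 \<le> 2 * v * sqrt v" by simp
    qed (use v K'(1) in auto)
    finally have 1: "norm (fv v) \<le> 2 * K' / v" by simp
    have "norm (al - be * of_real (ln v)) \<le> norm al * v + norm be * v"
    proof -
      have "norm (al - be * of_real (ln v)) \<le> norm al + norm be * \<bar>ln v\<bar>"
        by (rule order_trans[OF norm_triangle_ineq4]) (simp add: norm_mult)
      also have "\<dots> \<le> norm al * v + norm be * v"
        using v ln_le_minus_one[of v] mult_left_mono[of 1 v "norm al"] by (intro add_mono mult_left_mono) auto
      finally show ?thesis .
    qed
    then have "norm ((al - be * of_real (ln v)) / of_real (v\<^sup>2)) \<le> (norm al * v + norm be * v) / v\<^sup>2"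
      unfolding norm_divide norm_of_real by (simp add: divide_right_mono)
    also have "\<dots> = (norm al + norm be) / v"
      using v by (simp add: field_simps power2_eq_square)
    finally have 2: "norm ((al - be * of_real (ln v)) / of_real (v\<^sup>2)) \<le> (norm al + norm be) / v" .
    have "norm (ps v) \<le> norm (fv v) + norm ((al - be * of_real (ln v)) / of_real (v\<^sup>2))"
      unfolding ps_def by (rule norm_triangle_ineq)
    also have "\<dots> \<le> 2 * K' / v + (norm al + norm be) / v"
      by (rule add_mono[OF 1 2])
    finally show "norm (ps v) \<le> (2 * K' + (norm al + norm be)) / v ^ 1"
      by (simp add: add_divide_distrib)
  qed
  then obtain C2 where C2: "C2 \<ge> 0" "\<And>v. v > 0 \<Longrightarrow> norm (ps v) \<le> C2 \<and> norm (ps v) \<le> C2 / v"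
    by auto
  let ?r = "\<lambda>y s. sqrt (y\<^sup>2 + s\<^sup>2)"
  let ?E = "\<lambda>y s. \<i> * fu (?r y s) + of_real (y / ?r y s) * ps (?r y s)"
  have main: "(?E y has_integral - of_real pi * F_plus N A (Complex x y) + (al - be * of_real (ln y) - be * of_real I2) / of_real y) {0<..}"
    if y: "y > 0" for y
  proof -
    have rp: "?r y s > 0" for s
      using y by (simp add: add_pos_nonneg)
    have fu_b: "bessel_series N 0 (\<lambda>n. \<i> * of_real (freq N n) * A n) x v = fu v"
      and fv_b: "bessel_series N 1 (\<lambda>n. of_real \<bar>freq N n\<bar> * A n) x v = - fv v" if v: "v > 0" for v
    proof -
      let ?\<tau> = "Complex x v"
      have pos: "Im ?\<tau> > 0" using v by simp
      have u: "Fu ?\<tau> = of_real (sqrt v) * bessel_series N 0 (\<lambda>n. \<i> * of_real (freq N n) * A n) x v"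
        using bessel_expansion_partials(1)[OF N AF FP eqF pos] by simp
      have vv: "Fv ?\<tau> = of_real (1 / (2 * sqrt v)) * bessel_series N 0 A x v
          - of_real (sqrt v) * bessel_series N 1 (\<lambda>n. of_real \<bar>freq N n\<bar> * A n) x v"
        using bessel_expansion_partials(2)[OF N AF FP eqF pos] by simp
      have f: "F ?\<tau> = of_real (sqrt v) * bessel_series N 0 A x v"
        using eqF[OF pos] by simp
      have S: "complex_of_real (sqrt v) \<noteq> 0" "complex_of_real v \<noteq> 0"
        using v by simp_all
      show "bessel_series N 0 (\<lambda>n. \<i> * of_real (freq N n) * A n) x v = fu v"
        unfolding fu_def u using S by simp
      have alg: "B1 = - ((1 / (2 * S) * B0 - S * B1) / S - S * B0 / (2 * (S * S) * S))" if "S \<noteq> 0" for S B0 B1 :: complex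
        using that by (simp add: field_simps)
      have "complex_of_real v = of_real (sqrt v) * of_real (sqrt v)"
        using v by (simp flip: of_real_mult)
      then show "bessel_series N 1 (\<lambda>n. of_real \<bar>freq N n\<bar> * A n) x v = - fv v"
        unfolding fv_def vv f using alg[OF S(1)] by (simp only: of_real_mult of_real_divide of_real_1 of_real_numeral)
    qed
    have "((\<lambda>s. (\<i> * bessel_series N 0 (\<lambda>n. \<i> * of_real (freq N n) * A n) x (?r y s)
        - of_real (y / ?r y s) * bessel_series N 1 (\<lambda>n. of_real \<bar>freq N n\<bar> * A n) x (?r y s)) +
        of_real (y / ?r y s) * ((al - be * of_real (ln (?r y s))) / of_real ((?r y s)\<^sup>2)))
      has_integral - of_real pi * F_plus N A (Complex x y) + (al - be * of_real (ln y) - be * of_real I2) / of_real y) {0<..}"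
      unfolding I2_def by (intro has_integral_add F_plus_integral N AF y model_integral)
    moreover have "(\<i> * bessel_series N 0 (\<lambda>n. \<i> * of_real (freq N n) * A n) x (?r y s)
        - of_real (y / ?r y s) * bessel_series N 1 (\<lambda>n. of_real \<bar>freq N n\<bar> * A n) x (?r y s)) +
        of_real (y / ?r y s) * ((al - be * of_real (ln (?r y s))) / of_real ((?r y s)\<^sup>2)) = ?E y s" for s
      unfolding fu_b[OF rp] fv_b[OF rp] ps_def by (simp add: algebra_simps)
    ultimately show ?thesis by simp
  qed
  show ?thesis
  proof (rule tendsto_at_right_0I)
    fix X :: "nat \<Rightarrow> real" assume X: "\<And>n. X n > 0" "X \<longlonglongrightarrow> 0"
    have "Bseq X"
      using X(2) by (intro convergent_imp_Bseq convergentI)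
    then obtain B where B: "B > 0" "\<And>n. norm (X n) \<le> B"
      by (auto simp: Bseq_def)
    define D where "D = (C1 + C1) + (C2 + B * C2)"
    have rp: "?r (X n) s > 0" "?r (X n) s \<ge> X n" "s\<^sup>2 \<le> (?r (X n) s)\<^sup>2" for n s
      using X(1)[of n] by (auto simp: add_pos_nonneg intro: real_le_rsqrt)
    have bound: "norm (?E (X n) s) \<le> D * (1 / (1 + s\<^sup>2))" for n s
    proof -
      let ?R = "?r (X n) s"
      have 1: "norm (fu ?R) \<le> (C1 + C1) * (1 / (1 + s\<^sup>2))"
        by (rule cauchy_bound[OF _ _ _ _ rp(1)[where n = n and s = s] rp(3)[where n = n and s = s]]) (use C1(1) C1(2)[OF rp(1)[of n s]] in simp_all)
      have yR: "X n / ?R \<le> 1" "X n / ?R \<ge> 0"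
        using rp(1)[of n s] rp(2)[of n s] X(1)[of n] by auto
      have 2: "X n / ?R * norm (ps ?R) \<le> (C2 + B * C2) * (1 / (1 + s\<^sup>2))"
      proof (rule cauchy_bound[OF _ _ _ _ rp(1)[where n = n and s = s] rp(3)[where n = n and s = s]])
        have "X n / ?R * norm (ps ?R) \<le> 1 * C2"
          using C2(2)[OF rp(1)[of n s]] yR by (intro mult_mono) auto
        then show "X n / ?R * norm (ps ?R) \<le> C2" by simp
        have "X n / ?R * norm (ps ?R) \<le> B / ?R * (C2 / ?R)"
          using C2 rp(1)[of n s] B(2)[of n] X(1)[of n] by (intro mult_mono divide_right_mono) auto
        then show "X n / ?R * norm (ps ?R) \<le> B * C2 / ?R\<^sup>2"
          by (simp add: power2_eq_square)
      qed (use C2 B in auto)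
      have "norm (?E (X n) s) \<le> norm (fu ?R) + X n / ?R * norm (ps ?R)"
        by (rule order_trans[OF norm_triangle_ineq]) (use yR in \<open>simp add: norm_mult norm_divide X(1) less_imp_le\<close>)
      also have "\<dots> \<le> (C1 + C1) * (1 / (1 + s\<^sup>2)) + (C2 + B * C2) * (1 / (1 + s\<^sup>2))"
        by (rule add_mono[OF 1 2])
      finally show ?thesis
        by (simp only: D_def distrib_right)
    qed
    \<comment> \<open>For fixed s > 0 the weight of \<open>ps\<close> tends to 0, so only the term
      with \<open>fu\<close> survives in the limit.\<close>
    have lim: "(\<lambda>n. ?E (X n) s) \<longlonglongrightarrow> \<i> * fu s" if s: "s \<in> {0<..}" for s
    proof -
      have R: "(\<lambda>n. ?r (X n) s) \<longlonglongrightarrow> s"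
      proof -
        have "(\<lambda>n. ?r (X n) s) \<longlonglongrightarrow> sqrt (0\<^sup>2 + s\<^sup>2)"
          by (intro tendsto_intros X(2))
        then show ?thesis using s by simp
      qed
      have iso: "isCont f s" if "continuous_on {0<..} f" for f :: "real \<Rightarrow> complex"
        using that s by (simp add: continuous_on_eq_continuous_at)
      have "(\<lambda>n. \<i> * fu (?r (X n) s) + of_real (X n / ?r (X n) s) * ps (?r (X n) s)) \<longlonglongrightarrow> \<i> * fu s + of_real (0 / s) * ps s"
        using s by (intro tendsto_intros isCont_tendsto_compose[OF iso[OF cfu]] isCont_tendsto_compose[OF iso[OF cps]] R X(2)) auto
      then show ?thesis by simp
    qed
    have "(\<lambda>n. integral {0<..} (?E (X n))) \<longlonglongrightarrow> integral {0<..} (\<lambda>s. \<i> * fu s)"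
    proof (rule dominated_convergence(2)[where h = "\<lambda>s. D * (1 / (1 + s\<^sup>2))"])
      show "?E (X n) integrable_on {0<..}" for n
        using main[OF X(1)] by (rule has_integral_integrable)
      show "(\<lambda>s. D * (1 / (1 + s\<^sup>2))) integrable_on {0<..}"
        by (intro integrable_on_mult_right has_integral_integrable[OF inverse_square_has_integral])
    qed (use bound lim in auto)
    then have "(\<lambda>n. - of_real pi * F_plus N A (Complex x (X n)) + (al - be * of_real (ln (X n)) - be * of_real I2) / of_real (X n))
        \<longlonglongrightarrow> \<i> * integral {0<..} fu"
      by (simp only: integral_unique[OF main[OF X(1)]] integral_mult_right)
    then have "(\<lambda>n. - (1 / of_real pi) * (- of_real pi * F_plus N A (Complex x (X n)) + (al - be * of_real (ln (X n)) - be * of_real I2) / of_real (X n)))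
        \<longlonglongrightarrow> - (1 / of_real pi) * (\<i> * integral {0<..} fu)"
      by (rule tendsto_mult_left)
    moreover have "- (1 / of_real pi) * (- of_real pi * P + M / Y) = P - M / (of_real pi * Y)" for P M Y :: complex
      by (simp add: field_simps)
    ultimately show "(\<lambda>n. F_plus N A (Complex x (X n)) - (al - be * of_real (ln (X n)) - be * of_real I2) / (of_real pi * of_real (X n)))
        \<longlonglongrightarrow> - (\<i> / of_real pi) * integral {0<..} (\<lambda>v. Fu (Complex x v) / of_real (sqrt v))"
      by (simp add: fu_def[abs_def])
  qed
qed

text \<open>After multiplication by y the numerator itself tends to 0. Along y = exp (-n) it is an
  arithmetic progression with difference be, so be and then al must vanish.\<close>

lemma leading_term_bounded_imp_zero:
  fixes al be :: complex
  assumes "((\<lambda>y. (al - be * of_real (ln y)) / (of_real pi * of_real y)) \<longlongrightarrow> L) (at_right 0)"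
  shows "al = 0" "be = 0"
proof -
  have "((\<lambda>y. of_real (pi * y) * ((al - be * of_real (ln y)) / (of_real pi * of_real y))) \<longlongrightarrow> of_real (pi * 0) * L) (at_right 0)"
    by (intro tendsto_mult tendsto_of_real assms tendsto_ident_at tendsto_const)
  then have lim: "((\<lambda>y. of_real (pi * y) * ((al - be * of_real (ln y)) / (of_real pi * of_real y))) \<longlongrightarrow> 0) (at_right 0)"
    by simp
  have "filterlim (\<lambda>n. exp (- real n)) (at_right 0) sequentially"
    by real_asymp
  from filterlim_compose[OF lim this]
  have l: "(\<lambda>n. al + be * of_nat n) \<longlonglongrightarrow> 0"
    by simp
  from tendsto_diff[OF LIMSEQ_Suc[OF l] l] have "(\<lambda>n. be) \<longlonglongrightarrow> 0"
    by (simp add: algebra_simps)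
  then show "be = 0"
    by (simp add: LIMSEQ_const_iff)
  then show "al = 0"
    using l by (simp add: LIMSEQ_const_iff)
qed

section \<open>The cocycle\<close>

lemma inverse_square_bound:
  fixes f :: "real \<Rightarrow> complex"
  assumes "\<And>v. 0 < v \<Longrightarrow> v \<le> 1 \<Longrightarrow> norm (f v) \<le> C" "\<And>v. v \<ge> 1 \<Longrightarrow> norm (f v) \<le> C / v\<^sup>2" "v > 0"
  shows "norm (f v) \<le> 2 * C * (1 / (1 + v\<^sup>2))"
proof -
  have C: "C \<ge> 0"
    using assms(1)[of 1] norm_ge_zero[of "f 1"] by linarith
  have p: "1 + v\<^sup>2 > 0"
    by (rule add_pos_nonneg) auto
  show ?thesis
  proof (cases "v \<le> 1")
    case True
    then have "v\<^sup>2 \<le> 1"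
      using assms(3) by (simp add: power_le_one)
    then have "C * (1 + v\<^sup>2) \<le> C * 2"
      by (intro mult_left_mono C) simp
    then have "C \<le> 2 * C * (1 / (1 + v\<^sup>2))"
      using p by (simp add: le_divide_eq mult.commute)
    then show ?thesis
      using assms(1)[OF assms(3) True] by simp
  next
    case False
    then have "1 \<le> v\<^sup>2"
      by (simp add: one_le_power)
    then have "C * (1 + v\<^sup>2) \<le> C * (2 * v\<^sup>2)"
      by (intro mult_left_mono C) simp
    then have "C / v\<^sup>2 \<le> 2 * C * (1 / (1 + v\<^sup>2))"
      using p \<open>1 \<le> v\<^sup>2\<close> assms(3) by (simp add: divide_le_eq le_divide_eq mult_ac)
    then show ?thesis
      using assms(2)[of v] False by simp
  qed
qed

lemma absolutely_integrable_inverse_square: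
  fixes f :: "real \<Rightarrow> complex"
  assumes f: "continuous_on {0<..} f" and bound: "\<And>v. v > 0 \<Longrightarrow> norm (f v) \<le> C * (1 / (1 + v\<^sup>2))"
  shows "f absolutely_integrable_on {0<..}"
proof (rule measurable_bounded_by_integrable_imp_absolutely_integrable)
  show "f \<in> borel_measurable (lebesgue_on {0<..})"
    by (rule continuous_imp_measurable_on_sets_lebesgue[OF f]) auto
  show "(\<lambda>v. C * (1 / (1 + v\<^sup>2))) integrable_on {0::real<..}"
    by (intro integrable_on_mult_right has_integral_integrable[OF inverse_square_has_integral])
qed (use bound in auto)


lemma complex_of_rat: "complex_of_rat s = of_real (of_rat s)"
  by (cases s) (simp add: of_rat_rat)

lemma real_of_rat_abs: "real_of_rat \<bar>s\<bar> = \<bar>real_of_rat s\<bar>"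
  by (simp add: abs_if of_rat_minus)

lemma SL2Z_inverse_entries:
  assumes g: "g \<in> carrier SL2Z"
  shows "(inv\<^bsub>SL2Z\<^esub> g)$1$1 = g$2$2" "(inv\<^bsub>SL2Z\<^esub> g)$1$2 = - g$1$2"
    and "(inv\<^bsub>SL2Z\<^esub> g)$2$1 = - g$2$1" "(inv\<^bsub>SL2Z\<^esub> g)$2$2 = g$1$1"
proof -
  define B :: "int^2^2" where
    "B = (\<chi> i j. if i = 1 then (if j = 1 then g$2$2 else - g$1$2) else (if j = 1 then - g$2$1 else g$1$1))"
  have B: "B \<in> carrier SL2Z" "B ** g = mat 1"
    using g by (simp_all add: SL2Z_def B_def det_2 vec_eq_iff forall_2 matrix_matrix_mult_def sum_2 mat_def algebra_simps)
  have "inv\<^bsub>SL2Z\<^esub> g = B"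
    by (rule group.inv_equality[OF group_SL2Z _ g B(1)]) (simp add: SL2Z_mult SL2Z_one B(2))
  then show "(inv\<^bsub>SL2Z\<^esub> g)$1$1 = g$2$2" "(inv\<^bsub>SL2Z\<^esub> g)$1$2 = - g$1$2"
    "(inv\<^bsub>SL2Z\<^esub> g)$2$1 = - g$2$1" "(inv\<^bsub>SL2Z\<^esub> g)$2$2 = g$1$1"
    by (simp_all add: B_def)
qed

lemma cusp_act_Infty_eq_Fin:
  assumes "cusp_act g Infty = Fin q"
  shows "g$2$1 \<noteq> 0" "real_of_rat q = real_of_int (g$1$1) / real_of_int (g$2$1)"
  using assms by (auto split: if_splits simp: of_rat_divide)

text \<open>Pulling back multiplies the row of the kernel by g from the right. It serves twice for
  the cocycle: with a matrix carrying infinity to a cusp, and with \<gamma>^-1, under which F is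
  invariant.\<close>

lemma green_primitive_sl2_act:
  assumes W: "green_primitive W F Fu Fv (poisson P Q) (poisson_u P Q) (poisson_v P Q)"
    and F: "uhp_partials F Fu Fv" and PQ: "(P, Q) \<noteq> (0, 0)" and g: "g \<in> carrier SL2Z"
    and G: "uhp_partials G Gu Gv" "\<And>\<tau>. Im \<tau> > 0 \<Longrightarrow> F (sl2_act g \<tau>) = G \<tau>"
    and P': "P' = P * real_of_int (g$1$1) + Q * real_of_int (g$2$1)"
    and Q': "Q' = P * real_of_int (g$1$2) + Q * real_of_int (g$2$2)"
  shows "green_primitive (\<lambda>\<tau>. W (sl2_act g \<tau>)) G Gu Gv (poisson P' Q') (poisson_u P' Q') (poisson_v P' Q')"
    and "(P', Q') \<noteq> (0, 0)"
proof -
  define a b c d where abcd: "a = real_of_int (g$1$1)" "b = real_of_int (g$1$2)" "c = real_of_int (g$2$1)" "d = real_of_int (g$2$2)"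
  have det: "a * d - b * c = 1"
    unfolding abcd by (rule SL2Z_det(2)[OF g])
  have PQ'_eq: "P' = P * a + Q * c" "Q' = P * b + Q * d"
    by (simp_all add: P' Q' abcd)
  show PQ': "(P', Q') \<noteq> (0, 0)"
  proof
    assume "(P', Q') = (0, 0)"
    then have z: "P * a + Q * c = 0" "P * b + Q * d = 0"
      by (simp_all add: PQ'_eq)
    have "P * (a * d - b * c) = (P * a + Q * c) * d - (P * b + Q * d) * c"
      "Q * (a * d - b * c) = (P * b + Q * d) * a - (P * a + Q * c) * b"
      by (simp_all add: algebra_simps)
    with PQ show False
      unfolding det z by simp
  qed
  have act: "sl2_act g = moebius (of_real a) (of_real b) (of_real c) (of_real d)"
    unfolding abcd by (rule sl2_act_real)
  show "green_primitive (\<lambda>\<tau>. W (sl2_act g \<tau>)) G Gu Gv (poisson P' Q') (poisson_u P' Q') (poisson_v P' Q')"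
  proof (rule green_primitive_compose[OF W F eigenfunction_imp_partials[OF eigenfunction_poisson[OF PQ]] _ _ G(1) _
      eigenfunction_imp_partials[OF eigenfunction_poisson[OF PQ']]])
    fix \<tau> :: complex assume \<tau>: "Im \<tau> > 0"
    show "(sl2_act g has_field_derivative 1 / (of_real c * \<tau> + of_real d)\<^sup>2) (at \<tau>)"
      unfolding act by (rule moebius_real_has_field_derivative(1)[OF det \<tau>])
    show "Im (sl2_act g \<tau>) > 0"
      by (rule Im_sl2_act_pos[OF g \<tau>])
    show "F (sl2_act g \<tau>) = G \<tau>"
      by (rule G(2)[OF \<tau>])
    show "poisson P Q (sl2_act g \<tau>) = poisson P' Q' \<tau>"
      unfolding act PQ'_eq by (rule poisson_moebius[OF det \<tau>])
  qed
qed

text \<open>The dv-component of the Green form on the vertical line over x.\<close>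

definition green_density :: "real \<Rightarrow> real \<Rightarrow> (complex \<Rightarrow> complex) \<Rightarrow> (complex \<Rightarrow> complex) \<Rightarrow> real \<Rightarrow> real \<Rightarrow> complex" where
  "green_density P Q F Fu x v = poisson P Q (Complex x v) * Fu (Complex x v) - F (Complex x v) * poisson_u P Q (Complex x v)"

lemma norm_poisson_line_le:
  assumes "P \<noteq> 0" "v > 0"
  shows "norm (poisson P Q (Complex x v)) \<le> 1 / \<bar>P\<bar> / sqrt v"
proof -
  have "\<bar>P\<bar> * v \<le> norm (of_real P * Complex x v + of_real Q)"
    using abs_Im_le_cmod[of "of_real P * Complex x v + of_real Q"] assms by (simp add: abs_mult)
  then have "norm (poisson P Q (Complex x v)) \<le> sqrt v / (\<bar>P\<bar> * v)"
    unfolding poisson_def norm_of_real using assms by (simp add: frac_le)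
  also have "\<dots> = 1 / \<bar>P\<bar> / sqrt v"
    using assms by (simp add: field_simps)
  finally show ?thesis .
qed

text \<open>On every vertical line, even the one ending at the pole -Q/P, the kernel is at most 1 /
  (|P| v^(1/2)). The vanishing of F and \<open>Fu\<close> at both ends compensates this and the
  further 1/v in the derivative of the kernel.\<close>

lemma green_density_integrable:
  assumes F: "eigenfunction F Fu Fv" and dec: "decays_at_infinity F Fu Fv"
    and cusp: "cuspidal_at F (Fin q)" and P: "P \<noteq> 0"
  shows "green_density P Q F Fu (of_rat q) absolutely_integrable_on {0<..}"
proof -
  obtain C where C: "C \<ge> 0" and bound: "\<And>v. v > 0 \<Longrightarrow> norm (F (Complex (of_rat q) v)) \<le> C * v ^ 4 \<and> norm (F (Complex (of_rat q) v)) \<le> C / v ^ 4 \<and>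
      norm (Fu (Complex (of_rat q) v)) \<le> C * v ^ 4 \<and> norm (Fu (Complex (of_rat q) v)) \<le> C / v ^ 4"
    using vertical_line_bounds[OF F dec cusp] by blast
  let ?g = "green_density P Q F Fu (of_rat q)"
  let ?c = "1 / \<bar>P\<bar>"
  have PQ: "(P, Q) \<noteq> (0, 0)" using P by simp
  have b: "norm (?g v) \<le> ?c * (norm (Fu (Complex (of_rat q) v)) / sqrt v) + ?c * (norm (F (Complex (of_rat q) v)) / (2 * v * sqrt v))"
    if v: "v > 0" for v
  proof -
    have R: "norm (poisson P Q (Complex (of_rat q) v)) \<le> ?c / sqrt v"
      by (rule norm_poisson_line_le[OF P v])
    have "norm (poisson_u P Q (Complex (of_rat q) v)) \<le> norm (poisson P Q (Complex (of_rat q) v)) / (2 * v)"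
      using norm_poisson_partials_le(1)[OF PQ, of "Complex (of_rat q) v"] v by simp
    also have "\<dots> \<le> ?c / sqrt v / (2 * v)"
      using R v by (intro divide_right_mono) auto
    finally have Ru: "norm (poisson_u P Q (Complex (of_rat q) v)) \<le> ?c / sqrt v / (2 * v)" .
    have "norm (?g v) \<le> norm (poisson P Q (Complex (of_rat q) v)) * norm (Fu (Complex (of_rat q) v))
        + norm (F (Complex (of_rat q) v)) * norm (poisson_u P Q (Complex (of_rat q) v))"
      unfolding green_density_def by (rule order_trans[OF norm_triangle_ineq4]) (simp add: norm_mult)
    also have "\<dots> \<le> ?c / sqrt v * norm (Fu (Complex (of_rat q) v)) + norm (F (Complex (of_rat q) v)) * (?c / sqrt v / (2 * v))"
      by (intro add_mono mult_right_mono mult_left_mono R Ru norm_ge_zero)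
    also have "\<dots> = ?c * (norm (Fu (Complex (of_rat q) v)) / sqrt v) + ?c * (norm (F (Complex (of_rat q) v)) / (2 * v * sqrt v))"
      by (simp add: mult_ac)
    finally show ?thesis .
  qed
  show ?thesis
  proof (rule absolutely_integrable_inverse_square)
    show "continuous_on {0<..} ?g"
      unfolding green_density_def[abs_def]
      by (intro continuous_intros continuous_on_vertical eigenfunction_continuous_on[OF F] eigenfunction_continuous_on[OF eigenfunction_poisson[OF PQ]])
    fix v :: real assume "v > 0"
    then show "norm (?g v) \<le> 2 * (2 * (?c * C)) * (1 / (1 + v\<^sup>2))"
    proof (rule inverse_square_bound[rotated 2])
      fix v :: real assume v: "0 < v" "v \<le> 1"
      have s: "v \<le> sqrt v"
        using v by (intro real_le_rsqrt) (simp add: power2_eq_square mult_left_le)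
      have 1: "v ^ 4 \<le> v ^ 1" "v ^ 4 \<le> v ^ 2"
        using v by (intro power_decreasing; simp)+
      have "v\<^sup>2 \<le> v * sqrt v"
        using s v by (simp add: power2_eq_square mult_left_mono)
      then have 2: "C * v ^ 4 \<le> C * sqrt v" "C * v ^ 4 \<le> C * (v * sqrt v)"
        using 1 s C by (auto intro!: mult_left_mono)
      have "norm (Fu (Complex (of_rat q) v)) / sqrt v \<le> C"
        using bound[OF v(1)] 2(1) v by (simp add: divide_le_eq)
      moreover have "norm (F (Complex (of_rat q) v)) / (2 * v * sqrt v) \<le> C"
      proof -
        have "norm (F (Complex (of_rat q) v)) \<le> C * (v * sqrt v)"
          using bound[OF v(1)] 2(2) by linarith
        also have "\<dots> \<le> C * (2 * v * sqrt v)"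
          using C v by (intro mult_left_mono) auto
        finally show ?thesis
          using v by (simp add: divide_le_eq)
      qed
      ultimately have "norm (?g v) \<le> ?c * C + ?c * C"
        by (intro order_trans[OF b[OF v(1)]] add_mono mult_left_mono) auto
      then show "norm (?g v) \<le> 2 * (?c * C)" by simp
    next
      fix v :: real assume v: "v \<ge> 1"
      have 1: "C / v ^ 4 \<le> C / v\<^sup>2"
        using C v by (intro divide_left_mono power_increasing) auto
      have "1 * 1 \<le> (2 * v) * sqrt v"
        using v by (intro mult_mono) auto
      then have "norm (F (Complex (of_rat q) v)) / (2 * v * sqrt v) \<le> (C / v\<^sup>2) / 1"
        using bound[of v] v C 1 by (intro frac_le) auto
      moreover have "norm (Fu (Complex (of_rat q) v)) / sqrt v \<le> (C / v\<^sup>2) / 1"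
        using bound[of v] v C 1 by (intro frac_le) auto
      ultimately have "norm (?g v) \<le> ?c * (C / v\<^sup>2) + ?c * (C / v\<^sup>2)"
        using v by (intro order_trans[OF b] add_mono mult_left_mono) auto
      then show "norm (?g v) \<le> 2 * (?c * C) / v\<^sup>2" by simp
    qed
  qed
qed

text \<open>On the line through its pole the kernel is v^(-1/2) / |P|, and by reflection symmetry
  its derivative in u is 0. The Green integral thus becomes the integral that represents the value
  of F+ at x.\<close>

lemma green_density_pole:
  assumes P: "P \<noteq> 0" and v: "v > 0"
  shows "green_density P (- P * x) F Fu x v = inverse (of_real \<bar>P\<bar>) * (Fu (Complex x v) / of_real (sqrt v))"
proof -
  have e: "of_real P * Complex x v + of_real (- P * x) = \<i> * of_real (P * v)"
    by (simp add: complex_eq_iff)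
  have "sqrt v / (\<bar>P\<bar> * v) = inverse \<bar>P\<bar> / sqrt v"
    using P v by (simp add: field_simps)
  then have 1: "poisson P (- P * x) (Complex x v) = of_real (inverse \<bar>P\<bar> / sqrt v)"
    unfolding poisson_def e using v by (simp add: norm_mult abs_mult)
  have "1 / (\<i> * complex_of_real (P * v))\<^sup>2 = of_real (- (1 / (P * v)\<^sup>2))"
    by (simp add: power_mult_distrib)
  then have "Im (1 / (\<i> * complex_of_real (P * v))\<^sup>2) = 0"
    by (simp only: Im_complex_of_real)
  then have 2: "poisson_u P (- P * x) (Complex x v) = 0"
    unfolding poisson_u_def e by (simp only: mult_zero_left div_0 of_real_0)
  show ?thesis
    unfolding green_density_def 1 2 by simp
qed

text \<open>The lower end is the image of height n + 1 under \<open>sl2_act_vertical\<close>, so the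
  truncated edges can be joined by horizontal segments at each cusp.\<close>

lemma primitive_edge:
  assumes W: "green_primitive W F Fu Fv (poisson P Q) (poisson_u P Q) (poisson_v P Q)"
    and int: "green_density P Q F Fu x absolutely_integrable_on {0<..}" and c: "\<bar>c\<bar> \<ge> 1"
  shows "(\<lambda>n. W (Complex x (real n + 1)) - W (Complex x (1 / (c\<^sup>2 * (real n + 1))))) \<longlonglongrightarrow> integral {0<..} (green_density P Q F Fu x)"
proof -
  have c2: "c\<^sup>2 \<ge> 1"
    using one_le_power[OF c, of 2] by simp
  show ?thesis
    unfolding green_density_def[abs_def]
  proof (rule vertical_integral_limit[OF W[unfolded green_primitive_def]])
    show "(\<lambda>v. poisson P Q (Complex x v) * Fu (Complex x v) - F (Complex x v) * poisson_u P Q (Complex x v)) absolutely_integrable_on {0<..}"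
      using int unfolding green_density_def[abs_def] .
    show "1 / (c\<^sup>2 * (real n + 1)) > 0" for n
      using c2 by (intro divide_pos_pos mult_pos_pos) auto
    have "(\<lambda>n. 1 / c\<^sup>2 * (1 / (real n + 1))) \<longlonglongrightarrow> 1 / c\<^sup>2 * 0"
      by (intro tendsto_mult_left) real_asymp
    then show "(\<lambda>n. 1 / (c\<^sup>2 * (real n + 1))) \<longlonglongrightarrow> 0"
      by simp
    show "filterlim (\<lambda>n. real n + 1) at_top sequentially"
      by real_asymp
    show "1 / (c\<^sup>2 * (real n + 1)) \<le> real n + 1" for n
    proof -
      have "1 * 1 \<le> c\<^sup>2 * (real n + 1)"
        using c2 by (intro mult_mono) auto
      then have "1 / (c\<^sup>2 * (real n + 1)) \<le> 1"
        by (simp add: divide_le_eq_1)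
      then show ?thesis by linarith
    qed
  qed
qed

text \<open>The closed form is integrated around the ideal triangle with vertices \<open>\<infinity>\<close>, the cusp \<open>x\<close> and the
  cusp \<open>p = \<gamma>\<^sup>-\<^sup>1 \<infinity>\<close>; each ideal vertex contributes nothing because \<open>F\<close> decays there. The
  edge from \<open>p\<close> to \<open>x\<close> is the image under \<open>\<gamma>\<^sup>-\<^sup>1\<close> of the vertical line over \<open>\<gamma> x\<close>.\<close>

lemma cocycle_formula:
  assumes F: "eigenfunction F Fu Fv" and dec: "decays_at_infinity F Fu Fv" and \<gamma>: "\<gamma> \<in> carrier SL2Z"
    and inv: "\<And>\<tau>. Im \<tau> > 0 \<Longrightarrow> F (sl2_act \<gamma> \<tau>) = F \<tau>" and c0: "\<gamma>$2$1 \<noteq> 0"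
    and p: "cuspidal_at F (Fin p)" "real_of_rat p = - real_of_int (\<gamma>$2$2) / real_of_int (\<gamma>$2$1)"
    and q: "cuspidal_at F (Fin q)" "cusp_act \<gamma> (Fin q) = Fin q'" "cuspidal_at F (Fin q')"
  shows "integral {0<..} (\<lambda>v. Fu (Complex (of_rat q) v) / of_real (sqrt v))
      - inverse (of_rat \<bar>of_int (\<gamma>$2$1) * q + of_int (\<gamma>$2$2)\<bar>) * integral {0<..} (\<lambda>v. Fu (Complex (of_rat q') v) / of_real (sqrt v)) =
    integral {0<..} (green_density 1 (- of_rat q) F Fu (of_rat p))"
proof -
  define a b c d where abcd: "a = real_of_int (\<gamma>$1$1)" "b = real_of_int (\<gamma>$1$2)" "c = real_of_int (\<gamma>$2$1)" "d = real_of_int (\<gamma>$2$2)"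
  define x y J where "x = real_of_rat q" and "y = real_of_rat q'" and "J = c * x + d"
  have FP: "uhp_partials F Fu Fv"
    by (rule eigenfunction_imp_partials[OF F])
  have q_ne: "of_int (\<gamma>$2$1) * q + of_int (\<gamma>$2$2) \<noteq> (0 :: rat)"
    using q(2) by (auto split: if_splits)
  have J: "J = of_rat (of_int (\<gamma>$2$1) * q + of_int (\<gamma>$2$2))"
    by (simp add: J_def abcd x_def of_rat_add of_rat_mult)
  have J0: "J \<noteq> 0"
    unfolding J using q_ne by simp
  have "q' = (of_int (\<gamma>$1$1) * q + of_int (\<gamma>$1$2)) / (of_int (\<gamma>$2$1) * q + of_int (\<gamma>$2$2))"
    using q(2) q_ne by simp
  then have "y = (a * x + b) / J"
    by (simp add: J y_def x_def abcd of_rat_add of_rat_mult of_rat_divide)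
  then have yJ: "J * y = a * x + b"
    using J0 by simp
  have absJ: "complex_of_rat \<bar>of_int (\<gamma>$2$1) * q + of_int (\<gamma>$2$2)\<bar> = of_real \<bar>J\<bar>"
    unfolding J complex_of_rat real_of_rat_abs ..
  obtain g Gu Gv where g: "g \<in> carrier SL2Z" "cusp_act g Infty = Fin q"
    and G: "uhp_partials (\<lambda>\<tau>. F (sl2_act g \<tau>)) Gu Gv" and decG: "decays_at_infinity (\<lambda>\<tau>. F (sl2_act g \<tau>)) Gu Gv"
    using cuspidal_at_decays[OF F q(1)] by blast
  \<comment> \<open>A matrix carrying infinity to q' that is compatible with the one for q: heights
    near q' measured by k are heights near q measured by g.\<close>
  define k where "k = \<gamma> ** g"
  have k: "k \<in> carrier SL2Z"
    unfolding k_def by (rule SL2Z_closed[OF \<gamma> g(1)])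
  have kq: "cusp_act k Infty = Fin q'"
    unfolding k_def cusp_act_mult_Infty[OF \<gamma> g(1)] g(2) by (rule q(2))
  note gx = cusp_act_Infty_eq_Fin[OF g(2), folded x_def] and ky = cusp_act_Infty_eq_Fin[OF kq, folded y_def]
  let ?\<gamma>' = "inv\<^bsub>SL2Z\<^esub> \<gamma>"
  note \<gamma>' = SL2Z_inverse(1)[OF \<gamma>]
  have inv': "F (sl2_act ?\<gamma>' \<tau>) = F \<tau>" if "Im \<tau> > 0" for \<tau>
    using inv[OF Im_sl2_act_pos[OF \<gamma>' that]] by (simp only: sl2_act_inverse(2)[OF \<gamma> that])
  have PQ: "(1 :: real, - x) \<noteq> (0, 0)" by simp
  obtain W where W: "green_primitive W F Fu Fv (poisson 1 (- x)) (poisson_u 1 (- x)) (poisson_v 1 (- x))"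
    using green_primitive_exists[OF F eigenfunction_poisson[OF PQ]] by blast
  note Wg = green_primitive_sl2_act[OF W FP PQ g(1) G refl refl refl]
  \<comment> \<open>The row (1, -x) times \<gamma>^-1 is (J, -J y) with J = c x + d: the pole moves
    from x to y = \<gamma> x, and the kernel acquires the factor 1 / |J|.\<close>
  have W': "green_primitive (\<lambda>\<tau>. W (sl2_act ?\<gamma>' \<tau>)) F Fu Fv (poisson J (- J * y)) (poisson_u J (- J * y)) (poisson_v J (- J * y))"
    and PQ': "(J, - J * y) \<noteq> (0, 0)"
  proof -
    have r: "J = 1 * real_of_int (?\<gamma>'$1$1) + - x * real_of_int (?\<gamma>'$2$1)"
      "- J * y = 1 * real_of_int (?\<gamma>'$1$2) + - x * real_of_int (?\<gamma>'$2$2)"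
      using yJ unfolding SL2Z_inverse_entries[OF \<gamma>] by (simp_all add: J_def abcd algebra_simps)
    show "green_primitive (\<lambda>\<tau>. W (sl2_act ?\<gamma>' \<tau>)) F Fu Fv (poisson J (- J * y)) (poisson_u J (- J * y)) (poisson_v J (- J * y))"
      by (rule green_primitive_sl2_act(1)[OF W FP PQ \<gamma>' FP inv' r])
    show "(J, - J * y) \<noteq> (0, 0)" using J0 by simp
  qed
  let ?T = "\<lambda>n. real n + 1"
  have T: "filterlim ?T at_top sequentially" "?T n > 0" for n
    by real_asymp auto
  let ?cg = "real_of_int (g$2$1)" and ?ck = "real_of_int (k$2$1)"
  let ?ug = "- real_of_int (g$2$2) / ?cg" and ?uk = "- real_of_int (k$2$2) / ?ck"
  \<comment> \<open>Matching of the truncation points at the two finite vertices: the ends near x of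
    both adjacent edges are images under g of points at the same height, and the end near p is the
    image of a high point under \<gamma>^-1.\<close>
  have e1: "sl2_act g (Complex ?ug (?T n)) = Complex x (1 / (?cg\<^sup>2 * ?T n))" for n
    unfolding gx(2) by (rule sl2_act_vertical[OF g(1) gx(1) T(2)])
  have e2: "sl2_act g (Complex ?uk (?T n)) = sl2_act ?\<gamma>' (Complex y (1 / (?ck\<^sup>2 * ?T n)))" for n
  proof -
    have I: "Im (Complex ?uk (?T n)) > 0" by simp
    have "Complex y (1 / (?ck\<^sup>2 * ?T n)) = sl2_act \<gamma> (sl2_act g (Complex ?uk (?T n)))"
      unfolding ky(2) sl2_act_vertical[OF k ky(1) T(2), symmetric] unfolding k_def
      by (rule sl2_act_mult[OF \<gamma> g(1)]) simp
    then show ?thesis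
      by (simp only: sl2_act_inverse(1)[OF \<gamma> Im_sl2_act_pos[OF g(1) I]])
  qed
  have e3: "sl2_act ?\<gamma>' (Complex (a / c) (?T n)) = Complex (of_rat p) (1 / (c\<^sup>2 * ?T n))" for n
    using sl2_act_vertical[OF \<gamma>' _ T(2), of n] c0 unfolding SL2Z_inverse_entries[OF \<gamma>] by (simp add: abcd p(2))
  note edge = primitive_edge[OF W green_density_integrable[OF F dec _ one_neq_zero]]
  have l1: "(\<lambda>n. W (Complex x (?T n)) - W (Complex x (1 / (?cg\<^sup>2 * ?T n)))) \<longlonglongrightarrow> integral {0<..} (green_density 1 (- x) F Fu x)"
    unfolding x_def by (rule edge[OF q(1) SL2Z_c_ge_1[OF gx(1)], unfolded x_def])
  have l2: "(\<lambda>n. W (Complex (of_rat p) (?T n)) - W (Complex (of_rat p) (1 / (c\<^sup>2 * ?T n)))) \<longlonglongrightarrow> integral {0<..} (green_density 1 (- x) F Fu (of_rat p))"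
    unfolding abcd by (rule edge[OF p(1) SL2Z_c_ge_1[OF c0]])
  have l3: "(\<lambda>n. W (sl2_act ?\<gamma>' (Complex y (?T n))) - W (sl2_act ?\<gamma>' (Complex y (1 / (?ck\<^sup>2 * ?T n))))) \<longlonglongrightarrow>
      integral {0<..} (green_density J (- J * y) F Fu y)"
    by (rule primitive_edge[OF W' green_density_integrable[OF F dec q(3) J0, folded y_def] SL2Z_c_ge_1[OF ky(1)]])
  have k1: "(\<lambda>n. W (Complex x (?T n)) - W (Complex (of_rat p) (?T n))) \<longlonglongrightarrow> 0"
    by (rule primitive_corner[OF W PQ dec T(1)])
  have k2: "(\<lambda>n. W (sl2_act g (Complex ?uk (?T n))) - W (sl2_act g (Complex ?ug (?T n)))) \<longlonglongrightarrow> 0"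
    by (rule primitive_corner[OF Wg(1) Wg(2) decG T(1)])
  have k3: "(\<lambda>n. W (sl2_act ?\<gamma>' (Complex (a / c) (?T n))) - W (sl2_act ?\<gamma>' (Complex y (?T n)))) \<longlonglongrightarrow> 0"
    by (rule primitive_corner[OF W' PQ' dec T(1)])
  \<comment> \<open>Edges and corners telescope around the truncated triangle; the three corners
    contribute 0.\<close>
  have "(\<lambda>n. W (Complex x (?T n)) - W (Complex x (1 / (?cg\<^sup>2 * ?T n)))) \<longlonglongrightarrow>
      0 + integral {0<..} (green_density 1 (- x) F Fu (of_rat p)) + 0 + integral {0<..} (green_density J (- J * y) F Fu y) + 0"
    using tendsto_add[OF tendsto_add[OF tendsto_add[OF tendsto_add[OF k1 l2] k3] l3] k2]
    unfolding e1 e2 e3 by simp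
  from LIMSEQ_unique[OF l1 this]
  have sum: "integral {0<..} (green_density 1 (- x) F Fu x) =
      integral {0<..} (green_density 1 (- x) F Fu (of_rat p)) + integral {0<..} (green_density J (- J * y) F Fu y)"
    by simp
  have "integral {0<..} (green_density P (- P * z) F Fu z) = inverse (of_real \<bar>P\<bar>) * integral {0<..} (\<lambda>v. Fu (Complex z v) / of_real (sqrt v))"
    if "P \<noteq> 0" for P z
  proof -
    have "integral {0<..} (green_density P (- P * z) F Fu z) = integral {0<..} (\<lambda>v. inverse (of_real \<bar>P\<bar>) * (Fu (Complex z v) / of_real (sqrt v)))"
      by (rule integral_cong, rule green_density_pole[OF that]) simp
    then show ?thesis
      by (simp only: integral_mult_right)
  qed
  note pole = this[OF one_neq_zero] this[OF J0]
  show ?thesis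
    using sum pole(1)[of x] unfolding pole(2) absJ x_def[symmetric] y_def[symmetric] by (simp add: diff_eq_eq)
qed

section \<open>Analyticity of the cocycle\<close>

text \<open>Over compact intervals the integral is holomorphic by differentiation under the
  integral. The tails are bounded by those of a majorant independent of z, so the convergence is
  uniform and holomorphy persists.\<close>

lemma holomorphic_integral_Ioi:
  fixes K :: "complex \<Rightarrow> real \<Rightarrow> complex"
  assumes U: "open U" "convex U"
    and der: "\<And>z v. z \<in> U \<Longrightarrow> v > 0 \<Longrightarrow> ((\<lambda>z. K z v) has_field_derivative K' z v) (at z)"
    and cont: "\<And>z. z \<in> U \<Longrightarrow> continuous_on {0<..} (K z)"
    and cont': "continuous_on (U \<times> {0<..}) (\<lambda>(z, v). K' z v)"
    and M: "M \<ge> 0" and bound: "\<And>z v. z \<in> U \<Longrightarrow> v > 0 \<Longrightarrow> norm (K z v) \<le> M * (1 / (1 + v\<^sup>2))"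
  shows "(\<lambda>z. integral {0<..} (K z)) holomorphic_on U"
proof (rule holomorphic_uniform_sequence[OF U(1), where f = "\<lambda>n z. integral {inverse (real (Suc n))..real (Suc n)} (K z)"])
  let ?h = "\<lambda>v::real. M * (1 / (1 + v\<^sup>2))"
  let ?I = "\<lambda>n. {inverse (real (Suc n))..real (Suc n)}"
  have I: "?I n \<subseteq> {0<..}" for n
  proof
    fix v assume "v \<in> ?I n"
    then have "inverse (real (Suc n)) \<le> v" by simp
    moreover have "inverse (real (Suc n)) > 0" by simp
    ultimately show "v \<in> {0<..}" by (simp only: greaterThan_iff)
  qed
  have int: "K z absolutely_integrable_on {0<..}" if "z \<in> U" for z
    by (rule absolutely_integrable_inverse_square[OF cont[OF that] bound[OF that]])
  have "1 + v\<^sup>2 \<noteq> 0" for v :: real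
    by (rule less_imp_neq[THEN not_sym], rule add_pos_nonneg) auto
  then have hc: "continuous_on T ?h" for T
    by (intro continuous_intros) blast
  have hi: "?h integrable_on {0<..}"
    by (intro integrable_on_mult_right has_integral_integrable[OF inverse_square_has_integral])
  have hI: "?h integrable_on ?I n" for n
    by (rule integrable_continuous_interval[OF hc])
  have KI: "K z integrable_on ?I n" if "z \<in> U" for z n
    by (rule integrable_continuous_interval[OF continuous_on_subset[OF cont[OF that] I]])
  show "(\<lambda>z. integral (?I n) (K z)) holomorphic_on U" for n
  proof -
    have "(\<lambda>z. integral (cbox (inverse (real (Suc n))) (real (Suc n))) (K z)) holomorphic_on U"
    proof (rule leibniz_rule_holomorphic[where fx = K'])
      have pos: "v > 0" if "v \<in> cbox (inverse (real (Suc n))) (real (Suc n))" for v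
        using subsetD[OF I that[unfolded box_real]] by (simp only: greaterThan_iff)
      show "((\<lambda>z. K z v) has_field_derivative K' z v) (at z within U)" if "z \<in> U" "v \<in> cbox (inverse (real (Suc n))) (real (Suc n))" for z v
        by (rule has_field_derivative_at_within, rule der[OF that(1) pos[OF that(2)]])
      show "K z integrable_on cbox (inverse (real (Suc n))) (real (Suc n))" if "z \<in> U" for z
        unfolding box_real by (rule KI[OF that])
      show "continuous_on (U \<times> cbox (inverse (real (Suc n))) (real (Suc n))) (\<lambda>(z, v). K' z v)"
        unfolding box_real by (rule continuous_on_subset[OF cont' Sigma_mono[OF order_refl I]])
    qed (rule U(2))
    then show ?thesis unfolding box_real .
  qed
  have "(\<lambda>n. integral {0<..} ?h - integral (?I n) ?h) \<longlonglongrightarrow> integral {0<..} ?h - integral {0<..} ?h"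
  proof (intro tendsto_diff tendsto_const integral_Icc_tendsto)
    show "?h absolutely_integrable_on {0<..}"
      by (rule nonnegative_absolutely_integrable_1[OF hi]) (use M in simp)
    show "(\<lambda>n. inverse (real (Suc n))) \<longlonglongrightarrow> 0"
      by (rule LIMSEQ_inverse_real_of_nat)
    show "filterlim (\<lambda>n. real (Suc n)) at_top sequentially"
      by (rule filterlim_compose[OF filterlim_real_sequentially filterlim_Suc])
  qed simp
  then have lim: "(\<lambda>n. integral {0<..} ?h - integral (?I n) ?h) \<longlonglongrightarrow> 0"
    by (simp only: diff_self)
  fix z assume z: "z \<in> U"
  then obtain d where d: "d > 0" "cball z d \<subseteq> U"
    using U(1) by (meson open_contains_cball)
  have "uniform_limit (cball z d) (\<lambda>n z. integral (?I n) (K z)) (\<lambda>z. integral {0<..} (K z)) sequentially"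
  proof (rule uniform_limitI)
    fix e :: real assume "e > 0"
    then have "eventually (\<lambda>n. integral {0<..} ?h - integral (?I n) ?h < e) sequentially"
      using order_tendstoD(2)[OF lim] by blast
    then show "\<forall>\<^sub>F n in sequentially. \<forall>y\<in>cball z d. dist (integral (?I n) (K y)) (integral {0<..} (K y)) < e"
    proof (rule eventually_mono, intro ballI)
      fix n y assume e: "integral {0<..} ?h - integral (?I n) ?h < e" and "y \<in> cball z d"
      then have y: "y \<in> U" using d by blast
      have neg: "negligible (?I n - {0<..})"
        using I[of n] by (metis Diff_eq_empty_iff negligible_empty)
      have Ky: "K y integrable_on {0<..}"
        using int[OF y] by (simp add: absolutely_integrable_on_def)
      have "norm (integral ({0<..} - ?I n) (K y)) \<le> integral ({0<..} - ?I n) ?h"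
        by (rule integral_norm_bound_integral)
           (use bound[OF y] neg in \<open>auto intro!: integrable_setdiff[OF integrable_integral integrable_integral] Ky KI[OF y] hi hI simp only: Diff_iff greaterThan_iff\<close>)
      then have "norm (integral {0<..} (K y) - integral (?I n) (K y)) \<le> integral {0<..} ?h - integral (?I n) ?h"
        by (simp only: integral_setdiff[OF Ky KI[OF y] neg] integral_setdiff[OF hi hI neg])
      then show "dist (integral (?I n) (K y)) (integral {0<..} (K y)) < e"
        using e by (simp only: dist_norm norm_minus_commute)
    qed
  qed
  with d show "\<exists>d>0. cball z d \<subseteq> U \<and> uniform_limit (cball z d) (\<lambda>n z. integral (?I n) (K z)) (\<lambda>z. integral {0<..} (K z)) sequentially"
    by blast
qed

lemma holomorphic_imp_real_analytic:
  assumes "\<And>x. x \<in> U \<Longrightarrow> \<exists>G \<rho>. \<rho> > 0 \<and> G holomorphic_on ball (of_real x) \<rho> \<and> (\<forall>y. \<bar>y - x\<bar> < \<rho> \<longrightarrow> g y = G (of_real y))"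
  shows "real_analytic_on g U"
  unfolding real_analytic_on_def
proof
  fix x assume "x \<in> U"
  then obtain G \<rho> where G: "\<rho> > 0" "G holomorphic_on ball (of_real x) \<rho>" "\<And>y. \<bar>y - x\<bar> < \<rho> \<Longrightarrow> g y = G (of_real y)"
    using assms by blast
  show "\<exists>a r. r > 0 \<and> (\<forall>y. \<bar>y - x\<bar> < r \<longrightarrow> (\<lambda>n. a n * of_real (y - x) ^ n) sums g y)"
  proof (intro exI conjI allI impI)
    fix y assume y: "\<bar>y - x\<bar> < \<rho>"
    then have "of_real y \<in> ball (complex_of_real x) \<rho>"
      by (simp add: dist_norm norm_minus_commute flip: of_real_diff)
    from holomorphic_power_series[OF G(2) this]
    show "(\<lambda>n. (deriv ^^ n) G (of_real x) / fact n * of_real (y - x) ^ n) sums g y"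
      by (simp add: G(3)[OF y])
  qed (rule G(1))
qed

text \<open>Here \<open>S\<close> plays the role of the square root of (p - z)^2 + v^2.\<close>

lemma kernel_has_field_derivative:
  fixes S :: "complex \<Rightarrow> complex"
  assumes S: "(S has_field_derivative - (p - z) / S z) (at z)" and S0: "S z \<noteq> 0"
  shows "((\<lambda>z. a * (c / S z) + b * (c * (p - z) / S z ^ 3)) has_field_derivative
    a * (c * (p - z) / S z ^ 3) + b * (c * (3 * (p - z)\<^sup>2 / S z ^ 5 - 1 / S z ^ 3))) (at z)"
proof -
  have 1: "((\<lambda>z. inverse (S z)) has_field_derivative - (inverse (S z) * (- (p - z) / S z) * inverse (S z))) (at z)"
    by (rule DERIV_inverse'[OF S S0])
  have 2: "((\<lambda>z. inverse (S z) ^ 3) has_field_derivative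
      of_nat 3 * (- (inverse (S z) * (- (p - z) / S z) * inverse (S z)) * inverse (S z) ^ (3 - Suc 0))) (at z)"
    by (rule DERIV_power[OF 1])
  have 3: "((\<lambda>z. p - z) has_field_derivative 0 - 1) (at z)"
    by (rule DERIV_diff[OF DERIV_const DERIV_ident])
  have eq: "a * (c * - (i * (- P * i) * i)) + b * (c * ((0 - 1) * i ^ 3 + of_nat 3 * (- (i * (- P * i) * i) * i ^ (3 - Suc 0)) * P)) =
      a * (c * P * i ^ 3) + b * (c * (3 * P\<^sup>2 * i ^ 5 - i ^ 3))" for P i
    by (simp add: algebra_simps eval_nat_numeral)
  have "((\<lambda>z. a * (c * inverse (S z)) + b * (c * ((p - z) * inverse (S z) ^ 3))) has_field_derivative
      a * (c * - (inverse (S z) * (- (p - z) / S z) * inverse (S z))) +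
      b * (c * ((0 - 1) * inverse (S z) ^ 3 + of_nat 3 * (- (inverse (S z) * (- (p - z) / S z) * inverse (S z)) * inverse (S z) ^ (3 - Suc 0)) * (p - z)))) (at z)"
    by (intro DERIV_add DERIV_cmult DERIV_mult 1 2 3)
  then show ?thesis
    unfolding divide_inverse eq by (simp only: power_inverse mult.assoc mult_1_left)
qed

text \<open>The kernel extends holomorphically to complex z in the disc about x of radius |p - x| /
  2. There |Im z| is at most |p - Re z|, so (p - z)^2 + v^2 has real part at least v^2: the
  principal root is holomorphic in z and its modulus is at least v.\<close>

lemma kernel_integral_real_analytic:
  fixes f g :: "real \<Rightarrow> complex" and p :: real
  assumes f: "continuous_on {0<..} f" and g: "continuous_on {0<..} g"
    and bound: "\<And>v. v > 0 \<Longrightarrow> norm (f v) \<le> C * v ^ 4 \<and> norm (f v) \<le> C / v ^ 4 \<and> norm (g v) \<le> C * v ^ 4 \<and> norm (g v) \<le> C / v ^ 4"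
  shows "real_analytic_on (\<lambda>x. integral {0<..} (\<lambda>v. f v * of_real (sqrt v / sqrt ((p - x)\<^sup>2 + v\<^sup>2)) +
    g v * of_real (sqrt v * (p - x) / sqrt ((p - x)\<^sup>2 + v\<^sup>2) ^ 3))) (UNIV - {p})"
proof (rule holomorphic_imp_real_analytic)
  fix x assume "x \<in> UNIV - {p}"
  then have xp: "x \<noteq> p" by simp
  define \<rho> where "\<rho> = \<bar>p - x\<bar> / 2"
  have \<rho>: "\<rho> > 0" using xp by (simp add: \<rho>_def)
  define D where "D z v = (of_real p - z)\<^sup>2 + (of_real v)\<^sup>2" for z :: complex and v :: real
  define K where "K z v = f v * (of_real (sqrt v) / csqrt (D z v)) + g v * (of_real (sqrt v) * (of_real p - z) / csqrt (D z v) ^ 3)" for z v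
  define K' where "K' z v = f v * (of_real (sqrt v) * (of_real p - z) / csqrt (D z v) ^ 3) +
     g v * (of_real (sqrt v) * (3 * (of_real p - z)\<^sup>2 / csqrt (D z v) ^ 5 - 1 / csqrt (D z v) ^ 3))" for z v
  let ?U = "ball (complex_of_real x) \<rho>"
  have D: "Re (D z v) \<ge> v\<^sup>2" "norm (of_real p - z) \<le> 3 * \<rho>" if z: "z \<in> ?U" for z v
  proof -
    have n: "norm (of_real x - z) < \<rho>"
      using z by (simp add: dist_norm)
    have "\<bar>Re (of_real x - z)\<bar> < \<rho>" "\<bar>Im (of_real x - z)\<bar> < \<rho>"
      using n abs_Re_le_cmod[of "of_real x - z"] abs_Im_le_cmod[of "of_real x - z"] by linarith+
    then have "\<bar>Im z\<bar> \<le> \<bar>p - Re z\<bar>"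
      unfolding \<rho>_def by (simp add: abs_if split: if_splits)
    then have "(Im z)\<^sup>2 \<le> (p - Re z)\<^sup>2"
      by (simp add: abs_le_square_iff)
    then show "Re (D z v) \<ge> v\<^sup>2"
      by (simp add: D_def Re_power2)
    have "norm (of_real p - z) \<le> norm (of_real p - complex_of_real x) + norm (of_real x - z)"
      by (rule order_trans[OF _ norm_triangle_ineq]) simp
    also have "norm (of_real p - complex_of_real x) = 2 * \<rho>"
      by (simp add: \<rho>_def flip: of_real_diff)
    finally show "norm (of_real p - z) \<le> 3 * \<rho>"
      using n by linarith
  qed
  have Dpos: "Re (D z v) > 0" if "z \<in> ?U" "v > 0" for z v
    using D(1)[OF that(1), of v] that(2) by (meson less_le_trans zero_less_power)
  have s0: "csqrt (D z v) \<noteq> 0" if "z \<in> ?U" "v > 0" for z v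
    using Dpos[OF that] by auto
  have sv: "norm (csqrt (D z v)) \<ge> v" if "z \<in> ?U" "v > 0" for z v
  proof -
    have "v\<^sup>2 \<le> norm (D z v)"
      using D(1)[OF that(1), of v] complex_Re_le_cmod[of "D z v"] by linarith
    then show ?thesis
      using that(2) by (simp add: real_le_rsqrt)
  qed
  have csq: "continuous_on {w. Re w > 0} csqrt"
    by (rule continuous_at_imp_continuous_on) (auto intro!: continuous_at_csqrt simp: complex_nonpos_Reals_iff)
  have cD: "continuous_on T (\<lambda>y. D (Z y) (V y))" if "continuous_on T Z" "continuous_on T V" for T :: "'b::topological_space set" and Z V
    unfolding D_def by (intro continuous_intros that)
  have cs: "continuous_on T (\<lambda>y. csqrt (D (Z y) (V y)))"
    if "continuous_on T Z" "continuous_on T V" "\<And>y. y \<in> T \<Longrightarrow> Z y \<in> ?U \<and> V y > 0" for T :: "'b::topological_space set" and Z V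
    by (rule continuous_on_compose2[OF csq cD[OF that(1,2)]]) (use that(3) Dpos in auto)
  have "norm (f 1) \<le> C"
    using bound[of 1] by simp
  then have C: "C \<ge> 0"
    using norm_ge_zero[of "f 1"] by linarith
  have "(\<lambda>z. integral {0<..} (K z)) holomorphic_on ?U"
  proof (rule holomorphic_integral_Ioi)
    show "2 * (C * (1 + 3 * \<rho>)) \<ge> 0"
      using C \<rho> by simp
    fix z v assume z: "z \<in> ?U" and v: "(v::real) > 0"
    have ds: "((\<lambda>z. csqrt (D z v)) has_field_derivative - (of_real p - z) / csqrt (D z v)) (at z)"
    proof -
      have "(csqrt has_field_derivative inverse (2 * csqrt (D z v))) (at (D z v))"
        by (rule has_field_derivative_csqrt) (use Dpos[OF z v] in \<open>auto simp: complex_nonpos_Reals_iff\<close>)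
      moreover have "((\<lambda>z. D z v) has_field_derivative - 2 * (of_real p - z)) (at z)"
        unfolding D_def by (auto intro!: derivative_eq_intros)
      ultimately have "((\<lambda>z. csqrt (D z v)) has_field_derivative inverse (2 * csqrt (D z v)) * (- 2 * (of_real p - z))) (at z)"
        by (rule DERIV_chain2)
      moreover have "inverse (2 * s) * (- 2 * P) = - P / s" for s P :: complex
        by (simp add: field_simps)
      ultimately show ?thesis by (simp only:)
    qed
    show "((\<lambda>z. K z v) has_field_derivative K' z v) (at z)"
      unfolding K_def K'_def by (rule kernel_has_field_derivative[OF ds s0[OF z v]])
    show "norm (K z v) \<le> 2 * (C * (1 + 3 * \<rho>)) * (1 / (1 + v\<^sup>2))"
    proof -
      have *: "(w \<le> 1 \<longrightarrow> norm (K z w) \<le> C * (1 + 3 * \<rho>)) \<and> (w \<ge> 1 \<longrightarrow> norm (K z w) \<le> C * (1 + 3 * \<rho>) / w\<^sup>2)"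
        if w: "w > 0" for w
      proof (intro conjI impI)
        have b: "norm (K z w) \<le> norm (f w) * (sqrt w / w) + norm (g w) * (sqrt w * (3 * \<rho>) / w ^ 3)"
          unfolding K_def
          by (rule order_trans[OF norm_triangle_ineq])
             (use w \<rho> in \<open>auto simp: norm_mult norm_divide norm_power simp del: norm_csqrt intro!: add_mono mult_left_mono frac_le mult_mono power_mono
                D(2)[OF z] sv[OF z w] mult_nonneg_nonneg\<close>)
        have bw: "norm (f w) \<le> C * w ^ 4" "norm (f w) \<le> C / w ^ 4" "norm (g w) \<le> C * w ^ 4" "norm (g w) \<le> C / w ^ 4"
          using bound[OF w] by blast+
        show "norm (K z w) \<le> C * (1 + 3 * \<rho>)" if w1: "w \<le> 1"
        proof -
          have s1: "sqrt w \<le> 1" using w1 by simp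
          have "norm (f w) * (sqrt w / w) + norm (g w) * (sqrt w * (3 * \<rho>) / w ^ 3) \<le>
              (C * w ^ 4) * (1 / w) + (C * w ^ 4) * (1 * (3 * \<rho>) / w ^ 3)"
            using s1 w \<rho> C by (intro add_mono mult_mono bw divide_right_mono mult_right_mono) auto
          also have "\<dots> = C * w ^ 3 + C * (3 * \<rho>) * w"
            using w by (simp add: field_simps eval_nat_numeral)
          also have "\<dots> \<le> C * 1 + C * (3 * \<rho>) * 1"
            using w w1 \<rho> C by (intro add_mono mult_left_mono power_le_one) auto
          finally show ?thesis
            using b by (simp add: distrib_left)
        qed
        show "norm (K z w) \<le> C * (1 + 3 * \<rho>) / w\<^sup>2" if w1: "w \<ge> 1"
        proof -
          have "sqrt w \<le> w"
            using w1 by (intro real_le_lsqrt) (auto simp: power2_eq_square)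
          then have "norm (f w) * (sqrt w / w) + norm (g w) * (sqrt w * (3 * \<rho>) / w ^ 3) \<le>
              (C / w ^ 4) * (w / w) + (C / w ^ 4) * (w * (3 * \<rho>) / w ^ 3)"
            using w \<rho> C by (intro add_mono mult_mono bw divide_right_mono mult_right_mono) auto
          also have "\<dots> = C / w\<^sup>2 * (1 / w\<^sup>2) + C / w\<^sup>2 * (3 * \<rho> * (1 / w ^ 4))"
            using w by (simp add: field_simps eval_nat_numeral)
          also have "\<dots> \<le> C / w\<^sup>2 * 1 + C / w\<^sup>2 * (3 * \<rho> * 1)"
            using w w1 \<rho> C by (intro add_mono mult_left_mono) (auto simp: divide_le_eq_1 one_le_power)
          finally show ?thesis
            using b by (simp add: distrib_left add_divide_distrib)
        qed
      qed
      have "norm (K z w) \<le> C * (1 + 3 * \<rho>)" if "0 < w" "w \<le> 1" for w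
        using *[OF that(1)] that(2) by blast
      moreover have "norm (K z w) \<le> C * (1 + 3 * \<rho>) / w\<^sup>2" if "w \<ge> 1" for w
      proof -
        have "w > 0" using that by linarith
        from *[OF this] that show ?thesis by blast
      qed
      ultimately show ?thesis
        using v by (rule inverse_square_bound)
    qed
  next
    show "continuous_on {0<..} (K z)" if "z \<in> ?U" for z
      unfolding K_def by (intro continuous_intros f g cs) (use that s0 in auto)
    have f2: "continuous_on (?U \<times> {0<..}) (\<lambda>y. f (snd y))" "continuous_on (?U \<times> {0<..}) (\<lambda>y. g (snd y))"
      by (auto intro!: continuous_on_compose2[OF f] continuous_on_compose2[OF g] continuous_intros)
    show "continuous_on (?U \<times> {0<..}) (\<lambda>(z, v). K' z v)"
      unfolding K'_def case_prod_beta by (intro continuous_intros f2 cs) (use s0 in auto)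
  qed auto
  then show "\<exists>G \<rho>. \<rho> > 0 \<and> G holomorphic_on ball (of_real x) \<rho> \<and> (\<forall>y. \<bar>y - x\<bar> < \<rho> \<longrightarrow>
      integral {0<..} (\<lambda>v. f v * of_real (sqrt v / sqrt ((p - y)\<^sup>2 + v\<^sup>2)) + g v * of_real (sqrt v * (p - y) / sqrt ((p - y)\<^sup>2 + v\<^sup>2) ^ 3)) = G (of_real y))"
  proof (intro exI conjI allI impI)
    have "D (of_real y) v = of_real ((p - y)\<^sup>2 + v\<^sup>2)" for y v
      by (simp add: D_def)
    then have "csqrt (D (of_real y) v) = of_real (sqrt ((p - y)\<^sup>2 + v\<^sup>2))" for y v
      by (simp only: of_real_sqrt sum_power2_ge_zero)
    then show "integral {0<..} (\<lambda>v. f v * of_real (sqrt v / sqrt ((p - y)\<^sup>2 + v\<^sup>2)) + g v * of_real (sqrt v * (p - y) / sqrt ((p - y)\<^sup>2 + v\<^sup>2) ^ 3)) =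
       integral {0<..} (K (of_real y))" for y
      unfolding K_def by simp
  qed (use \<rho> in auto)
qed

section \<open>Values at the cusps\<close>

text \<open>The series has no constant term. Compared with height 1, every term at height y gains at
  least the factor \<open>exp (- f1 * (y - 1))\<close> of the lowest frequency.\<close>

lemma F_plus_tendsto_at_Infty:
  assumes N: "N > 0" and A: "subexponential A"
  shows "((\<lambda>t. F_plus N A (\<i> * of_real t)) \<longlongrightarrow> 0) at_top"
proof -
  define f1 where "f1 = freq N 1"
  have f1: "f1 > 0" and fn: "freq N n = of_int n * f1" for n
    using N by (simp_all add: f1_def freq_1_pos) (simp add: freq_def)
  let ?t = "\<lambda>y n. A n * of_real (exp (- freq N n * y)) * cis (freq N n * 0)"
  have sumb: "(\<lambda>n. norm (?t y n)) summable_on {0<..}" if "y > 0" for y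
    using has_sum_imp_summable[OF F_plus_has_sum[OF N A that, of 0]] by (simp only: summable_on_iff_abs_summable_on_complex)
  define S where "S = (\<Sum>\<^sub>\<infinity>n\<in>{0<..}. norm (?t 1 n))"
  have bound: "norm (F_plus N A (\<i> * of_real y)) \<le> exp (- f1 * (y - 1)) * S" if y: "y \<ge> 1" for y
  proof -
    have y0: "y > 0" using y by simp
    have "norm (F_plus N A (Complex 0 y)) \<le> (\<Sum>\<^sub>\<infinity>n\<in>{0<..}. norm (?t y n))"
      unfolding infsumI[OF F_plus_has_sum[OF N A y0, of 0], symmetric] by (rule norm_infsum_bound[OF sumb[OF y0]])
    also have "\<dots> \<le> (\<Sum>\<^sub>\<infinity>n\<in>{0<..}. exp (- f1 * (y - 1)) * norm (?t 1 n))"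
    proof (rule infsum_mono[OF sumb[OF y0] summable_on_cmult_right[OF sumb[OF zero_less_one]]])
      fix n :: int assume "n \<in> {0<..}"
      then have "1 * (f1 * (y - 1)) \<le> of_int n * (f1 * (y - 1))"
        using f1 y by (intro mult_right_mono) auto
      then have "- freq N n * y \<le> - f1 * (y - 1) + - freq N n * 1"
        unfolding fn by (simp add: algebra_simps)
      then have "exp (- freq N n * y) \<le> exp (- f1 * (y - 1)) * exp (- freq N n * 1)"
        by (simp only: exp_add[symmetric] exp_le_cancel_iff)
      then have "norm (A n) * exp (- freq N n * y) \<le> norm (A n) * (exp (- f1 * (y - 1)) * exp (- freq N n * 1))"
        by (rule mult_left_mono) simp
      then show "norm (?t y n) \<le> exp (- f1 * (y - 1)) * norm (?t 1 n)"
        by (simp add: norm_mult mult_ac)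
    qed
    also have "\<dots> = exp (- f1 * (y - 1)) * S"
      unfolding S_def by (rule infsum_cmult_right')
    also have "Complex 0 y = \<i> * of_real y"
      by (simp add: complex_eq_iff)
    finally show ?thesis .
  qed
  show ?thesis
  proof (rule Lim_null_comparison)
    show "\<forall>\<^sub>F y in at_top. norm (F_plus N A (\<i> * of_real y)) \<le> exp (- f1 * (y - 1)) * S"
      using eventually_ge_at_top[of 1] by eventually_elim (rule bound)
    show "((\<lambda>y. exp (- f1 * (y - 1)) * S) \<longlongrightarrow> 0) at_top"
      using f1 by real_asymp
  qed
qed

lemma vertical_line_eq: "of_rat q + \<i> * of_real t = Complex (of_rat q) t"
  by (simp add: complex_of_rat complex_eq_iff)

text \<open>Up to the factor -i/pi this is the value of F+ at a cuspidal cusp x.\<close>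

definition ray_integral :: "(complex \<Rightarrow> complex) \<Rightarrow> real \<Rightarrow> complex" where
  "ray_integral Fu x = integral {0<..} (\<lambda>v. Fu (Complex x v) / of_real (sqrt v))"

lemma F_plus_value:
  assumes N: "N > 0" and F: "eigenfunction F Fu Fv" and expF: "has_cusp_expansion N F 0 0 A" and cusp: "cuspidal_at F (Fin q)"
  shows "has_cusp_value (F_plus N A) (Fin q) (- (\<i> / of_real pi) * ray_integral Fu (of_rat q))"
proof -
  obtain g h a where g: "g \<in> carrier SL2Z" "h > 0" "cusp_act g Infty = Fin q"
    and expG: "has_cusp_expansion h (\<lambda>\<tau>. F (sl2_act g \<tau>)) 0 0 a"
    using cusp unfolding cuspidal_at_def by blast
  note gq = cusp_act_Infty_eq_Fin[OF g(3)]
  show ?thesis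
    using F_plus_at_cusp[OF N F expF g(1) gq(1) g(2) expG]
    by (simp add: gq(2)[symmetric] vertical_line_eq ray_integral_def)
qed

text \<open>Subtracting the assumed limit from the asymptotic formula leaves a divergent term that
  converges, so its coefficients vanish. The constant \<open>be * I2\<close> is merged into the
  first coefficient; \<open>be\<close> = 0 gives k2 = 0, and then \<open>al\<close> = 0 gives k1 =
  0.\<close>

lemma cuspidal_at_if_F_plus_value:
  assumes \<Gamma>: "congruence_subgroup \<Gamma>" and maass: "maass_waveform \<Gamma> (1/4) F"
    and N: "N > 0" and expF: "has_cusp_expansion N F 0 0 A" and val: "has_cusp_value (F_plus N A) (Fin q) L"
  shows "cuspidal_at F (Fin q)"
proof -
  obtain g where g: "g \<in> carrier SL2Z" "cusp_act g Infty = Fin q"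
    using ex_SL2Z_cusp by blast
  note gq = cusp_act_Infty_eq_Fin[OF g(2)]
  obtain h k1 k2 a where h: "h > 0" and expG: "has_cusp_expansion h (\<lambda>\<tau>. F (sl2_act g \<tau>)) k1 k2 a"
    using cusp_expansion_exists[OF \<Gamma> maass g(1)] by blast
  define r where "r = \<bar>real_of_int (g$2$1)\<bar>"
  have r: "r \<noteq> 0" using gq(1) by (simp add: r_def)
  define I2 where "I2 = integral {0<..} (\<lambda>m::real. ln (sqrt (1 + m\<^sup>2)) / sqrt (1 + m\<^sup>2) ^ 3)"
  define al where "al = (k1 + k2 - k2 * of_real (ln (r\<^sup>2))) / of_real r"
  define be where "be = k2 / of_real r"
  have 1: "((\<lambda>y. F_plus N A (Complex (of_rat q) y)) \<longlongrightarrow> L) (at_right 0)"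
    using val by (simp add: vertical_line_eq)
  note 2 = F_plus_at_cusp[OF N maass_waveform_eigenfunction[OF maass] expF g(1) gq(1) h expG,
      folded gq(2) r_def I2_def, folded al_def be_def]
  have eq: "P - (P - (al - be * l - be * of_real I2) / Y) = ((al - be * of_real I2) - be * l) / Y" for P l Y
    by (simp add: diff_right_commute)
  have "((\<lambda>y. ((al - be * of_real I2) - be * of_real (ln y)) / (of_real pi * of_real y)) \<longlongrightarrow>
      L - (- (\<i> / of_real pi) * integral {0<..} (\<lambda>v. dir_deriv 1 F (Complex (of_rat q) v) / of_real (sqrt v)))) (at_right 0)"
    using tendsto_diff[OF 1 2] unfolding eq .
  from leading_term_bounded_imp_zero[OF this] have "k2 = 0" "al = 0"
    using r by (auto simp: be_def)
  then have "k1 = 0"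
    using r by (simp add: al_def)
  with \<open>k2 = 0\<close> expG g h show ?thesis
    unfolding cuspidal_at_def by blast
qed

lemma cuspidal_at_cusp_act:
  assumes \<gamma>: "\<gamma> \<in> carrier SL2Z" and inv: "\<And>\<tau>. Im \<tau> > 0 \<Longrightarrow> F (sl2_act \<gamma> \<tau>) = F \<tau>" and cusp: "cuspidal_at F \<alpha>"
  shows "cuspidal_at F (cusp_act \<gamma> \<alpha>)"
proof -
  obtain g h a where g: "g \<in> carrier SL2Z" "h > 0" "cusp_act g Infty = \<alpha>"
    and expG: "has_cusp_expansion h (\<lambda>\<tau>. F (sl2_act g \<tau>)) 0 0 a"
    using cusp unfolding cuspidal_at_def by blast
  have e: "F (sl2_act (\<gamma> ** g) \<tau>) = F (sl2_act g \<tau>)" if "Im \<tau> > 0" for \<tau>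
    unfolding sl2_act_mult[OF \<gamma> g(1) that] by (rule inv[OF Im_sl2_act_pos[OF g(1) that]])
  have "has_cusp_expansion h (\<lambda>\<tau>. F (sl2_act (\<gamma> ** g) \<tau>)) 0 0 a"
    using expG by (simp add: has_cusp_expansion_def upper_half_plane_def e)
  moreover have "cusp_act (\<gamma> ** g) Infty = cusp_act \<gamma> \<alpha>"
    unfolding cusp_act_mult_Infty[OF \<gamma> g(1)] g(3) ..
  ultimately show ?thesis
    unfolding cuspidal_at_def using SL2Z_closed[OF \<gamma> g(1)] g(2) by blast
qed

text \<open>The form in which x may become complex: it enters only through p - x and the root of (p
  - x)^2 + v^2.\<close>

lemma green_density_eq:
  assumes v: "v > 0"
  shows "green_density 1 (- x) F Fu p v = Fu (Complex p v) * of_real (sqrt v / sqrt ((p - x)\<^sup>2 + v\<^sup>2)) +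
    F (Complex p v) * of_real (sqrt v * (p - x) / sqrt ((p - x)\<^sup>2 + v\<^sup>2) ^ 3)"
proof -
  let ?s = "sqrt ((p - x)\<^sup>2 + v\<^sup>2)"
  have Z: "of_real 1 * Complex p v + of_real (- x) = Complex (p - x) v"
    by (simp add: complex_eq_iff)
  have s: "?s > 0" "?s\<^sup>2 = (p - x)\<^sup>2 + v\<^sup>2"
    using v by (auto simp: add_nonneg_pos)
  have R: "poisson 1 (- x) (Complex p v) = of_real (sqrt v / ?s)"
    unfolding poisson_def Z by (simp add: complex_norm)
  have "Im (1 / (Complex (p - x) v)\<^sup>2) = - (2 * (p - x) * v) / (((p - x)\<^sup>2 - v\<^sup>2)\<^sup>2 + (2 * (p - x) * v)\<^sup>2)"
    by (simp add: Im_divide Re_power2 Im_power2)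
  also have "((p - x)\<^sup>2 - v\<^sup>2)\<^sup>2 + (2 * (p - x) * v)\<^sup>2 = ((p - x)\<^sup>2 + v\<^sup>2)\<^sup>2"
    by (simp add: power2_eq_square algebra_simps)
  finally have im: "Im (1 / (Complex (p - x) v)\<^sup>2) = - (2 * (p - x) * v) / (?s\<^sup>2)\<^sup>2"
    by (simp only: s(2))
  have "- (2 * y * t\<^sup>2) / (S\<^sup>2)\<^sup>2 * S / (2 * t) = - (t * y / S ^ 3)" if "S > 0" "t > 0" for y S t :: real
    using that by (simp add: field_simps eval_nat_numeral)
  from this[OF s(1), of "sqrt v" "p - x"] have "- (2 * (p - x) * v) / (?s\<^sup>2)\<^sup>2 * ?s / (2 * sqrt v) = - (sqrt v * (p - x) / ?s ^ 3)"
    using v by (simp only: real_sqrt_gt_0_iff real_sqrt_pow2 less_imp_le)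
  then have Ru: "poisson_u 1 (- x) (Complex p v) = of_real (- (sqrt v * (p - x) / ?s ^ 3))"
    unfolding poisson_u_def Z complex.sel im by (simp only: complex_norm complex.sel)
  show ?thesis
    unfolding green_density_def R Ru by simp
qed

section \<open>The analytic extension of the cocycle\<close>

lemma real_analytic_on_cmult:
  assumes "real_analytic_on g U"
  shows "real_analytic_on (\<lambda>x. c * g x) U"
  unfolding real_analytic_on_def
proof
  fix x assume "x \<in> U"
  then obtain a r where a: "r > 0" "\<And>y. \<bar>y - x\<bar> < r \<Longrightarrow> (\<lambda>n. a n * of_real (y - x) ^ n) sums g y"
    using assms unfolding real_analytic_on_def by blast
  show "\<exists>a r. r > 0 \<and> (\<forall>y. \<bar>y - x\<bar> < r \<longrightarrow> (\<lambda>n. a n * of_real (y - x) ^ n) sums (c * g y))"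
    using a(1) sums_mult[OF a(2), of _ c] by (intro exI[of _ "\<lambda>n. c * a n"] exI[of _ r]) (simp add: mult.assoc)
qed

lemma cocycle_real_analytic:
  assumes F: "eigenfunction F Fu Fv" and dec: "decays_at_infinity F Fu Fv" and p: "cuspidal_at F (Fin p)"
  shows "real_analytic_on (\<lambda>x. c * integral {0<..} (green_density 1 (- x) F Fu (of_rat p))) (UNIV - {of_rat p})"
proof -
  obtain C where bound: "\<And>v. v > 0 \<Longrightarrow> norm (F (Complex (of_rat p) v)) \<le> C * v ^ 4 \<and> norm (F (Complex (of_rat p) v)) \<le> C / v ^ 4 \<and>
      norm (Fu (Complex (of_rat p) v)) \<le> C * v ^ 4 \<and> norm (Fu (Complex (of_rat p) v)) \<le> C / v ^ 4"
    using vertical_line_bounds[OF F dec p] by blast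
  have "integral {0<..} (green_density 1 (- x) F Fu (of_rat p)) =
      integral {0<..} (\<lambda>v. Fu (Complex (of_rat p) v) * of_real (sqrt v / sqrt ((of_rat p - x)\<^sup>2 + v\<^sup>2)) +
        F (Complex (of_rat p) v) * of_real (sqrt v * (of_rat p - x) / sqrt ((of_rat p - x)\<^sup>2 + v\<^sup>2) ^ 3))" for x
    by (rule integral_cong, rule green_density_eq) simp
  then show ?thesis
    by (simp only:) (intro real_analytic_on_cmult kernel_integral_real_analytic[where C = C]
      continuous_on_vertical eigenfunction_continuous_on[OF F]; use bound in blast)
qed

lemma ray_integral_translate:
  assumes F: "uhp_partials F Fu Fv" and per: "\<And>\<tau>. Im \<tau> > 0 \<Longrightarrow> F (\<tau> + of_real t) = F \<tau>"
  shows "ray_integral Fu (x + t) = ray_integral Fu x"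
proof -
  have m: "((\<lambda>\<tau>. \<tau> + of_real t) has_field_derivative 1) (at \<tau>)" for \<tau> :: complex
    by (auto intro!: derivative_eq_intros)
  have "uhp_partials (\<lambda>\<tau>. F (\<tau> + of_real t))
    (\<lambda>\<tau>. of_real (Re 1) * Fu (\<tau> + of_real t) + of_real (Im 1) * Fv (\<tau> + of_real t))
    (\<lambda>\<tau>. of_real (Re 1) * Fv (\<tau> + of_real t) - of_real (Im 1) * Fu (\<tau> + of_real t))"
    by (rule uhp_partials_compose[OF F m]) simp
  from uhp_partials_unique(1)[OF this F per] have "Fu (\<tau> + of_real t) = Fu \<tau>" if "Im \<tau> > 0" for \<tau>
    using that by simp
  moreover have "Complex (x + t) v = Complex x v + of_real t" for v
    by (simp add: complex_eq_iff)
  ultimately show ?thesis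
    unfolding ray_integral_def by (intro integral_cong) simp
qed

text \<open>If \<gamma> fixes infinity, it acts as a translation and the cocycle is 0 by
  periodicity. Otherwise the integral over the line from p = \<gamma>^-1 infinity is the extension,
  analytic off p; the condition on x keeps both x and \<gamma> x finite.\<close>

lemma cocycle_extends:
  assumes F: "eigenfunction F Fu Fv" and dec: "decays_at_infinity F Fu Fv" and \<gamma>: "\<gamma> \<in> carrier SL2Z"
    and inv: "\<And>\<tau>. Im \<tau> > 0 \<Longrightarrow> F (sl2_act \<gamma> \<tau>) = F \<tau>"
    and p: "cuspidal_at F (cusp_act (inv\<^bsub>SL2Z\<^esub> \<gamma>) Infty)"
    and f: "\<And>q. f (Fin q) = k * ray_integral Fu (of_rat q)"
  shows "\<exists>U r. open U \<and> real_analytic_on r U \<and>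
    (\<forall>x. cuspidal_at F (Fin x) \<and> of_int (\<gamma>$2$1) * x + of_int (\<gamma>$2$2) \<noteq> 0 \<longrightarrow> of_rat x \<in> U \<and>
      r (of_rat x) = f (Fin x) - inverse (of_rat \<bar>of_int (\<gamma>$2$1) * x + of_int (\<gamma>$2$2)\<bar>) * f (cusp_act \<gamma> (Fin x)))"
proof (cases "\<gamma>$2$1 = 0")
  case True
  define a b d where abd: "a = \<gamma>$1$1" "b = \<gamma>$1$2" "d = \<gamma>$2$2"
  have "a * d = 1"
    using SL2Z_det(1)[OF \<gamma>] True by (simp add: abd)
  \<comment> \<open>The diagonal entries are both 1 or both -1. The translation is by b / d, which
    is \<open>b * d\<close> in either case.\<close>
  then have ad: "a = d" "d = 1 \<or> d = - 1"
    using zmult_eq_1_iff[of a d] by auto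
  have "F (\<tau> + of_real (real_of_int (b * d))) = F \<tau>" if "Im \<tau> > 0" for \<tau>
  proof -
    have "sl2_act \<gamma> \<tau> = \<tau> + of_real (real_of_int (b * d))"
      using ad by (auto simp: sl2_act_def moebius_def True simp flip: abd)
    with inv[OF that] show ?thesis by simp
  qed
  note per = ray_integral_translate[OF eigenfunction_imp_partials[OF F] this]
  have "f (Fin x) - inverse (of_rat \<bar>of_int (\<gamma>$2$1) * x + of_int (\<gamma>$2$2)\<bar>) * f (cusp_act \<gamma> (Fin x)) = 0" for x
  proof -
    have "cusp_act \<gamma> (Fin x) = Fin (x + of_int (b * d))"
      using ad by (auto simp: True simp flip: abd)
    moreover have "inverse (complex_of_rat \<bar>of_int (\<gamma>$2$1) * x + of_int (\<gamma>$2$2)\<bar>) = 1"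
      using ad(2) by (auto simp: True simp flip: abd)
    ultimately show ?thesis
      by (simp add: f of_rat_add per del: of_int_mult)
  qed
  moreover have "real_analytic_on (\<lambda>_. 0) UNIV"
    unfolding real_analytic_on_def by (auto intro!: exI[of _ "\<lambda>_. 0"] exI[of _ 1])
  ultimately show ?thesis
    by (intro exI[of _ UNIV] exI[of _ "\<lambda>_. 0"]) simp
next
  case False
  define p where "p = - of_int (\<gamma>$2$2) / (of_int (\<gamma>$2$1) :: rat)"
  have "cusp_act (inv\<^bsub>SL2Z\<^esub> \<gamma>) Infty = Fin p"
    using False by (simp add: SL2Z_inverse_entries[OF \<gamma>] p_def)
  with p have cp: "cuspidal_at F (Fin p)" by simp
  have pr: "real_of_rat p = - real_of_int (\<gamma>$2$2) / real_of_int (\<gamma>$2$1)"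
    by (simp add: p_def of_rat_divide of_rat_minus)
  let ?r = "\<lambda>x. k * integral {0<..} (green_density 1 (- x) F Fu (of_rat p))"
  show ?thesis
  proof (intro exI conjI allI impI)
    show "open (UNIV - {real_of_rat p})" by (rule open_delete) simp
    show "real_analytic_on ?r (UNIV - {of_rat p})"
      by (rule cocycle_real_analytic[OF F dec cp])
    fix x assume "cuspidal_at F (Fin x) \<and> of_int (\<gamma>$2$1) * x + of_int (\<gamma>$2$2) \<noteq> 0"
    then have x: "cuspidal_at F (Fin x)" "of_int (\<gamma>$2$1) * x + of_int (\<gamma>$2$2) \<noteq> 0" by auto
    then show "real_of_rat x \<in> UNIV - {of_rat p}"
      using False by (auto simp: p_def)
    obtain y where y: "cusp_act \<gamma> (Fin x) = Fin y"
      using x(2) by simp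
    have cy: "cuspidal_at F (Fin y)"
      using cuspidal_at_cusp_act[OF \<gamma> inv x(1)] unfolding y by blast
    have cf: "integral {0<..} (\<lambda>v. Fu (Complex (of_rat x) v) / of_real (sqrt v))
        - inverse (of_rat \<bar>of_int (\<gamma>$2$1) * x + of_int (\<gamma>$2$2)\<bar>) * integral {0<..} (\<lambda>v. Fu (Complex (of_rat y) v) / of_real (sqrt v)) =
      integral {0<..} (green_density 1 (- of_rat x) F Fu (of_rat p))"
      by (rule cocycle_formula[OF F dec \<gamma> inv False cp pr x(1) y cy])
    have alg: "k * (a - j * b) = k * a - j * (k * b)" for a j b :: complex
      by (simp add: algebra_simps)
    show "?r (of_rat x) = f (Fin x) - inverse (of_rat \<bar>of_int (\<gamma>$2$1) * x + of_int (\<gamma>$2$2)\<bar>) * f (cusp_act \<gamma> (Fin x))"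
      unfolding y f ray_integral_def cf[symmetric] by (rule alg)
  qed
qed

theorem theorem2p8:
  fixes \<Gamma> :: "(int^2^2) set" and F :: "complex \<Rightarrow> complex"
    and N :: nat and A :: "int \<Rightarrow> complex"
  assumes "congruence_subgroup \<Gamma>"
    and "maass_waveform \<Gamma> (1/4) F"
    and "cuspidal_at F Infty"
    and "N > 0" and "has_cusp_expansion N F 0 0 A"
  shows "\<exists>X. defines_quantum_modular_form (F_plus N A) X (Gamma_F \<Gamma> F) \<and>
             (\<forall>Y. defines_quantum_modular_form (F_plus N A) Y (Gamma_F \<Gamma> F) \<longrightarrow> Y \<subseteq> X) \<and>
             (\<forall>\<alpha>. cuspidal_at F \<alpha> \<longleftrightarrow> \<alpha> \<in> X)"
proof -
  let ?Fu = "dir_deriv 1 F" and ?Fv = "dir_deriv \<i> F"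
  have F: "eigenfunction F ?Fu ?Fv"
    by (rule maass_waveform_eigenfunction[OF assms(2)])
  have dec: "decays_at_infinity F ?Fu ?Fv"
    by (rule cuspidal_expansion_decays[OF assms(4) eigenfunction_imp_partials[OF F] assms(5)])
  have A: "subexponential A"
    using assms(5) by (simp add: has_cusp_expansion_iff[OF assms(4)])
  have sub: "subgroup \<Gamma> SL2Z"
    using assms(1) by (simp add: congruence_subgroup_def)
  have \<Gamma>: "\<gamma> \<in> carrier SL2Z" if "\<gamma> \<in> \<Gamma>" for \<gamma>
    using subgroup.subset[OF sub] that by (rule subsetD)
  have inv: "F (sl2_act \<gamma> \<tau>) = F \<tau>" if "\<gamma> \<in> \<Gamma>" "Im \<tau> > 0" for \<gamma> \<tau>
    using assms(2) that by (simp add: maass_waveform_def upper_half_plane_def)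
  have stable: "cuspidal_at F (cusp_act \<gamma> \<alpha>)" if "\<gamma> \<in> \<Gamma>" "cuspidal_at F \<alpha>" for \<gamma> \<alpha>
    by (rule cuspidal_at_cusp_act[OF \<Gamma>[OF that(1)] inv[OF that(1)] that(2)])
  have pole: "cuspidal_at F (cusp_act (inv\<^bsub>SL2Z\<^esub> \<gamma>) Infty)" if "\<gamma> \<in> \<Gamma>" for \<gamma>
    by (rule stable[OF subgroup.m_inv_closed[OF sub that] assms(3)])
  \<comment> \<open>\<gamma>^-1 infinity is equivalent to infinity under \<Gamma>, where F is
    cuspidal, so every \<gamma> satisfies the condition in \<open>Gamma_F\<close>. In particular
    \<open>Gamma_F\<close> is a subgroup.\<close>
  have \<Gamma>_F: "Gamma_F \<Gamma> F = \<Gamma>"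
    unfolding Gamma_F_def using pole by blast
  define k where "k = - (\<i> / of_real pi)"
  \<comment> \<open>At \<open>Infty\<close> the value is the limit 0 of F+ along the imaginary
    axis.\<close>
  define f where "f \<alpha> = (case \<alpha> of Infty \<Rightarrow> 0 | Fin q \<Rightarrow> k * ray_integral ?Fu (of_rat q))" for \<alpha>
  have f_Fin: "f (Fin q) = k * ray_integral ?Fu (of_rat q)" for q
    by (simp add: f_def)
  let ?X = "{\<alpha>. cuspidal_at F \<alpha>}"
  have "has_cusp_value (F_plus N A) \<alpha> (f \<alpha>)" if "\<alpha> \<in> ?X" for \<alpha>
  proof (cases \<alpha>)
    case Infty
    then show ?thesis
      using F_plus_tendsto_at_Infty[OF assms(4) A] by (simp add: f_def)
  next
    case (Fin q)
    then show ?thesis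
      using F_plus_value[OF assms(4) F assms(5)] that unfolding Fin f_Fin k_def by blast
  qed
  moreover have "quantum_modular_form f ?X \<Gamma>"
    unfolding quantum_modular_form_def mem_Collect_eq
    using sub stable cocycle_extends[OF F dec \<Gamma> inv pole f_Fin] by blast
  ultimately have X: "defines_quantum_modular_form (F_plus N A) ?X (Gamma_F \<Gamma> F)"
    unfolding defines_quantum_modular_form_def \<Gamma>_F by blast
  \<comment> \<open>The existence of the vertical limits on Y already forces F to be cuspidal at the
    finite cusps of Y, while \<open>Infty\<close> is cuspidal by assumption.\<close>
  moreover have "Y \<subseteq> ?X" if "defines_quantum_modular_form (F_plus N A) Y (Gamma_F \<Gamma> F)" for Y
  proof
    fix \<alpha> assume "\<alpha> \<in> Y"
    with that obtain L where L: "has_cusp_value (F_plus N A) \<alpha> L"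
      unfolding defines_quantum_modular_form_def by blast
    show "\<alpha> \<in> ?X"
    proof (cases \<alpha>)
      case Infty
      with assms(3) show ?thesis by simp
    next
      case (Fin q)
      with cuspidal_at_if_F_plus_value[OF assms(1,2,4,5) L[unfolded Fin]] show ?thesis by simp
    qed
  qed
  ultimately show ?thesis
    by (intro exI[of _ ?X] conjI allI impI) auto
qed

end
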